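(* For every $\boldsymbol{g}\in \boldsymbol{L}^2_t(\Sigma_r)$, the data operator $\mathcal{N}$ satisfies $$(\mathcal{N}\boldsymbol{g})\times\nu=\overline{\mathcal{H}^*\,\overline{\mathcal{T}\mathcal{H}\boldsymbol{g}}}\qquad\text{on }\Sigma_r ,$$ where $\mathcal{H}$, $\mathcal{H}^*$, $\mathcal{T}$ are the operators defined in the context and the overline denotes pointwise complex conjugation.
   Context: **Waveguide.** Let $a,b>0$, $\Sigma=(0,a)\times(0,b)$, $W=\Sigma\times(-\infty,0)$. Points are $\boldsymbol{x}=(x_1,x_2,x_3)$, $\widehat{x}=(x_1,x_2)$, $\boldsymbol{x}^-=(x_1,x_2,-x_3)$; $k>0$ is the wavenumber; $T$ denotes transpose without conjugation; $\nu$ is the unit outward normal. **Modes.** For integers $m_1,m_2\ge 0$ let $u_m(\widehat{x})=\alpha_m\cos(\frac{m_1\pi x_1}{a})\cos(\frac{m_2\pi x_2}{b})$, $\lambda_m\ge0$, $\lambda_m^2=(\frac{m_1\pi}{a})^2+(\frac{m_2\pi}{b})^2$, enumerated by $m=0,1,2,\dots$ with $\lambda_m\le\lambda_{m+1}$ (so $m=0$ is $(0,0)$). For integers $n_1,n_2\ge1$ let $v_n(\widehat{x})=\beta_n\sin(\frac{n_1\pi x_1}{a})\sin(\frac{n_2\pi x_2}{b})$, $\mu_n>0$, $\mu_n^2=(\frac{n_1\pi}{a})^2+(\frac{n_2\pi}{b})^2$, enumerated by $n=1,2,\dots$ with $\mu_n\le\mu_{n+1}$. The constants $\alpha_m,\beta_n>0$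 are such that $u_m,v_n$ have unit $L^2(\Sigma)$ norm. Assume $k^2\ne\lambda_m^2,\mu_n^2$ for all $m,n$. Let $h_m=\sqrt{k^2-\lambda_m^2}$, $g_n=\sqrt{k^2-\mu_n^2}$ (positive if the radicand is positive, in $i(0,\infty)$ if it is negative), and $$M_m(\boldsymbol{x})=(\partial_2u_m,-\partial_1u_m,0)^Te^{ih_mx_3},\quad P_n(\boldsymbol{x})=\tfrac1k(ig_n\partial_1v_n,ig_n\partial_2v_n,0)^Te^{ig_nx_3},\quad Q_n(\boldsymbol{x})=\tfrac1k(0,0,\mu_n^2v_n)^Te^{ig_nx_3}.$$ **Radiation condition.** A field $\boldsymbol{E}$ is outgoing radiating if for all sufficiently negative $x_3$, $\boldsymbol{E}(\boldsymbol{x})=\sum_{m\ge1}a_mM_m(\boldsymbol{x}^-)+\sum_{n\ge1}b_n[P_n(\boldsymbol{x}^-)-Q_n(\boldsymbol{x}^-)]$ for some constants $a_m,b_n$. **Dyadic Green function.** $\mathbb{G}_e(\boldsymbol{x};\boldsymbol{y})$ is the outgoing radiating ($3\times3$-matrix valued) solution of $\mathrm{curl}_{\boldsymbol{x}}^2\mathbb{G}_e-k^2\mathbb{G}_e=\delta(\boldsymbol{x}-\boldsymbol{y})\boldsymbol{I}$ in $W$, $\nu\times\mathbb{G}_e=0$ on $\partial W$. With $c_m=\frac{i}{2h_m\lambda_m^2}$, $d_n=-\frac{i}{2g_n\mu_n^2}$ it is given for $x_3>y_3$ by $$\mathbb{G}_e(\boldsymbol{x};\boldsymbol{y})=\sum_{m\ge1}c_m[M_m(\boldsymbol{x})-M_m(\boldsymbol{x}^-)]M_m^T(\boldsymbol{y}^-)+\sum_{n\ge1}d_n\big([P_n(\boldsymbol{x})-P_n(\boldsymbol{x}^-)]+[Q_n(\boldsymbol{x})+Q_n(\boldsymbol{x}^-)]\big)[P_n(\boldsymbol{y}^-)-Q_n(\boldsymbol{y}^-)]^T,$$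 and for $x_3<y_3$ by $\mathbb{G}_e(\boldsymbol{x};\boldsymbol{y})=\mathbb{G}_e(\boldsymbol{y};\boldsymbol{x})^T$. **Scatterer and forward problem.** $D\subset W$ is a bounded open Lipschitz domain; the complex-valued relative permittivity $\epsilon\in L^\infty(W)$ has real part bounded below by a positive constant, and $\epsilon=1$ in $W\setminus\overline{D}$. The measurement surface is $\Sigma_r=\Sigma\times\{r\}$, $r<0$, with $D\subset\Sigma\times(r,0)$ and $D$ at positive distance from $\Sigma_r$. For an incident field $\boldsymbol{w}^i$ with $\boldsymbol{w}^i|_D\in\boldsymbol{L}^2(D):=(L^2(D))^3$, the scattered field $\boldsymbol{w}^s\in\boldsymbol{H}_{loc}(\mathrm{curl},W)$ is the outgoing radiating solution of $\mathrm{curl}^2\boldsymbol{w}^s-k^2\epsilon\boldsymbol{w}^s=k^2(\epsilon-1)\boldsymbol{w}^i$ in $W$, $\nu\times\boldsymbol{w}^s=0$ on $\partial W$. It is assumed throughout that $k$ is such that this problem is well-posed (unique solution depending continuously on the data). **Data operator.** For $\boldsymbol{y}\in\Sigma_r$ and a polarization vector $\boldsymbol{p}$, $\boldsymbol{E}^i(\cdot;\boldsymbol{y};\boldsymbol{p})=\mathbb{G}_e(\cdot;\boldsymbol{y})\boldsymbol{p}$ and $\boldsymbol{E}^s(\cdot;\boldsymbol{y};\boldsymbol{p})$ is the scattered field for this incident field. $\boldsymbol{L}^2_t(\Sigma_r)=\{\boldsymbol{u}\in(L^2(\Sigma_r))^3:\boldsymbol{u}\cdot\nu=0\}$. $\mathcal{N}:\boldsymbol{L}^2_t(\Sigma_r)\to\boldsymbol{L}^2_t(\Sigma_r)$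 is $$(\mathcal{N}\boldsymbol{g})(\boldsymbol{x})=\nu(\boldsymbol{x})\times\int_{\Sigma_r}\boldsymbol{E}^s(\boldsymbol{x};\boldsymbol{y};\boldsymbol{g}(\boldsymbol{y}))\,dS_{\boldsymbol{y}},\quad \boldsymbol{x}\in\Sigma_r.$$ **Factor operators.** $\boldsymbol{H}_{inc}(D)=\{\boldsymbol{u}\in\boldsymbol{L}^2(D):\mathrm{curl}^2\boldsymbol{u}-k^2\boldsymbol{u}=0\text{ in }D\}$. - $\mathcal{H}:\boldsymbol{L}^2_t(\Sigma_r)\to\boldsymbol{H}_{inc}(D)$, $(\mathcal{H}\boldsymbol{g})(\boldsymbol{x})=\int_{\Sigma_r}\mathbb{G}_e(\boldsymbol{x};\boldsymbol{y})\boldsymbol{g}(\boldsymbol{y})\,dS_{\boldsymbol{y}}$, $\boldsymbol{x}\in D$. - $(\mathcal{H}^*\boldsymbol{v})(\boldsymbol{x})=\Big(\nu(\boldsymbol{x})\times\int_D\overline{\mathbb{G}_e(\boldsymbol{x};\boldsymbol{y})}\,\boldsymbol{v}(\boldsymbol{y})\,d\boldsymbol{y}\Big)\times\nu(\boldsymbol{x})$, $\boldsymbol{x}\in\Sigma_r$, for $\boldsymbol{v}\in\boldsymbol{L}^2(D)$ (its restriction to $\boldsymbol{H}_{inc}(D)$ is the adjoint of $\mathcal{H}$). - $\mathcal{T}:\boldsymbol{H}_{inc}(D)\to\boldsymbol{L}^2(D)$, $\mathcal{T}\boldsymbol{w}^i=k^2(\epsilon-1)(\boldsymbol{w}^i+\boldsymbol{w}^s)|_D$,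 with $\boldsymbol{w}^s$ the scattered field for $\boldsymbol{w}^i$. *)

theory Defs
  imports "HOL-Analysis.Analysis"
begin

section \<open>Complex vectors and dyads\<close>

text \<open>The bilinear product, without conjugation.\<close>

definition cdot :: "complex^3 \<Rightarrow> complex^3 \<Rightarrow> complex" where
  "cdot u v = (\<Sum>i\<in>UNIV. u $ i * v $ i)"

definition ccross :: "complex^3 \<Rightarrow> complex^3 \<Rightarrow> complex^3" where
  "ccross u v = vector [u$2 * v$3 - u$3 * v$2, u$3 * v$1 - u$1 * v$3, u$1 * v$2 - u$2 * v$1]"

definition outer :: "complex^3 \<Rightarrow> complex^3 \<Rightarrow> complex^3^3" where
  "outer u v = (\<chi> i j. u $ i * v $ j)"

definition vec_cnj :: "complex^3 \<Rightarrow> complex^3" where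
  "vec_cnj v = (\<chi> i. cnj (v $ i))"

definition mat_cnj :: "complex^3^3 \<Rightarrow> complex^3^3" where
  "mat_cnj A = (\<chi> i j. cnj (A $ i $ j))"


section \<open>Derivatives, test fields, weak curl\<close>

definition partial :: "'n \<Rightarrow> (real^'n \<Rightarrow> 'b) \<Rightarrow> real^'n \<Rightarrow> 'b::real_normed_vector" where
  "partial i f x = vector_derivative (\<lambda>t. f (x + t *\<^sub>R axis i 1)) (at 0)"

definition curl :: "(real^3 \<Rightarrow> complex^3) \<Rightarrow> real^3 \<Rightarrow> complex^3" where
  "curl F x = vector
     [partial 2 (\<lambda>z. F z $ 3) x - partial 3 (\<lambda>z. F z $ 2) x,
      partial 3 (\<lambda>z. F z $ 1) x - partial 1 (\<lambda>z. F z $ 3) x,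
      partial 1 (\<lambda>z. F z $ 2) x - partial 2 (\<lambda>z. F z $ 1) x]"

definition smooth :: "(real^3 \<Rightarrow> complex^3) \<Rightarrow> bool" where
  "smooth f \<longleftrightarrow> (\<forall>is. foldr partial is f differentiable_on UNIV)"

definition test_fields :: "(real^3) set \<Rightarrow> (real^3 \<Rightarrow> complex^3) set" where
  "test_fields S = {\<phi>. smooth \<phi> \<and> compact (closure {x. \<phi> x \<noteq> 0}) \<and> closure {x. \<phi> x \<noteq> 0} \<subseteq> S}"

text \<open>Elements of $L^2$ are handled through representatives.\<close>

definition L2 :: "'a::euclidean_space set \<Rightarrow> ('a \<Rightarrow> 'b::euclidean_space) set" where
  "L2 S = {f. f \<in> borel_measurable (lebesgue_on S) \<and> integrable (lebesgue_on S) (\<lambda>x. (norm (f x))\<^sup>2)}"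

definition L2norm :: "'a::euclidean_space set \<Rightarrow> ('a \<Rightarrow> 'b::euclidean_space) \<Rightarrow> real" where
  "L2norm S f = sqrt (LINT x|lebesgue_on S. (norm (f x))\<^sup>2)"

definition has_weak_curl :: "(real^3) set \<Rightarrow> (real^3 \<Rightarrow> complex^3) \<Rightarrow> (real^3 \<Rightarrow> complex^3) \<Rightarrow> bool" where
  "has_weak_curl S w c \<longleftrightarrow> (\<forall>\<phi>\<in>test_fields S.
     (LINT x|lebesgue_on S. cdot (w x) (curl \<phi> x)) = (LINT x|lebesgue_on S. cdot (c x) (\<phi> x)))"

text \<open>The tangential trace $\nu\times w$ on the boundary of \<open>S\<close> is the functional
  $\varphi \mapsto \int_S (\mathrm{curl}\,w\cdot\varphi - w\cdot\mathrm{curl}\,\varphi)$ given by Green's formula;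
  here \<open>c\<close> is the weak curl of \<open>w\<close>, and the test fields need not vanish on the boundary.\<close>

definition zero_tangential_trace :: "(real^3) set \<Rightarrow> (real^3 \<Rightarrow> complex^3) \<Rightarrow> (real^3 \<Rightarrow> complex^3) \<Rightarrow> bool" where
  "zero_tangential_trace S w c \<longleftrightarrow> (\<forall>\<phi>\<in>test_fields UNIV.
     (LINT x|lebesgue_on S. cdot (c x) (\<phi> x) - cdot (w x) (curl \<phi> x)) = 0)"

text \<open>The value at \<open>x\<close> of a field known up to null sets which has a representative that is
  continuous near \<open>x\<close>.\<close>

definition point_value :: "(real^3 \<Rightarrow> complex^3) \<Rightarrow> real^3 \<Rightarrow> complex^3" where
  "point_value w x = (THE v. \<exists>U f. open U \<and> x \<in> U \<and> continuous_on U f \<and>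
     (AE z in lebesgue_on U. f z = w z) \<and> f x = v)"

text \<open>Locally, up to a rigid motion, the set is a Lipschitz hypograph (the translation is absorbed
  into \<open>\<phi>\<close>). Connectedness is not imposed.\<close>

definition lipschitz_domain :: "(real^3) set \<Rightarrow> bool" where
  "lipschitz_domain D \<longleftrightarrow> open D \<and> bounded D \<and>
     (\<forall>p\<in>frontier D. \<exists>U (A :: real^3 \<Rightarrow> real^3) (\<phi> :: real^2 \<Rightarrow> real) L.
        open U \<and> p \<in> U \<and> orthogonal_transformation A \<and> L-lipschitz_on UNIV \<phi> \<and>
        D \<inter> U = {x \<in> U. A x $ 3 < \<phi> (vector [A x $ 1, A x $ 2])})"


section \<open>The waveguide\<close>

definition proj12 :: "real^3 \<Rightarrow> real^2" where
  "proj12 x = vector [x$1, x$2]"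

definition reflect :: "real^3 \<Rightarrow> real^3" where
  "reflect x = vector [x$1, x$2, - x$3]"

definition at_height :: "real \<Rightarrow> real^2 \<Rightarrow> real^3" where
  "at_height r s = vector [s$1, s$2, r]"

text \<open>\<open>te m\<close> is the index pair $(m_1,m_2)$ of $u_m$ for $m \ge 0$, and \<open>tm n\<close> is the index pair
  $(n_1,n_2)$ of $v_n$ for $n \ge 1$ (\<open>tm 0\<close> is never used).\<close>

context
  fixes a b k :: real and te tm :: "nat \<Rightarrow> nat \<times> nat"
begin

definition cross_section :: "(real^2) set" where
  "cross_section = {s. 0 < s$1 \<and> s$1 < a \<and> 0 < s$2 \<and> s$2 < b}"

definition waveguide :: "(real^3) set" where
  "waveguide = {x. proj12 x \<in> cross_section \<and> x$3 < 0}"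

definition section_between :: "real \<Rightarrow> real \<Rightarrow> (real^3) set" where
  "section_between R R' = {x. proj12 x \<in> cross_section \<and> R < x$3 \<and> x$3 < R'}"

definition eigen_rt :: "nat \<times> nat \<Rightarrow> real" where
  "eigen_rt p = sqrt ((real (fst p) * pi / a)\<^sup>2 + (real (snd p) * pi / b)\<^sup>2)"

definition lam :: "nat \<Rightarrow> real" where
  "lam m = eigen_rt (te m)"

definition mu :: "nat \<Rightarrow> real" where
  "mu n = eigen_rt (tm n)"

definition mode_enumeration :: bool where
  "mode_enumeration \<longleftrightarrow>
     bij te \<and> mono lam \<and> bij_betw tm {1..} ({1..} \<times> {1..}) \<and> mono_on {1..} mu"

definition cos_cos :: "nat \<times> nat \<Rightarrow> real^2 \<Rightarrow> real" where
  "cos_cos p s = cos (real (fst p) * pi * s$1 / a) * cos (real (snd p) * pi * s$2 / b)"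

definition sin_sin :: "nat \<times> nat \<Rightarrow> real^2 \<Rightarrow> real" where
  "sin_sin p s = sin (real (fst p) * pi * s$1 / a) * sin (real (snd p) * pi * s$2 / b)"

definition u_mode :: "nat \<Rightarrow> real^2 \<Rightarrow> real" where
  "u_mode m s = cos_cos (te m) s / L2norm cross_section (cos_cos (te m))"

definition v_mode :: "nat \<Rightarrow> real^2 \<Rightarrow> real" where
  "v_mode n s = sin_sin (tm n) s / L2norm cross_section (sin_sin (tm n))"

text \<open>The principal square root is positive on positive reals and in $i(0,\infty)$ on negative reals.\<close>

definition h_const :: "nat \<Rightarrow> complex" where
  "h_const m = csqrt (of_real (k\<^sup>2 - (lam m)\<^sup>2))"

definition g_const :: "nat \<Rightarrow> complex" where
  "g_const n = csqrt (of_real (k\<^sup>2 - (mu n)\<^sup>2))"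

definition M_mode :: "nat \<Rightarrow> real^3 \<Rightarrow> complex^3" where
  "M_mode m x = exp (\<i> * h_const m * of_real (x$3)) *s
     vector [of_real (partial 2 (u_mode m) (proj12 x)), - of_real (partial 1 (u_mode m) (proj12 x)), 0]"

definition P_mode :: "nat \<Rightarrow> real^3 \<Rightarrow> complex^3" where
  "P_mode n x = (exp (\<i> * g_const n * of_real (x$3)) / of_real k) *s
     vector [\<i> * g_const n * of_real (partial 1 (v_mode n) (proj12 x)),
             \<i> * g_const n * of_real (partial 2 (v_mode n) (proj12 x)), 0]"

definition Q_mode :: "nat \<Rightarrow> real^3 \<Rightarrow> complex^3" where
  "Q_mode n x = (exp (\<i> * g_const n * of_real (x$3)) / of_real k) *s
     vector [0, 0, of_real ((mu n)\<^sup>2 * v_mode n (proj12 x))]"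

text \<open>The modal series is required to converge in $L^2$ on all bounded pieces of the part
  $x_3 < R$ of the waveguide.\<close>

definition outgoing_radiating :: "(real^3 \<Rightarrow> complex^3) \<Rightarrow> bool" where
  "outgoing_radiating E \<longleftrightarrow> (\<exists>R<0. \<exists>A B. \<forall>R'<R. E \<in> L2 (section_between R' R) \<and>
     (\<lambda>N. L2norm (section_between R' R) (\<lambda>x. E x -
         ((\<Sum>m=1..N. A m *s M_mode m (reflect x))
          + (\<Sum>n=1..N. B n *s (P_mode n (reflect x) - Q_mode n (reflect x)))))) \<longlonglongrightarrow> 0)"

definition c_coeff :: "nat \<Rightarrow> complex" where
  "c_coeff m = \<i> / (2 * h_const m * of_real ((lam m)\<^sup>2))"

definition d_coeff :: "nat \<Rightarrow> complex" where
  "d_coeff n = - \<i> / (2 * g_const n * of_real ((mu n)\<^sup>2))"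

text \<open>The series for $x_3 > y_3$; the summation indices are shifted so that they start at $1$.\<close>

definition green_above :: "real^3 \<Rightarrow> real^3 \<Rightarrow> complex^3^3" where
  "green_above x y =
     (\<Sum>m. outer (c_coeff (Suc m) *s (M_mode (Suc m) x - M_mode (Suc m) (reflect x)))
                 (M_mode (Suc m) (reflect y)))
   + (\<Sum>n. outer (d_coeff (Suc n) *s ((P_mode (Suc n) x - P_mode (Suc n) (reflect x))
                                    + (Q_mode (Suc n) x + Q_mode (Suc n) (reflect x))))
                 (P_mode (Suc n) (reflect y) - Q_mode (Suc n) (reflect y)))"

text \<open>The electric dyadic Green function, through its modal expansion. On the plane $x_3 = y_3$, where
  the expansion is not available, it is set to \<open>0\<close>; the operators below evaluate it only with one
  argument on the measurement surface and the other in the scatterer, hence off that plane.\<close>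

definition green :: "real^3 \<Rightarrow> real^3 \<Rightarrow> complex^3^3" where
  "green x y = (if x$3 > y$3 then green_above x y
                else if x$3 < y$3 then transpose (green_above y x) else 0)"


section \<open>The scattering problem\<close>

context
  fixes D :: "(real^3) set" and eps :: "real^3 \<Rightarrow> complex"
begin

definition permittivity :: bool where
  "permittivity \<longleftrightarrow> eps \<in> borel_measurable (lebesgue_on waveguide) \<and>
     (\<exists>C. AE x in lebesgue_on waveguide. norm (eps x) \<le> C) \<and>
     (\<exists>c>0. AE x in lebesgue_on waveguide. c \<le> Re (eps x)) \<and>
     (AE x in lebesgue_on (waveguide - closure D). eps x = 1)"

text \<open>The field \<open>w\<close>, with weak curl \<open>c\<close>, solves the scattering problem for the incident field \<open>wi\<close>.
  The first line is $H_{loc}(\mathrm{curl})$: square integrability is required on each truncated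
  waveguide, up to the walls. The equation is in the sense of distributions; its right-hand side
  is supported in \<open>D\<close>, as $\epsilon = 1$ outside.\<close>

definition solves_scattering ::
    "(real^3 \<Rightarrow> complex^3) \<Rightarrow> (real^3 \<Rightarrow> complex^3) \<Rightarrow> (real^3 \<Rightarrow> complex^3) \<Rightarrow> bool" where
  "solves_scattering wi w c \<longleftrightarrow>
     (\<forall>R<0. w \<in> L2 (section_between R 0) \<and> c \<in> L2 (section_between R 0)) \<and> has_weak_curl waveguide w c \<and>
     zero_tangential_trace waveguide w c \<and>
     (\<forall>\<phi>\<in>test_fields waveguide.
        (LINT x|lebesgue_on waveguide.
           cdot (c x) (curl \<phi> x) - of_real (k\<^sup>2) * eps x * cdot (w x) (\<phi> x))
        = (LINT x|lebesgue_on D. of_real (k\<^sup>2) * (eps x - 1) * cdot (wi x) (\<phi> x))) \<and>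
     outgoing_radiating w"

definition well_posed :: bool where
  "well_posed \<longleftrightarrow>
     (\<forall>wi \<in> L2 D. \<exists>w c. solves_scattering wi w c) \<and>
     (\<forall>wi \<in> L2 D. \<forall>w c w' c'. solves_scattering wi w c \<and> solves_scattering wi w' c'
        \<longrightarrow> (AE x in lebesgue_on waveguide. w x = w' x)) \<and>
     (\<forall>R<0. \<exists>C. \<forall>wi \<in> L2 D. \<forall>w c. solves_scattering wi w c
        \<longrightarrow> L2norm (section_between R 0) w + L2norm (section_between R 0) c \<le> C * L2norm D wi)"

text \<open>A representative of the solution, which is unique up to null sets under \<open>well_posed\<close>.\<close>

definition scattered_field :: "(real^3 \<Rightarrow> complex^3) \<Rightarrow> real^3 \<Rightarrow> complex^3" where
  "scattered_field wi = (SOME w. \<exists>c. solves_scattering wi w c)"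

definition T_op :: "(real^3 \<Rightarrow> complex^3) \<Rightarrow> real^3 \<Rightarrow> complex^3" where
  "T_op wi x = (of_real (k\<^sup>2) * (eps x - 1)) *s (wi x + scattered_field wi x)"

context
  fixes r :: real
begin

definition surface :: "(real^3) set" where
  "surface = at_height r ` cross_section"

text \<open>The surface measure of the flat surface is the planar Lebesgue measure of the cross-section.\<close>

definition surface_integral :: "(real^3 \<Rightarrow> complex^3) \<Rightarrow> complex^3" where
  "surface_integral f = (LINT s|lebesgue_on cross_section. f (at_height r s))"

text \<open>The unit normal on the surface pointing out of the truncated waveguide $r < x_3 < 0$.\<close>

definition normal :: "complex^3" where
  "normal = vector [0, 0, -1]"

definition L2t :: "(real^3 \<Rightarrow> complex^3) set" where
  "L2t = {g. (\<lambda>s. g (at_height r s)) \<in> L2 cross_section \<and>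
             (AE s in lebesgue_on cross_section. cdot (g (at_height r s)) normal = 0)}"

definition admissible_scatterer :: bool where
  "admissible_scatterer \<longleftrightarrow> r < 0 \<and> lipschitz_domain D \<and> D \<subseteq> section_between r 0 \<and>
     (\<exists>\<delta>>0. \<forall>x\<in>D. \<forall>y\<in>surface. \<delta> \<le> dist x y)"

text \<open>Away from the closure of \<open>D\<close> the scattered field is smooth after modification on a null set;
  \<open>point_value\<close> evaluates this smooth representative.\<close>

definition E_scat :: "real^3 \<Rightarrow> real^3 \<Rightarrow> complex^3 \<Rightarrow> complex^3" where
  "E_scat x y p = point_value (scattered_field (\<lambda>z. green z y *v p)) x"

definition N_op :: "(real^3 \<Rightarrow> complex^3) \<Rightarrow> real^3 \<Rightarrow> complex^3" where
  "N_op g x = ccross normal (surface_integral (\<lambda>y. E_scat x y (g y)))"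

definition H_op :: "(real^3 \<Rightarrow> complex^3) \<Rightarrow> real^3 \<Rightarrow> complex^3" where
  "H_op g x = surface_integral (\<lambda>y. green x y *v g y)"

definition H_adj :: "(real^3 \<Rightarrow> complex^3) \<Rightarrow> real^3 \<Rightarrow> complex^3" where
  "H_adj v x = ccross (ccross normal (LINT y|lebesgue_on D. mat_cnj (green x y) *v v y)) normal"

end

end

end

end

theory Submission
  imports Defs
begin

text \<open>Outside \<open>D\<close> the scattered field of \<open>w\<close> solves Maxwell's equations with source \<open>T w\<close>
  supported in \<open>D\<close>. Testing the weak equation, together with the zero tangential trace, against
  products of a transversal mode and a profile in \<open>x\<^sub>3\<close> shows that every modal component of the
  scattered field satisfies a Helmholtz equation on a half line. The radiation condition selects its
  solution, whose amplitude below \<open>D\<close> is a moment of \<open>T w\<close> against the standing wave occurring in the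
  Green function. As the trigonometric profiles are complete, the scattered field on the surface is
  $\int_D G(x,y)\,(T w)(y)\,dy$, which is the adjoint of the Herglotz-type operator up to
  conjugation. The modal series of the Green function converges absolutely between the surface and \<open>D\<close>, so
  well-posedness, that is linearity and continuity of the solution map, lets the superposition
  over the surface be exchanged with \<open>T\<close>.\<close>

section \<open>Smooth functions of one real variable\<close>

text \<open>Its place is taken, mode by mode, by the half-line Green function in x_3, which is
  explicit. Two obstacles shape the passage to one dimension. The modes do not vanish on the walls,
  hence are no test fields of the equation. The trace condition admits them and moves a curl for
  free; the equation itself differentiates each component only in directions in which its profile
  vanishes at the ends, so boundary cutoffs converge there together with one derivative. Moreover
  \<open>scattered_field\<close> is a choice among representatives: linearity comes from uniqueness
  and holds almost everywhere only, and point values are recovered from the continuity of the modal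
  series. All convergence rests on the positive distance between D and the surface: with D above
  \<rho> and the surface below \<sigma> < \<rho>, the source factor of an evanescent mode grows like
  exp (- \<rho> Im \<kappa>) and its outgoing factor decays like exp (\<sigma> Im \<kappa>).\<close>

abbreviation vderiv :: "(real \<Rightarrow> complex) \<Rightarrow> real \<Rightarrow> complex" where
  "vderiv f \<equiv> \<lambda>x. vector_derivative f (at x)"

primrec diff_times :: "nat \<Rightarrow> (real \<Rightarrow> complex) \<Rightarrow> bool" where
  "diff_times 0 f \<longleftrightarrow> (\<forall>x. f differentiable at x)"
| "diff_times (Suc n) f \<longleftrightarrow> (\<forall>x. f differentiable at x) \<and> diff_times n (vderiv f)"

text \<open>The one-variable counterpart of \<open>smooth\<close>, which speaks of iterated partial
  derivatives. Products of such functions in separate coordinates are the only test fields that the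
  proof builds.\<close>

definition smooth1 :: "(real \<Rightarrow> complex) \<Rightarrow> bool" where
  "smooth1 f \<longleftrightarrow> (\<forall>n. diff_times n f)"

lemma diff_times_differentiable: "diff_times n f \<Longrightarrow> f differentiable at x"
  by (cases n) auto

lemma diff_times_Suc_D: "diff_times (Suc n) f \<Longrightarrow> diff_times n f"
proof (induction n arbitrary: f)
  case (Suc n)
  have "diff_times (Suc n) (vderiv f)" using Suc.prems by simp
  then have "diff_times n (vderiv f)" by (rule Suc.IH)
  then show ?case using Suc.prems by simp
qed simp

lemma vderiv_eqI: "(\<And>x. (f has_vector_derivative f' x) (at x)) \<Longrightarrow> vderiv f = f'"
  by (auto simp: vector_derivative_at)

lemma diff_times_SucI:
  assumes "\<And>x. (f has_vector_derivative f' x) (at x)" and "diff_times n f'"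
  shows "diff_times (Suc n) f"
  using vderiv_eqI[OF assms(1)] differentiableI_vector[OF assms(1)] assms(2) by simp

lemma diff_times_0I: "(\<And>x. (f has_vector_derivative f' x) (at x)) \<Longrightarrow> diff_times 0 f"
  by (auto intro: differentiableI_vector)

lemma has_vderiv: "(\<And>x. f differentiable at x) \<Longrightarrow> (f has_vector_derivative vderiv f x) (at x)"
  by (simp add: vector_derivative_works[symmetric])

lemma diff_times_has_vderiv: "diff_times n f \<Longrightarrow> (f has_vector_derivative vderiv f x) (at x)"
  by (intro has_vderiv diff_times_differentiable)

lemma diff_times_add:
  "diff_times n f \<Longrightarrow> diff_times n g \<Longrightarrow> diff_times n (\<lambda>x. f x + g x)"
proof (induction n arbitrary: f g)
  case 0
  then show ?case by auto
next
  case (Suc n)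
  show ?case
  proof (rule diff_times_SucI)
    show "((\<lambda>x. f x + g x) has_vector_derivative vderiv f x + vderiv g x) (at x)" for x
      by (intro has_vector_derivative_add diff_times_has_vderiv[OF Suc.prems(1)] diff_times_has_vderiv[OF Suc.prems(2)])
    show "diff_times n (\<lambda>x. vderiv f x + vderiv g x)"
      using Suc by simp
  qed
qed

lemma diff_times_mult:
  "diff_times n f \<Longrightarrow> diff_times n g \<Longrightarrow> diff_times n (\<lambda>x. f x * g x)"
proof (induction n arbitrary: f g)
  case 0
  then show ?case by auto
next
  case (Suc n)
  show ?case
  proof (rule diff_times_SucI)
    show "((\<lambda>x. f x * g x) has_vector_derivative f x * vderiv g x + vderiv f x * g x) (at x)" for x
      by (intro has_vector_derivative_mult diff_times_has_vderiv[OF Suc.prems(1)] diff_times_has_vderiv[OF Suc.prems(2)])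
    show "diff_times n (\<lambda>x. f x * vderiv g x + vderiv f x * g x)"
      using Suc.prems diff_times_Suc_D[OF Suc.prems(1)] diff_times_Suc_D[OF Suc.prems(2)]
      by (intro diff_times_add Suc.IH) auto
  qed
qed

lemma diff_times_const: "diff_times n (\<lambda>x. c)"
proof (induction n arbitrary: c)
  case (Suc n)
  show ?case by (rule diff_times_SucI[where f' = "\<lambda>x. 0"]) (simp_all add: Suc)
qed auto

lemma diff_times_inverse:
  "diff_times n f \<Longrightarrow> (\<And>x. f x \<noteq> 0) \<Longrightarrow> diff_times n (\<lambda>x. inverse (f x))"
proof (induction n arbitrary: f)
  case 0
  have "((\<lambda>x. inverse (f x)) has_vector_derivative - (inverse (f x) * vderiv f x * inverse (f x))) (at x)" for x
    using diff_times_has_vderiv[OF 0(1), of x] 0(2)[of x]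
    unfolding has_vector_derivative_def by (auto intro!: derivative_eq_intros simp: algebra_simps)
  then show ?case by (rule diff_times_0I)
next
  case (Suc n)
  show ?case
  proof (rule diff_times_SucI)
    show "((\<lambda>x. inverse (f x)) has_vector_derivative (-1) * (inverse (f x) * vderiv f x * inverse (f x))) (at x)" for x
      using diff_times_has_vderiv[OF Suc.prems(1), of x] Suc.prems(2)[of x]
      unfolding has_vector_derivative_def by (auto intro!: derivative_eq_intros simp: algebra_simps)
    have i: "diff_times n (\<lambda>x. inverse (f x))"
      using Suc.prems diff_times_Suc_D[OF Suc.prems(1)] by (intro Suc.IH) auto
    have d: "diff_times n (vderiv f)" using Suc.prems by simp
    show "diff_times n (\<lambda>x. (-1) * (inverse (f x) * vderiv f x * inverse (f x)))"
      by (rule diff_times_mult[OF diff_times_const diff_times_mult[OF diff_times_mult[OF i d] i]])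
  qed
qed

lemma diff_times_affine:
  "diff_times n f \<Longrightarrow> diff_times n (\<lambda>x. f (c * x + d))"
proof (induction n arbitrary: f)
  case 0
  have "((\<lambda>x. f (c * x + d)) has_vector_derivative c *\<^sub>R vderiv f (c * x + d)) (at x)" for x
  proof -
    have 1: "((\<lambda>x. c * x + d) has_vector_derivative c) (at x)"
      by (auto intro!: derivative_eq_intros simp: has_real_derivative_iff_has_vector_derivative[symmetric])
    show ?thesis
      using vector_diff_chain_at[OF 1 diff_times_has_vderiv[OF 0]] by (simp add: o_def)
  qed
  then show ?case by (rule diff_times_0I)
next
  case (Suc n)
  show ?case
  proof (rule diff_times_SucI)
    show "((\<lambda>x. f (c * x + d)) has_vector_derivative of_real c * vderiv f (c * x + d)) (at x)" for x
    proof -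
      have 1: "((\<lambda>x. c * x + d) has_vector_derivative c) (at x)"
        by (auto intro!: derivative_eq_intros simp: has_real_derivative_iff_has_vector_derivative[symmetric])
      show ?thesis
        using vector_diff_chain_at[OF 1 diff_times_has_vderiv[OF Suc.prems]]
        by (simp add: o_def scaleR_conv_of_real)
    qed
    show "diff_times n (\<lambda>x. of_real c * vderiv f (c * x + d))"
      using Suc.IH[of "vderiv f"] Suc.prems by (intro diff_times_mult diff_times_const) auto
  qed
qed

lemma smooth1_add: "smooth1 f \<Longrightarrow> smooth1 g \<Longrightarrow> smooth1 (\<lambda>x. f x + g x)"
  and smooth1_mult: "smooth1 f \<Longrightarrow> smooth1 g \<Longrightarrow> smooth1 (\<lambda>x. f x * g x)"
  and smooth1_const: "smooth1 (\<lambda>x. c)"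
  and smooth1_inverse: "smooth1 f \<Longrightarrow> (\<And>x. f x \<noteq> 0) \<Longrightarrow> smooth1 (\<lambda>x. inverse (f x))"
  and smooth1_affine: "smooth1 f \<Longrightarrow> smooth1 (\<lambda>x. f (p * x + q))"
  and smooth1_vderiv: "smooth1 f \<Longrightarrow> smooth1 (vderiv f)"
  and smooth1_has_vderiv: "smooth1 f \<Longrightarrow> (f has_vector_derivative vderiv f x) (at x)"
proof -
  show "smooth1 f \<Longrightarrow> smooth1 g \<Longrightarrow> smooth1 (\<lambda>x. f x + g x)"
    by (simp add: smooth1_def diff_times_add)
  show "smooth1 f \<Longrightarrow> smooth1 g \<Longrightarrow> smooth1 (\<lambda>x. f x * g x)"
    by (simp add: smooth1_def diff_times_mult)
  show "smooth1 (\<lambda>x. c)"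
    by (simp add: smooth1_def diff_times_const)
  show "smooth1 f \<Longrightarrow> (\<And>x. f x \<noteq> 0) \<Longrightarrow> smooth1 (\<lambda>x. inverse (f x))"
    by (simp add: smooth1_def diff_times_inverse)
  show "smooth1 f \<Longrightarrow> smooth1 (\<lambda>x. f (p * x + q))"
    by (simp add: smooth1_def diff_times_affine)
  show "smooth1 f \<Longrightarrow> smooth1 (vderiv f)"
    unfolding smooth1_def by (metis diff_times.simps(2))
  show "smooth1 f \<Longrightarrow> (f has_vector_derivative vderiv f x) (at x)"
    unfolding smooth1_def by (blast intro: diff_times_has_vderiv)
qed

lemma smooth1_minus: "smooth1 f \<Longrightarrow> smooth1 (\<lambda>x. - f x)"
  using smooth1_mult[OF smooth1_const[of "-1"], of f] by simp

lemma smooth1_diff: "smooth1 f \<Longrightarrow> smooth1 g \<Longrightarrow> smooth1 (\<lambda>x. f x - g x)"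
  using smooth1_add[OF _ smooth1_minus, of f g] by simp

lemma smooth1_antiderivative:
  assumes "\<And>x. (f has_vector_derivative f' x) (at x)" and "smooth1 f'"
  shows "smooth1 f"
  unfolding smooth1_def
proof
  fix n
  show "diff_times n f"
    using assms diff_times_0I diff_times_SucI unfolding smooth1_def by (cases n) blast+
qed

lemma smooth1_continuous: "smooth1 f \<Longrightarrow> continuous_on S f"
  by (meson smooth1_has_vderiv continuous_at_imp_continuous_on differentiable_imp_continuous_within differentiableI_vector)

lemma has_vector_derivative_exp_ii:
  "((\<lambda>x. exp (c * of_real x)) has_vector_derivative c * exp (c * of_real x)) (at x)" for c :: complex
proof -
  have "((\<lambda>z. exp (c * z)) has_field_derivative c * exp (c * of_real x)) (at (of_real x))"
    by (auto intro!: derivative_eq_intros)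
  from has_vector_derivative_real_field[OF this] show ?thesis by simp
qed

lemma smooth1_exp: "smooth1 (\<lambda>x. exp (c * of_real x))"
proof -
  have "diff_times n (\<lambda>x. exp (c * of_real x))" for n
  proof (induction n)
    case 0
    show ?case by (rule diff_times_0I[OF has_vector_derivative_exp_ii])
  next
    case (Suc n)
    show ?case
      by (rule diff_times_SucI[OF has_vector_derivative_exp_ii]) (intro diff_times_mult diff_times_const Suc)
  qed
  then show ?thesis by (simp add: smooth1_def)
qed

lemma smooth1_id: "smooth1 (\<lambda>x. of_real x)"
  by (rule smooth1_antiderivative[where f' = "\<lambda>x. 1"])
     (auto intro!: derivative_eq_intros smooth1_const simp: has_vector_derivative_def scaleR_conv_of_real)

lemma has_vector_derivative_of_real_cos:
  "((\<lambda>x. complex_of_real (cos (p * x))) has_vector_derivative of_real (- p * sin (p * x))) (at x)"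
  by (intro has_vector_derivative_of_real)
     (auto intro!: derivative_eq_intros simp: has_real_derivative_iff_has_vector_derivative[symmetric])

lemma has_vector_derivative_of_real_sin:
  "((\<lambda>x. complex_of_real (sin (p * x))) has_vector_derivative of_real (p * cos (p * x))) (at x)"
  by (intro has_vector_derivative_of_real)
     (auto intro!: derivative_eq_intros simp: has_real_derivative_iff_has_vector_derivative[symmetric])

lemma smooth1_cos_sin:
  "smooth1 (\<lambda>x. complex_of_real (cos (p * x)))" "smooth1 (\<lambda>x. complex_of_real (sin (p * x)))"
proof -
  have "diff_times n (\<lambda>x. complex_of_real (cos (p * x))) \<and> diff_times n (\<lambda>x. complex_of_real (sin (p * x)))" for n
  proof (induction n)
    case 0
    show ?case
      using diff_times_0I[OF has_vector_derivative_of_real_cos] diff_times_0I[OF has_vector_derivative_of_real_sin]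
      by blast
  next
    case (Suc n)
    have "diff_times (Suc n) (\<lambda>x. complex_of_real (cos (p * x)))"
      by (rule diff_times_SucI[OF has_vector_derivative_of_real_cos])
         (use Suc diff_times_mult[OF diff_times_const[of n "- of_real p"]] in simp)
    moreover have "diff_times (Suc n) (\<lambda>x. complex_of_real (sin (p * x)))"
      by (rule diff_times_SucI[OF has_vector_derivative_of_real_sin])
         (use Suc diff_times_mult[OF diff_times_const[of n "of_real p"]] in simp)
    ultimately show ?case by simp
  qed
  then show "smooth1 (\<lambda>x. complex_of_real (cos (p * x)))" "smooth1 (\<lambda>x. complex_of_real (sin (p * x)))"
    by (auto simp: smooth1_def)
qed

section \<open>Flat functions, smooth steps, cutoffs and bumps\<close>

definition flat_fun :: "nat \<Rightarrow> real \<Rightarrow> complex" where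
  "flat_fun n x = (if 0 < x then of_real (exp (- 1 / x) / x ^ n) else 0)"

lemma flat_fun_limit: "((\<lambda>x. exp (- 1 / x) / x ^ n) \<longlongrightarrow> 0) (at_right (0::real))"
proof -
  have "((\<lambda>x. inverse x ^ n / exp (inverse x)) \<longlongrightarrow> 0) (at_right (0::real))"
    by (rule filterlim_compose[OF tendsto_power_div_exp_0 filterlim_inverse_at_top_right])
  then show ?thesis
    by (rule Lim_transform_eventually)
       (auto simp: eventually_at_filter exp_minus field_simps inverse_eq_divide)
qed

text \<open>The index n is carried because the functions exp (- 1 / x) / x^n, extended by 0, are
  closed under differentiation up to linear combinations. Smoothness of the whole family is then a
  single induction.\<close>

lemma flat_fun_has_vderiv:
  "(flat_fun n has_vector_derivative flat_fun (n + 2) x - of_nat n * flat_fun (n + 1) x) (at x)"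
proof -
  consider "x > 0" | "x < 0" | "x = 0" by linarith
  then show ?thesis
  proof cases
    case 1
    have "((\<lambda>x. exp (- 1 / x) / x ^ n) has_real_derivative exp (- 1 / x) / x ^ (n + 2) - n * (exp (- 1 / x) / x ^ (n + 1))) (at x)"
      by (rule derivative_eq_intros refl | (use 1 in simp; fail))+
         (use 1 in \<open>cases n; simp add: field_simps power2_eq_square power_Suc\<close>)
    then have "((\<lambda>x. complex_of_real (exp (- 1 / x) / x ^ n)) has_vector_derivative
        of_real (exp (- 1 / x) / x ^ (n + 2) - n * (exp (- 1 / x) / x ^ (n + 1)))) (at x)"
      by (intro has_vector_derivative_of_real) (simp add: has_real_derivative_iff_has_vector_derivative)
    then have "(flat_fun n has_vector_derivative
        of_real (exp (- 1 / x) / x ^ (n + 2) - n * (exp (- 1 / x) / x ^ (n + 1)))) (at x)"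
      by (rule has_vector_derivative_transform_within_open[where S = "{0<..}"])
         (use 1 in \<open>auto simp: flat_fun_def\<close>)
    then show ?thesis using 1 by (simp only: flat_fun_def of_real_diff of_real_mult of_real_of_nat_eq if_True)
  next
    case 2
    have "((\<lambda>x. 0::complex) has_vector_derivative 0) (at x)" by simp
    then have "(flat_fun n has_vector_derivative 0) (at x)"
      by (rule has_vector_derivative_transform_within_open[where S = "{..<0}"])
         (use 2 in \<open>auto simp: flat_fun_def\<close>)
    then show ?thesis using 2 by (simp add: flat_fun_def)
  next
    case 3
    \<comment> \<open>At 0 the modulus of the difference quotient is the next member of the family
      on the right and 0 on the left, so both limits are 0.\<close>
    have r: "((\<lambda>h. norm (flat_fun n h) / \<bar>h\<bar>) \<longlongrightarrow> 0) (at_right 0)"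
    proof (rule Lim_transform_eventually[OF flat_fun_limit[of "n + 1"] eventually_at_rightI[of 0 1]])
      show "exp (- 1 / h) / h ^ (n + 1) = norm (flat_fun n h) / \<bar>h\<bar>" if "h \<in> {0<..<1}" for h :: real
        using that by (simp add: flat_fun_def norm_divide norm_power mult.commute)
    qed simp
    have l: "((\<lambda>h. norm (flat_fun n h) / \<bar>h\<bar>) \<longlongrightarrow> 0) (at_left 0)"
      by (rule Lim_transform_eventually[OF tendsto_const eventually_at_leftI[of "-1" 0]])
         (simp_all add: flat_fun_def)
    have "((\<lambda>h. norm (flat_fun n h) / \<bar>h\<bar>) \<longlongrightarrow> 0) (at 0)"
      using l r by (simp add: filterlim_split_at)
    then have "(flat_fun n has_derivative (\<lambda>h. h *\<^sub>R 0)) (at 0)"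
      by (simp add: has_derivative_at flat_fun_def[of n 0])
    then show ?thesis using 3 by (simp add: flat_fun_def has_vector_derivative_def)
  qed
qed

lemma smooth1_flat_fun: "smooth1 (flat_fun n)"
proof -
  have "diff_times m (flat_fun n)" for m n
  proof (induction m arbitrary: n)
    case 0
    show ?case by (rule diff_times_0I[OF flat_fun_has_vderiv])
  next
    case (Suc m)
    have "diff_times m (\<lambda>x. flat_fun (n + 2) x + (- of_nat n) * flat_fun (n + 1) x)"
      by (intro diff_times_add diff_times_mult diff_times_const Suc)
    then show ?case
      by (intro diff_times_SucI[OF flat_fun_has_vderiv]) simp
  qed
  then show ?thesis by (simp add: smooth1_def)
qed

lemma vderiv_zero_open:
  assumes "open S" "x \<in> S" "\<And>y. y \<in> S \<Longrightarrow> f y = c"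
  shows "vderiv f x = 0"
proof -
  have "((\<lambda>x. c) has_vector_derivative 0) (at x)" by simp
  then have "(f has_vector_derivative 0) (at x)"
    by (rule has_vector_derivative_transform_within_open[OF _ assms(1,2)]) (simp add: assms(3))
  then show ?thesis by (rule vector_derivative_at)
qed

text \<open>The classical quotient f(x) / (f(x) + f(1 - x)) with f = \<open>flat_fun 0\<close>. At
  every x at least one of the two summands is positive, so the denominator never vanishes.\<close>

lemma smooth_step_unit:
  obtains s :: "real \<Rightarrow> complex" and B where "smooth1 s" "\<And>x. x \<le> 0 \<Longrightarrow> s x = 0" "\<And>x. x \<ge> 1 \<Longrightarrow> s x = 1"
    "\<And>x. norm (s x) \<le> B" "\<And>x. norm (vderiv s x) \<le> B" "B > 0"
proof -
  define d where "d x = flat_fun 0 x + flat_fun 0 ((-1) * x + 1)" for x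
  define s where "s x = flat_fun 0 x * inverse (d x)" for x
  have dnz: "d x \<noteq> 0" for x
  proof -
    have "Re (d x) > 0"
      unfolding d_def flat_fun_def by (auto intro: add_pos_pos simp del: exp_gt_zero simp add: exp_gt_zero)
    then show ?thesis by auto
  qed
  have "smooth1 d" unfolding d_def by (intro smooth1_add smooth1_affine smooth1_flat_fun)
  then have s: "smooth1 s"
    unfolding s_def by (intro smooth1_mult smooth1_inverse smooth1_flat_fun dnz)
  have s0: "s x = 0" if "x \<le> 0" for x using that by (simp add: s_def flat_fun_def)
  have s1: "s x = 1" if "x \<ge> 1" for x
    using that dnz[of x] by (simp add: s_def d_def flat_fun_def)
  have "bounded (s ` {0..1})" "bounded (vderiv s ` {0..1})"
    by (intro compact_imp_bounded compact_continuous_image smooth1_continuous s smooth1_vderiv compact_Icc)+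
  then obtain B1 B2 where B: "\<And>x. x \<in> {0..1} \<Longrightarrow> norm (s x) \<le> B1" "\<And>x. x \<in> {0..1} \<Longrightarrow> norm (vderiv s x) \<le> B2"
    unfolding bounded_iff by blast
  have v: "vderiv s x = 0" if "x \<notin> {0..1}" for x
  proof (cases "x < 0")
    case True
    then show ?thesis by (intro vderiv_zero_open[of "{..<0}" _ _ 0]) (auto simp: s0)
  next
    case False
    then show ?thesis using that by (intro vderiv_zero_open[of "{1<..}" _ _ 1]) (auto simp: s1)
  qed
  show thesis
  \<comment> \<open>The maxima over the unit interval bound s and its derivative there. The 1 covers
    the constant value to the right of it and makes the bound positive.\<close>
  proof (rule that[of s "max 1 (max B1 B2)"])
    show "norm (s x) \<le> max 1 (max B1 B2)" for x
      using B(1)[of x] s0[of x] s1[of x] by (cases "x \<in> {0..1}") auto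
    show "norm (vderiv s x) \<le> max 1 (max B1 B2)" for x
      using B(2)[of x] v[of x] by (cases "x \<in> {0..1}") auto
  qed (use s s0 s1 in auto)
qed

text \<open>A cutoff in a layer of width of order 1/N has a derivative of order N. If h vanishes at
  both ends, then h is of order 1/N in the layer, so the derivative of the product stays bounded.
  These are the bounds that dominated convergence needs when profiles with boundary values 0 are
  approximated by compactly supported ones.\<close>

lemma cutoff_sequence:
  fixes h :: "real \<Rightarrow> complex"
  assumes h: "smooth1 h" and lu: "l < u"
  obtains H :: "nat \<Rightarrow> real \<Rightarrow> complex" and C where
    "\<And>N. smooth1 (H N)"
    "\<And>N. \<exists>p q. l < p \<and> q < u \<and> (\<forall>x. x \<notin> {p..q} \<longrightarrow> H N x = 0)"
    "\<And>N x. x \<in> {l<..<u} \<Longrightarrow> norm (H N x) \<le> C"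
    "\<And>x. x \<in> {l<..<u} \<Longrightarrow> (\<lambda>N. H N x) \<longlonglongrightarrow> h x"
    "h l = 0 \<and> h u = 0 \<Longrightarrow> (\<And>N x. x \<in> {l<..<u} \<Longrightarrow> norm (vderiv (H N) x) \<le> C)"
    "h l = 0 \<and> h u = 0 \<Longrightarrow> (\<And>x. x \<in> {l<..<u} \<Longrightarrow> (\<lambda>N. vderiv (H N) x) \<longlonglongrightarrow> vderiv h x)"
proof -
  obtain s :: "real \<Rightarrow> complex" and B where s: "smooth1 s" "\<And>x. x \<le> 0 \<Longrightarrow> s x = 0" "\<And>x. x \<ge> 1 \<Longrightarrow> s x = 1"
    "\<And>x. norm (s x) \<le> B" "\<And>x. norm (vderiv s x) \<le> B" "B > 0"
    by (rule smooth_step_unit) blast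
  have vs0: "vderiv s x = 0" if "x < 0 \<or> x > 1" for x
  proof (cases "x < 0")
    case True
    then show ?thesis by (intro vderiv_zero_open[of "{..<0}" _ _ 0]) (auto simp: s)
  next
    case False
    then show ?thesis using that by (intro vderiv_zero_open[of "{1<..}" _ _ 1]) (auto simp: s)
  qed
  define M where "M N = real (Suc N)" for N
  \<comment> \<open>\<open>\<tau> N\<close> is 0 up to l + 1/M and 1 from l + 2/M on;
    \<open>\<sigma> N\<close> is its mirror image at u. The gap of 1/M keeps the support of
    \<open>H N\<close> away from both ends.\<close>
  define \<tau> where "\<tau> N x = s (M N * x + (- M N * l - 1))" for N x
  define \<sigma> where "\<sigma> N x = s ((- M N) * x + (M N * u - 1))" for N x
  define H where "H N x = h x * (\<tau> N x * \<sigma> N x)" for N x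
  have M: "M N > 0" for N by (simp add: M_def)
  have sm: "smooth1 (\<tau> N)" "smooth1 (\<sigma> N)" for N
    unfolding \<tau>_def \<sigma>_def by (intro smooth1_affine s)+
  have bs: "norm (\<tau> N x) \<le> B" "norm (\<sigma> N x) \<le> B" for N x
    by (simp_all add: \<tau>_def \<sigma>_def s)
  have dcomp: "((\<lambda>x. s (p * x + q)) has_vector_derivative of_real p * vderiv s (p * x + q)) (at x)" for p q x
  proof -
    have 1: "((\<lambda>x. p * x + q) has_vector_derivative p) (at x)"
      by (auto intro!: derivative_eq_intros simp: has_real_derivative_iff_has_vector_derivative[symmetric])
    show ?thesis
      using vector_diff_chain_at[OF 1 smooth1_has_vderiv[OF s(1)]] by (simp add: o_def scaleR_conv_of_real)
  qed
  have d\<tau>: "vderiv (\<tau> N) x = of_real (M N) * vderiv s (M N * x + (- M N * l - 1))"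
    and d\<sigma>: "vderiv (\<sigma> N) x = of_real (- M N) * vderiv s ((- M N) * x + (M N * u - 1))" for N x
    unfolding \<tau>_def \<sigma>_def by (rule vector_derivative_at, rule dcomp)+
  have dH: "vderiv (H N) x = h x * (\<tau> N x * vderiv (\<sigma> N) x + vderiv (\<tau> N) x * \<sigma> N x)
      + vderiv h x * (\<tau> N x * \<sigma> N x)" for N x
    unfolding H_def
    by (rule vector_derivative_at) (intro has_vector_derivative_mult smooth1_has_vderiv sm h)
  have "bounded (h ` {l..u})" "bounded (vderiv h ` {l..u})"
    by (intro compact_imp_bounded compact_continuous_image smooth1_continuous h smooth1_vderiv compact_Icc)+
  then obtain K1 K2 where K: "\<And>x. x \<in> {l..u} \<Longrightarrow> norm (h x) \<le> K1" "\<And>x. x \<in> {l..u} \<Longrightarrow> norm (vderiv h x) \<le> K2"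
    unfolding bounded_iff by blast
  have K0: "K1 \<ge> 0" "K2 \<ge> 0"
    using order_trans[OF norm_ge_zero K(1)[of l]] order_trans[OF norm_ge_zero K(2)[of l]] lu by auto
  \<comment> \<open>Together with h l = 0 this reads |h x| \<le> K2 (x - l), which compensates the
    factor M of the derivative of the cutoff, since x - l \<le> 2/M in the layer.\<close>
  have lip: "norm (h x - h y) \<le> K2 * \<bar>x - y\<bar>" if "x \<in> {l..u}" "y \<in> {l..u}" for x y
    using differentiable_bound[of "{l..u}" h "\<lambda>x t. t *\<^sub>R vderiv h x" K2 x y] that K(2)
      smooth1_has_vderiv[OF h]
    by (auto simp: has_vector_derivative_def has_derivative_at_withinI onorm_scaleR_left onorm_id
        bounded_linear_ident)
  have ev\<tau>: "\<forall>\<^sub>F N in sequentially. \<tau> N x = 1 \<and> vderiv (\<tau> N) x = 0" if "x > l" for x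
  proof -
    have "\<forall>\<^sub>F N in sequentially. real N > 2 / (x - l)"
      using filterlim_real_sequentially by (simp add: filterlim_at_top_dense)
    then show ?thesis
    proof eventually_elim
      case (elim N)
      then have "M N * (x - l) > 2"
        using that unfolding M_def by (simp add: field_simps)
      then have "M N * x + (- M N * l - 1) > 1" by (simp add: algebra_simps)
      then show ?case unfolding d\<tau> by (simp add: \<tau>_def s vs0)
    qed
  qed
  have ev\<sigma>: "\<forall>\<^sub>F N in sequentially. \<sigma> N x = 1 \<and> vderiv (\<sigma> N) x = 0" if "x < u" for x
  proof -
    have "\<forall>\<^sub>F N in sequentially. real N > 2 / (u - x)"
      using filterlim_real_sequentially by (simp add: filterlim_at_top_dense)
    then show ?thesis
    proof eventually_elim
      case (elim N)
      then have "M N * (u - x) > 2"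
        using that unfolding M_def by (simp add: field_simps)
      then have "(- M N) * x + (M N * u - 1) > 1" by (simp add: algebra_simps)
      then show ?case unfolding d\<sigma> by (simp add: \<sigma>_def s vs0)
    qed
  qed
  \<comment> \<open>The first term bounds \<open>H N\<close> itself. The other three bound the terms
    of the product rule, where the derivative hits the left cutoff, the right cutoff or h.\<close>
  define C where "C = K1 * B * B + (2 * K2 * B * B + 2 * K2 * B * B) + K2 * (B * B)"
  have C: "K1 * (B * B) \<le> C"
    unfolding C_def using K0 s(6) by (simp add: algebra_simps)
  show thesis
  proof (rule that[of H C])
    show "smooth1 (H N)" for N unfolding H_def by (intro smooth1_mult h sm)
    show "\<exists>p q. l < p \<and> q < u \<and> (\<forall>x. x \<notin> {p..q} \<longrightarrow> H N x = 0)" for N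
    proof (intro exI conjI allI impI)
      show "l < l + 1 / M N" "u - 1 / M N < u" using M[of N] by auto
      fix x assume "x \<notin> {l + 1 / M N..u - 1 / M N}"
      then have "M N * x + (- M N * l - 1) \<le> 0 \<or> (- M N) * x + (M N * u - 1) \<le> 0"
        using M[of N] by (auto simp: field_simps)
      then show "H N x = 0" by (auto simp: H_def \<tau>_def \<sigma>_def s)
    qed
    show "norm (H N x) \<le> C" if "x \<in> {l<..<u}" for N x
    proof -
      have "norm (H N x) \<le> K1 * (B * B)"
        unfolding H_def norm_mult using K0 s(6) that
        by (intro mult_mono bs K) auto
      then show ?thesis using C by linarith
    qed
    show "(\<lambda>N. H N x) \<longlonglongrightarrow> h x" if x: "x \<in> {l<..<u}" for x
    proof (rule Lim_transform_eventually[OF tendsto_const])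
      have "l < x" "x < u" using x by auto
      from ev\<tau>[OF this(1)] ev\<sigma>[OF this(2)] show "\<forall>\<^sub>F N in sequentially. h x = H N x"
        by eventually_elim (simp add: H_def)
    qed
    assume h0: "h l = 0 \<and> h u = 0"
    show "(\<lambda>N. vderiv (H N) x) \<longlonglongrightarrow> vderiv h x" if x: "x \<in> {l<..<u}" for x
    proof (rule Lim_transform_eventually[OF tendsto_const])
      have "l < x" "x < u" using x by auto
      from ev\<tau>[OF this(1)] ev\<sigma>[OF this(2)] show "\<forall>\<^sub>F N in sequentially. vderiv h x = vderiv (H N) x"
        by eventually_elim (simp add: dH)
    qed
    show "norm (vderiv (H N) x) \<le> C" if x: "x \<in> {l<..<u}" for N x
    proof -
      have a: "norm (h x * vderiv (\<tau> N) x) \<le> 2 * K2 * B"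
      proof (cases "vderiv (\<tau> N) x = 0")
        case False
        then have "M N * x + (- M N * l - 1) \<le> 1"
          by (intro leI notI) (simp add: d\<tau> vs0)
        then have m: "M N * (x - l) \<le> 2" by (simp add: algebra_simps)
        have "norm (h x) \<le> K2 * (x - l)" using lip[of x l] h0 x by auto
        then have "norm (h x * vderiv (\<tau> N) x) \<le> (K2 * (x - l)) * (M N * B)"
          unfolding norm_mult d\<tau> using M[of N] s(5) K0 x by (intro mult_mono) auto
        also have "\<dots> = K2 * (M N * (x - l)) * B" by simp
        also have "\<dots> \<le> K2 * 2 * B" using m K0 s(6) M[of N] x by (intro mult_mono mult_nonneg_nonneg) auto
        finally show ?thesis by simp
      qed (use K0 s(6) in auto)
      have b: "norm (h x * vderiv (\<sigma> N) x) \<le> 2 * K2 * B"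
      proof (cases "vderiv (\<sigma> N) x = 0")
        case False
        then have "(- M N) * x + (M N * u - 1) \<le> 1"
          by (intro leI notI) (simp add: d\<sigma> vs0)
        then have m: "M N * (u - x) \<le> 2" by (simp add: algebra_simps)
        have "norm (h x) \<le> K2 * (u - x)" using lip[of x u] h0 x by auto
        then have "norm (h x * vderiv (\<sigma> N) x) \<le> (K2 * (u - x)) * (M N * B)"
          unfolding norm_mult d\<sigma> using M[of N] s(5) K0 x by (intro mult_mono) auto
        also have "\<dots> = K2 * (M N * (u - x)) * B" by simp
        also have "\<dots> \<le> K2 * 2 * B" using m K0 s(6) M[of N] x by (intro mult_mono mult_nonneg_nonneg) auto
        finally show ?thesis by simp
      qed (use K0 s(6) in auto)
      have "vderiv (H N) x = (h x * vderiv (\<sigma> N) x) * \<tau> N x + (h x * vderiv (\<tau> N) x) * \<sigma> N x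
          + vderiv h x * (\<tau> N x * \<sigma> N x)" by (simp add: dH algebra_simps)
      also have "norm \<dots> \<le> 2 * K2 * B * B + 2 * K2 * B * B + K2 * (B * B)"
        using a b K0 s(6) x
        by (intro norm_triangle_mono) (auto simp: norm_mult intro!: mult_mono bs K)
      also have "\<dots> \<le> C" unfolding C_def using K0 s(6) by simp
      finally show ?thesis .
    qed
  qed
qed

lemma bump_function:
  fixes l' l u u' :: real
  assumes "l' < l" "l \<le> u" "u < u'"
  obtains t :: "real \<Rightarrow> complex" where "smooth1 t" "\<And>x. x \<in> {l..u} \<Longrightarrow> t x = 1" "\<And>x. x \<notin> {l'..u'} \<Longrightarrow> t x = 0"
proof -
  obtain s :: "real \<Rightarrow> complex" and B where s: "smooth1 s" "\<And>x. x \<le> 0 \<Longrightarrow> s x = 0" "\<And>x. x \<ge> 1 \<Longrightarrow> s x = 1"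
    by (rule smooth_step_unit) blast
  define t where "t x = s (1 / (l - l') * x + (- l' / (l - l'))) * s ((- 1 / (u' - u)) * x + u' / (u' - u))" for x
  show thesis
  proof (rule that[of t])
    show "smooth1 t" unfolding t_def by (intro smooth1_mult smooth1_affine s)
    show "t x = 1" if "x \<in> {l..u}" for x
    proof -
      have "1 / (l - l') * x + (- l' / (l - l')) \<ge> 1" "(- 1 / (u' - u)) * x + u' / (u' - u) \<ge> 1"
        using that assms by (auto simp: add_divide_distrib[symmetric] diff_divide_distrib[symmetric] le_divide_eq_1)
      then show ?thesis by (simp add: t_def s)
    qed
    show "t x = 0" if "x \<notin> {l'..u'}" for x
    proof -
      have "1 / (l - l') * x + (- l' / (l - l')) \<le> 0 \<or> (- 1 / (u' - u)) * x + u' / (u' - u) \<le> 0"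
        using that assms by (auto simp: add_divide_distrib[symmetric] diff_divide_distrib[symmetric] divide_le_0_iff)
      then show ?thesis by (auto simp: t_def s)
    qed
  qed
qed

section \<open>Fields with separated variables\<close>

definition sep :: "(3 \<Rightarrow> real \<Rightarrow> complex) \<Rightarrow> real^3 \<Rightarrow> complex" where
  "sep f x = (\<Prod>j\<in>UNIV. f j (x $ j))"

definition sep_field :: "3 \<Rightarrow> (3 \<Rightarrow> real \<Rightarrow> complex) \<Rightarrow> real^3 \<Rightarrow> complex^3" where
  "sep_field i f x = sep f x *s axis i 1"

abbreviation dsep :: "3 \<Rightarrow> (3 \<Rightarrow> real \<Rightarrow> complex) \<Rightarrow> 3 \<Rightarrow> real \<Rightarrow> complex" where
  "dsep j f \<equiv> f(j := vderiv (f j))"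

lemma sep_3: "sep f x = f 1 (x $ 1) * f 2 (x $ 2) * f 3 (x $ 3)"
proof -
  have "(\<Prod>j\<in>UNIV. g j) = g 1 * (g 2 * g 3)" for g :: "3 \<Rightarrow> complex"
  proof -
    have "(1::3) \<notin> {2, 3}" "(2::3) \<notin> {3}" by auto
    then show ?thesis
      unfolding UNIV_3
      using prod.insert[of "{2, 3}" 1 g] prod.insert[of "{3}" 2 g] prod.insert[of "{}" 3 g]
      by (simp only: finite.intros simp_thms empty_iff prod.empty mult_1_right)
  qed
  then show ?thesis by (simp only: sep_def mult.assoc)
qed

lemma sep_field_nth: "sep_field i f x $ j = (if j = i then sep f x else 0)"
  by (simp add: sep_field_def axis_def)

lemma sep_split: "sep f x = f j (x $ j) * (\<Prod>k\<in>UNIV - {j}. f k (x $ k))"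
  unfolding sep_def by (subst prod.remove[of UNIV j]) auto

lemma sep_has_partial:
  assumes "smooth1 (f j)"
  shows "((\<lambda>t. sep f (x + t *\<^sub>R axis j 1)) has_vector_derivative sep (dsep j f) x) (at 0)"
proof -
  define P where "P = (\<Prod>k\<in>UNIV - {j}. f k (x $ k))"
  have P: "(\<Prod>k\<in>UNIV - {j}. f k ((x + t *\<^sub>R axis j 1) $ k)) = P" for t
    unfolding P_def by (rule prod.cong) (auto simp: axis_def)
  have e: "sep f (x + t *\<^sub>R axis j 1) = f j (x $ j + t) * P" for t
    by (subst sep_split[of _ _ j]) (simp only: P, simp add: axis_def)
  have "((\<lambda>t. f j (x $ j + t)) has_vector_derivative vderiv (f j) (x $ j)) (at 0)"
  proof -
    have 1: "((\<lambda>t. x $ j + t) has_vector_derivative 1) (at 0)"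
      by (auto intro!: derivative_eq_intros)
    have "(f j has_vector_derivative vderiv (f j) (x $ j)) (at (x $ j + 0))"
      using smooth1_has_vderiv[OF assms, of "x $ j"] by simp
    from vector_diff_chain_at[OF 1 this] show ?thesis by (simp add: o_def)
  qed
  then have "((\<lambda>t. f j (x $ j + t) * P) has_vector_derivative vderiv (f j) (x $ j) * P) (at 0)"
    by (rule has_vector_derivative_mult_left)
  moreover have "sep (dsep j f) x = vderiv (f j) (x $ j) * P"
    unfolding P_def by (subst sep_split[of _ _ j]) (auto intro!: prod.cong)
  ultimately show ?thesis by (simp add: e)
qed

lemma partial_sep: "smooth1 (f j) \<Longrightarrow> partial j (sep f) x = sep (dsep j f) x"
  unfolding partial_def by (rule vector_derivative_at) (rule sep_has_partial)

lemma bounded_linear_vector_smult: "bounded_linear (\<lambda>c::complex. c *s v)" for v :: "complex^3"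
  by (rule linear_conv_bounded_linear[THEN iffD1])
     (simp add: linear_iff vec_eq_iff algebra_simps)

lemma partial_sep_field: "smooth1 (f j) \<Longrightarrow> partial j (sep_field i f) = sep_field i (dsep j f)"
  unfolding partial_def sep_field_def
  by (rule ext, rule vector_derivative_at)
     (rule bounded_linear.has_vector_derivative[OF bounded_linear_vector_smult sep_has_partial])

lemma smooth1_differentiable_nth: "smooth1 f \<Longrightarrow> (\<lambda>x::real^3. f (x $ j)) differentiable at x within S"
proof -
  assume f: "smooth1 f"
  have 1: "((\<lambda>x::real^3. x $ j) has_derivative (\<lambda>x. x $ j)) (at x within S)"
    by (rule bounded_linear_imp_has_derivative) (rule bounded_linear_vec_nth)
  have 2: "(f has_derivative (\<lambda>t. t *\<^sub>R vderiv f (x $ j))) (at (x $ j) within (\<lambda>x. x $ j) ` S)"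
    using smooth1_has_vderiv[OF f, of "x $ j"] unfolding has_vector_derivative_def by (rule has_derivative_at_withinI)
  from diff_chain_within[OF 1 2] show ?thesis
    unfolding differentiable_def o_def by blast
qed

lemma differentiable_sep_field: "(\<And>j. smooth1 (f j)) \<Longrightarrow> sep_field i f differentiable_on S"
proof -
  assume f: "\<And>j. smooth1 (f j)"
  have "sep f differentiable at x within S" for x
    unfolding sep_3[abs_def] by (intro differentiable_mult smooth1_differentiable_nth f)
  then show ?thesis
    using bounded_linear.has_derivative[OF bounded_linear_vector_smult[of "axis i 1"]]
    unfolding differentiable_on_def sep_field_def[abs_def] differentiable_def by blast
qed

text \<open>A partial derivative only replaces one factor by its derivative, so iterated derivatives
  never leave the class of separated fields with smooth factors.\<close>

lemma smooth_sep_field: "(\<And>j. smooth1 (f j)) \<Longrightarrow> smooth (sep_field i f)"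
proof -
  assume f: "\<And>j. smooth1 (f j)"
  have "\<exists>f'. foldr partial is (sep_field i f) = sep_field i f' \<and> (\<forall>j. smooth1 (f' j))" for "is"
  proof (induction "is")
    case (Cons j "is")
    then obtain f' where "foldr partial is (sep_field i f) = sep_field i f'" "\<And>j. smooth1 (f' j)" by blast
    then show ?case
      by (intro exI[of _ "dsep j f'"]) (auto simp: partial_sep_field smooth1_vderiv fun_upd_def)
  qed (use f in auto)
  then show ?thesis
    unfolding smooth_def by (metis differentiable_sep_field)
qed

lemma continuous_on_sep: "(\<And>j. smooth1 (f j)) \<Longrightarrow> continuous_on S (sep f)"
  unfolding sep_3[abs_def]
  by (intro continuous_intros continuous_on_compose2[OF smooth1_continuous[of _ UNIV]]) auto

lemma sep_field_test_field:
  assumes "\<And>j. smooth1 (f j)" "\<And>j t. t \<notin> {l j..u j} \<Longrightarrow> f j t = 0" "{x. \<forall>j. x $ j \<in> {l j..u j}} \<subseteq> S"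
  shows "sep_field i f \<in> test_fields S"
proof -
  have b: "{x. \<forall>j. x $ j \<in> {l j..u j}} = cbox (\<chi> j. l j) (\<chi> j. u j)"
    by (auto simp: mem_box_cart)
  have "{x. sep_field i f x \<noteq> 0} \<subseteq> {x. \<forall>j. x $ j \<in> {l j..u j}}"
  proof safe
    fix x j assume *: "sep_field i f x \<noteq> 0"
    show "x $ j \<in> {l j..u j}"
    proof (rule ccontr)
      assume "x $ j \<notin> {l j..u j}"
      then have "sep f x = 0" using assms(2)[of "x $ j" j] by (subst sep_split[of _ _ j]) simp
      then show False using * by (simp add: sep_field_def)
    qed
  qed
  then have c: "closure {x. sep_field i f x \<noteq> 0} \<subseteq> cbox (\<chi> j. l j) (\<chi> j. u j)"
    unfolding b by (intro closure_minimal closed_cbox)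
  then have "compact (closure {x. sep_field i f x \<noteq> 0})"
    using bounded_subset[OF bounded_cbox] by (simp add: compact_eq_bounded_closed)
  moreover have "closure {x. sep_field i f x \<noteq> 0} \<subseteq> S"
    using c assms(3) unfolding b by (rule subset_trans)
  ultimately show ?thesis
    using smooth_sep_field[OF assms(1)] unfolding test_fields_def by simp
qed

lemma partial_zero: "partial j (\<lambda>z. 0) x = 0"
  unfolding partial_def by simp

lemma sep_field_component: "(\<lambda>z. sep_field i f z $ j) = (if j = i then sep f else (\<lambda>z. 0))"
  by (auto simp: sep_field_nth fun_eq_iff)

lemma curl_sep_field:
  assumes "\<And>j. smooth1 (f j)"
  shows "curl (sep_field 1 f) x = vector [0, sep (dsep 3 f) x, - sep (dsep 2 f) x]"
    "curl (sep_field 2 f) x = vector [- sep (dsep 3 f) x, 0, sep (dsep 1 f) x]"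
    "curl (sep_field 3 f) x = vector [sep (dsep 2 f) x, - sep (dsep 1 f) x, 0]"
  by (simp_all add: curl_def sep_field_component partial_sep[OF assms] partial_zero)

section \<open>The weak form of Maxwell's equations against separated fields\<close>

lemma section_between_eq_box: "section_between a b R R' = box (vector [0, 0, R]) (vector [a, b, R'])"
  by (auto simp: section_between_def cross_section_def proj12_def mem_box_cart forall_3)

lemma waveguide_eq: "waveguide a b = {x. 0 < x$1 \<and> x$1 < a \<and> 0 < x$2 \<and> x$2 < b \<and> x$3 < 0}"
  by (auto simp: waveguide_def cross_section_def proj12_def)

lemma section_between_eq:
  "section_between a b R R' = {x. 0 < x$1 \<and> x$1 < a \<and> 0 < x$2 \<and> x$2 < b \<and> R < x$3 \<and> x$3 < R'}"
  by (auto simp: section_between_def cross_section_def proj12_def)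

lemma open_waveguide: "open (waveguide a b)"
  unfolding waveguide_eq by (intro open_Collect_conj open_Collect_less continuous_intros)

lemma lmeasurable_section_between: "section_between a b R R' \<in> lmeasurable"
  by (simp add: section_between_eq_box)

lemma sets_section_between [measurable]: "section_between a b R R' \<in> sets lebesgue"
  using lmeasurable_section_between by (rule fmeasurableD)

lemma sets_waveguide [measurable]: "waveguide a b \<in> sets lebesgue"
  using open_waveguide by (simp add: borel_open sets_completionI_sets)

lemma section_subset_waveguide: "R' \<le> 0 \<Longrightarrow> section_between a b R R' \<subseteq> waveguide a b"
  by (auto simp: section_between_eq waveguide_eq)

lemma integral_lebesgue_on_subset:
  fixes G :: "'a::euclidean_space \<Rightarrow> 'b::euclidean_space"
  assumes "S \<subseteq> W" "S \<in> sets lebesgue" "W \<in> sets lebesgue" "\<And>x. x \<in> W - S \<Longrightarrow> G x = 0"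
  shows "integral\<^sup>L (lebesgue_on W) G = integral\<^sup>L (lebesgue_on S) G"
    and "integrable (lebesgue_on W) G \<longleftrightarrow> integrable (lebesgue_on S) G"
proof -
  have "(\<lambda>x. indicator W x *\<^sub>R G x) = (\<lambda>x. indicator S x *\<^sub>R G x)"
    using assms(1,4) by (auto simp: indicator_def fun_eq_iff)
  then show "integral\<^sup>L (lebesgue_on W) G = integral\<^sup>L (lebesgue_on S) G"
    and "integrable (lebesgue_on W) G \<longleftrightarrow> integrable (lebesgue_on S) G"
    using assms(2,3) by (simp_all add: integral_restrict_space integrable_restrict_space)
qed

lemma continuous_measurable_lebesgue_on:
  fixes G :: "'a::euclidean_space \<Rightarrow> 'b::euclidean_space"
  assumes "continuous_on UNIV G"
  shows "G \<in> borel_measurable (lebesgue_on S)"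
  using borel_measurable_continuous_onI[OF assms]
  by (intro measurable_restrict_space1 measurable_completion) (simp_all add: measurable_lborel1)

section \<open>Square integrable fields against bounded functions\<close>

lemma L2_measurable: "w \<in> L2 S \<Longrightarrow> w \<in> borel_measurable (lebesgue_on S)"
  and L2_integrable: "w \<in> L2 S \<Longrightarrow> integrable (lebesgue_on S) (\<lambda>x. (norm (w x))\<^sup>2)"
  by (simp_all add: L2_def)

lemma borel_measurable_vec_nth:
  fixes w :: "'a \<Rightarrow> complex^3"
  assumes "w \<in> borel_measurable M"
  shows "(\<lambda>x. w x $ i) \<in> borel_measurable M"
  by (rule measurable_compose[OF assms])
     (rule borel_measurable_continuous_onI, intro continuous_intros)

lemma integrable_const_lebesgue_on: "S \<in> lmeasurable \<Longrightarrow> integrable (lebesgue_on S) (\<lambda>x. c)"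
  by (intro finite_measure.integrable_const finite_measure_lebesgue_on)

lemma L2_integrable_norm:
  assumes "w \<in> L2 S" "S \<in> lmeasurable"
  shows "integrable (lebesgue_on S) (\<lambda>x. norm (w x))"
proof (rule Bochner_Integration.integrable_bound)
  show "integrable (lebesgue_on S) (\<lambda>x. 1 + (norm (w x))\<^sup>2)"
    using integrable_const_lebesgue_on[OF assms(2)] L2_integrable[OF assms(1)]
    by (rule Bochner_Integration.integrable_add)
  show "(\<lambda>x. norm (w x)) \<in> borel_measurable (lebesgue_on S)"
    using L2_measurable[OF assms(1)] by simp
  have "t \<le> 1 + t\<^sup>2" for t :: real
    using zero_le_power2[of "t - 1"] zero_le_power2[of t] by (simp add: power2_eq_square algebra_simps) (smt (verit) zero_le_square)
  then show "AE x in lebesgue_on S. norm (norm (w x)) \<le> norm (1 + (norm (w x))\<^sup>2)"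
    by (intro AE_I2) (simp add: abs_of_nonneg)
qed

lemma L2_integrable_mult:
  fixes w :: "'a::euclidean_space \<Rightarrow> complex^3"
  assumes "w \<in> L2 S" "S \<in> lmeasurable" "G \<in> borel_measurable (lebesgue_on S)" "\<And>x. x \<in> S \<Longrightarrow> norm (G x) \<le> C"
  shows "integrable (lebesgue_on S) (\<lambda>x. w x $ i * G x)"
proof (rule Bochner_Integration.integrable_bound)
  show "integrable (lebesgue_on S) (\<lambda>x. C * norm (w x))"
    using L2_integrable_norm[OF assms(1,2)] by simp
  show "(\<lambda>x. w x $ i * G x) \<in> borel_measurable (lebesgue_on S)"
    using assms(3) borel_measurable_vec_nth[OF L2_measurable[OF assms(1)]] by (rule borel_measurable_times[rotated])
  show "AE x in lebesgue_on S. norm (w x $ i * G x) \<le> norm (C * norm (w x))"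
  proof (rule AE_I2)
    fix x assume "x \<in> space (lebesgue_on S)"
    then have "norm (G x) \<le> C" using assms(4) by simp
    then have "norm (w x $ i) * norm (G x) \<le> norm (w x) * C"
      by (intro mult_mono) (auto simp: Finite_Cartesian_Product.norm_nth_le)
    also have "\<dots> \<le> \<bar>C * norm (w x)\<bar>" by (metis abs_ge_self mult.commute)
    finally show "norm (w x $ i * G x) \<le> norm (C * norm (w x))"
      by (simp add: norm_mult)
  qed
qed

definition wint :: "real \<Rightarrow> real \<Rightarrow> (real^3 \<Rightarrow> complex^3) \<Rightarrow> 3 \<Rightarrow> (3 \<Rightarrow> real \<Rightarrow> complex) \<Rightarrow> complex" where
  "wint a b w i f = (LINT x|lebesgue_on (waveguide a b). w x $ i * sep f x)"

definition side_lo :: "real \<Rightarrow> 3 \<Rightarrow> real" where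
  "side_lo L j = (if j = 3 then L else 0)"

definition side_hi :: "real \<Rightarrow> real \<Rightarrow> 3 \<Rightarrow> real" where
  "side_hi a b j = (if j = 1 then a else if j = 2 then b else 0)"

lemma section_sides: "section_between a b L 0 = {x. \<forall>j. x $ j \<in> {side_lo L j<..<side_hi a b j}}"
proof -
  have "(3::3) \<noteq> 1" "(3::3) \<noteq> 2" "(1::3) \<noteq> 3" "(2::3) \<noteq> 3" "(1::3) \<noteq> 2" by auto
  then show ?thesis
    by (auto simp: section_between_eq side_lo_def side_hi_def forall_3)
qed

lemma sep_bound:
  assumes "\<And>j. norm (f j (x $ j)) \<le> C"
  shows "norm (sep f x) \<le> C ^ 3"
proof -
  have "norm (sep f x) \<le> (\<Prod>j\<in>(UNIV::3 set). C)"
    unfolding sep_def prod_norm[symmetric] by (intro prod_mono) (auto simp: assms)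
  then show ?thesis by simp
qed

lemma sep_bounded_section:
  assumes "\<And>j. smooth1 (f j)"
  obtains C where "\<And>x. x \<in> section_between a b R R' \<Longrightarrow> norm (sep f x) \<le> C"
proof -
  have "compact (sep f ` cbox (vector [0, 0, R]) (vector [a, b, R']))"
    by (intro compact_continuous_image continuous_on_sep assms compact_cbox)
  then have "bounded (sep f ` cbox (vector [0, 0, R]) (vector [a, b, R']))"
    by (rule compact_imp_bounded)
  then obtain C where C: "\<forall>y\<in>sep f ` cbox (vector [0, 0, R]) (vector [a, b, R']). norm y \<le> C"
    unfolding bounded_iff by blast
  show thesis
  proof (rule that)
    fix x assume "x \<in> section_between a b R R'"
    then have "x \<in> cbox (vector [0, 0, R]) (vector [a, b, R'])"
      unfolding section_between_eq_box using box_subset_cbox by blast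
    then show "norm (sep f x) \<le> C" using C by blast
  qed
qed

lemma integrable_sep_section:
  fixes w :: "real^3 \<Rightarrow> complex^3"
  assumes "w \<in> L2 (section_between a b R R')" "\<And>j. smooth1 (f j)"
  shows "integrable (lebesgue_on (section_between a b R R')) (\<lambda>x. w x $ i * sep f x)"
proof -
  obtain C where C: "\<And>x. x \<in> section_between a b R R' \<Longrightarrow> norm (sep f x) \<le> C"
    using sep_bounded_section[of f a b R R'] assms(2) by auto
  show ?thesis
    by (rule L2_integrable_mult[OF assms(1) lmeasurable_section_between
          continuous_measurable_lebesgue_on[OF continuous_on_sep[OF assms(2)]] C])
qed

lemma sep_zero: "f j (x $ j) = 0 \<Longrightarrow> sep f x = 0"
  by (subst sep_split[of _ _ j]) simp

text \<open>A profile that vanishes below L turns an integral over the infinite guide into one over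
  a truncated guide, where the fields are square integrable and the measure is finite.\<close>

lemma wint_section:
  assumes "\<And>t. t < L \<Longrightarrow> f 3 t = 0" "L \<le> 0" "L' < L"
  shows "wint a b w i f = (LINT x|lebesgue_on (section_between a b L' 0). w x $ i * sep f x)"
    and "integrable (lebesgue_on (waveguide a b)) (\<lambda>x. w x $ i * sep f x) \<longleftrightarrow>
      integrable (lebesgue_on (section_between a b L' 0)) (\<lambda>x. w x $ i * sep f x)"
proof -
  have z: "w x $ i * sep f x = 0" if "x \<in> waveguide a b - section_between a b L' 0" for x
    using that assms by (auto simp: waveguide_eq section_between_eq sep_zero[of _ 3])
  show "wint a b w i f = (LINT x|lebesgue_on (section_between a b L' 0). w x $ i * sep f x)"
    unfolding wint_def
    by (rule integral_lebesgue_on_subset) (auto simp: z section_subset_waveguide)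
  show "integrable (lebesgue_on (waveguide a b)) (\<lambda>x. w x $ i * sep f x) \<longleftrightarrow>
      integrable (lebesgue_on (section_between a b L' 0)) (\<lambda>x. w x $ i * sep f x)"
    by (rule integral_lebesgue_on_subset) (auto simp: z section_subset_waveguide)
qed

lemma cdot_sep_field: "cdot v (sep_field i f x) = v $ i * sep f x"
  unfolding cdot_def sep_field_nth by (simp add: if_distrib[of "\<lambda>y. v $ _ * y"] cong: if_cong)

text \<open>With i, j, l as a cyclic triple, an identity for component i of a curl is stated and
  proved once for all three components.\<close>

definition cyclic3 :: "3 \<Rightarrow> 3 \<Rightarrow> 3 \<Rightarrow> bool" where
  "cyclic3 i j l \<longleftrightarrow> (i, j, l) \<in> {(1, 2, 3), (2, 3, 1), (3, 1, 2)}"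

lemma cyclic3_rotate: "cyclic3 i j l \<Longrightarrow> cyclic3 j l i"
  by (auto simp: cyclic3_def)

lemma cyclic3_distinct: "cyclic3 i j l \<Longrightarrow> i \<noteq> j \<and> j \<noteq> l \<and> l \<noteq> i"
  by (auto simp: cyclic3_def)

lemma cdot_curl_sep_field:
  assumes "\<And>j. smooth1 (f j)" "cyclic3 i j l"
  shows "cdot v (curl (sep_field i f) x) = v $ j * sep (dsep l f) x - v $ l * sep (dsep j f) x"
proof -
  have "i = 1 \<and> j = 2 \<and> l = 3 \<or> i = 2 \<and> j = 3 \<and> l = 1 \<or> i = 3 \<and> j = 1 \<and> l = 2"
    using assms(2) by (auto simp: cyclic3_def)
  then show ?thesis
    by (elim disjE conjE; hypsubst; simp only: curl_sep_field[OF assms(1)];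
        simp add: cdot_def sum_3)
qed

lemma vderiv_cong_open:
  assumes "open U" "x \<in> U" "\<And>t. t \<in> U \<Longrightarrow> f t = g t"
  shows "vderiv f x = vderiv g x"
  by (intro vector_derivative_cong_eq) (auto simp: eventually_nhds intro!: exI[of _ U] assms)

text \<open>Maxwell's equations with constant coefficients: the permittivity has been absorbed into
  the source \<open>F\<close>, which will be the contrast times the total field in D and hence
  vanishes below \<rho>. The trace condition ranges over all test fields, so it also expresses that
  \<open>c\<close> is the weak curl of \<open>w\<close>.\<close>

locale weak_maxwell =
  fixes a b k \<rho> :: real and w c F :: "real^3 \<Rightarrow> complex^3"
  assumes ab: "0 < a" "0 < b" and k: "0 < k"
    and w: "\<And>R. R < 0 \<Longrightarrow> w \<in> L2 (section_between a b R 0)"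
    and c: "\<And>R. R < 0 \<Longrightarrow> c \<in> L2 (section_between a b R 0)"
    and F: "\<And>R. R < 0 \<Longrightarrow> F \<in> L2 (section_between a b R 0)"
    and trace: "zero_tangential_trace (waveguide a b) w c"
    and maxwell: "\<And>\<phi>. \<phi> \<in> test_fields (waveguide a b) \<Longrightarrow>
      (LINT x|lebesgue_on (waveguide a b). cdot (c x) (curl \<phi> x) - of_real (k\<^sup>2) * cdot (w x) (\<phi> x))
      = (LINT x|lebesgue_on (waveguide a b). cdot (F x) (\<phi> x))"
    and F_zero: "\<And>x. x $ 3 \<le> \<rho> \<Longrightarrow> F x = 0"
    and \<rho>: "\<rho> < 0"
begin

abbreviation W where "W \<equiv> waveguide a b"
abbreviation J where "J \<equiv> wint a b"

lemma integrable_sep_waveguide: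
  fixes v :: "real^3 \<Rightarrow> complex^3"
  assumes "\<And>R. R < 0 \<Longrightarrow> v \<in> L2 (section_between a b R 0)" "\<And>j. smooth1 (f j)" "\<And>t. t < L \<Longrightarrow> f 3 t = 0"
  shows "integrable (lebesgue_on W) (\<lambda>x. v x $ i * sep f x)"
proof -
  have "min L 0 - 1 < (0::real)" by simp
  then show ?thesis
    using wint_section(2)[of "min L 0" f "min L 0 - 1" a b v i] assms(3)
      integrable_sep_section[OF assms(1) assms(2), of "min L 0 - 1" i] by auto
qed

lemma dsep_props:
  assumes "\<And>j. smooth1 (f j)" "\<And>t. t < L \<Longrightarrow> f 3 t = 0"
  shows "\<And>j. smooth1 (dsep l f j)" "\<And>t. t < L \<Longrightarrow> dsep l f 3 t = 0"
proof -
  show "smooth1 (dsep l f j)" for j by (simp add: assms(1) smooth1_vderiv)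
  have "vderiv (f 3) t = 0" if "t < L" for t
    using that by (intro vderiv_zero_open[of "{..<L}" _ _ 0]) (auto simp: assms(2))
  then show "dsep l f 3 t = 0" if "t < L" for t using that assms(2) by simp
qed

text \<open>One curl is moved onto the profile without any boundary condition on it, because the
  test fields of the trace condition may be nonzero on the walls. Only compact support has to be
  arranged, by factors that equal 1 on the part of the guide where the profile lives.\<close>

lemma trace_sep:
  assumes f: "\<And>j. smooth1 (f j)" "\<And>t. t < L \<Longrightarrow> f 3 t = 0" and ijl: "cyclic3 i j l"
  shows "J c i f = J w j (dsep l f) - J w l (dsep j f)"
proof -
  define L' where "L' = min L 0"
  have L': "L' \<le> 0" "L' \<le> L" by (auto simp: L'_def)
  define p where "p j = (if j = 3 then L' - 1 else - 1)" for j :: 3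
  define q where "q j = (if j = 1 then a + 1 else if j = 2 then b + 1 else 1)" for j :: 3
  have pq: "p j \<le> q j" for j using ab L' by (auto simp: p_def q_def)
  have "\<exists>t. smooth1 t \<and> (\<forall>x\<in>{p j..q j}. t x = 1) \<and> (\<forall>x. x \<notin> {p j - 1..q j + 1} \<longrightarrow> t x = 0)" for j
    by (rule bump_function[of "p j - 1" "p j" "q j" "q j + 1"]) (use pq[of j] in auto)
  then obtain \<tau> where \<tau>: "\<And>j. smooth1 (\<tau> j)" "\<And>j x. x \<in> {p j..q j} \<Longrightarrow> \<tau> j x = 1"
    "\<And>j x. x \<notin> {p j - 1..q j + 1} \<Longrightarrow> \<tau> j x = 0" by metis
  define h where "h j t = f j t * \<tau> j t" for j t
  have h: "smooth1 (h j)" for j unfolding h_def by (intro smooth1_mult f \<tau>)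
  \<comment> \<open>On these open sets the cut profile equals f, hence so do its derivatives.
    Downwards the third set is unbounded, since f 3 is already 0 below L'.\<close>
  define U where "U j = (if j = 3 then {..<1} else {p j<..<q j})" for j
  have U: "open (U j)" for j by (simp add: U_def)
  have fh: "h j t = f j t" if "t \<in> U j" for j t
    using that \<tau>(2)[of t j] f(2)[of t] L' by (cases "t < L'") (auto simp: h_def U_def p_def q_def split: if_splits)
  have WU: "x $ j \<in> U j" if "x \<in> W" for x j
    using that exhaust_3[of j] by (auto simp: waveguide_eq U_def p_def q_def)
  have s: "sep h x = sep f x" if "x \<in> W" for x
    unfolding sep_def by (intro prod.cong refl fh WU that)
  have ds: "sep (dsep m h) x = sep (dsep m f) x" if "x \<in> W" for x m
    unfolding sep_def
    by (intro prod.cong refl) (auto simp: fh WU that intro!: vderiv_cong_open[OF U WU[OF that]])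
  have "sep_field i h \<in> test_fields UNIV"
    by (rule sep_field_test_field[where l = "\<lambda>j. p j - 1" and u = "\<lambda>j. q j + 1"]) (auto simp: h h_def \<tau>(3))
  then have "0 = (LINT x|lebesgue_on W. cdot (c x) (sep_field i h x) - cdot (w x) (curl (sep_field i h) x))"
    using trace unfolding zero_tangential_trace_def by simp
  also have "\<dots> = (LINT x|lebesgue_on W. c x $ i * sep f x - (w x $ j * sep (dsep l f) x - w x $ l * sep (dsep j f) x))"
    by (rule Bochner_Integration.integral_cong)
       (simp_all add: cdot_sep_field cdot_curl_sep_field[OF h ijl] s ds)
  also have "\<dots> = J c i f - (J w j (dsep l f) - J w l (dsep j f))"
  proof -
    have df: "smooth1 (dsep n f m)" "t < L \<Longrightarrow> dsep n f 3 t = 0" for n m t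
      using dsep_props(1)[where f = f and L = L and l = n and j = m, OF f(1)]
      dsep_props(2)[where f = f and L = L and l = n and t = t, OF f(1)] f(2) by simp_all
    have i: "integrable (lebesgue_on W) (\<lambda>x. c x $ i * sep f x)"
      "integrable (lebesgue_on W) (\<lambda>x. w x $ j * sep (dsep l f) x)"
      "integrable (lebesgue_on W) (\<lambda>x. w x $ l * sep (dsep j f) x)"
      by (intro integrable_sep_waveguide[where L = L] f df c w; assumption)+
    show ?thesis
      unfolding wint_def using i
      by (simp add: Bochner_Integration.integral_diff Bochner_Integration.integrable_diff)
  qed
  finally show ?thesis by simp
qed

lemma wint_limit:
  fixes v :: "real^3 \<Rightarrow> complex^3"
  assumes v: "v \<in> L2 (section_between a b L 0)"
    and m: "\<And>N j. continuous_on UNIV (g N j)" "\<And>j. continuous_on UNIV (h j)"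
    and bd: "\<And>N j t. t \<in> {side_lo L j<..<side_hi a b j} \<Longrightarrow> norm (g N j t) \<le> C"
    and lim: "\<And>j t. t \<in> {side_lo L j<..<side_hi a b j} \<Longrightarrow> (\<lambda>N. g N j t) \<longlonglongrightarrow> h j t"
  shows "(\<lambda>N. LINT x|lebesgue_on (section_between a b L 0). v x $ i * sep (g N) x)
    \<longlonglongrightarrow> (LINT x|lebesgue_on (section_between a b L 0). v x $ i * sep h x)"
proof (rule integral_dominated_convergence[where w = "\<lambda>x. norm (v x) * C ^ 3"])
  have cs: "continuous_on UNIV (sep f)" if "\<And>j. continuous_on UNIV (f j)" for f
    unfolding sep_3[abs_def] using that
    by (intro continuous_intros continuous_on_compose2[where t = UNIV and f = "\<lambda>x. x $ _"]) auto
  have mv: "(\<lambda>x. v x $ i) \<in> borel_measurable (lebesgue_on (section_between a b L 0))"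
    by (rule borel_measurable_vec_nth[OF L2_measurable[OF v]])
  show "(\<lambda>x. v x $ i * sep h x) \<in> borel_measurable (lebesgue_on (section_between a b L 0))"
    "(\<lambda>x. v x $ i * sep (g N) x) \<in> borel_measurable (lebesgue_on (section_between a b L 0))" for N
    by (intro borel_measurable_times mv continuous_measurable_lebesgue_on cs m)+
  show "integrable (lebesgue_on (section_between a b L 0)) (\<lambda>x. norm (v x) * C ^ 3)"
    using L2_integrable_norm[OF v lmeasurable_section_between] by simp
  show "AE x in lebesgue_on (section_between a b L 0). (\<lambda>N. v x $ i * sep (g N) x) \<longlonglongrightarrow> v x $ i * sep h x"
    unfolding sep_def
    by (intro AE_I2 tendsto_mult tendsto_const tendsto_prod lim) (auto simp: section_sides)
  show "AE x in lebesgue_on (section_between a b L 0). norm (v x $ i * sep (g N) x) \<le> norm (v x) * C ^ 3" for N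
  proof (rule AE_I2)
    fix x assume "x \<in> space (lebesgue_on (section_between a b L 0))"
    then have "norm (sep (g N) x) \<le> C ^ 3"
      by (intro sep_bound bd) (simp add: section_sides)
    then show "norm (v x $ i * sep (g N) x) \<le> norm (v x) * C ^ 3"
      unfolding norm_mult by (intro mult_mono) (auto simp: Finite_Cartesian_Product.norm_nth_le)
  qed
qed

text \<open>Here the test fields must have support inside the guide. The curl of a field in
  direction i differentiates its profile only with respect to j and l, which are the directions in
  which the profile vanishes at both ends. The cutoffs therefore converge boundedly with one
  derivative where a derivative occurs, and boundedly without derivative in direction i.\<close>

lemma maxwell_sep:
  assumes f: "\<And>j. smooth1 (f j)" "\<And>t. t < L \<Longrightarrow> f 3 t = 0" and ijl: "cyclic3 i j l"
    and bc: "\<And>n. n \<noteq> i \<Longrightarrow> f n 0 = 0" "\<And>n. n \<noteq> i \<Longrightarrow> f n (side_hi a b n) = 0"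
  shows "J c j (dsep l f) - J c l (dsep j f) - of_real (k\<^sup>2) * J w i f = J F i f"
proof -
  \<comment> \<open>Strictly below L, so that the third factor vanishes at the artificial lower end
    as well, and strictly below 0, so that the interval is not empty.\<close>
  define L' where "L' = min L 0 - 1"
  have L': "L' < 0" "L' < L" by (auto simp: L'_def)
  let ?S = "section_between a b L' 0"
  have lh: "side_lo L' n < side_hi a b n" for n
    using ab L' exhaust_3[of n] by (auto simp: side_lo_def side_hi_def)
  have ends: "f n (side_lo L' n) = 0 \<and> f n (side_hi a b n) = 0" if "n \<noteq> i" for n
    using bc[OF that] f(2)[of L'] L' by (auto simp: side_lo_def)
  \<comment> \<open>The conclusions of \<open>cutoff_sequence\<close> in one predicate, so that the
    sequences can be chosen for all coordinates simultaneously.\<close>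
  define P where "P n H C \<longleftrightarrow> (\<forall>N. smooth1 (H N)) \<and>
      (\<forall>N. \<exists>p q. side_lo L' n < p \<and> q < side_hi a b n \<and> (\<forall>x. x \<notin> {p..q} \<longrightarrow> H N x = 0)) \<and>
      (\<forall>x\<in>{side_lo L' n<..<side_hi a b n}. (\<forall>N. norm (H N x) \<le> C) \<and> (\<lambda>N. H N x) \<longlonglongrightarrow> f n x \<and>
        (n \<noteq> i \<longrightarrow> (\<forall>N. norm (vderiv (H N) x) \<le> C) \<and> (\<lambda>N. vderiv (H N) x) \<longlonglongrightarrow> vderiv (f n) x))"
    for n and H :: "nat \<Rightarrow> real \<Rightarrow> complex" and C
  have "\<exists>H C. P n H C" for n
  proof (rule cutoff_sequence[OF f(1)[of n] lh[of n]])
    fix H C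
    assume *: "\<And>N. smooth1 (H N)"
      "\<And>N. \<exists>p q. side_lo L' n < p \<and> q < side_hi a b n \<and> (\<forall>x. x \<notin> {p..q} \<longrightarrow> H N x = 0)"
      "\<And>N x. x \<in> {side_lo L' n<..<side_hi a b n} \<Longrightarrow> norm (H N x) \<le> C"
      "\<And>x. x \<in> {side_lo L' n<..<side_hi a b n} \<Longrightarrow> (\<lambda>N. H N x) \<longlonglongrightarrow> f n x"
      "\<And>N x. f n (side_lo L' n) = 0 \<and> f n (side_hi a b n) = 0 \<Longrightarrow>
        x \<in> {side_lo L' n<..<side_hi a b n} \<Longrightarrow> norm (vderiv (H N) x) \<le> C"
      "\<And>x. f n (side_lo L' n) = 0 \<and> f n (side_hi a b n) = 0 \<Longrightarrow>
        x \<in> {side_lo L' n<..<side_hi a b n} \<Longrightarrow> (\<lambda>N. vderiv (H N) x) \<longlonglongrightarrow> vderiv (f n) x"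
    have "P n H C"
      unfolding P_def by (intro conjI ballI allI impI * ends)
    then show "\<exists>H C. P n H C" by (intro exI)
  qed
  then obtain H C where HC': "\<And>n. P n (H n) (C n)" by metis
  have HC: "\<And>n N. smooth1 (H n N)"
      "\<And>n N. \<exists>p q. side_lo L' n < p \<and> q < side_hi a b n \<and> (\<forall>x. x \<notin> {p..q} \<longrightarrow> H n N x = 0)"
      "\<And>n N x. x \<in> {side_lo L' n<..<side_hi a b n} \<Longrightarrow> norm (H n N x) \<le> C n"
      "\<And>n x. x \<in> {side_lo L' n<..<side_hi a b n} \<Longrightarrow> (\<lambda>N. H n N x) \<longlonglongrightarrow> f n x"
      "\<And>n N x. n \<noteq> i \<Longrightarrow> x \<in> {side_lo L' n<..<side_hi a b n} \<Longrightarrow> norm (vderiv (H n N) x) \<le> C n"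
      "\<And>n x. n \<noteq> i \<Longrightarrow> x \<in> {side_lo L' n<..<side_hi a b n} \<Longrightarrow> (\<lambda>N. vderiv (H n N) x) \<longlonglongrightarrow> vderiv (f n) x"
    using HC' unfolding P_def by auto
  define g where "g N n = H n N" for N n
  have g: "smooth1 (g N n)" for N n by (simp add: g_def HC)
  have g0: "g N 3 t = 0" if "t < L'" for N t
    using HC(2)[of 3 N] that by (auto simp: g_def side_lo_def)
  define C' where "C' = Max (range C)"
  have C': "C n \<le> C'" for n unfolding C'_def by (rule Max_ge) auto
  have test: "sep_field i (g N) \<in> test_fields W" for N
  proof -
    obtain p q where pq: "\<And>n. side_lo L' n < p n" "\<And>n. q n < side_hi a b n"
      "\<And>n x. x \<notin> {p n..q n} \<Longrightarrow> g N n x = 0"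
    proof -
      have "\<forall>n. \<exists>p q. side_lo L' n < p \<and> q < side_hi a b n \<and> (\<forall>x. x \<notin> {p..q} \<longrightarrow> g N n x = 0)"
        using HC(2)[of _ N] unfolding g_def by simp
      from this[THEN choice] obtain p where "\<forall>n. \<exists>q. side_lo L' n < p n \<and> q < side_hi a b n \<and> (\<forall>x. x \<notin> {p n..q} \<longrightarrow> g N n x = 0)" ..
      from this[THEN choice] obtain q where "\<forall>n. side_lo L' n < p n \<and> q n < side_hi a b n \<and> (\<forall>x. x \<notin> {p n..q n} \<longrightarrow> g N n x = 0)" ..
      then show thesis by (intro that) auto
    qed
    have "x \<in> W" if "\<forall>j. x $ j \<in> {p j..q j}" for x
      using that pq(1,2)[of 1] pq(1,2)[of 2] pq(1,2)[of 3]
      by (auto simp: waveguide_eq side_lo_def side_hi_def forall_3)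
    then show ?thesis
      by (intro sep_field_test_field[of _ p q] g pq) auto
  qed
  have dg: "smooth1 (dsep n (g N) m)" "t < L' \<Longrightarrow> dsep n (g N) 3 t = 0" for n m t N
    using dsep_props(1)[where f = "g N" and L = L' and l = n and j = m, OF g]
      dsep_props(2)[where f = "g N" and L = L' and l = n and t = t, OF g] g0 by simp_all
  have eqN: "J c j (dsep l (g N)) - J c l (dsep j (g N)) - of_real (k\<^sup>2) * J w i (g N) = J F i (g N)" for N
  proof -
    have "J F i (g N) = (LINT x|lebesgue_on W. cdot (c x) (curl (sep_field i (g N)) x) - of_real (k\<^sup>2) * cdot (w x) (sep_field i (g N) x))"
      unfolding wint_def maxwell[OF test] by (simp add: cdot_sep_field)
    also have "\<dots> = (LINT x|lebesgue_on W. (c x $ j * sep (dsep l (g N)) x - c x $ l * sep (dsep j (g N)) x)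
        - of_real (k\<^sup>2) * (w x $ i * sep (g N) x))"
      by (rule Bochner_Integration.integral_cong)
         (simp_all add: cdot_sep_field cdot_curl_sep_field[OF g ijl])
    also have "\<dots> = J c j (dsep l (g N)) - J c l (dsep j (g N)) - of_real (k\<^sup>2) * J w i (g N)"
    proof -
      have i1: "integrable (lebesgue_on W) (\<lambda>x. c x $ j * sep (dsep l (g N)) x)"
        "integrable (lebesgue_on W) (\<lambda>x. c x $ l * sep (dsep j (g N)) x)"
        by (intro integrable_sep_waveguide[where L = L'] dg c; assumption)+
      have i2: "integrable (lebesgue_on W) (\<lambda>x. w x $ i * sep (g N) x)"
        by (intro integrable_sep_waveguide[where L = L'] g g0 w; assumption)
      show ?thesis
        unfolding wint_def using i1 i2
        by (simp add: Bochner_Integration.integral_diff Bochner_Integration.integrable_diff)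
    qed
    finally show ?thesis by simp
  qed
  have jl: "i \<noteq> j" "l \<noteq> i" "j \<noteq> l" using cyclic3_distinct[OF ijl] by auto
  have df: "smooth1 (dsep n f m)" "t < L \<Longrightarrow> dsep n f 3 t = 0" for n m t
    using dsep_props(1)[where f = f and L = L and l = n and j = m, OF f(1)]
      dsep_props(2)[where f = f and L = L and l = n and t = t, OF f(1)] f(2) by simp_all
  have lim: "(\<lambda>N. J v m (g N)) \<longlonglongrightarrow> J v m f"
    if "\<And>R. R < 0 \<Longrightarrow> v \<in> L2 (section_between a b R 0)" for v :: "real^3 \<Rightarrow> complex^3" and m
  proof -
    have "J v m (g N) = (LINT x|lebesgue_on ?S. v x $ m * sep (g N) x)" for N
      unfolding wint_def
    proof (rule integral_lebesgue_on_subset)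
      show "v x $ m * sep (g N) x = 0" if "x \<in> W - ?S" for x
        using that g0[of "x $ 3" N] HC(2)[of 3 N]
        by (cases "x $ 3 < L'") (auto simp: waveguide_eq section_between_eq sep_zero[of _ 3] g_def side_lo_def)
    qed (auto simp: section_subset_waveguide)
    moreover have "J v m f = (LINT x|lebesgue_on ?S. v x $ m * sep f x)"
      by (rule wint_section[of "min L 0"]) (auto simp: f L'_def)
    moreover have "(\<lambda>N. LINT x|lebesgue_on ?S. v x $ m * sep (g N) x)
        \<longlonglongrightarrow> (LINT x|lebesgue_on ?S. v x $ m * sep f x)"
    proof (rule wint_limit[where C = C'])
      show "v \<in> L2 ?S" by (rule that[OF L'(1)])
      show "continuous_on UNIV (g N j)" "continuous_on UNIV (f j)" for N j
        by (rule smooth1_continuous, rule g f(1))+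
      show "norm (g N j t) \<le> C'" if "t \<in> {side_lo L' j<..<side_hi a b j}" for N j t
        using HC(3)[OF that, of N] C'[of j] by (simp add: g_def)
      show "(\<lambda>N. g N j t) \<longlonglongrightarrow> f j t" if "t \<in> {side_lo L' j<..<side_hi a b j}" for j t
        using HC(4)[OF that] by (simp add: g_def)
    qed
    ultimately show ?thesis by simp
  qed
  have dlim: "(\<lambda>N. J v m (dsep n (g N))) \<longlonglongrightarrow> J v m (dsep n f)"
    if v: "\<And>R. R < 0 \<Longrightarrow> v \<in> L2 (section_between a b R 0)" and n: "n \<noteq> i" for v :: "real^3 \<Rightarrow> complex^3" and m n
  proof -
    have "J v m (dsep n (g N)) = (LINT x|lebesgue_on ?S. v x $ m * sep (dsep n (g N)) x)" for N
      unfolding wint_def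
    proof (rule integral_lebesgue_on_subset)
      fix x assume x: "x \<in> W - ?S"
      obtain p q where pq: "side_lo L' 3 < p" "\<And>x. x \<notin> {p..q} \<Longrightarrow> g N 3 x = 0"
        using HC(2)[of 3 N] unfolding g_def by blast
      have *: "x $ 3 < p" using x pq(1) by (auto simp: waveguide_eq section_between_eq side_lo_def)
      have "dsep n (g N) 3 (x $ 3) = 0"
        using * pq(2) by (rule dsep_props(2)[where f = "g N", OF g, rotated]) auto
      then show "v x $ m * sep (dsep n (g N)) x = 0"
        by (simp add: sep_zero[of _ 3])
    qed (auto simp: section_subset_waveguide)
    moreover have "J v m (dsep n f) = (LINT x|lebesgue_on ?S. v x $ m * sep (dsep n f) x)"
      by (rule wint_section[of "min L 0"]) (use df(2) in \<open>auto simp: L'_def\<close>)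
    moreover have "(\<lambda>N. LINT x|lebesgue_on ?S. v x $ m * sep (dsep n (g N)) x)
        \<longlonglongrightarrow> (LINT x|lebesgue_on ?S. v x $ m * sep (dsep n f) x)"
    proof (rule wint_limit[where C = C'])
      show "v \<in> L2 ?S" by (rule v[OF L'(1)])
      show "continuous_on UNIV (dsep n (g N) j)" for N j by (rule smooth1_continuous[OF dg(1)])
      show "continuous_on UNIV (dsep n f j)" for j by (rule smooth1_continuous[OF df(1)])
      show "norm (dsep n (g N) j t) \<le> C'" if "t \<in> {side_lo L' j<..<side_hi a b j}" for N j t
        using HC(3)[OF that, of N] HC(5)[OF n, of t N] that C'[of j] by (cases "j = n") (simp_all add: g_def)
      show "(\<lambda>N. dsep n (g N) j t) \<longlonglongrightarrow> dsep n f j t" if "t \<in> {side_lo L' j<..<side_hi a b j}" for j t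
        using HC(4)[OF that] HC(6)[OF n, of t] that by (cases "j = n") (simp_all add: g_def)
    qed
    ultimately show ?thesis by simp
  qed
  have "(\<lambda>N. J c j (dsep l (g N)) - J c l (dsep j (g N)) - of_real (k\<^sup>2) * J w i (g N))
      \<longlonglongrightarrow> J c j (dsep l f) - J c l (dsep j f) - of_real (k\<^sup>2) * J w i f"
    using jl by (intro tendsto_diff tendsto_mult tendsto_const lim dlim c w) auto
  then have "(\<lambda>N. J F i (g N)) \<longlonglongrightarrow> J c j (dsep l f) - J c l (dsep j f) - of_real (k\<^sup>2) * J w i f"
    unfolding eqN .
  from LIMSEQ_unique[OF this lim[OF F]] show ?thesis .
qed

theorem curl_curl_sep:
  assumes f: "\<And>j. smooth1 (f j)" "\<And>t. t < L \<Longrightarrow> f 3 t = 0" and ijl: "cyclic3 i j l"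
    and bc: "\<And>n. n \<noteq> i \<Longrightarrow> f n 0 = 0" "\<And>n. n \<noteq> i \<Longrightarrow> f n (side_hi a b n) = 0"
  shows "J w j (dsep i (dsep j f)) + J w l (dsep i (dsep l f))
    - J w i (dsep j (dsep j f)) - J w i (dsep l (dsep l f)) - of_real (k\<^sup>2) * J w i f = J F i f"
proof -
  have df: "smooth1 (dsep n f m)" "t < L \<Longrightarrow> dsep n f 3 t = 0" for n m t
    using dsep_props(1)[where f = f and L = L and l = n and j = m, OF f(1)]
      dsep_props(2)[where f = f and L = L and l = n and t = t, OF f(1)] f(2) by simp_all
  have 1: "J c j (dsep l f) = J w l (dsep i (dsep l f)) - J w i (dsep l (dsep l f))"
    using df cyclic3_rotate[OF ijl] by (intro trace_sep[where L = L])
  have 2: "J c l (dsep j f) = J w i (dsep j (dsep j f)) - J w j (dsep i (dsep j f))"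
    using df cyclic3_rotate[OF cyclic3_rotate[OF ijl]] by (intro trace_sep[where L = L])
  have e: "J c j (dsep l f) - J c l (dsep j f) - of_real (k\<^sup>2) * J w i f = J F i f"
    using f ijl bc by (intro maxwell_sep[where L = L])
  have "u + x - z - y - K = R" if "x - y - (z - u) - K = R" for x y z u K R :: complex
    using that by (simp add: algebra_simps)
  then show ?thesis using e unfolding 1 2 .
qed

end

section \<open>The modal equations on the half line\<close>

lemma integral_lborel_antiderivative:
  fixes f :: "real \<Rightarrow> complex"
  assumes "\<And>x. (G has_vector_derivative f x) (at x)" "continuous_on UNIV f" "l \<le> u" "\<And>x. x \<notin> {l..u} \<Longrightarrow> f x = 0"
  shows "(LINT x|lborel. f x) = G u - G l"
proof -
  have "(LINT x|lborel. f x) = (LINT x|lborel. indicator {l..u} x *\<^sub>R f x)"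
    by (rule Bochner_Integration.integral_cong) (auto simp: indicator_def assms(4))
  also have "\<dots> = G u - G l"
    by (rule integral_FTC_Icc[OF assms(3)])
       (auto intro: has_vector_derivative_at_within assms(1) continuous_on_subset[OF assms(2)])
  finally show ?thesis .
qed

lemma antiderivative_exists:
  fixes f :: "real \<Rightarrow> complex"
  assumes "smooth1 f" "\<And>x. x \<notin> {l..u} \<Longrightarrow> f x = 0" "l \<le> u"
  obtains G where "smooth1 G" "\<And>x. (G has_vector_derivative f x) (at x)" "\<And>x. x \<le> l \<Longrightarrow> G x = 0"
    "\<And>x. x \<ge> u \<Longrightarrow> G x = (LINT t|lborel. f t)"
proof -
  \<comment> \<open>The integral starts at l - 1 rather than at l, so that l is an interior point
    and the derivative there is two-sided.\<close>
  define G where "G x = integral {l - 1..x} f" for x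
  have d: "(G has_vector_derivative f x) (at x)" for x
  proof (cases "x < l")
    case True
    have G0: "G y = 0" if "y \<in> {..<l}" for y
      unfolding G_def by (intro integral_unique has_integral_is_0) (use assms(2) that in simp)
    have "((\<lambda>x. 0::complex) has_vector_derivative 0) (at x)" by simp
    then have "(G has_vector_derivative 0) (at x)"
      by (rule has_vector_derivative_transform_within_open[OF _ open_lessThan[of l]]) (use True G0 in simp_all)
    then show ?thesis using assms(2)[of x] True by simp
  next
    case False
    have "(G has_vector_derivative f x) (at x within {l - 1..x + 1})"
      unfolding G_def by (rule integral_has_vector_derivative[OF smooth1_continuous[OF assms(1)]]) (use False in auto)
    then show ?thesis
      using False at_within_Icc_at[of "l - 1" x "x + 1"] by simp
  qed
  have z: "G x = 0" if "x \<le> l" for x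
    unfolding G_def
    by (intro integral_unique has_integral_spike_finite[where S = "{l}" and f = "\<lambda>x. 0" and g = f])
       (use assms(2) that in simp_all)
  show thesis
  proof (rule that[of G])
    show "smooth1 G" by (rule smooth1_antiderivative[OF d assms(1)])
    show "G x = (LINT t|lborel. f t)" if "x \<ge> u" for x
    proof -
      have "(LINT t|lborel. f t) = G x - G l"
        by (rule integral_lborel_antiderivative[OF d smooth1_continuous[OF assms(1)]])
           (use that assms(3) in simp, rule assms(2), use that in auto)
      then show ?thesis using z[of l] by simp
    qed
  qed (use d z in auto)
qed

text \<open>The moment against exp (- i \<kappa> t), the x_3 factor of a mode that travels or decays
  towards minus infinity. On a field that is outgoing below, the pairing of a mode with the profile
  \<zeta> is a constant times this moment.\<close>

definition exp_moment :: "complex \<Rightarrow> (real \<Rightarrow> complex) \<Rightarrow> complex" where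
  "exp_moment \<kappa> \<zeta> = (LINT t|lborel. exp (- \<i> * \<kappa> * of_real t) * \<zeta> t)"

lemma vderiv_outside:
  assumes "\<And>t. t \<notin> {l..u} \<Longrightarrow> f t = 0" "t \<notin> {l..u}"
  shows "vderiv f t = 0"
  by (rule vderiv_zero_open[of "- {l..u}" _ _ 0]) (use assms in auto)

lemma exp_moment_vderiv:
  assumes "smooth1 \<zeta>" "\<And>t. t \<notin> {l..u} \<Longrightarrow> \<zeta> t = 0" "l \<le> u"
  shows "exp_moment \<kappa> (vderiv \<zeta>) = \<i> * \<kappa> * exp_moment \<kappa> \<zeta>"
proof -
  define G where "G t = exp (- \<i> * \<kappa> * of_real t) * \<zeta> t" for t
  let ?g = "\<lambda>t. exp (- \<i> * \<kappa> * of_real t) * vderiv \<zeta> t"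
  let ?h = "\<lambda>t. (- \<i> * \<kappa>) * G t"
  have d: "(G has_vector_derivative ?g t + ?h t) (at t)" for t
    unfolding G_def
    using has_vector_derivative_mult[OF has_vector_derivative_exp_ii[of "- \<i> * \<kappa>" t] smooth1_has_vderiv[OF assms(1), of t]]
    by (simp add: algebra_simps)
  have s: "smooth1 ?g" "smooth1 ?h"
    unfolding G_def by (intro smooth1_mult smooth1_exp smooth1_vderiv smooth1_const assms(1))+
  have vz: "vderiv \<zeta> t = 0" if "t \<notin> {l..u}" for t
    by (rule vderiv_outside[OF assms(2) that])
  have gz: "?g t + ?h t = 0" if "t \<notin> {l..u}" for t
    using vz[OF that] assms(2)[OF that] by (simp add: G_def)
  have "(LINT t|lborel. ?g t + ?h t) = G (u + 1) - G (l - 1)"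
    by (rule integral_lborel_antiderivative[OF d smooth1_continuous[OF smooth1_add[OF s]]])
       (use assms(3) gz in auto)
  also have "\<dots> = 0" using assms(2) by (simp add: G_def)
  finally have 0: "(LINT t|lborel. ?g t + ?h t) = 0" .
  have i: "integrable lborel h" if "smooth1 h" "\<And>t. t \<notin> {l..u} \<Longrightarrow> h t = 0" for h :: "real \<Rightarrow> complex"
  proof -
    have "integrable lborel (\<lambda>t. indicator {l..u} t *\<^sub>R h t)"
      using borel_integrable_compact[of "{l..u}" h] smooth1_continuous[OF that(1)] by simp
    moreover have "(\<lambda>t. indicator {l..u} t *\<^sub>R h t) = h" using that(2) by (auto simp: indicator_def)
    ultimately show ?thesis by simp
  qed
  have ig: "integrable lborel ?g" "integrable lborel ?h"
    by (rule i[OF s(1)], simp add: vz, rule i[OF s(2)], simp add: G_def assms(2))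
  have "(LINT t|lborel. ?g t) + (LINT t|lborel. ?h t) = 0"
    unfolding Bochner_Integration.integral_add[OF ig, symmetric] by (rule 0)
  then show ?thesis
    unfolding exp_moment_def G_def by (simp add: add_eq_0_iff)
qed

lemma vderiv_add: "smooth1 f \<Longrightarrow> smooth1 g \<Longrightarrow> vderiv (\<lambda>t. f t + g t) x = vderiv f x + vderiv g x"
  and vderiv_mult: "smooth1 f \<Longrightarrow> smooth1 g \<Longrightarrow> vderiv (\<lambda>t. f t * g t) x = f x * vderiv g x + vderiv f x * g x"
  and vderiv_exp: "vderiv (\<lambda>t. exp (c * of_real t)) x = c * exp (c * of_real x)"
  by (intro vector_derivative_at has_vector_derivative_add has_vector_derivative_mult has_vector_derivative_mult_right
      smooth1_has_vderiv has_vector_derivative_exp_ii; assumption)+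

text \<open>The half-line Green function with boundary condition of sign \<open>\<sigma>\<close> turns \<open>\<zeta>\<close> into a solution
  that radiates towards \<open>-\<infinity>\<close>; after cutting it off there, \<open>rad\<close> annihilates the error because the
  exponential moment of the commutator is the integral of a derivative.\<close>

lemma half_line_ode:
  fixes L :: "(real \<Rightarrow> complex) \<Rightarrow> complex" and \<kappa> \<sigma> F0 A :: complex
  assumes \<kappa>: "\<kappa> \<noteq> 0"
    and add: "\<And>\<phi> \<eta> l. smooth1 \<phi> \<Longrightarrow> smooth1 \<eta> \<Longrightarrow> (\<And>t. t < l \<Longrightarrow> \<phi> t = 0) \<Longrightarrow> (\<And>t. t < l \<Longrightarrow> \<eta> t = 0)
      \<Longrightarrow> L (\<lambda>t. \<phi> t + \<eta> t) = L \<phi> + L \<eta>"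
    and main: "\<And>\<phi> C l. smooth1 \<phi> \<Longrightarrow> (\<And>t. t < l \<Longrightarrow> \<phi> t = 0) \<Longrightarrow>
      (\<And>t. t \<ge> \<rho> \<Longrightarrow> \<phi> t = C * (exp (\<i> * \<kappa> * of_real t) + \<sigma> * exp (- \<i> * \<kappa> * of_real t)))
      \<Longrightarrow> L (\<lambda>t. - vderiv (vderiv \<phi>) t - \<kappa>\<^sup>2 * \<phi> t) = C * F0"
    and rad: "\<And>\<zeta> l u. smooth1 \<zeta> \<Longrightarrow> l \<le> u \<Longrightarrow> u < R \<Longrightarrow> (\<And>t. t \<notin> {l..u} \<Longrightarrow> \<zeta> t = 0) \<Longrightarrow> L \<zeta> = A * exp_moment \<kappa> \<zeta>"
    and \<zeta>: "smooth1 \<zeta>" "\<And>t. t \<notin> {l..u} \<Longrightarrow> \<zeta> t = 0" "l \<le> u" "u \<le> \<rho>"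
  shows "L \<zeta> = \<i> / (2 * \<kappa>) * F0 * exp_moment \<kappa> \<zeta>"
proof -
  define e where "e t = exp (\<i> * \<kappa> * of_real t)" for t :: real
  define e' where "e' t = exp (- \<i> * \<kappa> * of_real t)" for t :: real
  have ee: "e t * e' t = 1" "e' t * e t = 1" for t by (simp_all add: e_def e'_def exp_add[symmetric])
  have se: "smooth1 e" "smooth1 e'"
    using smooth1_exp[of "\<i> * \<kappa>"] smooth1_exp[of "- \<i> * \<kappa>"] unfolding e_def[abs_def] e'_def[abs_def] by simp_all
  have de: "vderiv e t = \<i> * \<kappa> * e t" "vderiv e' t = - \<i> * \<kappa> * e' t" for t
    using vderiv_exp[of "\<i> * \<kappa>"] vderiv_exp[of "- \<i> * \<kappa>"] unfolding e_def[abs_def] e'_def[abs_def]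
    by (simp_all add: fun_eq_iff)
  obtain I1 where I1: "smooth1 I1" "\<And>t. (I1 has_vector_derivative e' t * \<zeta> t) (at t)" "\<And>t. t \<le> l \<Longrightarrow> I1 t = 0"
      "\<And>t. t \<ge> u \<Longrightarrow> I1 t = (LINT t|lborel. e' t * \<zeta> t)"
    by (rule antiderivative_exists[of "\<lambda>t. e' t * \<zeta> t" l u]) (use se \<zeta> smooth1_mult in auto)
  obtain I2 where I2: "smooth1 I2" "\<And>t. (I2 has_vector_derivative e t * \<zeta> t) (at t)" "\<And>t. t \<le> l \<Longrightarrow> I2 t = 0"
      "\<And>t. t \<ge> u \<Longrightarrow> I2 t = (LINT t|lborel. e t * \<zeta> t)"
    by (rule antiderivative_exists[of "\<lambda>t. e t * \<zeta> t" l u]) (use se \<zeta> smooth1_mult in auto)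
  define E1 where "E1 = exp_moment \<kappa> \<zeta>"
  define E2 where "E2 = (LINT t|lborel. e t * \<zeta> t)"
  define c0 where "c0 = \<i> / (2 * \<kappa>)"
  \<comment> \<open>Chosen so that above the support of \<zeta> the solution is a multiple of e +
    \<sigma> e', which is the boundary condition at 0, while below the support only the outgoing e'
    remains.\<close>
  define K where "K = E2 + \<sigma> * E1"
  define \<phi> where "\<phi> t = c0 * (e t * I1 t + e' t * (K - I2 t))" for t
  define \<phi>1 where "\<phi>1 t = c0 * (\<i> * \<kappa>) * (e t * I1 t + (-1) * (e' t * (K - I2 t)))" for t
  have E1: "E1 = (LINT t|lborel. e' t * \<zeta> t)" by (simp add: E1_def exp_moment_def e'_def)
  have dE: "(e has_vector_derivative \<i> * \<kappa> * e t) (at t)" "(e' has_vector_derivative - \<i> * \<kappa> * e' t) (at t)" for t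
    using smooth1_has_vderiv[OF se(1), of t] smooth1_has_vderiv[OF se(2), of t] unfolding de by simp_all
  have dp: "((\<lambda>t. e t * I1 t) has_vector_derivative \<zeta> t + \<i> * \<kappa> * (e t * I1 t)) (at t)" for t
    using has_vector_derivative_mult[OF dE(1)[of t] I1(2)[of t]] by (simp add: mult.assoc[symmetric] ee)
  have dm: "((\<lambda>t. e' t * (K - I2 t)) has_vector_derivative - \<zeta> t - \<i> * \<kappa> * (e' t * (K - I2 t))) (at t)" for t
    using has_vector_derivative_mult[OF dE(2)[of t] has_vector_derivative_diff[OF has_vector_derivative_const[of K] I2(2)[of t]]]
    by (simp add: mult.assoc[symmetric] ee)
  have d1: "(\<phi> has_vector_derivative \<phi>1 t) (at t)" for t
    unfolding \<phi>_def \<phi>1_def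
    using has_vector_derivative_mult_right[OF has_vector_derivative_add[OF dp[of t] dm[of t]], of c0]
    by (simp add: algebra_simps)
  have c0: "c0 * (\<i> * \<kappa>) * 2 = -1" using \<kappa> by (simp add: c0_def)
  have d2: "(\<phi>1 has_vector_derivative - \<zeta> t - \<kappa>\<^sup>2 * \<phi> t) (at t)" for t
  proof -
    have "(\<phi>1 has_vector_derivative c0 * (\<i> * \<kappa>) * (\<zeta> t + \<i> * \<kappa> * (e t * I1 t) + (-1) * (- \<zeta> t - \<i> * \<kappa> * (e' t * (K - I2 t))))) (at t)"
      unfolding \<phi>1_def
      by (rule has_vector_derivative_mult_right[OF has_vector_derivative_add[OF dp has_vector_derivative_mult_right[OF dm]]])
    also have "c0 * (\<i> * \<kappa>) * (\<zeta> t + \<i> * \<kappa> * (e t * I1 t) + (-1) * (- \<zeta> t - \<i> * \<kappa> * (e' t * (K - I2 t))))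
        = (c0 * (\<i> * \<kappa>) * 2) * \<zeta> t + (\<i> * \<kappa>)\<^sup>2 * \<phi> t"
      by (simp add: \<phi>_def algebra_simps power2_eq_square)
    finally show ?thesis by (simp add: c0 power_mult_distrib)
  qed
  have s\<phi>: "smooth1 \<phi>"
    unfolding \<phi>_def by (intro smooth1_mult smooth1_add smooth1_diff smooth1_const se I1 I2)
  have v\<phi>: "vderiv \<phi> t = \<phi>1 t" "vderiv \<phi>1 t = - \<zeta> t - \<kappa>\<^sup>2 * \<phi> t" for t
    by (rule vector_derivative_at, rule d1, rule vector_derivative_at, rule d2)
  have top: "\<phi> t = (c0 * E1) * (e t + \<sigma> * e' t)" if "t \<ge> u" for t
    using I1(4)[OF that] I2(4)[OF that] unfolding \<phi>_def K_def E1[symmetric] E2_def[symmetric]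
    by (simp add: algebra_simps)
  have low: "\<phi> t = c0 * K * e' t" if "t \<le> l" for t
    using I1(3)[OF that] I2(3)[OF that] by (simp add: \<phi>_def)
  \<comment> \<open>Below R, where \<open>rad\<close> applies, and below l, where \<phi> is a pure
    outgoing wave.\<close>
  define R2 where "R2 = min R l - 1"
  have R2: "R2 < R" "R2 < l" by (auto simp: R2_def)
  obtain \<tau> where \<tau>: "smooth1 \<tau>" "\<And>t. t \<ge> R2 \<Longrightarrow> \<tau> t = 1" "\<And>t. t \<le> R2 - 1 \<Longrightarrow> \<tau> t = 0"
  proof -
    obtain s :: "real \<Rightarrow> complex" and B where s: "smooth1 s" "\<And>x. x \<le> 0 \<Longrightarrow> s x = 0" "\<And>x. x \<ge> 1 \<Longrightarrow> s x = 1"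
      by (rule smooth_step_unit) blast
    show thesis
      by (rule that[of "\<lambda>t. s (1 * t + (1 - R2))"]) (use smooth1_affine[OF s(1), of 1 "1 - R2"] s in auto)
  qed
  have d\<tau>0: "vderiv \<tau> t = 0" if "t \<notin> {R2 - 1..R2}" for t
  proof (cases "t > R2")
    case True
    then show ?thesis by (intro vderiv_zero_open[of "{R2<..}" _ _ 1]) (auto simp: \<tau>)
  next
    case False
    then show ?thesis using that by (intro vderiv_zero_open[of "{..<R2 - 1}" _ _ 0]) (auto simp: \<tau>)
  qed
  define \<psi> where "\<psi> t = \<tau> t * \<phi> t" for t
  \<comment> \<open>The commutator of the cutoff with the Helmholtz operator, that is, the error
    term produced by replacing \<phi> by \<psi>.\<close>
  define \<eta> where "\<eta> t = (-2) * (vderiv \<tau> t * \<phi>1 t) + (-1) * (vderiv (vderiv \<tau>) t * \<phi> t)" for t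
  have s\<phi>1: "smooth1 \<phi>1" using smooth1_vderiv[OF s\<phi>] by (simp add: v\<phi>)
  have s\<psi>: "smooth1 \<psi>" unfolding \<psi>_def by (intro smooth1_mult \<tau> s\<phi>)
  have s\<eta>: "smooth1 \<eta>"
    unfolding \<eta>_def by (intro smooth1_add smooth1_mult smooth1_const smooth1_vderiv \<tau> s\<phi> s\<phi>1)
  have \<eta>0: "\<eta> t = 0" if "t \<notin> {R2 - 1..R2}" for t
    using d\<tau>0[OF that] vderiv_outside[OF d\<tau>0 that] by (simp add: \<eta>_def)
  have "vderiv \<psi> = (\<lambda>t. \<tau> t * \<phi>1 t + vderiv \<tau> t * \<phi> t)"
    unfolding \<psi>_def by (rule ext) (simp add: vderiv_mult[OF \<tau>(1) s\<phi>] v\<phi>)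
  then have "vderiv (vderiv \<psi>) t = (\<tau> t * vderiv \<phi>1 t + vderiv \<tau> t * \<phi>1 t) + (vderiv \<tau> t * vderiv \<phi> t + vderiv (vderiv \<tau>) t * \<phi> t)" for t
    by (simp add: vderiv_add[OF smooth1_mult[OF \<tau>(1) s\<phi>1] smooth1_mult[OF smooth1_vderiv[OF \<tau>(1)] s\<phi>]]
        vderiv_mult[OF \<tau>(1) s\<phi>1] vderiv_mult[OF smooth1_vderiv[OF \<tau>(1)] s\<phi>])
  then have "- vderiv (vderiv \<psi>) t - \<kappa>\<^sup>2 * \<psi> t = \<tau> t * \<zeta> t + \<eta> t" for t
    by (simp add: v\<phi> \<psi>_def \<eta>_def algebra_simps)
  moreover have "\<tau> t * \<zeta> t = \<zeta> t" for t
    using \<tau>(2)[of t] \<zeta>(2)[of t] R2 by (cases "t \<ge> l") auto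
  ultimately have eq: "- vderiv (vderiv \<psi>) t - \<kappa>\<^sup>2 * \<psi> t = \<zeta> t + \<eta> t" for t by simp
  have "L (\<lambda>t. - vderiv (vderiv \<psi>) t - \<kappa>\<^sup>2 * \<psi> t) = (c0 * E1) * F0"
  proof (rule main[where l = "R2 - 1"])
    show "\<psi> t = 0" if "t < R2 - 1" for t using that by (simp add: \<psi>_def \<tau>)
    show "\<psi> t = (c0 * E1) * (exp (\<i> * \<kappa> * of_real t) + \<sigma> * exp (- \<i> * \<kappa> * of_real t))" if "t \<ge> \<rho>" for t
      using top[of t] that \<zeta>(3,4) R2 \<tau>(2)[of t] by (simp add: \<psi>_def e_def e'_def)
  qed (rule s\<psi>)
  also have "(\<lambda>t. - vderiv (vderiv \<psi>) t - \<kappa>\<^sup>2 * \<psi> t) = (\<lambda>t. \<zeta> t + \<eta> t)" by (simp add: eq)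
  also have "L (\<lambda>t. \<zeta> t + \<eta> t) = L \<zeta> + L \<eta>"
    by (rule add[OF \<zeta>(1) s\<eta>, of "R2 - 1"]) (use \<zeta>(2) \<eta>0 R2 in auto)
  also have "L \<eta> = A * exp_moment \<kappa> \<eta>"
    by (rule rad[OF s\<eta>, of "R2 - 1" R2]) (use R2 \<eta>0 in auto)
  also have "exp_moment \<kappa> \<eta> = 0"
  proof -
    \<comment> \<open>With \<phi> = c0 K e' on the support of the derivative of \<tau>,
      differentiating this function gives e' \<eta>. It has compact support, as it contains the
      derivative of \<tau>.\<close>
    define G where "G t = (- c0 * K) * (e' t * e' t * vderiv \<tau> t)" for t
    have q: "((\<lambda>t. e' t * e' t) has_vector_derivative (- 2 * \<i> * \<kappa>) * (e' t * e' t)) (at t)" for t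
      using has_vector_derivative_mult[OF dE(2)[of t] dE(2)[of t]] by (simp add: algebra_simps)
    have dG: "vderiv G t = (- c0 * K) * (e' t * e' t * vderiv (vderiv \<tau>) t + (- 2 * \<i> * \<kappa>) * (e' t * e' t) * vderiv \<tau> t)" for t
      unfolding G_def
      by (rule vector_derivative_at, rule has_vector_derivative_mult_right,
          rule has_vector_derivative_mult[OF q smooth1_has_vderiv[OF smooth1_vderiv[OF \<tau>(1)]]])
    have sG: "smooth1 G"
      unfolding G_def by (intro smooth1_mult smooth1_const se smooth1_vderiv \<tau>)
    have low1: "\<phi>1 t = c0 * K * (- \<i> * \<kappa>) * e' t" if "t \<le> l" for t
      using I1(3)[OF that] I2(3)[OF that] by (simp add: \<phi>1_def)
    have "e' t * \<eta> t = vderiv G t" for t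
    proof (cases "t \<in> {R2 - 1..R2}")
      case True
      then have "t \<le> l" using R2 by auto
      then show ?thesis by (simp add: dG \<eta>_def low low1 algebra_simps)
    next
      case False
      then show ?thesis using d\<tau>0[OF False] vderiv_outside[OF d\<tau>0 False] \<eta>0[OF False] by (simp add: dG)
    qed
    moreover have Gz: "vderiv G t = 0" if "t \<notin> {R2 - 1..R2}" for t
      using d\<tau>0[OF that] vderiv_outside[OF d\<tau>0 that] by (simp add: dG)
    moreover have "(LINT t|lborel. vderiv G t) = G (R2 + 1) - G (R2 - 2)"
      by (rule integral_lborel_antiderivative[OF smooth1_has_vderiv[OF sG] smooth1_continuous[OF smooth1_vderiv[OF sG]]])
         (auto intro!: Gz)
    ultimately show ?thesis
      unfolding exp_moment_def e'_def[symmetric] by (simp add: G_def d\<tau>0)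
  qed
  finally show ?thesis by (simp add: c0_def E1_def mult_ac)
qed

text \<open>Cosine in the direction of the component itself and sine in the other transversal
  direction, so that component i vanishes on the walls to which it is tangential. The components of
  the modes M, P and Q have the same profiles.\<close>

definition trig_profile :: "3 \<Rightarrow> real \<Rightarrow> real \<Rightarrow> (real \<Rightarrow> complex) \<Rightarrow> 3 \<Rightarrow> real \<Rightarrow> complex" where
  "trig_profile i p q f j = (if j = 3 then f
     else if j = 1 then (if i = 1 then (\<lambda>t. of_real (cos (p * t))) else (\<lambda>t. of_real (sin (p * t))))
     else (if i = 2 then (\<lambda>t. of_real (cos (q * t))) else (\<lambda>t. of_real (sin (q * t)))))"

lemma three_distinct: "(1::3) \<noteq> 2" "(2::3) \<noteq> 1" "(1::3) \<noteq> 3" "(3::3) \<noteq> 1" "(2::3) \<noteq> 3" "(3::3) \<noteq> 2"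
  by auto

lemma trig_profile_simps:
  "trig_profile i p q f 3 = f"
  "trig_profile 1 p q f 1 = (\<lambda>t. of_real (cos (p * t)))"
  "trig_profile 2 p q f 1 = (\<lambda>t. of_real (sin (p * t)))"
  "trig_profile 3 p q f 1 = (\<lambda>t. of_real (sin (p * t)))"
  "trig_profile 1 p q f 2 = (\<lambda>t. of_real (sin (q * t)))"
  "trig_profile 2 p q f 2 = (\<lambda>t. of_real (cos (q * t)))"
  "trig_profile 3 p q f 2 = (\<lambda>t. of_real (sin (q * t)))"
  by (simp_all add: trig_profile_def three_distinct)

lemma smooth1_trig_profile: "smooth1 f \<Longrightarrow> smooth1 (trig_profile i p q f j)"
  using smooth1_cos_sin by (auto simp: trig_profile_def)

lemma vderiv_cos: "vderiv (\<lambda>t. of_real (cos (p * t))) = (\<lambda>t. - of_real p * of_real (sin (p * t)))"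
  and vderiv_sin: "vderiv (\<lambda>t. of_real (sin (p * t))) = (\<lambda>t. of_real p * of_real (cos (p * t)))"
  and vderiv_neg_sin: "vderiv (\<lambda>t. - of_real p * of_real (sin (p * t))) = (\<lambda>t. - (of_real p)\<^sup>2 * of_real (cos (p * t)))"
  and vderiv_cmult_cos: "vderiv (\<lambda>t. of_real p * of_real (cos (p * t))) = (\<lambda>t. - (of_real p)\<^sup>2 * of_real (sin (p * t)))"
proof -
  show "vderiv (\<lambda>t. of_real (cos (p * t))) = (\<lambda>t. - of_real p * of_real (sin (p * t)))"
    by (rule vderiv_eqI) (use has_vector_derivative_of_real_cos in simp)
  show "vderiv (\<lambda>t. of_real (sin (p * t))) = (\<lambda>t. of_real p * of_real (cos (p * t)))"
    by (rule vderiv_eqI) (use has_vector_derivative_of_real_sin in simp)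
  show "vderiv (\<lambda>t. - of_real p * of_real (sin (p * t))) = (\<lambda>t. - (of_real p)\<^sup>2 * of_real (cos (p * t)))"
    by (rule vderiv_eqI) (use has_vector_derivative_mult_right[OF has_vector_derivative_of_real_sin[of p], of "- of_real p"] in
        \<open>simp add: power2_eq_square mult.assoc\<close>)
  show "vderiv (\<lambda>t. of_real p * of_real (cos (p * t))) = (\<lambda>t. - (of_real p)\<^sup>2 * of_real (sin (p * t)))"
    by (rule vderiv_eqI) (use has_vector_derivative_mult_right[OF has_vector_derivative_of_real_cos[of p], of "of_real p"] in
        \<open>simp add: power2_eq_square mult.assoc\<close>)
qed

lemma wint_scale:
  assumes "\<And>x. sep f x = c * sep g x"
  shows "wint a b v i f = c * wint a b v i g"
proof -
  have "wint a b v i f = (LINT x|lebesgue_on (waveguide a b). c * (v x $ i * sep g x))"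
    unfolding wint_def assms by (simp add: mult_ac)
  then show ?thesis by (simp add: wint_def)
qed

definition mode_int :: "real \<Rightarrow> real \<Rightarrow> real \<Rightarrow> real \<Rightarrow> (real^3 \<Rightarrow> complex^3) \<Rightarrow> 3 \<Rightarrow> (real \<Rightarrow> complex) \<Rightarrow> complex" where
  "mode_int a b p q v i f = wint a b v i (trig_profile i p q f)"

lemma sep_trig_profile:
  "sep (trig_profile i p q f) x = sep (trig_profile i p q (\<lambda>t. 1)) x * f (x $ 3)"
  by (simp add: sep_3 trig_profile_def three_distinct)

section \<open>Maxwell's equations on one transversal mode\<close>

context weak_maxwell
begin

abbreviation M where "M \<equiv> mode_int a b"

lemma integrable_mode:
  fixes v :: "real^3 \<Rightarrow> complex^3"
  assumes "\<And>R. R < 0 \<Longrightarrow> v \<in> L2 (section_between a b R 0)" "smooth1 f" "\<And>t. t < L \<Longrightarrow> f t = 0"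
  shows "integrable (lebesgue_on W) (\<lambda>x. v x $ i * sep (trig_profile i p q f) x)"
  by (rule integrable_sep_waveguide[OF assms(1)]) (use assms(2,3) in \<open>auto simp: smooth1_trig_profile trig_profile_simps\<close>)

lemma mode_int_add:
  fixes v :: "real^3 \<Rightarrow> complex^3"
  assumes "\<And>R. R < 0 \<Longrightarrow> v \<in> L2 (section_between a b R 0)"
    "smooth1 f" "\<And>t. t < L \<Longrightarrow> f t = 0" "smooth1 g" "\<And>t. t < L \<Longrightarrow> g t = 0"
  shows "M p q v i (\<lambda>t. f t + g t) = M p q v i f + M p q v i g"
proof -
  have "v x $ i * sep (trig_profile i p q (\<lambda>t. f t + g t)) x
      = v x $ i * sep (trig_profile i p q f) x + v x $ i * sep (trig_profile i p q g) x" for x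
    by (simp add: sep_trig_profile[of i p q "\<lambda>t. f t + g t"] sep_trig_profile[of i p q f] sep_trig_profile[of i p q g] algebra_simps)
  then show ?thesis
    unfolding mode_int_def wint_def
    using integrable_mode[OF assms(1,2,3)] integrable_mode[OF assms(1,4,5)]
    by simp
qed

lemma mode_int_cmult: "M p q v i (\<lambda>t. z * f t) = z * M p q v i f"
  unfolding mode_int_def
  by (rule wint_scale) (simp add: sep_trig_profile[of i p q "\<lambda>t. z * f t"] sep_trig_profile[of i p q f])

context
  fixes p q :: real
  assumes pa: "sin (p * a) = 0" and qb: "sin (q * b) = 0"
begin

text \<open>The profiles close the system: a mixed transversal derivative maps the profile of one
  component to a multiple of the profile of the other. What remains for fixed p and q are three
  coupled equations in x_3, in weak form. Components 1 and 2 are tangential to the end x_3 = 0, so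
  their equations require f 0 = 0; component 3 is normal to it.\<close>

lemma mode_equations:
  assumes f: "smooth1 f" "\<forall>t<L. f t = 0"
  shows "f 0 = 0 \<Longrightarrow> - (p * q) * M p q w 2 f - p * M p q w 3 (vderiv f) + q\<^sup>2 * M p q w 1 f
      - M p q w 1 (vderiv (vderiv f)) - k\<^sup>2 * M p q w 1 f = M p q F 1 f"
    and "f 0 = 0 \<Longrightarrow> - (p * q) * M p q w 1 f - q * M p q w 3 (vderiv f) + p\<^sup>2 * M p q w 2 f
      - M p q w 2 (vderiv (vderiv f)) - k\<^sup>2 * M p q w 2 f = M p q F 2 f"
    and "p * M p q w 1 (vderiv f) + q * M p q w 2 (vderiv f) + (p\<^sup>2 + q\<^sup>2 - k\<^sup>2) * M p q w 3 f = M p q F 3 f"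
proof -
  have s: "smooth1 (trig_profile i p q f j)" for i j by (rule smooth1_trig_profile[OF f(1)])
  have z: "trig_profile i p q f 3 t = 0" if "t < L" for i t using f(2) that by (simp add: trig_profile_simps)
  note eqs = fun_upd_apply three_distinct if_True if_False simp_thms trig_profile_simps vderiv_cos vderiv_sin
    vderiv_neg_sin vderiv_cmult_cos
  have sc: "J v i (dsep m (dsep n g)) = c * M p q v i h"
    if "\<And>x. sep (dsep m (dsep n g)) x = c * sep (trig_profile i p q h) x" for v i m n g c h
    unfolding mode_int_def by (rule wint_scale) (rule that)
  {
    assume f0: "f 0 = 0"
    have "J w 2 (dsep 1 (dsep 2 (trig_profile 1 p q f))) + J w 3 (dsep 1 (dsep 3 (trig_profile 1 p q f)))
      - J w 1 (dsep 2 (dsep 2 (trig_profile 1 p q f))) - J w 1 (dsep 3 (dsep 3 (trig_profile 1 p q f)))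
      - of_real (k\<^sup>2) * J w 1 (trig_profile 1 p q f) = J F 1 (trig_profile 1 p q f)"
      by (rule curl_curl_sep[where L = L and f = "trig_profile 1 p q f", OF s z])
         (use exhaust_3 in \<open>auto simp: cyclic3_def trig_profile_def side_hi_def f0 pa qb\<close>)
    moreover have "J w 2 (dsep 1 (dsep 2 (trig_profile 1 p q f))) = - (p * q) * M p q w 2 f"
      by (rule sc) (simp only: sep_3 eqs, simp)
    moreover have "J w 3 (dsep 1 (dsep 3 (trig_profile 1 p q f))) = (- p) * M p q w 3 (vderiv f)"
      by (rule sc) (simp only: sep_3 eqs, simp)
    moreover have "J w 1 (dsep 2 (dsep 2 (trig_profile 1 p q f))) = (- q\<^sup>2) * M p q w 1 f"
      by (rule sc) (simp only: sep_3 eqs, simp)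
    moreover have "J w 1 (dsep 3 (dsep 3 (trig_profile 1 p q f))) = 1 * M p q w 1 (vderiv (vderiv f))"
      by (rule sc) (simp only: sep_3 eqs, simp)
    ultimately show "- (p * q) * M p q w 2 f - p * M p q w 3 (vderiv f) + q\<^sup>2 * M p q w 1 f
      - M p q w 1 (vderiv (vderiv f)) - k\<^sup>2 * M p q w 1 f = M p q F 1 f"
      unfolding mode_int_def[of _ _ _ _ F] mode_int_def[of _ _ _ _ w 1 f] by simp
  }
  {
    assume f0: "f 0 = 0"
    have "J w 3 (dsep 2 (dsep 3 (trig_profile 2 p q f))) + J w 1 (dsep 2 (dsep 1 (trig_profile 2 p q f)))
      - J w 2 (dsep 3 (dsep 3 (trig_profile 2 p q f))) - J w 2 (dsep 1 (dsep 1 (trig_profile 2 p q f)))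
      - of_real (k\<^sup>2) * J w 2 (trig_profile 2 p q f) = J F 2 (trig_profile 2 p q f)"
      by (rule curl_curl_sep[where L = L and f = "trig_profile 2 p q f", OF s z])
         (use exhaust_3 in \<open>auto simp: cyclic3_def trig_profile_def side_hi_def f0 pa qb\<close>)
    moreover have "J w 1 (dsep 2 (dsep 1 (trig_profile 2 p q f))) = - (p * q) * M p q w 1 f"
      by (rule sc) (simp only: sep_3 eqs, simp)
    moreover have "J w 3 (dsep 2 (dsep 3 (trig_profile 2 p q f))) = (- q) * M p q w 3 (vderiv f)"
      by (rule sc) (simp only: sep_3 eqs, simp)
    moreover have "J w 2 (dsep 1 (dsep 1 (trig_profile 2 p q f))) = (- p\<^sup>2) * M p q w 2 f"
      by (rule sc) (simp only: sep_3 eqs, simp)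
    moreover have "J w 2 (dsep 3 (dsep 3 (trig_profile 2 p q f))) = 1 * M p q w 2 (vderiv (vderiv f))"
      by (rule sc) (simp only: sep_3 eqs, simp)
    ultimately show "- (p * q) * M p q w 1 f - q * M p q w 3 (vderiv f) + p\<^sup>2 * M p q w 2 f
      - M p q w 2 (vderiv (vderiv f)) - k\<^sup>2 * M p q w 2 f = M p q F 2 f"
      unfolding mode_int_def[of _ _ _ _ F] mode_int_def[of _ _ _ _ w 2 f] by (simp add: algebra_simps)
  }
  have "J w 1 (dsep 3 (dsep 1 (trig_profile 3 p q f))) + J w 2 (dsep 3 (dsep 2 (trig_profile 3 p q f)))
    - J w 3 (dsep 1 (dsep 1 (trig_profile 3 p q f))) - J w 3 (dsep 2 (dsep 2 (trig_profile 3 p q f)))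
    - of_real (k\<^sup>2) * J w 3 (trig_profile 3 p q f) = J F 3 (trig_profile 3 p q f)"
    by (rule curl_curl_sep[where L = L and f = "trig_profile 3 p q f", OF s z])
       (use exhaust_3 in \<open>auto simp: cyclic3_def trig_profile_def side_hi_def pa qb\<close>)
  moreover have "J w 1 (dsep 3 (dsep 1 (trig_profile 3 p q f))) = p * M p q w 1 (vderiv f)"
    by (rule sc) (simp only: sep_3 eqs, simp)
  moreover have "J w 2 (dsep 3 (dsep 2 (trig_profile 3 p q f))) = q * M p q w 2 (vderiv f)"
    by (rule sc) (simp only: sep_3 eqs, simp)
  moreover have "J w 3 (dsep 1 (dsep 1 (trig_profile 3 p q f))) = (- p\<^sup>2) * M p q w 3 f"
    by (rule sc) (simp only: sep_3 eqs, simp)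
  moreover have "J w 3 (dsep 2 (dsep 2 (trig_profile 3 p q f))) = (- q\<^sup>2) * M p q w 3 f"
    by (rule sc) (simp only: sep_3 eqs, simp)
  ultimately show "p * M p q w 1 (vderiv f) + q * M p q w 2 (vderiv f) + (p\<^sup>2 + q\<^sup>2 - k\<^sup>2) * M p q w 3 f = M p q F 3 f"
    unfolding mode_int_def[of _ _ _ _ F] mode_int_def[of _ _ _ _ w 3 f] by (simp add: algebra_simps)
qed

text \<open>The combination of the two transversal components in which transversal gradients cancel.
  It sees the M modes and is blind to the P modes.\<close>

definition TE :: "(real^3 \<Rightarrow> complex^3) \<Rightarrow> (real \<Rightarrow> complex) \<Rightarrow> complex" where
  "TE v f = - q * M p q v 1 f + p * M p q v 2 f"

text \<open>The complementary combination, a transversal divergence: it sees the P modes and is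
  blind to the M modes.\<close>

definition TM :: "(real^3 \<Rightarrow> complex^3) \<Rightarrow> (real \<Rightarrow> complex) \<Rightarrow> complex" where
  "TM v f = p * M p q v 1 f + q * M p q v 2 f"

text \<open>The axial component enters the two transversal equations with factors p and q, which
  cancel in this combination. A scalar Helmholtz equation is left.\<close>

lemma TE_equation:
  assumes f: "smooth1 f" "\<forall>t<L. f t = 0" "f 0 = 0"
  shows "- TE w (vderiv (vderiv f)) - (k\<^sup>2 - (p\<^sup>2 + q\<^sup>2)) * TE w f = TE F f"
  unfolding TE_def mode_equations(1)[OF f, symmetric] mode_equations(2)[OF f, symmetric]
  by (simp add: algebra_simps power2_eq_square)

lemma TM_equations:
  assumes f: "smooth1 f" "\<forall>t<L. f t = 0"
  shows "f 0 = 0 \<Longrightarrow> - TM w (vderiv (vderiv f)) - k\<^sup>2 * TM w f - (p\<^sup>2 + q\<^sup>2) * M p q w 3 (vderiv f) = TM F f"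
    and "TM w (vderiv f) - (k\<^sup>2 - (p\<^sup>2 + q\<^sup>2)) * M p q w 3 f = M p q F 3 f"
proof -
  show "- TM w (vderiv (vderiv f)) - k\<^sup>2 * TM w f - (p\<^sup>2 + q\<^sup>2) * M p q w 3 (vderiv f) = TM F f" if "f 0 = 0"
    unfolding TM_def mode_equations(1)[OF f that, symmetric] mode_equations(2)[OF f that, symmetric]
    by (simp add: algebra_simps power2_eq_square)
  show "TM w (vderiv f) - (k\<^sup>2 - (p\<^sup>2 + q\<^sup>2)) * M p q w 3 f = M p q F 3 f"
    unfolding TM_def mode_equations(3)[OF f, symmetric]
    by (simp add: algebra_simps)
qed

lemma TE_add: "smooth1 f \<Longrightarrow> smooth1 g \<Longrightarrow> (\<And>t. t < L \<Longrightarrow> f t = 0) \<Longrightarrow> (\<And>t. t < L \<Longrightarrow> g t = 0) \<Longrightarrow>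
    TE w (\<lambda>t. f t + g t) = TE w f + TE w g"
  and TM_add: "smooth1 f \<Longrightarrow> smooth1 g \<Longrightarrow> (\<And>t. t < L \<Longrightarrow> f t = 0) \<Longrightarrow> (\<And>t. t < L \<Longrightarrow> g t = 0) \<Longrightarrow>
    TM w (\<lambda>t. f t + g t) = TM w f + TM w g"
  unfolding TE_def TM_def by (simp_all add: mode_int_add[where L = L, OF w] algebra_simps)

lemma TE_cmult: "TE v (\<lambda>t. z * f t) = z * TE v f"
  and TM_cmult: "TM v (\<lambda>t. z * f t) = z * TM v f"
  unfolding TE_def TM_def by (simp_all add: mode_int_cmult algebra_simps)

text \<open>The source sees a profile only above \<rho>. This allows the solution of the half-line
  problem, cut off far below, to be replaced by the standing wave on the source side.\<close>

lemma mode_int_F_cong: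
  assumes "\<And>t. \<rho> < t \<Longrightarrow> f t = g t"
  shows "M p q F i f = M p q F i g"
  unfolding mode_int_def wint_def
proof (intro Bochner_Integration.integral_cong refl)
  fix x
  show "F x $ i * sep (trig_profile i p q f) x = F x $ i * sep (trig_profile i p q g) x"
    using F_zero[of x] assms[of "x $ 3"]
    by (cases "x $ 3 \<le> \<rho>") (simp_all add: sep_trig_profile[of i p q f] sep_trig_profile[of i p q g])
qed

text \<open>\<open>half_line_ode\<close> with \<sigma> = -1: a tangential component has to vanish at
  x_3 = 0, so the standing wave is the odd one.\<close>

theorem TE_moment:
  fixes h A :: complex
  assumes h: "h \<noteq> 0" "h\<^sup>2 = of_real (k\<^sup>2 - (p\<^sup>2 + q\<^sup>2))"
    and rad: "\<And>\<zeta> l u. smooth1 \<zeta> \<Longrightarrow> l \<le> u \<Longrightarrow> u < R \<Longrightarrow> (\<And>t. t \<notin> {l..u} \<Longrightarrow> \<zeta> t = 0) \<Longrightarrow>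
      TE w \<zeta> = A * exp_moment h \<zeta>"
    and \<zeta>: "smooth1 \<zeta>" "\<And>t. t \<notin> {l..u} \<Longrightarrow> \<zeta> t = 0" "l \<le> u" "u \<le> \<rho>"
  shows "TE w \<zeta> = \<i> / (2 * h) * TE F (\<lambda>t. exp (\<i> * h * of_real t) - exp (- \<i> * h * of_real t)) * exp_moment h \<zeta>"
proof (rule half_line_ode[where \<sigma> = "-1" and \<rho> = \<rho> and L = "TE w" and R = R and A = A, OF h(1) _ _ _ \<zeta>])
  fix f g :: "real \<Rightarrow> complex" and l
  assume "smooth1 f" "smooth1 g" "\<And>t. t < l \<Longrightarrow> f t = 0" "\<And>t. t < l \<Longrightarrow> g t = 0"
  then show "TE w (\<lambda>t. f t + g t) = TE w f + TE w g" by (rule TE_add)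
next
  fix f C l
  assume f: "smooth1 f" "\<And>t. t < l \<Longrightarrow> f t = 0"
    "\<And>t. t \<ge> \<rho> \<Longrightarrow> f t = C * (exp (\<i> * h * of_real t) + (-1) * exp (- \<i> * h * of_real t))"
  have s: "smooth1 (vderiv (vderiv f))" by (intro smooth1_vderiv f)
  have z1: "vderiv f t = 0" if "t < l" for t
    by (rule vderiv_zero_open[of "{..<l}" _ _ 0, OF open_lessThan]) (use that f(2) in simp_all)
  have z: "vderiv (vderiv f) t = 0" if "t < l" for t
    by (rule vderiv_zero_open[of "{..<l}" _ _ 0, OF open_lessThan]) (use that z1 in simp_all)
  have "TE w (\<lambda>t. (-1) * vderiv (vderiv f) t + (- h\<^sup>2) * f t) = - TE w (vderiv (vderiv f)) - h\<^sup>2 * TE w f"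
  proof -
    have "TE w (\<lambda>t. (-1) * vderiv (vderiv f) t + (- h\<^sup>2) * f t)
        = TE w (\<lambda>t. (-1) * vderiv (vderiv f) t) + TE w (\<lambda>t. (- h\<^sup>2) * f t)"
      by (rule TE_add[where L = l])
         (rule smooth1_mult[OF smooth1_const s], rule smooth1_mult[OF smooth1_const f(1)], simp add: z, simp add: f(2))
    then show ?thesis unfolding TE_cmult by simp
  qed
  also have "\<dots> = TE F f"
    using TE_equation[of f l] f(1,2) f(3)[of 0] \<rho> by (simp add: h(2))
  also have "\<dots> = TE F (\<lambda>t. C * (exp (\<i> * h * of_real t) - exp (- \<i> * h * of_real t)))"
    unfolding TE_def by (intro arg_cong2[where f = "(+)"] arg_cong2[where f = "(*)"] refl mode_int_F_cong) (simp_all add: f(3))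
  finally show "TE w (\<lambda>t. - vderiv (vderiv f) t - h\<^sup>2 * f t) = C * TE F (\<lambda>t. exp (\<i> * h * of_real t) - exp (- \<i> * h * of_real t))"
    by (simp add: TE_cmult)
qed (rule rad)

text \<open>The right-hand side of the Helmholtz equation of the axial component after elimination
  of the transversal ones: the odd standing wave meets the transversal source, the even one the
  axial source. It is a multiple of the source moment against the TM factor of the Green
  function.\<close>

definition TM_source :: "complex \<Rightarrow> complex" where
  "TM_source g = (\<i> * g * TM F (\<lambda>t. exp (\<i> * g * of_real t) - exp (- \<i> * g * of_real t))
      + of_real (p\<^sup>2 + q\<^sup>2) * M p q F 3 (\<lambda>t. exp (\<i> * g * of_real t) + exp (- \<i> * g * of_real t))) / of_real (k\<^sup>2)"

text \<open>The two TM equations are coupled, so the axial component is solved first. Its scalar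
  equation comes from eliminating the transversal part and carries \<sigma> = 1, because now f' and
  not f has to vanish at the end. Below \<rho> the equations have no source and express the
  transversal part through the axial one.\<close>

theorem TM_moment:
  fixes g A :: complex
  assumes g: "g \<noteq> 0" "g\<^sup>2 = of_real (k\<^sup>2 - (p\<^sup>2 + q\<^sup>2))"
    and rad: "\<And>\<zeta> l u. smooth1 \<zeta> \<Longrightarrow> l \<le> u \<Longrightarrow> u < R \<Longrightarrow> (\<And>t. t \<notin> {l..u} \<Longrightarrow> \<zeta> t = 0) \<Longrightarrow>
      M p q w 3 \<zeta> = A * exp_moment g \<zeta>"
    and \<zeta>: "smooth1 \<zeta>" "\<And>t. t \<notin> {l..u} \<Longrightarrow> \<zeta> t = 0" "l \<le> u" "u \<le> \<rho>"
  shows "M p q w 3 \<zeta> = \<i> / (2 * g) * TM_source g * exp_moment g \<zeta>"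
    and "TM w \<zeta> = 1 / 2 * TM_source g * exp_moment g \<zeta>"
proof -
  have k0: "of_real (k\<^sup>2) \<noteq> (0::complex)" using k by simp
  have main3: "M p q w 3 \<xi> = \<i> / (2 * g) * TM_source g * exp_moment g \<xi>"
    if \<xi>: "smooth1 \<xi>" "\<And>t. t \<notin> {l..u} \<Longrightarrow> \<xi> t = 0" for \<xi>
  proof (rule half_line_ode[where \<sigma> = 1 and \<rho> = \<rho> and L = "M p q w 3" and R = R and A = A, OF g(1) _ _ _ \<xi> \<zeta>(3,4)])
    fix f1 f2 :: "real \<Rightarrow> complex" and l
    assume "smooth1 f1" "smooth1 f2" "\<And>t. t < l \<Longrightarrow> f1 t = 0" "\<And>t. t < l \<Longrightarrow> f2 t = 0"
    then show "M p q w 3 (\<lambda>t. f1 t + f2 t) = M p q w 3 f1 + M p q w 3 f2" by (intro mode_int_add[OF w])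
  next
    fix f C l
    assume f: "smooth1 f" "\<And>t. t < l \<Longrightarrow> f t = 0"
      "\<And>t. t \<ge> \<rho> \<Longrightarrow> f t = C * (exp (\<i> * g * of_real t) + 1 * exp (- \<i> * g * of_real t))"
    have s1: "smooth1 (vderiv f)" and s2: "smooth1 (vderiv (vderiv f))" by (intro smooth1_vderiv f)+
    have z1: "vderiv f t = 0" if "t < l" for t
      by (rule vderiv_zero_open[of "{..<l}" _ _ 0, OF open_lessThan]) (use that f(2) in simp_all)
    have z2: "vderiv (vderiv f) t = 0" if "t < l" for t
      by (rule vderiv_zero_open[of "{..<l}" _ _ 0, OF open_lessThan]) (use that z1 in simp_all)
    have dC: "vderiv (\<lambda>t. C' * (exp (\<i> * g * of_real t) + s * exp (- \<i> * g * of_real t))) t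
        = C' * (\<i> * g) * (exp (\<i> * g * of_real t) + (- s) * exp (- \<i> * g * of_real t))" for t s C'
    proof -
      have "((\<lambda>t. C' * (exp (\<i> * g * of_real t) + s * exp (- \<i> * g * of_real t))) has_vector_derivative
          C' * ((\<i> * g) * exp (\<i> * g * of_real t) + s * ((- \<i> * g) * exp (- \<i> * g * of_real t)))) (at t)"
        by (intro has_vector_derivative_mult_right has_vector_derivative_add has_vector_derivative_exp_ii)
      from vector_derivative_at[OF this] show ?thesis by (simp add: algebra_simps)
    qed
    have f1: "vderiv f t = C * (\<i> * g) * (exp (\<i> * g * of_real t) + (-1) * exp (- \<i> * g * of_real t))" if "t > \<rho>" for t
      using dC[of C 1 t] vderiv_cong_open[of "{\<rho><..}" t f] that f(3) by simp
    have f2: "vderiv (vderiv f) t = - g\<^sup>2 * f t" if "t > \<rho>" for t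
    proof -
      have "vderiv (vderiv f) t = vderiv (\<lambda>t. C * (\<i> * g) * (exp (\<i> * g * of_real t) + (-1) * exp (- \<i> * g * of_real t))) t"
        by (rule vderiv_cong_open[of "{\<rho><..}"]) (use that f1 in auto)
      also have "\<dots> = C * (\<i> * g) * (\<i> * g) * (exp (\<i> * g * of_real t) + (- (- 1)) * exp (- \<i> * g * of_real t))"
        by (rule dC)
      finally show ?thesis using f(3)[of t] that by (simp add: power2_eq_square algebra_simps)
    qed
    define \<theta> where "\<theta> t = f t + (1 / of_real (k\<^sup>2)) * vderiv (vderiv f) t" for t
    have s\<theta>: "smooth1 \<theta>" unfolding \<theta>_def by (intro smooth1_add smooth1_mult smooth1_const f(1) s2)
    have z\<theta>: "\<theta> t = 0" if "t < l" for t using that by (simp add: \<theta>_def f(2) z2)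
    have d\<theta>: "vderiv \<theta> = (\<lambda>t. vderiv f t + (1 / of_real (k\<^sup>2)) * vderiv (vderiv (vderiv f)) t)"
      unfolding \<theta>_def
      by (rule vderiv_eqI, rule has_vector_derivative_add[OF smooth1_has_vderiv[OF f(1)]
            has_vector_derivative_mult_right[OF smooth1_has_vderiv[OF s2]]])
    have s3: "smooth1 (vderiv (vderiv (vderiv f)))" by (rule smooth1_vderiv[OF s2])
    have z3: "vderiv (vderiv (vderiv f)) t = 0" if "t < l" for t
      by (rule vderiv_zero_open[of "{..<l}" _ _ 0, OF open_lessThan]) (use that z2 in simp_all)
    have e1: "- TM w (vderiv (vderiv (vderiv f))) - k\<^sup>2 * TM w (vderiv f) - (p\<^sup>2 + q\<^sup>2) * M p q w 3 (vderiv (vderiv f)) = TM F (vderiv f)"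
      by (rule TM_equations(1)[OF s1, of l]) (use f1[of 0] \<rho> z1 in simp_all)
    have e2: "TM w (vderiv \<theta>) - (k\<^sup>2 - (p\<^sup>2 + q\<^sup>2)) * M p q w 3 \<theta> = M p q F 3 \<theta>"
      by (rule TM_equations(2)[OF s\<theta>, of l]) (use z\<theta> in simp)
    have "TM w (vderiv \<theta>) = TM w (vderiv f) + (1 / of_real (k\<^sup>2)) * TM w (vderiv (vderiv (vderiv f)))"
    proof -
      have "TM w (vderiv \<theta>) = TM w (vderiv f) + TM w (\<lambda>t. (1 / of_real (k\<^sup>2)) * vderiv (vderiv (vderiv f)) t)"
        unfolding d\<theta>
        by (rule TM_add[where L = l])
           (rule s1, rule smooth1_mult[OF smooth1_const s3], simp add: z1, simp add: z3)
      then show ?thesis unfolding TM_cmult .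
    qed
    moreover have "M p q w 3 \<theta> = M p q w 3 f + (1 / of_real (k\<^sup>2)) * M p q w 3 (vderiv (vderiv f))"
    proof -
      have "M p q w 3 \<theta> = M p q w 3 f + M p q w 3 (\<lambda>t. (1 / of_real (k\<^sup>2)) * vderiv (vderiv f) t)"
        unfolding \<theta>_def
        by (rule mode_int_add[where L = l, OF w])
           (assumption, rule f(1), simp add: f(2), rule smooth1_mult[OF smooth1_const s2], simp add: z2)
      then show ?thesis unfolding mode_int_cmult .
    qed
    ultimately have e3: "- M p q w 3 (vderiv (vderiv f)) - g\<^sup>2 * M p q w 3 f = TM F (vderiv f) / of_real (k\<^sup>2) + M p q F 3 \<theta>"
      using k0 unfolding e1[symmetric] e2[symmetric] g(2)
      by (simp add: field_simps power2_eq_square)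
    have "M p q w 3 (\<lambda>t. (-1) * vderiv (vderiv f) t + (- g\<^sup>2) * f t) = - M p q w 3 (vderiv (vderiv f)) - g\<^sup>2 * M p q w 3 f"
    proof -
      have "M p q w 3 (\<lambda>t. (-1) * vderiv (vderiv f) t + (- g\<^sup>2) * f t)
          = M p q w 3 (\<lambda>t. (-1) * vderiv (vderiv f) t) + M p q w 3 (\<lambda>t. (- g\<^sup>2) * f t)"
        by (rule mode_int_add[where L = l, OF w])
           (assumption, rule smooth1_mult[OF smooth1_const s2], simp add: z2, rule smooth1_mult[OF smooth1_const f(1)], simp add: f(2))
      then show ?thesis unfolding mode_int_cmult by simp
    qed
    also have "\<dots> = TM F (vderiv f) / of_real (k\<^sup>2) + M p q F 3 \<theta>" by (rule e3)
    also have "TM F (vderiv f) = TM F (\<lambda>t. C * (\<i> * g) * (exp (\<i> * g * of_real t) - exp (- \<i> * g * of_real t)))"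
      unfolding TM_def by (intro arg_cong2[where f = "(+)"] arg_cong2[where f = "(*)"] refl mode_int_F_cong) (simp_all add: f1)
    also have "M p q F 3 \<theta> = M p q F 3 (\<lambda>t. (C * (of_real (p\<^sup>2 + q\<^sup>2) / of_real (k\<^sup>2))) * (exp (\<i> * g * of_real t) + exp (- \<i> * g * of_real t)))"
    proof (rule mode_int_F_cong)
      fix t assume t: "\<rho> < t"
      have "\<theta> t = (1 - g\<^sup>2 / of_real (k\<^sup>2)) * f t" by (simp add: \<theta>_def f2[OF t] algebra_simps)
      also have "1 - g\<^sup>2 / of_real (k\<^sup>2) = of_real (p\<^sup>2 + q\<^sup>2) / of_real (k\<^sup>2)"
        using k0 unfolding g(2) by (simp add: field_simps)
      finally show "\<theta> t = (C * (of_real (p\<^sup>2 + q\<^sup>2) / of_real (k\<^sup>2))) * (exp (\<i> * g * of_real t) + exp (- \<i> * g * of_real t))"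
        using f(3)[of t] t by simp
    qed
    finally have "M p q w 3 (\<lambda>t. (-1) * vderiv (vderiv f) t + (- g\<^sup>2) * f t) = C * TM_source g"
      unfolding TM_cmult mode_int_cmult TM_source_def by (simp add: algebra_simps add_divide_distrib)
    then show "M p q w 3 (\<lambda>t. - vderiv (vderiv f) t - g\<^sup>2 * f t) = C * TM_source g" by simp
  qed (rule rad)
  show "M p q w 3 \<zeta> = \<i> / (2 * g) * TM_source g * exp_moment g \<zeta>" by (rule main3[OF \<zeta>(1,2)])
  have zl: "\<zeta> t = 0" if "t < l" for t using that by (intro \<zeta>(2)) simp
  have dl: "vderiv \<zeta> t = 0" if "t \<notin> {l..u}" for t by (rule vderiv_outside[OF \<zeta>(2) that])
  have zl': "vderiv \<zeta> t = 0" if "t < l" for t using that by (intro dl) simp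
  have \<zeta>0: "\<zeta> 0 = 0" using \<zeta>(2)[of 0] \<zeta>(4) \<rho> by simp
  have "- TM w (vderiv (vderiv \<zeta>)) - k\<^sup>2 * TM w \<zeta> - (p\<^sup>2 + q\<^sup>2) * M p q w 3 (vderiv \<zeta>) = TM F \<zeta>"
    by (rule TM_equations(1)[OF \<zeta>(1) _ \<zeta>0, of l]) (use zl in simp)
  moreover have "TM F \<zeta> = TM F (\<lambda>t. 0 * 0)"
    unfolding TM_def using \<zeta>(2,4)
    by (intro arg_cong2[where f = "(+)"] arg_cong2[where f = "(*)"] refl mode_int_F_cong) simp_all
  moreover have "TM w (vderiv (vderiv \<zeta>)) - (k\<^sup>2 - (p\<^sup>2 + q\<^sup>2)) * M p q w 3 (vderiv \<zeta>) = M p q F 3 (vderiv \<zeta>)"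
    by (rule TM_equations(2)[OF smooth1_vderiv[OF \<zeta>(1)], of l]) (use zl' in simp)
  moreover have "M p q F 3 (vderiv \<zeta>) = M p q F 3 (\<lambda>t. 0 * 0)"
    using dl \<zeta>(4) by (intro mode_int_F_cong) simp
  ultimately have 1: "- TM w (vderiv (vderiv \<zeta>)) - k\<^sup>2 * TM w \<zeta> - (p\<^sup>2 + q\<^sup>2) * M p q w 3 (vderiv \<zeta>) = 0"
    and 2: "TM w (vderiv (vderiv \<zeta>)) - (k\<^sup>2 - (p\<^sup>2 + q\<^sup>2)) * M p q w 3 (vderiv \<zeta>) = 0"
    unfolding TM_cmult mode_int_cmult by simp_all
  have "s * (T + m) = 0" if "- X - s * T - l * m = 0" "X - (s - l) * m = 0" for X T m s l :: complex
  proof -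
    have "s * (T + m) = - (- X - s * T - l * m) - (X - (s - l) * m)" by (simp add: algebra_simps)
    then show ?thesis unfolding that by simp
  qed
  from this[of "TM w (vderiv (vderiv \<zeta>))" "of_real (k\<^sup>2)" "TM w \<zeta>" "of_real (p\<^sup>2 + q\<^sup>2)" "M p q w 3 (vderiv \<zeta>)"]
  have "of_real (k\<^sup>2) * (TM w \<zeta> + M p q w 3 (vderiv \<zeta>)) = 0"
    using 1 2 by simp
  then have "TM w \<zeta> = - M p q w 3 (vderiv \<zeta>)"
    using k by (simp add: add_eq_0_iff2)
  also have "\<dots> = - (\<i> / (2 * g) * TM_source g * (\<i> * g * exp_moment g \<zeta>))"
  proof -
    have "M p q w 3 (vderiv \<zeta>) = \<i> / (2 * g) * TM_source g * exp_moment g (vderiv \<zeta>)"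
      by (rule main3[OF smooth1_vderiv[OF \<zeta>(1)] dl])
    also have "exp_moment g (vderiv \<zeta>) = \<i> * g * exp_moment g \<zeta>"
      by (rule exp_moment_vderiv[OF \<zeta>(1,2,3)])
    finally show ?thesis by (simp only:)
  qed
  also have "\<dots> = 1 / 2 * TM_source g * exp_moment g \<zeta>" using g(1) by (simp add: mult_ac)
  finally show "TM w \<zeta> = 1 / 2 * TM_source g * exp_moment g \<zeta>" .
qed

end

end

section \<open>Completeness of the trigonometric profiles\<close>

lemma integrable_mult_bounded:
  fixes G :: "'a \<Rightarrow> complex" and h :: "'a \<Rightarrow> complex"
  assumes "integrable M G" "h \<in> borel_measurable M" "\<And>x. x \<in> space M \<Longrightarrow> norm (h x) \<le> C"
  shows "integrable M (\<lambda>x. G x * h x)"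
proof (rule Bochner_Integration.integrable_bound)
  show "integrable M (\<lambda>x. C * norm (G x))" using assms(1) by simp
  show "(\<lambda>x. G x * h x) \<in> borel_measurable M"
    using borel_measurable_integrable[OF assms(1)] assms(2) by simp
  show "AE x in M. norm (G x * h x) \<le> norm (C * norm (G x))"
  proof (rule AE_I2)
    fix x assume "x \<in> space M"
    then have "norm (G x) * norm (h x) \<le> norm (G x) * C"
      by (intro mult_left_mono assms(3)) auto
    then show "norm (G x * h x) \<le> norm (C * norm (G x))"
      by (simp add: norm_mult mult.commute abs_if)
  qed
qed

text \<open>The integrals of H against continuous functions that converge almost everywhere to sgn H
  tend to the integral of |H|, which is therefore 0.\<close>

lemma AE_zero_real_if_orthogonal_continuous:
  fixes H :: "'a::euclidean_space \<Rightarrow> real"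
  assumes S: "S \<in> sets lebesgue" and H: "integrable (lebesgue_on S) H"
    and orth: "\<And>h. continuous_on UNIV h \<Longrightarrow> (\<And>x. \<bar>h x\<bar> \<le> 1) \<Longrightarrow> (LINT x|lebesgue_on S. H x * h x) = 0"
  shows "AE x in lebesgue_on S. H x = 0"
proof -
  have m: "(\<lambda>x. sgn (H x)) \<in> borel_measurable (lebesgue_on S)"
    using borel_measurable_integrable[OF H] by measurable
  then obtain N g where g: "negligible N" "\<And>n. continuous_on UNIV (g n)"
      "\<And>x. x \<notin> N \<Longrightarrow> (\<lambda>n. g n x) \<longlonglongrightarrow> (if x \<in> S then sgn (H x) else 0)"
    unfolding measurable_on_iff_borel_measurable[OF S, symmetric] measurable_on_def by blast
  \<comment> \<open>Truncation to [-1, 1] supplies the majorant |H| and does not change the limit,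
    as sgn takes values in that interval.\<close>
  define h where "h n x = max (-1) (min 1 (g n x))" for n :: nat and x
  have hc: "continuous_on UNIV (h n)" for n
    unfolding h_def by (intro continuous_intros g)
  have hb: "\<bar>h n x\<bar> \<le> 1" for n x by (auto simp: h_def)
  have hm: "h n \<in> borel_measurable (lebesgue_on S)" for n
    by (rule continuous_measurable_lebesgue_on[OF hc])
  have "(\<lambda>n. LINT x|lebesgue_on S. H x * h n x) \<longlonglongrightarrow> (LINT x|lebesgue_on S. \<bar>H x\<bar>)"
  proof (rule integral_dominated_convergence[where w = "\<lambda>x. \<bar>H x\<bar>"])
    show "(\<lambda>x. \<bar>H x\<bar>) \<in> borel_measurable (lebesgue_on S)" "(\<lambda>x. H x * h n x) \<in> borel_measurable (lebesgue_on S)" for n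
      using borel_measurable_integrable[OF H] hm[of n] by measurable
    show "integrable (lebesgue_on S) (\<lambda>x. \<bar>H x\<bar>)" using H by simp
    show "AE x in lebesgue_on S. norm (H x * h n x) \<le> \<bar>H x\<bar>" for n
      using hb[of n] by (intro AE_I2) (simp add: abs_mult mult_left_le)
    have "AE x in lebesgue. x \<notin> N"
      using g(1) by (simp add: negligible_iff_null_sets AE_not_in)
    then have "AE x in lebesgue_on S. x \<notin> N"
      using S by (simp add: AE_restrict_space_iff) (erule eventually_mono, simp)
    then show "AE x in lebesgue_on S. (\<lambda>n. H x * h n x) \<longlonglongrightarrow> \<bar>H x\<bar>"
    proof (rule AE_mp, intro AE_I2 impI)
      fix x assume "x \<in> space (lebesgue_on S)" "x \<notin> N"
      then have "(\<lambda>n. g n x) \<longlonglongrightarrow> sgn (H x)" using g(3)[of x] by simp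
      then have "(\<lambda>n. H x * h n x) \<longlonglongrightarrow> H x * max (-1) (min 1 (sgn (H x)))"
        unfolding h_def by (intro tendsto_intros)
      also have "H x * max (-1) (min 1 (sgn (H x))) = \<bar>H x\<bar>" by (auto simp: sgn_if)
      finally show "(\<lambda>n. H x * h n x) \<longlonglongrightarrow> \<bar>H x\<bar>" .
    qed
  qed
  then have "(LINT x|lebesgue_on S. \<bar>H x\<bar>) = 0"
    using orth[OF hc hb] by (simp add: LIMSEQ_const_iff)
  then have "AE x in lebesgue_on S. \<bar>H x\<bar> = 0"
    using H by (subst (asm) integral_nonneg_eq_0_iff_AE) auto
  then show ?thesis by simp
qed

lemma AE_zero_if_orthogonal_continuous:
  fixes H :: "'a::euclidean_space \<Rightarrow> complex"
  assumes S: "S \<in> sets lebesgue" and H: "integrable (lebesgue_on S) H"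
    and orth: "\<And>h. continuous_on UNIV h \<Longrightarrow> (\<And>x. \<bar>h x\<bar> \<le> 1) \<Longrightarrow> (LINT x|lebesgue_on S. H x * of_real (h x)) = 0"
  shows "AE x in lebesgue_on S. H x = 0"
proof -
  have i: "integrable (lebesgue_on S) (\<lambda>x. H x * of_real (h x))"
    if "continuous_on UNIV h" "\<And>x. \<bar>h x\<bar> \<le> 1" for h
    by (rule integrable_mult_bounded[OF H, where C = 1])
       (use that in \<open>auto intro!: continuous_measurable_lebesgue_on continuous_intros\<close>)
  have "AE x in lebesgue_on S. Re (H x) = 0"
  proof (rule AE_zero_real_if_orthogonal_continuous[OF S])
    show "integrable (lebesgue_on S) (\<lambda>x. Re (H x))" using H by (rule integrable_Re)
    show "(LINT x|lebesgue_on S. Re (H x) * h x) = 0" if "continuous_on UNIV h" "\<And>x. \<bar>h x\<bar> \<le> 1" for h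
      using orth[OF that] integral_Re[OF i[OF that]] by simp
  qed
  moreover have "AE x in lebesgue_on S. Im (H x) = 0"
  proof (rule AE_zero_real_if_orthogonal_continuous[OF S])
    show "integrable (lebesgue_on S) (\<lambda>x. Im (H x))" using H by (rule integrable_Im)
    show "(LINT x|lebesgue_on S. Im (H x) * h x) = 0" if "continuous_on UNIV h" "\<And>x. \<bar>h x\<bar> \<le> 1" for h
      using orth[OF that] integral_Im[OF i[OF that]] by simp
  qed
  ultimately show ?thesis by eventually_elim (simp add: complex_eq_iff)
qed

context
  fixes a b R R' :: real and i :: 3
  assumes ab: "0 < a" "0 < b"
begin

abbreviation (input) slab where "slab \<equiv> section_between a b R' R"

text \<open>Indices are integers rather than natural numbers, because the product formulas shift
  them by 1 in both directions.\<close>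

definition orth_profiles :: "(real^3 \<Rightarrow> complex) \<Rightarrow> bool" where
  "orth_profiles G \<longleftrightarrow> integrable (lebesgue_on slab) G \<and>
    (\<forall>(m::int) (n::int) f l u. smooth1 f \<longrightarrow> R' < l \<longrightarrow> u < R \<longrightarrow> (\<forall>t. t \<notin> {l..u} \<longrightarrow> f t = 0) \<longrightarrow>
      (LINT x|lebesgue_on slab. G x * sep (trig_profile i (m * pi / a) (n * pi / b) f) x) = 0)"

text \<open>Continuous multipliers preserving orthogonality form an algebra; product formulas for sine and
  cosine put the functions \<open>cos (\<pi> x\<^sub>1 / a)\<close> and \<open>cos (\<pi> x\<^sub>2 / b)\<close> into it.\<close>

definition multipliers :: "(real^3 \<Rightarrow> real) set" where
  "multipliers = {h. continuous_on UNIV h \<and> (\<forall>G. orth_profiles G \<longrightarrow> orth_profiles (\<lambda>x. G x * of_real (h x)))}"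

lemma integrable_mult_continuous:
  assumes "integrable (lebesgue_on slab) G" "continuous_on UNIV (h :: real^3 \<Rightarrow> complex)"
  shows "integrable (lebesgue_on slab) (\<lambda>x. G x * h x)"
proof -
  have "compact (h ` cbox (vector [0, 0, R']) (vector [a, b, R]))"
    by (intro compact_continuous_image continuous_on_subset[OF assms(2)] compact_cbox) auto
  then have "bounded (h ` cbox (vector [0, 0, R']) (vector [a, b, R]))" by (rule compact_imp_bounded)
  then obtain C where C: "\<forall>y\<in>h ` cbox (vector [0, 0, R']) (vector [a, b, R]). norm y \<le> C"
    unfolding bounded_iff by blast
  show ?thesis
  proof (rule integrable_mult_bounded[OF assms(1) continuous_measurable_lebesgue_on[OF assms(2)]])
    fix x assume "x \<in> space (lebesgue_on slab)"
    then have "x \<in> cbox (vector [0, 0, R']) (vector [a, b, R])"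
      unfolding section_between_eq_box using box_subset_cbox by auto
    then show "norm (h x) \<le> C" using C by blast
  qed
qed

lemma multipliersI:
  assumes "continuous_on UNIV h"
    "\<And>G (m::int) (n::int) f l u. orth_profiles G \<Longrightarrow> smooth1 f \<Longrightarrow> R' < l \<Longrightarrow> u < R \<Longrightarrow> (\<forall>t. t \<notin> {l..u} \<longrightarrow> f t = 0) \<Longrightarrow>
      (LINT x|lebesgue_on slab. G x * of_real (h x) * sep (trig_profile i (m * pi / a) (n * pi / b) f) x) = 0"
  shows "h \<in> multipliers"
proof -
  have "integrable (lebesgue_on slab) (\<lambda>x. G x * of_real (h x))" if "orth_profiles G" for G
    using that by (intro integrable_mult_continuous continuous_intros assms(1)) (simp add: orth_profiles_def)
  then show ?thesis
    unfolding multipliers_def mem_Collect_eq orth_profiles_def[of "\<lambda>x. _ x * of_real (h x)"]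
    using assms by blast
qed

lemma orth_profilesD:
  assumes "orth_profiles G" "smooth1 f" "R' < l" "u < R" "\<forall>t. t \<notin> {l..u} \<longrightarrow> f t = 0"
  shows "(LINT x|lebesgue_on slab. G x * sep (trig_profile i (of_int m * pi / a) (of_int n * pi / b) f) x) = 0"
    and "integrable (lebesgue_on slab) (\<lambda>x. G x * sep (trig_profile i p q f) x)"
proof -
  show "(LINT x|lebesgue_on slab. G x * sep (trig_profile i (of_int m * pi / a) (of_int n * pi / b) f) x) = 0"
    using assms unfolding orth_profiles_def by blast
  show "integrable (lebesgue_on slab) (\<lambda>x. G x * sep (trig_profile i p q f) x)"
    using assms(1) smooth1_trig_profile[OF assms(2)]
    by (intro integrable_mult_continuous continuous_on_sep) (simp_all add: orth_profiles_def)
qed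

lemma multipliers_algebra:
  "(\<lambda>x. c) \<in> multipliers"
  "f \<in> multipliers \<Longrightarrow> g \<in> multipliers \<Longrightarrow> (\<lambda>x. f x * g x) \<in> multipliers"
  "f \<in> multipliers \<Longrightarrow> g \<in> multipliers \<Longrightarrow> (\<lambda>x. f x + g x) \<in> multipliers"
proof -
  show "(\<lambda>x. c) \<in> multipliers"
  proof (rule multipliersI)
    fix G f l u and m n :: int
    assume *: "orth_profiles G" "smooth1 f" "R' < l" "u < R" "\<forall>t. t \<notin> {l..u} \<longrightarrow> f t = 0"
    have "(LINT x|lebesgue_on slab. c * (G x * sep (trig_profile i (m * pi / a) (n * pi / b) f) x)) = 0"
      using orth_profilesD(1)[OF *] by simp
    then show "(LINT x|lebesgue_on slab. G x * of_real c * sep (trig_profile i (m * pi / a) (n * pi / b) f) x) = 0"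
      by (simp add: mult_ac)
  qed simp
  show "(\<lambda>x. f x * g x) \<in> multipliers" if "f \<in> multipliers" "g \<in> multipliers"
  proof -
    have "orth_profiles (\<lambda>x. G x * of_real (f x * g x))" if "orth_profiles G" for G
      using that \<open>f \<in> multipliers\<close> \<open>g \<in> multipliers\<close> unfolding multipliers_def
      by (simp add: mult.assoc[symmetric])
    then show ?thesis
      using that unfolding multipliers_def by (auto intro!: continuous_intros)
  qed
  show "(\<lambda>x. f x + g x) \<in> multipliers" if fg: "f \<in> multipliers" "g \<in> multipliers"
  proof (rule multipliersI)
    fix G h l u and m n :: int
    assume G: "orth_profiles G" and *: "smooth1 h" "R' < l" "u < R" "\<forall>t. t \<notin> {l..u} \<longrightarrow> h t = 0"
    have fG: "orth_profiles (\<lambda>x. G x * of_real (f x))" "orth_profiles (\<lambda>x. G x * of_real (g x))"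
      using fg G unfolding multipliers_def by auto
    show "(LINT x|lebesgue_on slab. G x * of_real (f x + g x) * sep (trig_profile i (m * pi / a) (n * pi / b) h) x) = 0"
      using orth_profilesD[OF fG(1) *] orth_profilesD[OF fG(2) *] by (simp add: algebra_simps)
  qed (use fg in \<open>auto simp: multipliers_def intro!: continuous_intros\<close>)
qed

lemma two_cos_cos: "complex_of_real (cos s) * of_real (cos t) = (1 / 2) * of_real (cos (t + s)) + (1 / 2) * of_real (cos (t - s))"
  and two_cos_sin: "complex_of_real (cos s) * of_real (sin t) = (1 / 2) * of_real (sin (t + s)) + (1 / 2) * of_real (sin (t - s))"
  by (simp_all add: cos_add cos_diff sin_add sin_diff add_divide_distrib diff_divide_distrib mult.commute)

lemma coordinate_multipliers:
  "(\<lambda>x. cos (pi / a * x $ 1)) \<in> multipliers"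
  "(\<lambda>x. cos (pi / b * x $ 2)) \<in> multipliers"
  "(\<lambda>x. x $ 3) \<in> multipliers"
proof -
  show "(\<lambda>x. cos (pi / a * x $ 1)) \<in> multipliers"
  proof (rule multipliersI)
    fix G f l u and m n :: int
    assume *: "orth_profiles G" "smooth1 f" "R' < l" "u < R" "\<forall>t. t \<notin> {l..u} \<longrightarrow> f t = 0"
    let ?s = "\<lambda>m x. sep (trig_profile i (of_int m * pi / a) (of_int n * pi / b) f) x"
    have e: "of_real (cos (pi / a * x $ 1)) * ?s m x = (1 / 2) * ?s (m + 1) x + (1 / 2) * ?s (m - 1) x" for x
    proof -
      have a1: "(of_int (m + 1) * pi / a) * x $ 1 = (of_int m * pi / a) * x $ 1 + pi / a * x $ 1"
        "(of_int (m - 1) * pi / a) * x $ 1 = (of_int m * pi / a) * x $ 1 - pi / a * x $ 1"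
        by (simp_all add: algebra_simps add_divide_distrib diff_divide_distrib)
      define T where "T m' = trig_profile i (of_int m' * pi / a) (of_int n * pi / b) f 1 (x $ 1)" for m' :: int
      define B where "B = trig_profile i 0 (of_int n * pi / b) f 2 (x $ 2) * f (x $ 3)"
      have s: "?s m' x = T m' * B" for m'
        unfolding sep_3 T_def B_def by (simp add: trig_profile_def three_distinct)
      have "of_real (cos (pi / a * x $ 1)) * T m = (1 / 2) * T (m + 1) + (1 / 2) * T (m - 1)"
        unfolding T_def trig_profile_def
        by (cases "i = 1"; cases "i = 2"; simp only: three_distinct if_True if_False simp_thms a1 two_cos_cos two_cos_sin)
      then show ?thesis
        unfolding s by (simp only: mult.assoc[symmetric]) (simp add: algebra_simps)
    qed
    have "(LINT x|lebesgue_on slab. G x * of_real (cos (pi / a * x $ 1)) * ?s m x)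
        = (LINT x|lebesgue_on slab. (1 / 2) * (G x * ?s (m + 1) x) + (1 / 2) * (G x * ?s (m - 1) x))"
      unfolding mult.assoc e by (simp add: algebra_simps)
    also have "\<dots> = 0"
      using orth_profilesD(2)[OF *] orth_profilesD(1)[OF *, of "m + 1" n] orth_profilesD(1)[OF *, of "m - 1" n] by simp
    finally show "(LINT x|lebesgue_on slab. G x * of_real (cos (pi / a * x $ 1)) * ?s m x) = 0" .
  qed (intro continuous_intros)
  show "(\<lambda>x. cos (pi / b * x $ 2)) \<in> multipliers"
  proof (rule multipliersI)
    fix G f l u and m n :: int
    assume *: "orth_profiles G" "smooth1 f" "R' < l" "u < R" "\<forall>t. t \<notin> {l..u} \<longrightarrow> f t = 0"
    let ?s = "\<lambda>n x. sep (trig_profile i (of_int m * pi / a) (of_int n * pi / b) f) x"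
    have e: "of_real (cos (pi / b * x $ 2)) * ?s n x = (1 / 2) * ?s (n + 1) x + (1 / 2) * ?s (n - 1) x" for x
    proof -
      have a1: "(of_int (n + 1) * pi / b) * x $ 2 = (of_int n * pi / b) * x $ 2 + pi / b * x $ 2"
        "(of_int (n - 1) * pi / b) * x $ 2 = (of_int n * pi / b) * x $ 2 - pi / b * x $ 2"
        by (simp_all add: algebra_simps add_divide_distrib diff_divide_distrib)
      define T where "T m' = trig_profile i (of_int m * pi / a) (of_int m' * pi / b) f 2 (x $ 2)" for m' :: int
      define B where "B = trig_profile i (of_int m * pi / a) 0 f 1 (x $ 1) * f (x $ 3)"
      have s: "?s m' x = T m' * B" for m'
        unfolding sep_3 T_def B_def by (simp add: trig_profile_def three_distinct)
      have "of_real (cos (pi / b * x $ 2)) * T n = (1 / 2) * T (n + 1) + (1 / 2) * T (n - 1)"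
        unfolding T_def trig_profile_def
        by (cases "i = 1"; cases "i = 2"; simp only: three_distinct if_True if_False simp_thms a1 two_cos_cos two_cos_sin)
      then show ?thesis
        unfolding s by (simp only: mult.assoc[symmetric]) (simp add: algebra_simps)
    qed
    have "(LINT x|lebesgue_on slab. G x * of_real (cos (pi / b * x $ 2)) * ?s n x)
        = (LINT x|lebesgue_on slab. (1 / 2) * (G x * ?s (n + 1) x) + (1 / 2) * (G x * ?s (n - 1) x))"
      unfolding mult.assoc e by (simp add: algebra_simps)
    also have "\<dots> = 0"
      using orth_profilesD(2)[OF *] orth_profilesD(1)[OF *, of m "n + 1"] orth_profilesD(1)[OF *, of m "n - 1"] by simp
    finally show "(LINT x|lebesgue_on slab. G x * of_real (cos (pi / b * x $ 2)) * ?s n x) = 0" .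
  qed (intro continuous_intros)
  show "(\<lambda>x. x $ 3) \<in> multipliers"
  proof (rule multipliersI)
    fix G f l u and m n :: int
    assume *: "orth_profiles G" "smooth1 f" "R' < l" "u < R" "\<forall>t. t \<notin> {l..u} \<longrightarrow> f t = 0"
    \<comment> \<open>Multiplication by x_3 stays within the class, since t f(t) is again a smooth
      profile with the same support.\<close>
    have "(LINT x|lebesgue_on slab. G x * sep (trig_profile i (m * pi / a) (n * pi / b) (\<lambda>t. of_real t * f t)) x) = 0"
      by (rule orth_profilesD(1)[OF *(1) smooth1_mult[OF smooth1_id *(2)] *(3,4)]) (use *(5) in simp)
    then show "(LINT x|lebesgue_on slab. G x * of_real (x $ 3) * sep (trig_profile i (m * pi / a) (n * pi / b) f) x) = 0"
      by (simp add: sep_3 trig_profile_simps(1) trig_profile_def three_distinct mult_ac)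
  qed (intro continuous_intros)
qed

text \<open>On the closed box the arguments of the two cosines run through [0, \<pi>], where cosine
  is injective.\<close>

lemma multipliers_separate:
  assumes "x \<in> cbox (vector [0, 0, R']) (vector [a, b, R])" "y \<in> cbox (vector [0, 0, R']) (vector [a, b, R])" "x \<noteq> y"
  shows "\<exists>f\<in>multipliers. f x \<noteq> f y"
proof -
  have r: "0 \<le> x $ 1" "x $ 1 \<le> a" "0 \<le> x $ 2" "x $ 2 \<le> b" "0 \<le> y $ 1" "y $ 1 \<le> a" "0 \<le> y $ 2" "y $ 2 \<le> b"
    using assms(1,2) by (auto simp: mem_box_cart forall_3)
  have inj: "cos (pi / d * s) \<noteq> cos (pi / d * t)" if "0 < d" "0 \<le> s" "s \<le> d" "0 \<le> t" "t \<le> d" "s \<noteq> t" for d s t :: real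
  proof
    assume "cos (pi / d * s) = cos (pi / d * t)"
    moreover have "0 \<le> pi / d * s" "pi / d * s \<le> pi" "0 \<le> pi / d * t" "pi / d * t \<le> pi"
      using that by (simp_all add: field_simps)
    ultimately have "pi / d * s = pi / d * t" using cos_inj_pi[of "pi / d * s" "pi / d * t"] by blast
    then show False using that by simp
  qed
  consider "x $ 1 \<noteq> y $ 1" | "x $ 2 \<noteq> y $ 2" | "x $ 3 \<noteq> y $ 3"
    using assms(3) by (auto simp: vec_eq_iff forall_3)
  then show ?thesis
  proof cases
    case 1
    then show ?thesis using inj[OF ab(1) r(1,2,5,6)] coordinate_multipliers(1) by (intro bexI) auto
  next
    case 2
    then show ?thesis using inj[OF ab(2) r(3,4,7,8)] coordinate_multipliers(2) by (intro bexI) auto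
  next
    case 3
    then show ?thesis using coordinate_multipliers(3) by (intro bexI) auto
  qed
qed

text \<open>Stone-Weierstrass for the multiplier algebra makes G e orthogonal to all continuous
  functions for one fixed profile e, so G e = 0 almost everywhere. The conclusion concerns a smaller
  slab because e has compact support in x_3; there e has no zero and can be cancelled.\<close>

theorem orth_profiles_zero:
  assumes G: "integrable (lebesgue_on slab) G"
    and orth: "\<And>(m::nat) (n::nat) f l u. smooth1 f \<Longrightarrow> R' < l \<Longrightarrow> l \<le> u \<Longrightarrow> u < R \<Longrightarrow> (\<And>t. t \<notin> {l..u} \<Longrightarrow> f t = 0) \<Longrightarrow>
      (LINT x|lebesgue_on slab. G x * sep (trig_profile i (m * pi / a) (n * pi / b) f) x) = 0"
    and l'u': "R' < l'" "l' \<le> u'" "u' < R"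
  shows "AE x in lebesgue_on (section_between a b l' u'). G x = 0"
proof -
  have "orth_profiles G"
    unfolding orth_profiles_def
  proof (intro conjI allI impI G)
    fix m n :: int and f l u
    assume *: "smooth1 f" "R' < l" "u < R" "\<forall>t. t \<notin> {l..u} \<longrightarrow> f t = 0"
    show "(LINT x|lebesgue_on slab. G x * sep (trig_profile i (of_int m * pi / a) (of_int n * pi / b) f) x) = 0"
    proof (cases "l \<le> u")
      case True
      \<comment> \<open>Negative indices reduce to positive ones by parity: a sine changes sign with
        its frequency, a cosine does not. For frequency 0 the sine and sgn are both 0.\<close>
      define s where "s = ((if i = 1 then 1 else sgn m) * (if i = 2 then 1 else sgn n) :: int)"
      have c1: "trig_profile i (of_int m * pi / a) q f 1 t
          = of_int (if i = 1 then 1 else sgn m) * trig_profile i (real (nat \<bar>m\<bar>) * pi / a) q' f 1 t" for q q' t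
        by (cases "m = 0"; cases "m > 0") (auto simp: trig_profile_def three_distinct)
      have c2: "trig_profile i p (of_int n * pi / b) f 2 t
          = of_int (if i = 2 then 1 else sgn n) * trig_profile i p' (real (nat \<bar>n\<bar>) * pi / b) f 2 t" for p p' t
        by (cases "n = 0"; cases "n > 0") (auto simp: trig_profile_def three_distinct)
      have "sep (trig_profile i (of_int m * pi / a) (of_int n * pi / b) f) x
          = of_int s * sep (trig_profile i (real (nat \<bar>m\<bar>) * pi / a) (real (nat \<bar>n\<bar>) * pi / b) f) x" for x
        unfolding sep_3 c1[of "of_int n * pi / b" _ "real (nat \<bar>n\<bar>) * pi / b"]
          c2[of "of_int m * pi / a" _ "real (nat \<bar>m\<bar>) * pi / a"] s_def trig_profile_simps(1)
        by (simp only: of_int_mult mult_ac)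
      then have "(LINT x|lebesgue_on slab. G x * sep (trig_profile i (of_int m * pi / a) (of_int n * pi / b) f) x)
          = (LINT x|lebesgue_on slab. of_int s * (G x * sep (trig_profile i (real (nat \<bar>m\<bar>) * pi / a) (real (nat \<bar>n\<bar>) * pi / b) f) x))"
        by (simp add: mult_ac)
      also have "\<dots> = of_int s * (LINT x|lebesgue_on slab. G x * sep (trig_profile i (real (nat \<bar>m\<bar>) * pi / a) (real (nat \<bar>n\<bar>) * pi / b) f) x)"
        by simp
      also have "\<dots> = 0" using orth[OF *(1,2) True *(3), of "nat \<bar>m\<bar>" "nat \<bar>n\<bar>"] *(4) by simp
      finally show ?thesis .
    next
      case False
      then have "f = (\<lambda>t. 0)" using *(4) by auto
      then show ?thesis by (simp add: sep_3 trig_profile_simps(1))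
    qed
  qed
  interpret function_ring_on multipliers "cbox (vector [0, 0, R']) (vector [a, b, R]) :: (real^3) set"
    using multipliers_algebra multipliers_separate
    by unfold_locales (auto simp: multipliers_def intro: continuous_on_subset)
  define l where "l = (R' + l') / 2"
  define u where "u = (u' + R) / 2"
  have lu: "R' < l" "l < l'" "u' < u" "u < R" using l'u' by (auto simp: l_def u_def)
  obtain \<tau> where \<tau>: "smooth1 \<tau>" "\<And>t. t \<in> {l'..u'} \<Longrightarrow> \<tau> t = 1" "\<And>t. t \<notin> {l..u} \<Longrightarrow> \<tau> t = 0"
    by (rule bump_function[of l l' u' u]) (use lu l'u' in auto)
  \<comment> \<open>The lowest frequencies for which the profile of component i has no zero inside
    the cross-section: 0 for a cosine, 1 for a sine.\<close>
  define m where "m = (if i = 1 then 0 else 1 :: int)"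
  define n where "n = (if i = 2 then 0 else 1 :: int)"
  define e where "e = sep (trig_profile i (m * pi / a) (n * pi / b) \<tau>)"
  define H where "H x = G x * e x" for x
  have ec: "continuous_on UNIV e"
    unfolding e_def by (intro continuous_on_sep smooth1_trig_profile \<tau>)
  have H: "integrable (lebesgue_on slab) H"
    unfolding H_def by (rule integrable_mult_continuous[OF G ec])
  have "AE x in lebesgue_on slab. H x = 0"
  proof (rule AE_zero_if_orthogonal_continuous[OF sets_section_between H])
    fix h :: "real^3 \<Rightarrow> real"
    assume h: "continuous_on UNIV h" "\<And>x. \<bar>h x\<bar> \<le> 1"
    from Stone_Weierstrass[OF continuous_on_subset[OF h(1) subset_UNIV]]
    obtain F where F: "\<And>n. F n \<in> multipliers"
      "uniform_limit (cbox (vector [0, 0, R']) (vector [a, b, R])) F h sequentially" by blast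
    have z: "(LINT x|lebesgue_on slab. H x * of_real (F n x)) = 0" for n
    proof -
      have "orth_profiles (\<lambda>x. G x * of_real (F n x))"
        using F(1)[of n] \<open>orth_profiles G\<close> unfolding multipliers_def by blast
      then have "(LINT x|lebesgue_on slab. G x * of_real (F n x) * e x) = 0"
        unfolding e_def by (rule orth_profilesD(1)[OF _ \<tau>(1) lu(1,4)]) (use \<tau>(3) in blast)
      then show ?thesis by (simp add: H_def mult_ac)
    qed
    have "(\<lambda>n. LINT x|lebesgue_on slab. H x * of_real (F n x)) \<longlonglongrightarrow> (LINT x|lebesgue_on slab. H x * of_real (h x))"
    proof -
      have ev: "\<forall>\<^sub>F n in sequentially. \<forall>x\<in>cbox (vector [0, 0, R']) (vector [a, b, R]). dist (F n x) (h x) < 1"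
        using F(2) unfolding uniform_limit_iff by auto
      then obtain N where N: "\<And>n x. n \<ge> N \<Longrightarrow> x \<in> cbox (vector [0, 0, R']) (vector [a, b, R]) \<Longrightarrow> dist (F n x) (h x) < 1"
        unfolding eventually_sequentially by blast
      have sub: "x \<in> cbox (vector [0, 0, R']) (vector [a, b, R])" if "x \<in> space (lebesgue_on slab)" for x
        using that box_subset_cbox unfolding section_between_eq_box by auto
      \<comment> \<open>Uniform convergence bounds F n by 2 only from N on, hence the shifted
        sequence.\<close>
      have "(\<lambda>n. LINT x|lebesgue_on slab. H x * of_real (F (n + N) x)) \<longlonglongrightarrow> (LINT x|lebesgue_on slab. H x * of_real (h x))"
      proof (rule integral_dominated_convergence[where w = "\<lambda>x. norm (H x) * 2"])
        have c: "continuous_on UNIV (\<lambda>x. complex_of_real (F n x))" for n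
          using F(1)[of n] unfolding multipliers_def by (auto intro!: continuous_intros)
        show "(\<lambda>x. H x * of_real (h x)) \<in> borel_measurable (lebesgue_on slab)"
          "(\<lambda>x. H x * of_real (F (n + N) x)) \<in> borel_measurable (lebesgue_on slab)" for n
          by (rule borel_measurable_times[OF borel_measurable_integrable[OF H] continuous_measurable_lebesgue_on],
              intro continuous_intros h c)+
        show "integrable (lebesgue_on slab) (\<lambda>x. norm (H x) * 2)" using H by simp
        show "AE x in lebesgue_on slab. (\<lambda>n. H x * of_real (F (n + N) x)) \<longlonglongrightarrow> H x * of_real (h x)"
          by (intro AE_I2 tendsto_intros LIMSEQ_ignore_initial_segment tendsto_uniform_limitI[OF F(2)] sub)
        show "AE x in lebesgue_on slab. norm (H x * of_real (F (n + N) x)) \<le> norm (H x) * 2" for n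
        proof (rule AE_I2)
          fix x assume "x \<in> space (lebesgue_on slab)"
          then have "dist (F (n + N) x) (h x) < 1" by (intro N sub) auto
          then have "\<bar>F (n + N) x\<bar> \<le> 2" using h(2)[of x] by (auto simp: dist_real_def abs_if split: if_splits)
          then show "norm (H x * of_real (F (n + N) x)) \<le> norm (H x) * 2"
            by (simp add: norm_mult mult_left_mono)
        qed
      qed
      then show ?thesis by (rule LIMSEQ_offset)
    qed
    then show "(LINT x|lebesgue_on slab. H x * of_real (h x)) = 0"
      unfolding z by (simp add: LIMSEQ_const_iff)
  qed
  then have "AE x in lebesgue. x \<in> slab \<longrightarrow> H x = 0"
    by (simp add: AE_restrict_space_iff)
  then have "AE x in lebesgue. x \<in> section_between a b l' u' \<longrightarrow> G x = 0"
  proof eventually_elim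
    case (elim x)
    show ?case
    proof
      assume x: "x \<in> section_between a b l' u'"
      then have r: "0 < x $ 1" "x $ 1 < a" "0 < x $ 2" "x $ 2 < b" "l' < x $ 3" "x $ 3 < u'"
        by (auto simp: section_between_eq)
      have "sin (pi / d * t) > 0" if "0 < d" "0 < t" "t < d" for d t :: real
        using that by (intro sin_gt_zero) (simp_all add: field_simps)
      from this[OF ab(1) r(1,2)] this[OF ab(2) r(3,4)]
      have "e x \<noteq> 0"
        using \<tau>(2)[of "x $ 3"] r(5,6)
        unfolding e_def sep_3 trig_profile_def m_def n_def by (simp add: three_distinct)
      moreover have "x \<in> slab" using x lu l'u' by (auto simp: section_between_eq)
      ultimately show "G x = 0" using elim by (simp add: H_def)
    qed
  qed
  then show ?thesis by (simp add: AE_restrict_space_iff)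
qed

end

section \<open>Integrals of separated functions\<close>

text \<open>Lebesgue measure on vectors is the image of a product measure indexed by the basis. The
  factors are reindexed from basis vectors to coordinates, and Fubini for product measures
  applies.\<close>

lemma integral_prod_vec:
  fixes f :: "'n::finite \<Rightarrow> real \<Rightarrow> complex"
  assumes f: "\<And>j. integrable lborel (f j)"
  shows "(LINT x|lborel. (\<Prod>j\<in>UNIV. f j ((x :: real^'n) $ j))) = (\<Prod>j\<in>UNIV. LINT t|lborel. f j t)"
proof -
  interpret product_sigma_finite "\<lambda>_ :: real^'n. lborel :: real measure" by standard
  let ?T = "\<lambda>y :: real^'n \<Rightarrow> real. \<Sum>b\<in>Basis. y b *\<^sub>R b"
  have B: "(Basis :: (real^'n) set) = (\<lambda>j. axis j 1) ` UNIV"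
    by (auto simp: Basis_vec_def)
  have inj: "inj_on (\<lambda>j. axis j 1 :: real^'n) UNIV" by (auto simp: inj_on_def axis_eq_axis)
  have T: "?T y $ j = y (axis j 1)" for y j
  proof -
    have "?T y $ j = ?T y \<bullet> axis j 1" by (simp add: inner_axis)
    also have "\<dots> = y (axis j 1)" by (rule inner_sum_left_Basis) (auto simp: B)
    finally show ?thesis .
  qed
  have fm [measurable]: "f j \<in> borel_measurable borel" for j
    using borel_measurable_integrable[OF f] by simp
  have pm: "(\<lambda>x. \<Prod>j\<in>UNIV. f j ((x :: real^'n) $ j)) \<in> borel_measurable borel"
    by (intro borel_measurable_prod measurable_compose[OF _ fm] borel_measurable_continuous_onI continuous_intros)
  have "(\<lambda>y. y b :: real) \<in> borel_measurable (\<Pi>\<^sub>M b\<in>Basis. lborel)" if "b \<in> Basis" for b :: "real^'n"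
    using measurable_component_singleton[OF that, of "\<lambda>_. lborel :: real measure"] by simp
  then have Tm: "?T \<in> borel_measurable (\<Pi>\<^sub>M b\<in>Basis. lborel)"
    by (intro borel_measurable_sum borel_measurable_scaleR borel_measurable_const)
  have "(LINT x|lborel. (\<Prod>j\<in>UNIV. f j ((x :: real^'n) $ j)))
      = (LINT y|(\<Pi>\<^sub>M b\<in>(Basis :: (real^'n) set). lborel). (\<Prod>j\<in>UNIV. f j (?T y $ j)))"
    by (subst lborel_eq, rule integral_distr[OF Tm pm])
  also have "\<dots> = (LINT y|(\<Pi>\<^sub>M b\<in>(Basis :: (real^'n) set). lborel). (\<Prod>b\<in>Basis. f (axis_index b) (y b)))"
  proof -
    have "(\<Prod>j\<in>UNIV. f j (?T y $ j)) = (\<Prod>b\<in>Basis. f (axis_index b) (y b))" for y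
      unfolding T by (simp add: B prod.reindex[OF inj])
    then show ?thesis by (simp only:)
  qed
  also have "\<dots> = (\<Prod>b\<in>(Basis :: (real^'n) set). LINT t|lborel. f (axis_index b) t)"
    by (rule product_integral_prod) (auto intro: f)
  also have "\<dots> = (\<Prod>j\<in>UNIV. LINT t|lborel. f j t)"
    unfolding B by (simp add: prod.reindex[OF inj])
  finally show ?thesis .
qed

lemma integral_lebesgue_on_lborel:
  fixes f :: "'a::euclidean_space \<Rightarrow> complex"
  assumes "continuous_on UNIV f" "S \<in> sets borel"
  shows "(LINT x|lebesgue_on S. f x) = (LINT x|lborel. indicator S x * f x)"
proof -
  have "(\<lambda>x. indicator S x *\<^sub>R f x) \<in> borel_measurable lborel"
    using borel_measurable_continuous_onI[OF assms(1)] assms(2) by measurable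
  then have "(LINT x|lebesgue_on S. f x) = (LINT x|lborel. indicator S x *\<^sub>R f x)"
    using assms(2) by (simp add: integral_restrict_space integral_completion)
  also have "\<dots> = (LINT x|lborel. indicator S x * f x)"
    by (rule Bochner_Integration.integral_cong) (auto simp: indicator_def)
  finally show ?thesis .
qed

lemma integrable_indicator_Ioo:
  fixes f :: "real \<Rightarrow> complex"
  assumes "continuous_on UNIV f"
  shows "integrable lborel (\<lambda>t. indicator {l<..<u} t * f t)"
proof (rule Bochner_Integration.integrable_bound)
  show "integrable lborel (\<lambda>t. indicator {l..u} t *\<^sub>R f t)"
    by (rule borel_integrable_compact) (auto intro: continuous_on_subset[OF assms])
  show "(\<lambda>t. indicator {l<..<u} t * f t) \<in> borel_measurable lborel"
    using borel_measurable_continuous_onI[OF assms] by measurable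
qed (auto simp: indicator_def)

lemma integral_box_prod:
  fixes f :: "'n::finite \<Rightarrow> real \<Rightarrow> complex"
  assumes f: "\<And>j. continuous_on UNIV (f j)" and S: "S = {x. \<forall>j. x $ j \<in> {l j<..<u j}}"
  shows "(LINT x|lebesgue_on S. (\<Prod>j\<in>UNIV. f j ((x :: real^'n) $ j)))
    = (\<Prod>j\<in>UNIV. LINT t|lebesgue_on {l j<..<u j}. f j t)"
proof -
  have S': "S = box (\<chi> j. l j) (\<chi> j. u j)" by (auto simp: S mem_box_cart)
  have c: "continuous_on UNIV (\<lambda>x :: real^'n. \<Prod>j\<in>UNIV. f j (x $ j))"
    by (intro continuous_on_prod continuous_on_compose2[OF f]) (auto intro: continuous_intros)
  have "(LINT x|lebesgue_on S. (\<Prod>j\<in>UNIV. f j ((x :: real^'n) $ j)))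
      = (LINT x|lborel. indicator S x * (\<Prod>j\<in>UNIV. f j (x $ j)))"
    by (rule integral_lebesgue_on_lborel[OF c]) (simp add: S')
  also have "\<dots> = (LINT x|lborel. (\<Prod>j\<in>UNIV. indicator {l j<..<u j} (x $ j) * f j (x $ j)))"
  proof (intro Bochner_Integration.integral_cong refl)
    fix x :: "real^'n"
    have "indicator S x = (\<Prod>j\<in>UNIV. indicator {l j<..<u j} (x $ j) :: complex)"
    proof (cases "x \<in> S")
      case True
      then show ?thesis by (simp add: S)
    next
      case False
      then obtain j where "x $ j \<notin> {l j<..<u j}" by (auto simp: S)
      then have "(\<Prod>j\<in>UNIV. indicator {l j<..<u j} (x $ j) :: complex) = 0"
        by (intro prod_zero bexI[of _ j]) auto
      then show ?thesis using False by simp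
    qed
    then show "indicator S x * (\<Prod>j\<in>UNIV. f j (x $ j)) = (\<Prod>j\<in>UNIV. indicator {l j<..<u j} (x $ j) * f j (x $ j))"
      by (simp add: prod.distrib)
  qed
  also have "\<dots> = (\<Prod>j\<in>UNIV. LINT t|lborel. indicator {l j<..<u j} t * f j t)"
    by (rule integral_prod_vec) (rule integrable_indicator_Ioo[OF f])
  also have "\<dots> = (\<Prod>j\<in>UNIV. LINT t|lebesgue_on {l j<..<u j}. f j t)"
    by (intro prod.cong refl integral_lebesgue_on_lborel[symmetric] f) auto
  finally show ?thesis .
qed

lemma integral_section_sep:
  assumes "\<And>j. continuous_on UNIV (f j)"
  shows "(LINT x|lebesgue_on (section_between a b R' R). sep f x)
    = (LINT t|lebesgue_on {0<..<a}. f 1 t) * (LINT t|lebesgue_on {0<..<b}. f 2 t) * (LINT t|lebesgue_on {R'<..<R}. f 3 t)"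
proof -
  define l where "l j = (if j = 3 then R' else 0)" for j :: 3
  define u where "u j = (if j = 1 then a else if j = 2 then b else R)" for j :: 3
  have "section_between a b R' R = {x. \<forall>j. x $ j \<in> {l j<..<u j}}"
    by (auto simp: section_between_eq l_def u_def forall_3 three_distinct)
  from integral_box_prod[OF assms this]
  have "(LINT x|lebesgue_on (section_between a b R' R). sep f x) = sep (\<lambda>j _. LINT t|lebesgue_on {l j<..<u j}. f j t) 0"
    by (simp add: sep_def)
  then show ?thesis by (simp add: sep_3 l_def u_def three_distinct)
qed

lemma integral_cos_multiple:
  fixes n :: int
  assumes d: "0 < d"
  shows "(LINT t|lebesgue_on {0<..<d}. complex_of_real (cos (n * pi / d * t))) = (if n = 0 then of_real d else 0)"
proof -
  define F where "F t = (if n = 0 then t else sin (n * pi / d * t) / (n * pi / d))" for t :: real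
  have dF: "(F has_real_derivative cos (n * pi / d * t)) (at t)" for t
  proof (cases "n = 0")
    case False
    then have "((\<lambda>t. sin (n * pi / d * t) / (n * pi / d)) has_real_derivative cos (n * pi / d * t)) (at t)"
      using d by (auto intro!: derivative_eq_intros)
    then show ?thesis using False unfolding F_def[abs_def] by simp
  qed (simp add: F_def[abs_def])
  have "(LINT t|lebesgue_on {0<..<d}. complex_of_real (cos (n * pi / d * t)))
      = (LINT t|lborel. indicator {0<..<d} t * complex_of_real (cos (n * pi / d * t)))"
    by (rule integral_lebesgue_on_lborel) (use d in \<open>auto intro!: continuous_intros\<close>)
  also have "\<dots> = (LINT t|lborel. indicator {0..d} t *\<^sub>R complex_of_real (cos (n * pi / d * t)))"
  proof (rule integral_cong_AE)
    have c: "(\<lambda>t. complex_of_real (cos (n * pi / d * t))) \<in> borel_measurable borel"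
      by (intro borel_measurable_continuous_onI continuous_intros) (use d in simp)
    show "(\<lambda>t. indicator {0<..<d} t * complex_of_real (cos (n * pi / d * t))) \<in> borel_measurable lborel"
      "(\<lambda>t. indicator {0..d} t *\<^sub>R complex_of_real (cos (n * pi / d * t))) \<in> borel_measurable lborel"
      using c by measurable
    show "AE t in lborel. indicator {0<..<d} t * complex_of_real (cos (n * pi / d * t))
        = indicator {0..d} t *\<^sub>R complex_of_real (cos (n * pi / d * t))"
      using AE_lborel_singleton[of 0] AE_lborel_singleton[of d] by eventually_elim (auto simp: indicator_def)
  qed
  also have "\<dots> = of_real (F d) - of_real (F 0)"
  proof (rule integral_FTC_Icc)
    show "((\<lambda>t. complex_of_real (F t)) has_vector_derivative of_real (cos (n * pi / d * t))) (at t within {0..d})" for t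
      by (rule has_vector_derivative_at_within, rule has_vector_derivative_of_real)
         (rule dF)
    show "continuous_on {0..d} (\<lambda>t. complex_of_real (cos (n * pi / d * t)))"
      using d by (intro continuous_intros) simp
  qed (use d in simp)
  also have "\<dots> = (if n = 0 then of_real d else 0)"
  proof -
    have "sin (n * pi / d * d) = 0" using d by (simp add: sin_zero_iff_int2)
    then show ?thesis by (simp add: F_def)
  qed
  finally show ?thesis .
qed

section \<open>Orthogonality of sines and cosines\<close>

definition cos_overlap :: "real \<Rightarrow> nat \<Rightarrow> nat \<Rightarrow> complex" where
  "cos_overlap d m n = (if m = n then (if m = 0 then of_real d else of_real (d / 2)) else 0)"

definition sin_overlap :: "real \<Rightarrow> nat \<Rightarrow> nat \<Rightarrow> complex" where
  "sin_overlap d m n = (if m = n \<and> m \<noteq> 0 then of_real (d / 2) else 0)"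

lemma integral_cos_cos:
  fixes m n :: nat
  assumes d: "0 < d"
  shows "(LINT t|lebesgue_on {0<..<d}. of_real (cos (m * pi / d * t)) * of_real (cos (n * pi / d * t))) = cos_overlap d m n"
    and "(LINT t|lebesgue_on {0<..<d}. of_real (sin (m * pi / d * t)) * of_real (sin (n * pi / d * t))) = sin_overlap d m n"
proof -
  let ?C = "\<lambda>j::int. \<lambda>t. complex_of_real (cos (j * pi / d * t))"
  have i: "integrable (lebesgue_on {0<..<d}) (?C j)" for j
  proof -
    have "integrable lborel (\<lambda>t. indicator {0<..<d} t *\<^sub>R ?C j t)"
    proof -
      have "integrable lborel (\<lambda>t. indicator {0<..<d} t * ?C j t)"
        by (rule integrable_indicator_Ioo) (use d in \<open>auto intro!: continuous_intros\<close>)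
      moreover have "(\<lambda>t. indicator {0<..<d} t *\<^sub>R ?C j t) = (\<lambda>t. indicator {0<..<d} t * ?C j t)"
        by (auto simp: indicator_def)
      ultimately show ?thesis by simp
    qed
    then have "integrable lebesgue (\<lambda>t. indicator {0<..<d} t *\<^sub>R ?C j t)"
      using integrable_completion[of "\<lambda>t. indicator {0<..<d} t *\<^sub>R ?C j t" lborel] by (simp add: borel_measurable_integrable)
    then show ?thesis by (simp add: integrable_restrict_space)
  qed
  have a: "real_of_int (int m + int n) * pi / d * t = real m * pi / d * t + real n * pi / d * t"
    "real_of_int (int m - int n) * pi / d * t = real m * pi / d * t - real n * pi / d * t" for t
    by (simp_all add: algebra_simps add_divide_distrib diff_divide_distrib)
  have cc: "of_real (cos (m * pi / d * t)) * of_real (cos (n * pi / d * t)) = (1/2) * ?C (int m - int n) t + (1/2) * ?C (int m + int n) t" for t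
    unfolding a by (simp add: cos_add cos_diff add_divide_distrib diff_divide_distrib)
  have ss: "of_real (sin (m * pi / d * t)) * of_real (sin (n * pi / d * t)) = (1/2) * ?C (int m - int n) t - (1/2) * ?C (int m + int n) t" for t
    unfolding a by (simp add: cos_add cos_diff add_divide_distrib diff_divide_distrib)
  have half: "(LINT t|lebesgue_on {0<..<d}. (1/2) * ?C j t) = (1/2) * (if j = 0 then of_real d else 0)"
    "integrable (lebesgue_on {0<..<d}) (\<lambda>t. (1/2) * ?C j t)" for j
    using integral_cos_multiple[OF d, of j] i[of j] by (simp_all del: of_real_divide times_divide_eq_left)
  show "(LINT t|lebesgue_on {0<..<d}. of_real (cos (m * pi / d * t)) * of_real (cos (n * pi / d * t))) = cos_overlap d m n"
    unfolding cc Bochner_Integration.integral_add[OF half(2) half(2)] half by (auto simp: cos_overlap_def)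
  show "(LINT t|lebesgue_on {0<..<d}. of_real (sin (m * pi / d * t)) * of_real (sin (n * pi / d * t))) = sin_overlap d m n"
    unfolding ss Bochner_Integration.integral_diff[OF half(2) half(2)] half by (auto simp: sin_overlap_def)
qed

text \<open>The inner product, over the cross-section, of two profiles of component i with index
  pairs p and q.\<close>

definition profile_overlap :: "real \<Rightarrow> real \<Rightarrow> 3 \<Rightarrow> nat \<times> nat \<Rightarrow> nat \<times> nat \<Rightarrow> complex" where
  "profile_overlap a b i p q =
    (if i = 1 then cos_overlap a (fst p) (fst q) else sin_overlap a (fst p) (fst q)) *
    (if i = 2 then cos_overlap b (snd p) (snd q) else sin_overlap b (snd p) (snd q))"

abbreviation profile_at :: "real \<Rightarrow> real \<Rightarrow> 3 \<Rightarrow> nat \<times> nat \<Rightarrow> (real \<Rightarrow> complex) \<Rightarrow> 3 \<Rightarrow> real \<Rightarrow> complex" where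
  "profile_at a b i p \<equiv> trig_profile i (real (fst p) * pi / a) (real (snd p) * pi / b)"

lemma integral_profiles:
  assumes ab: "0 < a" "0 < b" and f: "continuous_on UNIV f" "continuous_on UNIV g"
  shows "(LINT x|lebesgue_on (section_between a b R' R). sep (profile_at a b i p f) x * sep (profile_at a b i q g) x)
    = profile_overlap a b i p q * (LINT t|lebesgue_on {R'<..<R}. f t * g t)"
proof -
  let ?h = "\<lambda>j t. profile_at a b i p f j t * profile_at a b i q g j t"
  have "continuous_on UNIV (profile_at a b i r h j)" if "continuous_on UNIV h" for r h j
    using that ab by (auto simp: trig_profile_def intro!: continuous_intros)
  then have c: "continuous_on UNIV (?h j)" for j by (intro continuous_on_mult) (use f in auto)
  have "(LINT x|lebesgue_on (section_between a b R' R). sep (profile_at a b i p f) x * sep (profile_at a b i q g) x)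
      = (LINT x|lebesgue_on (section_between a b R' R). sep ?h x)"
    by (simp add: sep_def prod.distrib)
  also have "\<dots> = (LINT t|lebesgue_on {0<..<a}. ?h 1 t) * (LINT t|lebesgue_on {0<..<b}. ?h 2 t) * (LINT t|lebesgue_on {R'<..<R}. ?h 3 t)"
    by (rule integral_section_sep[OF c])
  also have "(LINT t|lebesgue_on {0<..<a}. ?h 1 t) = (if i = 1 then cos_overlap a (fst p) (fst q) else sin_overlap a (fst p) (fst q))"
    using integral_cos_cos[OF ab(1), of "fst p" "fst q"] unfolding trig_profile_def by (simp only: three_distinct if_True if_False refl split: if_split) simp
  also have "(LINT t|lebesgue_on {0<..<b}. ?h 2 t) = (if i = 2 then cos_overlap b (snd p) (snd q) else sin_overlap b (snd p) (snd q))"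
    using integral_cos_cos[OF ab(2), of "snd p" "snd q"] unfolding trig_profile_def by (simp only: three_distinct if_True if_False refl split: if_split) simp
  finally show ?thesis by (simp add: profile_overlap_def trig_profile_simps(1))
qed

lemma integral_exp_profile:
  assumes f: "continuous_on UNIV f" "\<And>t. t \<notin> {l..u} \<Longrightarrow> f t = 0" "R' < l" "u < R"
  shows "(LINT t|lebesgue_on {R'<..<R}. exp (- \<i> * \<kappa> * of_real t) * f t) = exp_moment \<kappa> f"
proof -
  have "(LINT t|lebesgue_on {R'<..<R}. exp (- \<i> * \<kappa> * of_real t) * f t)
      = (LINT t|lborel. indicator {R'<..<R} t * (exp (- \<i> * \<kappa> * of_real t) * f t))"
    by (rule integral_lebesgue_on_lborel) (auto intro!: continuous_intros f)
  also have "\<dots> = exp_moment \<kappa> f"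
    unfolding exp_moment_def
  proof (intro Bochner_Integration.integral_cong refl)
    fix t show "indicator {R'<..<R} t * (exp (- \<i> * \<kappa> * of_real t) * f t) = exp (- \<i> * \<kappa> * of_real t) * f t"
      using f(2)[of t] f(3,4) by (cases "t \<in> {l..u}") auto
  qed
  finally show ?thesis .
qed

section \<open>Waveguide modes and modal expansions\<close>

lemma continuous_on_vec_components:
  fixes f :: "'a::topological_space \<Rightarrow> complex^3"
  assumes "\<And>i. continuous_on S (\<lambda>x. f x $ i)"
  shows "continuous_on S f"
proof -
  have "continuous_on S (\<lambda>x. \<chi> i. f x $ i)" by (intro continuous_on_vec_lambda assms)
  then show ?thesis by simp
qed

lemma partial_cos_cos:
  fixes p q c :: real and s :: "real^2"
  shows "partial 1 (\<lambda>s. cos (p * s $ 1) * cos (q * s $ 2) / c) s = - p * sin (p * s $ 1) * cos (q * s $ 2) / c"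
    and "partial 2 (\<lambda>s. cos (p * s $ 1) * cos (q * s $ 2) / c) s = - q * cos (p * s $ 1) * sin (q * s $ 2) / c"
    and "partial 1 (\<lambda>s. sin (p * s $ 1) * sin (q * s $ 2) / c) s = p * cos (p * s $ 1) * sin (q * s $ 2) / c"
    and "partial 2 (\<lambda>s. sin (p * s $ 1) * sin (q * s $ 2) / c) s = q * sin (p * s $ 1) * cos (q * s $ 2) / c"
proof -
  have d: "(s + t *\<^sub>R axis 1 1) $ 1 = s $ 1 + t" "(s + t *\<^sub>R axis 1 1) $ 2 = s $ 2"
    "(s + t *\<^sub>R axis 2 1) $ 1 = s $ 1" "(s + t *\<^sub>R axis 2 1) $ 2 = s $ 2 + t" for t
    by (simp_all add: axis_def)
  have c: "((\<lambda>t. cos (p * (y + t))) has_real_derivative - p * sin (p * y)) (at 0)" for p y :: real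
    by (auto intro!: derivative_eq_intros)
  have s: "((\<lambda>t. sin (p * (y + t))) has_real_derivative p * cos (p * y)) (at 0)" for p y :: real
    by (auto intro!: derivative_eq_intros)
  note [simp] = has_real_derivative_iff_has_vector_derivative[symmetric]
  show "partial 1 (\<lambda>s. cos (p * s $ 1) * cos (q * s $ 2) / c) s = - p * sin (p * s $ 1) * cos (q * s $ 2) / c"
    unfolding partial_def d using DERIV_cdivide[OF DERIV_cmult_right[OF c[of p "s $ 1"], of "cos (q * s $ 2)"], of c]
    by (intro vector_derivative_at) simp
  show "partial 2 (\<lambda>s. cos (p * s $ 1) * cos (q * s $ 2) / c) s = - q * cos (p * s $ 1) * sin (q * s $ 2) / c"
    unfolding partial_def d using DERIV_cdivide[OF DERIV_cmult[OF c[of q "s $ 2"], of "cos (p * s $ 1)"], of c]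
    by (intro vector_derivative_at) (simp add: mult_ac)
  show "partial 1 (\<lambda>s. sin (p * s $ 1) * sin (q * s $ 2) / c) s = p * cos (p * s $ 1) * sin (q * s $ 2) / c"
    unfolding partial_def d using DERIV_cdivide[OF DERIV_cmult_right[OF s[of p "s $ 1"], of "sin (q * s $ 2)"], of c]
    by (intro vector_derivative_at) simp
  show "partial 2 (\<lambda>s. sin (p * s $ 1) * sin (q * s $ 2) / c) s = q * sin (p * s $ 1) * cos (q * s $ 2) / c"
    unfolding partial_def d using DERIV_cdivide[OF DERIV_cmult[OF s[of q "s $ 2"], of "sin (p * s $ 1)"], of c]
    by (intro vector_derivative_at) (simp add: mult_ac)
qed

lemma proj12_nth: "proj12 x $ 1 = x $ 1" "proj12 x $ 2 = x $ 2"
  by (simp_all add: proj12_def)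

lemma reflect_nth: "reflect x $ 1 = x $ 1" "reflect x $ 2 = x $ 2" "reflect x $ 3 = - x $ 3"
  by (simp_all add: reflect_def)

text \<open>This and the next definition give the reciprocals of the normalising constants of the
  u_m and v_n.\<close>

definition cos_norm :: "real \<Rightarrow> real \<Rightarrow> nat \<times> nat \<Rightarrow> real" where
  "cos_norm a b p = L2norm (cross_section a b) (cos_cos a b p)"

definition sin_norm :: "real \<Rightarrow> real \<Rightarrow> nat \<times> nat \<Rightarrow> real" where
  "sin_norm a b p = L2norm (cross_section a b) (sin_sin a b p)"

lemma cross_section_box: "cross_section a b = {s. \<forall>j. s $ j \<in> {0<..<(if j = 1 then a else b)}}"
  by (auto simp: cross_section_def forall_2)

lemma cos_norm_sq:
  assumes ab: "0 < a" "0 < b"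
  shows "complex_of_real ((cos_norm a b p)\<^sup>2) = cos_overlap a (fst p) (fst p) * cos_overlap b (snd p) (snd p)"
    and "complex_of_real ((sin_norm a b p)\<^sup>2) = sin_overlap a (fst p) (fst p) * sin_overlap b (snd p) (snd p)"
proof -
  define hi :: "2 \<Rightarrow> real" where "hi j = (if j = 1 then a else b)" for j
  define n :: "2 \<Rightarrow> nat" where "n j = (if j = 1 then fst p else snd p)" for j
  have hi: "0 < hi j" for j using ab by (simp add: hi_def)
  have sq: "complex_of_real ((L2norm (cross_section a b) f)\<^sup>2) = (LINT s|lebesgue_on (cross_section a b). of_real ((f s)\<^sup>2))"
    for f :: "real^2 \<Rightarrow> real"
  proof -
    have "(L2norm (cross_section a b) f)\<^sup>2 = (LINT s|lebesgue_on (cross_section a b). (norm (f s))\<^sup>2)"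
      unfolding L2norm_def by (intro real_sqrt_pow2 Bochner_Integration.integral_nonneg) auto
    then show ?thesis by (simp add: integral_of_real del: of_real_power)
  qed
  have cc: "(LINT t|lebesgue_on {0<..<hi j}. of_real ((cos (n j * pi / hi j * t))\<^sup>2)) = cos_overlap (hi j) (n j) (n j)"
    "(LINT t|lebesgue_on {0<..<hi j}. of_real ((sin (n j * pi / hi j * t))\<^sup>2)) = sin_overlap (hi j) (n j) (n j)" for j
    using integral_cos_cos[OF hi[of j], of "n j" "n j"] by (simp_all add: power2_eq_square)
  have ct: "continuous_on UNIV (\<lambda>t. complex_of_real ((cos (n j * pi / hi j * t))\<^sup>2))"
    "continuous_on UNIV (\<lambda>t. complex_of_real ((sin (n j * pi / hi j * t))\<^sup>2))" for j
    using hi[of j] by (auto intro!: continuous_intros)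
  have S: "cross_section a b = {s. \<forall>j. s $ j \<in> {(0::real)<..<hi j}}" by (simp add: cross_section_box hi_def)
  have "complex_of_real ((cos_norm a b p)\<^sup>2) = (LINT s|lebesgue_on (cross_section a b). (\<Prod>j\<in>UNIV. complex_of_real ((cos (n j * pi / hi j * s $ j))\<^sup>2)))"
    unfolding cos_norm_def sq by (simp add: cos_cos_def prod_2 n_def hi_def power_mult_distrib UNIV_2)
  also have "\<dots> = (\<Prod>j\<in>UNIV. cos_overlap (hi j) (n j) (n j))"
    unfolding cc[symmetric] by (rule integral_box_prod[OF ct(1) S])
  finally show "complex_of_real ((cos_norm a b p)\<^sup>2) = cos_overlap a (fst p) (fst p) * cos_overlap b (snd p) (snd p)"
    by (simp add: UNIV_2 n_def hi_def)
  have "complex_of_real ((sin_norm a b p)\<^sup>2) = (LINT s|lebesgue_on (cross_section a b). (\<Prod>j\<in>UNIV. complex_of_real ((sin (n j * pi / hi j * s $ j))\<^sup>2)))"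
    unfolding sin_norm_def sq by (simp add: sin_sin_def prod_2 n_def hi_def power_mult_distrib UNIV_2)
  also have "\<dots> = (\<Prod>j\<in>UNIV. sin_overlap (hi j) (n j) (n j))"
    unfolding cc[symmetric] by (rule integral_box_prod[OF ct(2) S])
  finally show "complex_of_real ((sin_norm a b p)\<^sup>2) = sin_overlap a (fst p) (fst p) * sin_overlap b (snd p) (snd p)"
    by (simp add: UNIV_2 n_def hi_def)
qed

lemma cos_norm_lower:
  assumes ab: "0 < a" "0 < b"
  shows "(cos_norm a b p)\<^sup>2 \<ge> a * b / 4" "cos_norm a b p > 0"
    "fst p \<noteq> 0 \<Longrightarrow> snd p \<noteq> 0 \<Longrightarrow> (sin_norm a b p)\<^sup>2 = a * b / 4"
    "fst p \<noteq> 0 \<Longrightarrow> snd p \<noteq> 0 \<Longrightarrow> sin_norm a b p > 0"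
proof -
  define x where "x = (if fst p = 0 then a else a / 2)"
  define y where "y = (if snd p = 0 then b else b / 2)"
  have "complex_of_real ((cos_norm a b p)\<^sup>2) = complex_of_real (x * y)"
    unfolding cos_norm_sq(1)[OF ab] by (auto simp: cos_overlap_def x_def y_def)
  then have c: "(cos_norm a b p)\<^sup>2 = x * y" by (simp only: of_real_eq_iff)
  have "a / 2 * (b / 2) \<le> x * y" using ab by (intro mult_mono) (auto simp: x_def y_def)
  then show 1: "(cos_norm a b p)\<^sup>2 \<ge> a * b / 4" unfolding c by simp
  have nn: "cos_norm a b p \<ge> 0" "sin_norm a b p \<ge> 0"
    unfolding cos_norm_def sin_norm_def L2norm_def by (simp_all add: Bochner_Integration.integral_nonneg)
  have ab4: "a * b / 4 > 0" using ab by simp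
  then have "(cos_norm a b p)\<^sup>2 \<noteq> 0" using 1 by linarith
  then show "cos_norm a b p > 0" using nn(1) by (simp add: less_le)
  assume *: "fst p \<noteq> 0" "snd p \<noteq> 0"
  have "complex_of_real ((sin_norm a b p)\<^sup>2) = complex_of_real (a * b / 4)"
    unfolding cos_norm_sq(2)[OF ab] using * by (simp add: sin_overlap_def)
  then show 2: "(sin_norm a b p)\<^sup>2 = a * b / 4" by (simp only: of_real_eq_iff)
  then have "sin_norm a b p \<noteq> 0" using ab4 by auto
  then show "sin_norm a b p > 0" using nn(2) by (simp add: less_le)
qed

text \<open>The constant in front of the profile in component i of the M mode with index pair p.
  With it a component of a mode becomes a constant times a separated function.\<close>

definition TE_coeff :: "real \<Rightarrow> real \<Rightarrow> nat \<times> nat \<Rightarrow> 3 \<Rightarrow> complex" where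
  "TE_coeff a b p i = (if i = 1 then - of_real (real (snd p) * pi / b / cos_norm a b p)
    else if i = 2 then of_real (real (fst p) * pi / a / cos_norm a b p) else 0)"

text \<open>The same for P + Q, with g the axial constant. Under reflection P - Q takes the place of
  P + Q, and \<open>PQ_mode_nth\<close> shows that this only changes the sign of component
  3.\<close>

definition TM_coeff :: "real \<Rightarrow> real \<Rightarrow> real \<Rightarrow> complex \<Rightarrow> nat \<times> nat \<Rightarrow> 3 \<Rightarrow> complex" where
  "TM_coeff a b k g p i = (if i = 1 then \<i> * g * of_real (real (fst p) * pi / a / (k * sin_norm a b p))
    else if i = 2 then \<i> * g * of_real (real (snd p) * pi / b / (k * sin_norm a b p))
    else of_real ((eigen_rt a b p)\<^sup>2 / (k * sin_norm a b p)))"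

lemma M_mode_nth:
  "M_mode a b k te m x $ i = TE_coeff a b (te m) i
     * sep (profile_at a b i (te m) (\<lambda>t. exp (\<i> * h_const a b k te m * of_real t))) x"
  "M_mode a b k te m (reflect x) $ i = TE_coeff a b (te m) i
     * sep (profile_at a b i (te m) (\<lambda>t. exp (- \<i> * h_const a b k te m * of_real t))) x"
proof -
  have "u_mode a b te m = (\<lambda>s. cos (real (fst (te m)) * pi / a * s $ 1) * cos (real (snd (te m)) * pi / b * s $ 2) / cos_norm a b (te m))"
    by (simp add: fun_eq_iff u_mode_def cos_cos_def cos_norm_def)
  note p = partial_cos_cos(1,2)[of "real (fst (te m)) * pi / a" "real (snd (te m)) * pi / b" "cos_norm a b (te m)", folded this]
  have *: "M_mode a b k te m x $ i = TE_coeff a b (te m) i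
     * sep (profile_at a b i (te m) (\<lambda>t. exp (\<i> * h_const a b k te m * of_real t))) x" for x
    using exhaust_3[of i]
    by (auto simp: M_mode_def TE_coeff_def p proj12_nth sep_3 trig_profile_def)
  show "M_mode a b k te m x $ i = TE_coeff a b (te m) i
     * sep (profile_at a b i (te m) (\<lambda>t. exp (\<i> * h_const a b k te m * of_real t))) x" by (rule *)
  show "M_mode a b k te m (reflect x) $ i = TE_coeff a b (te m) i
     * sep (profile_at a b i (te m) (\<lambda>t. exp (- \<i> * h_const a b k te m * of_real t))) x"
    unfolding * by (simp add: sep_3 trig_profile_def three_distinct reflect_nth)
qed

lemma PQ_mode_nth:
  "(P_mode a b k tm n x + Q_mode a b k tm n x) $ i = TM_coeff a b k (g_const a b k tm n) (tm n) i
     * sep (profile_at a b i (tm n) (\<lambda>t. exp (\<i> * g_const a b k tm n * of_real t))) x"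
  "(P_mode a b k tm n (reflect x) - Q_mode a b k tm n (reflect x)) $ i =
     (if i = 3 then - 1 else 1) * TM_coeff a b k (g_const a b k tm n) (tm n) i
     * sep (profile_at a b i (tm n) (\<lambda>t. exp (- \<i> * g_const a b k tm n * of_real t))) x"
proof -
  have v: "v_mode a b tm n = (\<lambda>s. sin (real (fst (tm n)) * pi / a * s $ 1) * sin (real (snd (tm n)) * pi / b * s $ 2) / sin_norm a b (tm n))"
    by (simp add: fun_eq_iff v_mode_def sin_sin_def sin_norm_def)
  note p = partial_cos_cos(3,4)[of "real (fst (tm n)) * pi / a" "real (snd (tm n)) * pi / b" "sin_norm a b (tm n)", folded v]
  show "(P_mode a b k tm n x + Q_mode a b k tm n x) $ i = TM_coeff a b k (g_const a b k tm n) (tm n) i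
     * sep (profile_at a b i (tm n) (\<lambda>t. exp (\<i> * g_const a b k tm n * of_real t))) x"
    using exhaust_3[of i]
    by (auto simp: P_mode_def Q_mode_def TM_coeff_def p proj12_nth sep_3 trig_profile_def mu_def field_simps) (simp add: v proj12_nth mult_ac)
  show "(P_mode a b k tm n (reflect x) - Q_mode a b k tm n (reflect x)) $ i =
     (if i = 3 then - 1 else 1) * TM_coeff a b k (g_const a b k tm n) (tm n) i
     * sep (profile_at a b i (tm n) (\<lambda>t. exp (- \<i> * g_const a b k tm n * of_real t))) x"
    using exhaust_3[of i]
    by (auto simp: P_mode_def Q_mode_def TM_coeff_def p proj12_nth reflect_nth sep_3 trig_profile_def mu_def field_simps) (simp add: v proj12_nth reflect_nth mult_ac)
qed

section \<open>Estimates in L2 and partial sums of modes\<close>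

lemma L1_le_L2:
  fixes f :: "'a::euclidean_space \<Rightarrow> complex^3"
  assumes f: "f \<in> L2 S" and S: "S \<in> lmeasurable" and e: "L2norm S f \<le> e" "0 < e"
  shows "(LINT x|lebesgue_on S. norm (f x)) \<le> e * (measure lebesgue S + 1)"
proof -
  have sq: "(LINT x|lebesgue_on S. (norm (f x))\<^sup>2) \<le> e\<^sup>2"
  proof -
    have "(LINT x|lebesgue_on S. (norm (f x))\<^sup>2) = (L2norm S f)\<^sup>2"
      unfolding L2norm_def by (intro real_sqrt_pow2[symmetric] Bochner_Integration.integral_nonneg) auto
    also have "\<dots> \<le> e\<^sup>2" using e by (intro power_mono) (auto simp: L2norm_def)
    finally show ?thesis .
  qed
  have "(LINT x|lebesgue_on S. norm (f x)) \<le> (LINT x|lebesgue_on S. e + (1 / e) * (norm (f x))\<^sup>2)"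
  proof (rule integral_mono)
    show "integrable (lebesgue_on S) (\<lambda>x. norm (f x))" by (rule L2_integrable_norm[OF f S])
    show "integrable (lebesgue_on S) (\<lambda>x. e + (1 / e) * (norm (f x))\<^sup>2)"
      using integrable_const_lebesgue_on[OF S, of e] L2_integrable[OF f] by simp
    fix x
    have "t \<le> e + (1 / e) * t\<^sup>2" if "0 \<le> t" for t
    proof (cases "t \<le> e")
      case True
      have "0 \<le> (1 / e) * t\<^sup>2" using e(2) by simp
      with True show ?thesis by linarith
    next
      case False
      then have "t * e \<le> t * t" using that by (intro mult_left_mono) auto
      then have "t \<le> (1 / e) * t\<^sup>2" using e(2) by (simp add: field_simps power2_eq_square)
      then show ?thesis using e(2) by linarith
    qed
    then show "norm (f x) \<le> e + (1 / e) * (norm (f x))\<^sup>2" by simp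
  qed
  also have "\<dots> = e * measure lebesgue S + (1 / e) * (LINT x|lebesgue_on S. (norm (f x))\<^sup>2)"
    using integrable_const_lebesgue_on[OF S, of e] L2_integrable[OF f] S
    by (simp add: measure_restrict_space)
  also have "\<dots> \<le> e * measure lebesgue S + (1 / e) * e\<^sup>2"
    using sq e(2) by (intro add_left_mono mult_left_mono) auto
  finally show ?thesis using e(2) by (simp add: power2_eq_square algebra_simps)
qed

lemma norm_add_sq_le: "(norm (x + y))\<^sup>2 \<le> 2 * (norm x)\<^sup>2 + 2 * (norm y)\<^sup>2" for x y :: "'a::real_normed_vector"
proof -
  have "(norm (x + y))\<^sup>2 \<le> (norm x + norm y)\<^sup>2" by (intro power_mono norm_triangle_ineq) auto
  also have "\<dots> \<le> 2 * (norm x)\<^sup>2 + 2 * (norm y)\<^sup>2"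
    using zero_le_power2[of "norm x - norm y"] by (simp add: power2_eq_square algebra_simps)
  finally show ?thesis .
qed

lemma L2_add:
  assumes "f \<in> L2 S" "g \<in> L2 S"
  shows "(\<lambda>x. f x + g x) \<in> L2 S"
proof -
  have m: "(\<lambda>x. f x + g x) \<in> borel_measurable (lebesgue_on S)"
    using assms L2_measurable by (intro borel_measurable_add) auto
  have "integrable (lebesgue_on S) (\<lambda>x. (norm (f x + g x))\<^sup>2)"
  proof (rule Bochner_Integration.integrable_bound)
    show "integrable (lebesgue_on S) (\<lambda>x. 2 * (norm (f x))\<^sup>2 + 2 * (norm (g x))\<^sup>2)"
      by (intro Bochner_Integration.integrable_add integrable_mult_right L2_integrable assms)
    show "(\<lambda>x. (norm (f x + g x))\<^sup>2) \<in> borel_measurable (lebesgue_on S)" using m by measurable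
  qed (auto simp: norm_add_sq_le)
  then show ?thesis using m by (simp add: L2_def)
qed

lemma L2_const_mult:
  fixes f :: "'a::euclidean_space \<Rightarrow> complex^3"
  assumes "f \<in> L2 S"
  shows "(\<lambda>x. c *s f x) \<in> L2 S"
proof -
  have nm: "norm (c *s v) = norm c * norm v" for v :: "complex^3"
    by (simp add: norm_vec_def L2_set_def norm_mult power_mult_distrib real_sqrt_mult flip: sum_distrib_left)
  have m: "(\<lambda>x. c *s f x) \<in> borel_measurable (lebesgue_on S)"
  proof (rule measurable_compose[OF L2_measurable[OF assms]])
    show "(\<lambda>v :: complex^3. c *s v) \<in> borel_measurable borel"
      by (intro borel_measurable_continuous_onI continuous_on_vec_components) (auto intro!: continuous_intros)
  qed
  then show ?thesis
    using L2_integrable[OF assms] by (simp add: L2_def nm power_mult_distrib)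
qed

lemma L2_diff:
  fixes f g :: "'a::euclidean_space \<Rightarrow> complex^3"
  assumes "f \<in> L2 S" "g \<in> L2 S"
  shows "(\<lambda>x. f x - g x) \<in> L2 S"
  using L2_add[OF assms(1) L2_const_mult[OF assms(2), of "-1"]] by simp

lemma L2_bounded:
  fixes f :: "'a::euclidean_space \<Rightarrow> complex^3"
  assumes "f \<in> borel_measurable (lebesgue_on S)" "S \<in> lmeasurable" "\<And>x. x \<in> S \<Longrightarrow> norm (f x) \<le> C"
  shows "f \<in> L2 S"
proof -
  have "integrable (lebesgue_on S) (\<lambda>x. (norm (f x))\<^sup>2)"
  proof (rule Bochner_Integration.integrable_bound[OF integrable_const_lebesgue_on[OF assms(2), of "C\<^sup>2"]])
    show "(\<lambda>x. (norm (f x))\<^sup>2) \<in> borel_measurable (lebesgue_on S)" using assms(1) by measurable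
    show "AE x in lebesgue_on S. norm ((norm (f x))\<^sup>2) \<le> norm (C\<^sup>2)"
      using assms(3) by (intro AE_I2) (simp add: power_mono)
  qed
  then show ?thesis using assms(1) by (simp add: L2_def)
qed

lemma L2_continuous_section:
  fixes f :: "real^3 \<Rightarrow> complex^3"
  assumes "continuous_on UNIV f"
  shows "f \<in> L2 (section_between a b R' R)"
proof -
  have "bounded (f ` cbox (vector [0, 0, R']) (vector [a, b, R]))"
    by (intro compact_imp_bounded compact_continuous_image continuous_on_subset[OF assms] compact_cbox) auto
  then obtain C where C: "\<forall>y\<in>f ` cbox (vector [0, 0, R']) (vector [a, b, R]). norm y \<le> C"
    unfolding bounded_iff by blast
  show ?thesis
  proof (rule L2_bounded[OF continuous_measurable_lebesgue_on[OF assms] lmeasurable_section_between])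
    fix x assume "x \<in> section_between a b R' R"
    then have "x \<in> cbox (vector [0, 0, R']) (vector [a, b, R])"
      unfolding section_between_eq_box using box_subset_cbox by auto
    then show "norm (f x) \<le> C" using C by blast
  qed
qed

definition modal_sum :: "real \<Rightarrow> real \<Rightarrow> real \<Rightarrow> (nat \<Rightarrow> nat \<times> nat) \<Rightarrow> (nat \<Rightarrow> nat \<times> nat) \<Rightarrow> (nat \<Rightarrow> complex) \<Rightarrow> (nat \<Rightarrow> complex) \<Rightarrow> nat \<Rightarrow> real^3 \<Rightarrow> complex^3" where
  "modal_sum a b k te tm A B N x = (\<Sum>m=1..N. A m *s M_mode a b k te m (reflect x))
      + (\<Sum>n=1..N. B n *s (P_mode a b k tm n (reflect x) - Q_mode a b k tm n (reflect x)))"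

section \<open>Orthogonality of the modes in the TE and TM combinations\<close>

lemma overlap_diff: "p \<noteq> q \<Longrightarrow> profile_overlap a b i p q = 0"
  by (cases p; cases q) (auto simp: profile_overlap_def cos_overlap_def sin_overlap_def)

lemma eigen_rt_sq: "(eigen_rt a b p)\<^sup>2 = (real (fst p) * pi / a)\<^sup>2 + (real (snd p) * pi / b)\<^sup>2"
  by (simp add: eigen_rt_def)

text \<open>A mode of index p' is tested with profiles of index p. In the TE combination the P modes
  drop out, in the TM combination the M modes, and of the others only p' = p survives.\<close>

lemma overlap_TE:
  assumes ab: "0 < a" "0 < b"
  shows "- of_real (real (snd p) * pi / b) * (TE_coeff a b p' 1 * profile_overlap a b 1 p' p)
      + of_real (real (fst p) * pi / a) * (TE_coeff a b p' 2 * profile_overlap a b 2 p' p)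
    = (if p' = p then of_real ((eigen_rt a b p)\<^sup>2 * cos_norm a b p) else 0)"
    and "- of_real (real (snd p) * pi / b) * (TM_coeff a b k g p' 1 * profile_overlap a b 1 p' p)
      + of_real (real (fst p) * pi / a) * (TM_coeff a b k g p' 2 * profile_overlap a b 2 p' p) = 0"
    and "of_real (real (fst p) * pi / a) * (TE_coeff a b p' 1 * profile_overlap a b 1 p' p)
      + of_real (real (snd p) * pi / b) * (TE_coeff a b p' 2 * profile_overlap a b 2 p' p) = 0"
proof -
  \<comment> \<open>The sine and cosine overlaps of equal indices differ only at index 0, where the
    prefactor is 0. This covers modes with one vanishing index without a case split.\<close>
  have ss: "of_real (real n * pi / d) * sin_overlap d n n = of_real (real n * pi / d) * cos_overlap d n n" for n d
    by (simp add: sin_overlap_def cos_overlap_def)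
  define P where "P = complex_of_real (real (fst p) * pi / a)"
  define Q where "Q = complex_of_real (real (snd p) * pi / b)"
  define N where "N = complex_of_real (cos_norm a b p)"
  have N0: "N \<noteq> 0" using cos_norm_lower(2)[OF ab, of p] by (simp add: N_def)
  define ca where "ca = cos_overlap a (fst p) (fst p)"
  define cb where "cb = cos_overlap b (snd p) (snd p)"
  define sa where "sa = sin_overlap a (fst p) (fst p)"
  define sb where "sb = sin_overlap b (snd p) (snd p)"
  have PQ: "P * sa = P * ca" "Q * sb = Q * cb"
    unfolding P_def Q_def sa_def sb_def ca_def cb_def by (rule ss)+
  have N2: "N * N = ca * cb"
    using cos_norm_sq(1)[OF ab, of p] by (simp add: N_def ca_def cb_def power2_eq_square)
  have o: "profile_overlap a b 1 p p = ca * sb" "profile_overlap a b 2 p p = sa * cb"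
    by (simp_all add: profile_overlap_def ca_def cb_def sa_def sb_def)
  have te: "TE_coeff a b p 1 = - Q / N" "TE_coeff a b p 2 = P / N"
    by (simp_all add: TE_coeff_def P_def Q_def N_def)
  have tm: "TM_coeff a b k g p 1 = P * (\<i> * g / of_real (k * sin_norm a b p))"
     "TM_coeff a b k g p 2 = Q * (\<i> * g / of_real (k * sin_norm a b p))"
    by (simp_all add: TM_coeff_def P_def Q_def)
  have lam: "of_real ((eigen_rt a b p)\<^sup>2) = P\<^sup>2 + Q\<^sup>2"
    by (simp add: eigen_rt_sq P_def Q_def)
  show "- of_real (real (snd p) * pi / b) * (TE_coeff a b p' 1 * profile_overlap a b 1 p' p)
      + of_real (real (fst p) * pi / a) * (TE_coeff a b p' 2 * profile_overlap a b 2 p' p)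
    = (if p' = p then of_real ((eigen_rt a b p)\<^sup>2 * cos_norm a b p) else 0)"
  proof (cases "p' = p")
    case True
    have "- Q * (- Q / N * (ca * sb)) + P * (P / N * (sa * cb)) = (Q * (Q * sb) * ca + P * (P * sa) * cb) / N"
      by (simp add: algebra_simps add_divide_distrib)
    also have "\<dots> = (P\<^sup>2 + Q\<^sup>2) * (ca * cb) / N"
      unfolding PQ by (simp add: algebra_simps power2_eq_square)
    also have "\<dots> = (P\<^sup>2 + Q\<^sup>2) * N" using N0 unfolding N2[symmetric] by simp
    finally show ?thesis
      unfolding True o te of_real_mult lam P_def[symmetric] Q_def[symmetric] N_def[symmetric] by simp
  qed (simp add: overlap_diff)
  show "- of_real (real (snd p) * pi / b) * (TM_coeff a b k g p' 1 * profile_overlap a b 1 p' p)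
      + of_real (real (fst p) * pi / a) * (TM_coeff a b k g p' 2 * profile_overlap a b 2 p' p) = 0"
  proof (cases "p' = p")
    case True
    have "- Q * (P * z * (ca * sb)) + P * (Q * z * (sa * cb)) = z * (- (P * ca) * (Q * sb) + (P * sa) * (Q * cb))" for z
      by (simp add: algebra_simps)
    also have "\<dots> z = 0" for z unfolding PQ by simp
    finally show ?thesis
      unfolding True o tm P_def[symmetric] Q_def[symmetric] .
  qed (simp add: overlap_diff)
  show "of_real (real (fst p) * pi / a) * (TE_coeff a b p' 1 * profile_overlap a b 1 p' p)
      + of_real (real (snd p) * pi / b) * (TE_coeff a b p' 2 * profile_overlap a b 2 p' p) = 0"
  proof (cases "p' = p")
    case True
    have "P * (- Q / N * (ca * sb)) + Q * (P / N * (sa * cb)) = (- (P * ca) * (Q * sb) + (P * sa) * (Q * cb)) / N"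
      by (simp add: algebra_simps add_divide_distrib diff_divide_distrib)
    also have "\<dots> = 0" unfolding PQ by simp
    finally show ?thesis
      unfolding True o te P_def[symmetric] Q_def[symmetric] .
  qed (simp add: overlap_diff)
qed

text \<open>Both indices of a TM mode are nonzero, so all overlaps equal a/2 or b/2, their product
  is the squared norm of the sine product, and one power of the norm cancels.\<close>

lemma overlap_TM:
  assumes ab: "0 < a" "0 < b" and p: "fst p \<noteq> 0" "snd p \<noteq> 0" and k: "0 < k"
  shows "of_real (real (fst p) * pi / a) * (TM_coeff a b k g p' 1 * profile_overlap a b 1 p' p)
      + of_real (real (snd p) * pi / b) * (TM_coeff a b k g p' 2 * profile_overlap a b 2 p' p)
    = (if p' = p then \<i> * g * of_real ((eigen_rt a b p)\<^sup>2 * sin_norm a b p / k) else 0)"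
    and "TM_coeff a b k g p' 3 * profile_overlap a b 3 p' p
    = (if p' = p then of_real ((eigen_rt a b p)\<^sup>2 * sin_norm a b p / k) else 0)"
proof -
  define P where "P = complex_of_real (real (fst p) * pi / a)"
  define Q where "Q = complex_of_real (real (snd p) * pi / b)"
  define N where "N = complex_of_real (sin_norm a b p)"
  have N0: "N \<noteq> 0" using cos_norm_lower(4)[OF ab p] by (simp add: N_def)
  have k0: "of_real k \<noteq> (0::complex)" using k by simp
  have s: "sin_overlap a (fst p) (fst p) = of_real (a / 2)" "sin_overlap b (snd p) (snd p) = of_real (b / 2)"
    "cos_overlap a (fst p) (fst p) = of_real (a / 2)" "cos_overlap b (snd p) (snd p) = of_real (b / 2)"
    using p by (simp_all add: sin_overlap_def cos_overlap_def)
  have N2: "N * N = of_real (a / 2) * of_real (b / 2)"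
    using cos_norm_sq(2)[OF ab, of p] unfolding s N_def power2_eq_square of_real_mult .
  have o: "profile_overlap a b i p p = N * N" for i
    unfolding profile_overlap_def s N2 by simp
  have tm: "TM_coeff a b k g p 1 = P * (\<i> * g / (of_real k * N))"
     "TM_coeff a b k g p 2 = Q * (\<i> * g / (of_real k * N))" "TM_coeff a b k g p 3 = (P\<^sup>2 + Q\<^sup>2) / (of_real k * N)"
    by (simp_all add: TM_coeff_def P_def Q_def N_def eigen_rt_sq)
  have lam: "of_real ((eigen_rt a b p)\<^sup>2) = P\<^sup>2 + Q\<^sup>2"
    by (simp add: eigen_rt_sq P_def Q_def)
  show "of_real (real (fst p) * pi / a) * (TM_coeff a b k g p' 1 * profile_overlap a b 1 p' p)
      + of_real (real (snd p) * pi / b) * (TM_coeff a b k g p' 2 * profile_overlap a b 2 p' p)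
    = (if p' = p then \<i> * g * of_real ((eigen_rt a b p)\<^sup>2 * sin_norm a b p / k) else 0)"
  proof (cases "p' = p")
    case True
    show ?thesis
      unfolding True o tm P_def[symmetric] Q_def[symmetric]
      unfolding of_real_mult of_real_divide lam N_def[symmetric]
      using N0 k0 by (simp add: field_simps power2_eq_square)
  qed (simp add: overlap_diff)
  show "TM_coeff a b k g p' 3 * profile_overlap a b 3 p' p
    = (if p' = p then of_real ((eigen_rt a b p)\<^sup>2 * sin_norm a b p / k) else 0)"
  proof (cases "p' = p")
    case True
    show ?thesis
      unfolding True o tm of_real_mult of_real_divide lam N_def[symmetric]
      using N0 k0 by (simp add: field_simps power2_eq_square)
  qed (simp add: overlap_diff)
qed

lemma integral_two_sums:
  fixes f g :: "'i \<Rightarrow> 'a \<Rightarrow> complex"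
  assumes "\<And>m. integrable M (f m)" "\<And>n. integrable M (g n)"
  shows "(LINT x|M. (\<Sum>m\<in>I. c m * f m x) + (\<Sum>n\<in>I. d n * g n x))
    = (\<Sum>m\<in>I. c m * (LINT x|M. f m x)) + (\<Sum>n\<in>I. d n * (LINT x|M. g n x))"
  using assms by simp

lemma eventually_const_LIMSEQ:
  fixes c :: complex
  assumes "\<forall>\<^sub>F N in sequentially. f N = c" "f \<longlonglongrightarrow> L"
  shows "L = c"
  using LIMSEQ_unique[OF assms(2) tendsto_eventually[OF assms(1)]] .

lemma continuous_on_profile:
  assumes "continuous_on UNIV f"
  shows "continuous_on UNIV (sep (trig_profile i p q f))"
proof -
  have "continuous_on UNIV (\<lambda>x::real^3. trig_profile i p q f j (x $ j))" for j
  proof -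
    have "continuous_on UNIV (\<lambda>x::real^3. x $ j)" by (intro continuous_intros)
    from continuous_on_compose2[OF assms this] show ?thesis
      by (auto simp: trig_profile_def intro!: continuous_intros)
  qed
  then show ?thesis unfolding sep_3[abs_def] by (intro continuous_on_mult)
qed

lemma continuous_on_modes:
  "continuous_on UNIV (M_mode a b k te m)"
  "continuous_on UNIV (\<lambda>x. M_mode a b k te m (reflect x))"
  "continuous_on UNIV (\<lambda>x. P_mode a b k tm n x + Q_mode a b k tm n x)"
  "continuous_on UNIV (\<lambda>x. P_mode a b k tm n (reflect x) - Q_mode a b k tm n (reflect x))"
proof -
  have c: "continuous_on UNIV (\<lambda>x. z * sep (profile_at a b i p (\<lambda>t. exp (w * of_real t))) x)" for z i p w
    by (intro continuous_on_mult_left continuous_on_profile continuous_intros)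
  show "continuous_on UNIV (M_mode a b k te m)"
    by (rule continuous_on_vec_components) (simp only: M_mode_nth(1) c)
  show "continuous_on UNIV (\<lambda>x. M_mode a b k te m (reflect x))"
    by (rule continuous_on_vec_components) (simp only: M_mode_nth(2) c)
  show "continuous_on UNIV (\<lambda>x. P_mode a b k tm n x + Q_mode a b k tm n x)"
    by (rule continuous_on_vec_components) (simp only: PQ_mode_nth(1) c)
  show "continuous_on UNIV (\<lambda>x. P_mode a b k tm n (reflect x) - Q_mode a b k tm n (reflect x))"
    by (rule continuous_on_vec_components) (simp only: PQ_mode_nth(2) c)
qed

lemma vector_smult_sum: "(\<Sum>m\<in>I. c m *s v m) $ i = (\<Sum>m\<in>I. c m * v m $ i)" for v :: "_ \<Rightarrow> complex^3"
  by (simp add: sum_component)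

lemma continuous_on_modal_sum: "continuous_on UNIV (modal_sum a b k te tm A B N)"
  unfolding modal_sum_def
  by (rule continuous_on_vec_components)
     (simp only: vector_add_component vector_smult_sum,
      intro continuous_on_add continuous_on_sum continuous_on_mult_left continuous_on_component continuous_on_modes)

section \<open>Reading off the amplitudes of a radiating field\<close>

context
  fixes a b k R' R :: real and te tm :: "nat \<Rightarrow> nat \<times> nat" and E :: "real^3 \<Rightarrow> complex^3" and A B :: "nat \<Rightarrow> complex"
    and \<zeta> :: "real \<Rightarrow> complex" and l u :: real
  assumes ab: "0 < a" "0 < b" and k: "0 < k" and enum: "mode_enumeration a b te tm" and R: "R \<le> 0"
    and E: "E \<in> L2 (section_between a b R' R)"
    and lim: "(\<lambda>N. L2norm (section_between a b R' R) (\<lambda>x. E x - modal_sum a b k te tm A B N x)) \<longlonglongrightarrow> 0"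
    and \<zeta>: "smooth1 \<zeta>" "\<And>t. t \<notin> {l..u} \<Longrightarrow> \<zeta> t = 0" "R' < l" "u < R"
begin

abbreviation (input) sec where "sec \<equiv> section_between a b R' R"

abbreviation (input) MI where
  "MI p v i \<equiv> mode_int a b (real (fst p) * pi / a) (real (snd p) * pi / b) v i \<zeta>"

lemma mode_int_section: "MI p v i = (LINT x|lebesgue_on sec. v x $ i * sep (profile_at a b i p \<zeta>) x)"
  unfolding mode_int_def wint_def
proof (rule integral_lebesgue_on_subset)
  fix x assume "x \<in> waveguide a b - sec"
  then have "x $ 3 \<notin> {l..u}" using \<zeta>(3,4) by (auto simp: waveguide_eq section_between_eq)
  then have "sep (profile_at a b i p \<zeta>) x = 0"
    by (intro sep_zero[of _ 3]) (simp add: trig_profile_simps(1) \<zeta>(2))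
  then show "v x $ i * sep (profile_at a b i p \<zeta>) x = 0" by simp
qed (auto simp: section_subset_waveguide R)

lemma profile_bounded: obtains C where "\<And>x. x \<in> sec \<Longrightarrow> norm (sep (profile_at a b i p \<zeta>) x) \<le> C" "C > 0"
proof -
  obtain C where C: "\<And>x. x \<in> sec \<Longrightarrow> norm (sep (profile_at a b i p \<zeta>) x) \<le> C"
    using sep_bounded_section[of "profile_at a b i p \<zeta>" a b R' R] smooth1_trig_profile[OF \<zeta>(1)] by auto
  show thesis by (rule that[of "max C 1"]) (use C in \<open>auto simp: le_max_iff_disj\<close>)
qed

text \<open>Pairing with a fixed bounded profile is continuous for the L2 norm on the slab, in which
  the modal series converges by the radiation condition.\<close>

lemma mode_int_limit: "(\<lambda>N. MI p (modal_sum a b k te tm A B N) i) \<longlonglongrightarrow> MI p E i"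
proof -
  obtain C where C: "\<And>x. x \<in> sec \<Longrightarrow> norm (sep (profile_at a b i p \<zeta>) x) \<le> C" "C > 0"
    by (rule profile_bounded[where p = p and i = i]) blast
  let ?d = "\<lambda>N x. E x - modal_sum a b k te tm A B N x"
  have mL2: "modal_sum a b k te tm A B N \<in> L2 sec" for N
    by (rule L2_continuous_section[OF continuous_on_modal_sum])
  have dL2: "?d N \<in> L2 sec" for N by (rule L2_diff[OF E mL2])
  have pm: "sep (profile_at a b i p \<zeta>) \<in> borel_measurable (lebesgue_on sec)"
    by (intro continuous_measurable_lebesgue_on continuous_on_profile smooth1_continuous \<zeta>)
  have int: "integrable (lebesgue_on sec) (\<lambda>x. v x $ i * sep (profile_at a b i p \<zeta>) x)" if "v \<in> L2 sec" for v
    by (rule L2_integrable_mult[OF that lmeasurable_section_between pm C(1)])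
  have bd: "norm (MI p E i - MI p (modal_sum a b k te tm A B N) i) \<le> C * (LINT x|lebesgue_on sec. norm (?d N x))" for N
  proof -
    have "MI p E i - MI p (modal_sum a b k te tm A B N) i = (LINT x|lebesgue_on sec. ?d N x $ i * sep (profile_at a b i p \<zeta>) x)"
      unfolding mode_int_section Bochner_Integration.integral_diff[OF int[OF E] int[OF mL2], symmetric]
      by (simp only: vector_minus_component left_diff_distrib)
    then have "norm (MI p E i - MI p (modal_sum a b k te tm A B N) i)
        \<le> (LINT x|lebesgue_on sec. norm (?d N x $ i * sep (profile_at a b i p \<zeta>) x))"
      by (simp only: integral_norm_bound)
    also have "\<dots> \<le> (LINT x|lebesgue_on sec. C * norm (?d N x))"
    proof (rule integral_mono)
      show "integrable (lebesgue_on sec) (\<lambda>x. norm (?d N x $ i * sep (profile_at a b i p \<zeta>) x))"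
        by (rule integrable_norm[OF int[OF dL2]])
      show "integrable (lebesgue_on sec) (\<lambda>x. C * norm (?d N x))"
        using L2_integrable_norm[OF dL2 lmeasurable_section_between] by simp
      fix x assume "x \<in> space (lebesgue_on sec)"
      then have "norm (?d N x $ i) * norm (sep (profile_at a b i p \<zeta>) x) \<le> norm (?d N x) * C"
        by (intro mult_mono C) (auto simp: Finite_Cartesian_Product.norm_nth_le simp del: vector_minus_component)
      then show "norm (?d N x $ i * sep (profile_at a b i p \<zeta>) x) \<le> C * norm (?d N x)"
        by (simp add: norm_mult mult.commute)
    qed
    finally show ?thesis by simp
  qed
  let ?V = "measure lebesgue sec + 1"
  have V: "?V > 0" by (simp add: add_nonneg_pos)
  have "\<exists>N0. \<forall>N\<ge>N0. norm (MI p (modal_sum a b k te tm A B N) i - MI p E i) < e" if "e > 0" for e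
  proof -
    define d where "d = e / (2 * C * ?V)"
    have d: "d > 0" using that C(2) V by (simp add: d_def)
    obtain N0 where N0: "\<And>N. N \<ge> N0 \<Longrightarrow> L2norm sec (?d N) < d"
      using LIMSEQ_D[OF lim d] by (auto simp: abs_less_iff)
    show ?thesis
    proof (intro exI allI impI)
      fix N assume "N \<ge> N0"
      then have "(LINT x|lebesgue_on sec. norm (?d N x)) \<le> d * ?V"
        by (rule L1_le_L2[OF dL2 lmeasurable_section_between less_imp_le[OF N0] d])
      then have "norm (MI p E i - MI p (modal_sum a b k te tm A B N) i) \<le> C * (d * ?V)"
        using bd[of N] C(2) by (meson mult_left_mono order_trans less_imp_le)
      also have "\<dots> = e / 2" using C(2) V by (simp add: d_def)
      also have "\<dots> < e" using that by simp
      finally show "norm (MI p (modal_sum a b k te tm A B N) i - MI p E i) < e"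
        by (simp add: norm_minus_commute)
    qed
  qed
  then show ?thesis by (rule LIMSEQ_I)
qed

lemma mode_int_modal_sum:
  "MI p (modal_sum a b k te tm A B N) i =
    (\<Sum>m=1..N. A m * exp_moment (h_const a b k te m) \<zeta> * (TE_coeff a b (te m) i * profile_overlap a b i (te m) p))
    + (\<Sum>n=1..N. B n * exp_moment (g_const a b k tm n) \<zeta> *
        ((if i = 3 then -1 else 1) * (TM_coeff a b k (g_const a b k tm n) (tm n) i * profile_overlap a b i (tm n) p)))"
proof -
  let ?e = "\<lambda>\<kappa> t. exp (- \<i> * \<kappa> * complex_of_real t)"
  let ?I = "\<lambda>q \<kappa> x. sep (profile_at a b i q (?e \<kappa>)) x * sep (profile_at a b i p \<zeta>) x"
  have ec: "continuous_on UNIV (?e \<kappa>)" for \<kappa> by (intro continuous_intros)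
  have zc: "continuous_on UNIV \<zeta>" by (rule smooth1_continuous[OF \<zeta>(1)])
  have I: "(LINT x|lebesgue_on sec. ?I q \<kappa> x) = profile_overlap a b i q p * exp_moment \<kappa> \<zeta>" for q \<kappa>
  proof -
    have "(LINT t|lebesgue_on {R'<..<R}. ?e \<kappa> t * \<zeta> t) = exp_moment \<kappa> \<zeta>"
      by (rule integral_exp_profile[OF zc \<zeta>(2,3,4)])
    then show ?thesis unfolding integral_profiles[OF ab ec zc] by (simp only:)
  qed
  have int: "integrable (lebesgue_on sec) (\<lambda>x. ?I q \<kappa> x)" for q \<kappa>
  proof -
    have "(\<lambda>x. (\<chi> j. ?I q \<kappa> x) :: complex^3) \<in> L2 sec"
      by (intro L2_continuous_section continuous_on_vec_lambda continuous_on_mult continuous_on_profile ec zc)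
    from L2_integrable_mult[OF this lmeasurable_section_between, of "\<lambda>_. 1" 1 1] show ?thesis by simp
  qed
  have "modal_sum a b k te tm A B N x $ i * sep (profile_at a b i p \<zeta>) x =
      (\<Sum>m=1..N. (A m * TE_coeff a b (te m) i) * ?I (te m) (h_const a b k te m) x)
      + (\<Sum>n=1..N. (B n * ((if i = 3 then -1 else 1) * TM_coeff a b k (g_const a b k tm n) (tm n) i)) * ?I (tm n) (g_const a b k tm n) x)" for x
    unfolding modal_sum_def vector_add_component vector_smult_sum M_mode_nth(2) PQ_mode_nth(2)
    by (simp add: sum_distrib_right distrib_right mult.assoc)
  then have "MI p (modal_sum a b k te tm A B N) i =
      (\<Sum>m=1..N. (A m * TE_coeff a b (te m) i) * (LINT x|lebesgue_on sec. ?I (te m) (h_const a b k te m) x))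
      + (\<Sum>n=1..N. (B n * ((if i = 3 then -1 else 1) * TM_coeff a b k (g_const a b k tm n) (tm n) i)) * (LINT x|lebesgue_on sec. ?I (tm n) (g_const a b k tm n) x))"
    unfolding mode_int_section by (simp only: integral_two_sums[OF int int])
  then show ?thesis unfolding I by (simp add: mult_ac)
qed

lemma te_inj: "te m = te j \<longleftrightarrow> m = j"
  using enum unfolding mode_enumeration_def bij_def inj_def by blast

lemma tm_inj: "n \<ge> 1 \<Longrightarrow> j \<ge> 1 \<Longrightarrow> tm n = tm j \<longleftrightarrow> n = j"
  using enum unfolding mode_enumeration_def bij_betw_def inj_on_def by auto

lemma tm_pos: "n \<ge> 1 \<Longrightarrow> fst (tm n) \<noteq> 0 \<and> snd (tm n) \<noteq> 0"
proof -
  assume "n \<ge> 1"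
  then have "tm n \<in> {1..} \<times> {1..}" using enum unfolding mode_enumeration_def bij_betw_def by auto
  then show ?thesis by auto
qed

text \<open>Along the partial sums the pairing is constant from N = j on, by orthogonality, so its
  limit is that constant.\<close>

lemma modal_TE:
  assumes j: "j \<ge> 1"
  shows "- of_real (real (snd (te j)) * pi / b) * MI (te j) E 1 + of_real (real (fst (te j)) * pi / a) * MI (te j) E 2
    = A j * exp_moment (h_const a b k te j) \<zeta> * of_real ((lam a b te j)\<^sup>2 * cos_norm a b (te j))"
proof -
  let ?P = "complex_of_real (real (fst (te j)) * pi / a)" and ?Q = "complex_of_real (real (snd (te j)) * pi / b)"
  have "- ?Q * MI (te j) (modal_sum a b k te tm A B N) 1 + ?P * MI (te j) (modal_sum a b k te tm A B N) 2
      = A j * exp_moment (h_const a b k te j) \<zeta> * of_real ((lam a b te j)\<^sup>2 * cos_norm a b (te j))" if "N \<ge> j" for N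
  proof -
    let ?T = "\<lambda>i m. TE_coeff a b (te m) i * profile_overlap a b i (te m) (te j)"
    let ?S = "\<lambda>i n. TM_coeff a b k (g_const a b k tm n) (tm n) i * profile_overlap a b i (tm n) (te j)"
    have "- ?Q * MI (te j) (modal_sum a b k te tm A B N) 1 + ?P * MI (te j) (modal_sum a b k te tm A B N) 2
        = (\<Sum>m=1..N. A m * exp_moment (h_const a b k te m) \<zeta> * (- ?Q * ?T 1 m + ?P * ?T 2 m))
          + (\<Sum>n=1..N. B n * exp_moment (g_const a b k tm n) \<zeta> * (- ?Q * ?S 1 n + ?P * ?S 2 n))"
      unfolding mode_int_modal_sum
      by (simp only: three_distinct if_False distrib_left distrib_right sum.distrib sum_distrib_left mult_ac mult_1_right mult_1_left add_ac)
    also have "\<dots> = (\<Sum>m=1..N. A m * exp_moment (h_const a b k te m) \<zeta> * (if te m = te j then of_real ((lam a b te j)\<^sup>2 * cos_norm a b (te j)) else 0))"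
      unfolding overlap_TE(1,2)[OF ab] lam_def by simp
    also have "\<dots> = (\<Sum>m=1..N. if m = j then A m * exp_moment (h_const a b k te m) \<zeta> * of_real ((lam a b te j)\<^sup>2 * cos_norm a b (te j)) else 0)"
      by (intro sum.cong refl) (simp add: te_inj)
    also have "\<dots> = A j * exp_moment (h_const a b k te j) \<zeta> * of_real ((lam a b te j)\<^sup>2 * cos_norm a b (te j))"
      using j that by (subst sum.delta) auto
    finally show ?thesis .
  qed
  then have "\<forall>\<^sub>F N in sequentially. - ?Q * MI (te j) (modal_sum a b k te tm A B N) 1 + ?P * MI (te j) (modal_sum a b k te tm A B N) 2
      = A j * exp_moment (h_const a b k te j) \<zeta> * of_real ((lam a b te j)\<^sup>2 * cos_norm a b (te j))"
    unfolding eventually_sequentially by blast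
  moreover have "(\<lambda>N. - ?Q * MI (te j) (modal_sum a b k te tm A B N) 1 + ?P * MI (te j) (modal_sum a b k te tm A B N) 2)
      \<longlonglongrightarrow> - ?Q * MI (te j) E 1 + ?P * MI (te j) E 2"
    by (intro tendsto_intros mode_int_limit)
  ultimately show ?thesis
    by (rule eventually_const_LIMSEQ)
qed

lemma modal_TM:
  assumes j: "j \<ge> 1"
  defines "K \<equiv> complex_of_real ((mu a b tm j)\<^sup>2 * sin_norm a b (tm j) / k)"
  shows "of_real (real (fst (tm j)) * pi / a) * MI (tm j) E 1 + of_real (real (snd (tm j)) * pi / b) * MI (tm j) E 2
    = B j * exp_moment (g_const a b k tm j) \<zeta> * (\<i> * g_const a b k tm j * K)"
    and "MI (tm j) E 3 = - B j * exp_moment (g_const a b k tm j) \<zeta> * K"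
proof -
  let ?P = "complex_of_real (real (fst (tm j)) * pi / a)" and ?Q = "complex_of_real (real (snd (tm j)) * pi / b)"
  let ?T = "\<lambda>i m. TE_coeff a b (te m) i * profile_overlap a b i (te m) (tm j)"
  let ?S = "\<lambda>i n. TM_coeff a b k (g_const a b k tm n) (tm n) i * profile_overlap a b i (tm n) (tm j)"
  have p: "fst (tm j) \<noteq> 0" "snd (tm j) \<noteq> 0" using tm_pos[OF j] by auto
  have "?P * MI (tm j) (modal_sum a b k te tm A B N) 1 + ?Q * MI (tm j) (modal_sum a b k te tm A B N) 2
      = B j * exp_moment (g_const a b k tm j) \<zeta> * (\<i> * g_const a b k tm j * K)" if "N \<ge> j" for N
  proof -
    have "?P * MI (tm j) (modal_sum a b k te tm A B N) 1 + ?Q * MI (tm j) (modal_sum a b k te tm A B N) 2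
        = (\<Sum>m=1..N. A m * exp_moment (h_const a b k te m) \<zeta> * (?P * ?T 1 m + ?Q * ?T 2 m))
          + (\<Sum>n=1..N. B n * exp_moment (g_const a b k tm n) \<zeta> * (?P * ?S 1 n + ?Q * ?S 2 n))"
      unfolding mode_int_modal_sum
      by (simp only: three_distinct if_False distrib_left distrib_right sum.distrib sum_distrib_left mult_ac mult_1_right mult_1_left add_ac)
    also have "\<dots> = (\<Sum>n=1..N. B n * exp_moment (g_const a b k tm n) \<zeta> * (if tm n = tm j then \<i> * g_const a b k tm n * K else 0))"
      unfolding overlap_TE(3)[OF ab] overlap_TM(1)[OF ab p k] mu_def K_def by simp
    also have "\<dots> = (\<Sum>n=1..N. if n = j then B n * exp_moment (g_const a b k tm n) \<zeta> * (\<i> * g_const a b k tm n * K) else 0)"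
      by (intro sum.cong refl) (use tm_inj j in auto)
    also have "\<dots> = B j * exp_moment (g_const a b k tm j) \<zeta> * (\<i> * g_const a b k tm j * K)"
      using j that by (subst sum.delta) auto
    finally show ?thesis .
  qed
  then have "\<forall>\<^sub>F N in sequentially. ?P * MI (tm j) (modal_sum a b k te tm A B N) 1 + ?Q * MI (tm j) (modal_sum a b k te tm A B N) 2
      = B j * exp_moment (g_const a b k tm j) \<zeta> * (\<i> * g_const a b k tm j * K)"
    unfolding eventually_sequentially by blast
  moreover have "(\<lambda>N. ?P * MI (tm j) (modal_sum a b k te tm A B N) 1 + ?Q * MI (tm j) (modal_sum a b k te tm A B N) 2)
      \<longlonglongrightarrow> ?P * MI (tm j) E 1 + ?Q * MI (tm j) E 2"
    by (intro tendsto_intros mode_int_limit)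
  ultimately show "?P * MI (tm j) E 1 + ?Q * MI (tm j) E 2
    = B j * exp_moment (g_const a b k tm j) \<zeta> * (\<i> * g_const a b k tm j * K)"
    by (rule eventually_const_LIMSEQ)
  have "MI (tm j) (modal_sum a b k te tm A B N) 3 = - B j * exp_moment (g_const a b k tm j) \<zeta> * K" if "N \<ge> j" for N
  proof -
    have "MI (tm j) (modal_sum a b k te tm A B N) 3
        = (\<Sum>m=1..N. A m * exp_moment (h_const a b k te m) \<zeta> * ?T 3 m)
          + (\<Sum>n=1..N. - B n * exp_moment (g_const a b k tm n) \<zeta> * ?S 3 n)"
      unfolding mode_int_modal_sum by simp
    also have "\<dots> = (\<Sum>n=1..N. - B n * exp_moment (g_const a b k tm n) \<zeta> * (if tm n = tm j then K else 0))"
      unfolding overlap_TM(2)[OF ab p k] mu_def K_def by (simp add: TE_coeff_def three_distinct)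
    also have "\<dots> = (\<Sum>n=1..N. if n = j then - B n * exp_moment (g_const a b k tm n) \<zeta> * K else 0)"
      by (intro sum.cong refl) (use tm_inj j in auto)
    also have "\<dots> = - B j * exp_moment (g_const a b k tm j) \<zeta> * K"
      using j that by (subst sum.delta) auto
    finally show ?thesis .
  qed
  then have "\<forall>\<^sub>F N in sequentially. MI (tm j) (modal_sum a b k te tm A B N) 3 = - B j * exp_moment (g_const a b k tm j) \<zeta> * K"
    unfolding eventually_sequentially by blast
  from this mode_int_limit[of "tm j" 3] show "MI (tm j) E 3 = - B j * exp_moment (g_const a b k tm j) \<zeta> * K"
    by (rule eventually_const_LIMSEQ)
qed

end

section \<open>Decay of the modal series of the Green function\<close>

text \<open>h_m and g_n as a single function of the index pair, so that both families share their
  estimates.\<close>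

definition axial_const :: "real \<Rightarrow> real \<Rightarrow> real \<Rightarrow> nat \<times> nat \<Rightarrow> complex" where
  "axial_const a b k p = csqrt (of_real (k\<^sup>2 - (eigen_rt a b p)\<^sup>2))"

lemma axial_const_eqs: "h_const a b k te m = axial_const a b k (te m)" "g_const a b k tm n = axial_const a b k (tm n)"
  by (simp_all add: h_const_def g_const_def lam_def mu_def axial_const_def)

lemma axial_const_sq: "(axial_const a b k p)\<^sup>2 = of_real (k\<^sup>2 - (eigen_rt a b p)\<^sup>2)"
  by (simp add: axial_const_def)

lemma axial_const_nonzero: "k\<^sup>2 \<noteq> (eigen_rt a b p)\<^sup>2 \<Longrightarrow> axial_const a b k p \<noteq> 0"
proof
  assume k: "k\<^sup>2 \<noteq> (eigen_rt a b p)\<^sup>2" and "axial_const a b k p = 0"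
  then have "of_real (k\<^sup>2 - (eigen_rt a b p)\<^sup>2) = (0 :: complex)"
    unfolding axial_const_sq[symmetric] by simp
  then have "k\<^sup>2 - (eigen_rt a b p)\<^sup>2 = 0" by (simp only: of_real_eq_0_iff)
  with k show False by simp
qed

lemma eigen_rt_nonneg: "0 \<le> eigen_rt a b p"
  by (simp add: eigen_rt_def)

lemma axial_const_Im_nonneg: "0 \<le> Im (axial_const a b k p)"
proof (cases "0 \<le> k\<^sup>2 - (eigen_rt a b p)\<^sup>2")
  case True
  then have "axial_const a b k p = of_real (sqrt (k\<^sup>2 - (eigen_rt a b p)\<^sup>2))"
    unfolding axial_const_def by (subst csqrt_of_real_nonneg) simp_all
  then show ?thesis by simp
next
  case False
  then have "axial_const a b k p = \<i> * of_real (sqrt \<bar>k\<^sup>2 - (eigen_rt a b p)\<^sup>2\<bar>)"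
    unfolding axial_const_def by (subst csqrt_of_real_nonpos) simp_all
  then show ?thesis by simp
qed

lemma axial_const_large:
  assumes "0 < k" "2 * k \<le> eigen_rt a b p"
  shows "eigen_rt a b p / 2 \<le> Im (axial_const a b k p)" "k \<le> norm (axial_const a b k p)"
    "norm (axial_const a b k p) \<le> eigen_rt a b p"
proof -
  let ?L = "eigen_rt a b p"
  define s where "s = sqrt (?L\<^sup>2 - k\<^sup>2)"
  have k2: "4 * k\<^sup>2 \<le> ?L\<^sup>2"
    using power_mono[OF assms(2), of 2] assms(1) by (simp add: power_mult_distrib)
  then have neg: "k\<^sup>2 - ?L\<^sup>2 \<le> 0" using zero_le_power2[of k] by linarith
  have "axial_const a b k p = \<i> * of_real (sqrt \<bar>k\<^sup>2 - ?L\<^sup>2\<bar>)"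
    using neg unfolding axial_const_def by (subst csqrt_of_real_nonpos) simp_all
  also have "\<bar>k\<^sup>2 - ?L\<^sup>2\<bar> = ?L\<^sup>2 - k\<^sup>2" using neg by simp
  finally have e: "axial_const a b k p = \<i> * of_real s" by (simp add: s_def)
  have s0: "0 \<le> s" using neg by (simp add: s_def)
  have n: "norm (axial_const a b k p) = s" "Im (axial_const a b k p) = s"
    using s0 unfolding e by (simp_all add: norm_mult)
  have "(?L / 2)\<^sup>2 \<le> ?L\<^sup>2 - k\<^sup>2"
  proof -
    have "(?L / 2)\<^sup>2 = ?L\<^sup>2 / 4" by (simp add: power_divide)
    then show ?thesis using k2 zero_le_power2[of k] by linarith
  qed
  then have 1: "?L / 2 \<le> s" unfolding s_def by (rule real_le_rsqrt)
  then show "?L / 2 \<le> Im (axial_const a b k p)" unfolding n .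
  show "k \<le> norm (axial_const a b k p)" using 1 assms unfolding n by linarith
  have "s \<le> sqrt (?L\<^sup>2)" unfolding s_def by (rule real_sqrt_le_mono) simp
  then show "norm (axial_const a b k p) \<le> ?L" unfolding n by (simp add: eigen_rt_nonneg)
qed

text \<open>The third bound is linear in the sum of the two indices. It turns exponential decay in
  the eigenvalue into a product of two geometric sequences, without any asymptotics for the ordered
  eigenvalues.\<close>

lemma eigen_rt_lower:
  assumes ab: "0 < a" "0 < b"
  shows "real (fst p) * pi / a \<le> eigen_rt a b p" "real (snd p) * pi / b \<le> eigen_rt a b p"
    "pi / (2 * max a b) * real (fst p + snd p) \<le> eigen_rt a b p"
proof -
  show 1: "real (fst p) * pi / a \<le> eigen_rt a b p"
    unfolding eigen_rt_def by (rule real_le_rsqrt) simp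
  show 2: "real (snd p) * pi / b \<le> eigen_rt a b p"
    unfolding eigen_rt_def by (rule real_le_rsqrt) simp
  have "real n * pi / max a b \<le> real n * pi / a" "real n * pi / max a b \<le> real n * pi / b" for n
    using ab by (intro divide_left_mono; simp)+
  from this(1)[of "fst p"] this(2)[of "snd p"] 1 2
  have "real (fst p) * pi / max a b + real (snd p) * pi / max a b \<le> 2 * eigen_rt a b p" by linarith
  then have "(real (fst p) * pi / max a b + real (snd p) * pi / max a b) / 2 \<le> eigen_rt a b p" by simp
  also have "(real (fst p) * pi / max a b + real (snd p) * pi / max a b) / 2 = pi / (2 * max a b) * real (fst p + snd p)"
    by (simp add: add_divide_distrib algebra_simps)
  finally show "pi / (2 * max a b) * real (fst p + snd p) \<le> eigen_rt a b p" .
qed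

text \<open>A majorant, up to a constant, of one term of the Green function at vertical distance
  \<eta>: polynomial growth of the coefficients against the decay of the evanescent mode.\<close>

definition mode_weight :: "real \<Rightarrow> real \<Rightarrow> real \<Rightarrow> real \<Rightarrow> nat \<times> nat \<Rightarrow> real" where
  "mode_weight a b k \<eta> p = (norm (axial_const a b k p) + eigen_rt a b p + 1)\<^sup>2 / norm (axial_const a b k p)
    * exp (- \<eta> * Im (axial_const a b k p))"

lemma mode_weight_nonneg: "0 \<le> mode_weight a b k \<eta> p"
  by (simp add: mode_weight_def)

text \<open>The bound is over arbitrary finite sets of index pairs, so the order in which the modes
  are enumerated does not enter. Each weight is compared with a product of two geometric sequences;
  the finitely many modes with eigenvalue below 2 k only increase the constant.\<close>

lemma mode_weight_sum_bounded:
  assumes ab: "0 < a" "0 < b" and k: "0 < k" and \<eta>: "0 < \<eta>"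
  obtains S where "\<And>F. finite F \<Longrightarrow> (\<Sum>p\<in>F. mode_weight a b k \<eta> p) \<le> S"
proof -
  let ?L = "eigen_rt a b"
  define c0 where "c0 = pi / (2 * max a b)"
  have c0: "c0 > 0" using ab by (simp add: c0_def)
  define x where "x = exp (- (\<eta> * c0 / 4))"
  have x: "0 < x" "x < 1" using \<eta> c0 by (simp_all add: x_def)
  define g where "g p = x ^ fst p * x ^ snd p" for p :: "nat \<times> nat"
  have g: "g p > 0" for p using x by (simp add: g_def)
  \<comment> \<open>An evanescent mode decays at least like exp (- \<eta> L / 2). The quadratic
    factor is dominated by the square of exp (s L), which uses up half of this exponent and leaves
    exp (- \<eta> L / 4).\<close>
  define s where "s = \<eta> / 8"
  have s: "s > 0" using \<eta> by (simp add: s_def)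
  define K where "K = (2 / s + 1)\<^sup>2 / k"
  have "2 / s + 1 > 0" using s by (simp add: add_pos_pos)
  then have K: "K > 0" using k unfolding K_def by (intro divide_pos_pos zero_less_power)
  have large: "mode_weight a b k \<eta> p \<le> K * g p" if "2 * k \<le> ?L p" for p
  proof -
    let ?l = "?L p"
    have l: "0 \<le> ?l" by (rule eigen_rt_nonneg)
    note A = axial_const_large[OF k that]
    have e1: "(2 * ?l + 1)\<^sup>2 \<le> (2 / s + 1)\<^sup>2 * exp (\<eta> * ?l / 4)"
    proof -
      have "2 * ?l + 1 \<le> (2 / s + 1) * (1 + s * ?l)"
        using s l by (simp add: field_simps)
      also have "\<dots> \<le> (2 / s + 1) * exp (s * ?l)"
        using s exp_ge_add_one_self[of "s * ?l"] by (intro mult_left_mono) auto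
      finally have "(2 * ?l + 1)\<^sup>2 \<le> ((2 / s + 1) * exp (s * ?l))\<^sup>2"
        using l by (intro power_mono) auto
      also have "\<dots> = (2 / s + 1)\<^sup>2 * exp (\<eta> * ?l / 4)"
        by (simp add: power_mult_distrib s_def exp_double[symmetric])
      finally show ?thesis .
    qed
    have "mode_weight a b k \<eta> p \<le> (2 * ?l + 1)\<^sup>2 / k * exp (- \<eta> * (?l / 2))"
      unfolding mode_weight_def
    proof (intro mult_mono frac_le)
      show "(norm (axial_const a b k p) + ?l + 1)\<^sup>2 \<le> (2 * ?l + 1)\<^sup>2"
        using A(3) l by (intro power_mono) auto
      show "exp (- \<eta> * Im (axial_const a b k p)) \<le> exp (- \<eta> * (?l / 2))"
        using A(1) \<eta> by simp
    qed (use k A(2) in auto)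
    also have "\<dots> \<le> ((2 / s + 1)\<^sup>2 * exp (\<eta> * ?l / 4)) / k * exp (- \<eta> * (?l / 2))"
      using e1 k by (intro mult_right_mono divide_right_mono) auto
    also have "\<dots> = K * exp (- (\<eta> * ?l / 4))"
      by (simp add: K_def exp_add[symmetric] mult.assoc[symmetric])
    also have "\<dots> \<le> K * g p"
    proof (intro mult_left_mono)
      have "\<eta> / 4 * (c0 * real (fst p + snd p)) \<le> \<eta> / 4 * ?l"
        using eigen_rt_lower(3)[OF ab, of p] \<eta> by (intro mult_left_mono) (auto simp: c0_def)
      then have "exp (- (\<eta> * ?l / 4)) \<le> exp (real (fst p + snd p) * (- (\<eta> * c0 / 4)))"
        by (simp add: algebra_simps)
      also have "\<dots> = g p"
        unfolding exp_of_nat_mult g_def x_def power_add ..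
      finally show "exp (- (\<eta> * ?l / 4)) \<le> g p" .
    qed (use K in simp)
    finally show ?thesis .
  qed
  define A where "A = {p. ?L p < 2 * k}"
  have finA: "finite A"
  proof (rule finite_subset)
    show "A \<subseteq> {..nat \<lceil>2 * k / c0\<rceil>} \<times> {..nat \<lceil>2 * k / c0\<rceil>}"
    proof
      fix p assume "p \<in> A"
      then have "c0 * real (fst p + snd p) < 2 * k"
        using eigen_rt_lower(3)[OF ab, of p] by (simp add: A_def c0_def)
      then have "real (fst p + snd p) < 2 * k / c0" using c0 by (simp add: field_simps)
      then have "real (fst p + snd p) \<le> real (nat \<lceil>2 * k / c0\<rceil>)"
        by (meson less_imp_le order_trans real_nat_ceiling_ge)
      then have "fst p + snd p \<le> nat \<lceil>2 * k / c0\<rceil>" by (simp only: of_nat_le_iff)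
      then show "p \<in> {..nat \<lceil>2 * k / c0\<rceil>} \<times> {..nat \<lceil>2 * k / c0\<rceil>}" by (cases p) auto
    qed
  qed simp
  \<comment> \<open>Every index in the finite exceptional set contributes its own quotient to the
    constant.\<close>
  define K' where "K' = K + (\<Sum>p\<in>A. mode_weight a b k \<eta> p / g p)"
  have all: "mode_weight a b k \<eta> p \<le> K' * g p" for p
  proof (cases "p \<in> A")
    case True
    have "mode_weight a b k \<eta> p / g p \<le> (\<Sum>p\<in>A. mode_weight a b k \<eta> p / g p)"
      using True finA g mode_weight_nonneg by (intro member_le_sum divide_nonneg_pos) auto
    then have "mode_weight a b k \<eta> p / g p \<le> K'" using K by (simp add: K'_def)
    then show ?thesis using g[of p] by (simp add: field_simps)
  next
    case False
    have "0 \<le> (\<Sum>p\<in>A. mode_weight a b k \<eta> p / g p)"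
      using g mode_weight_nonneg by (intro sum_nonneg divide_nonneg_pos) auto
    then have "K * g p \<le> K' * g p" using g[of p] by (intro mult_right_mono) (auto simp: K'_def)
    then show ?thesis using large[of p] False by (simp add: A_def)
  qed
  have K'0: "0 \<le> K'"
    using all[of "(0,0)"] mode_weight_nonneg[of a b k \<eta> "(0,0)"] g[of "(0,0)"]
    by (metis less_le_not_le mult_less_0_iff not_le_imp_less order_trans)
  show thesis
  proof (rule that)
    fix F :: "(nat \<times> nat) set" assume F: "finite F"
    define n where "n = Suc (Max (insert 0 (fst ` F \<union> snd ` F)))"
    have sub: "F \<subseteq> {..<n} \<times> {..<n}"
    proof
      fix p assume "p \<in> F"
      then have "fst p \<le> Max (insert 0 (fst ` F \<union> snd ` F))" "snd p \<le> Max (insert 0 (fst ` F \<union> snd ` F))"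
        using F by (intro Max_ge; auto)+
      then show "p \<in> {..<n} \<times> {..<n}" by (cases p) (auto simp: n_def)
    qed
    have geo: "(\<Sum>i<n. x ^ i) \<le> 1 / (1 - x)"
    proof -
      have "(\<Sum>i<n. x ^ i) = (1 - x ^ n) / (1 - x)" using x by (subst sum_gp_strict) auto
      also have "\<dots> \<le> 1 / (1 - x)" using x by (intro divide_right_mono) auto
      finally show ?thesis .
    qed
    have "(\<Sum>p\<in>F. mode_weight a b k \<eta> p) \<le> (\<Sum>p\<in>F. K' * g p)" by (intro sum_mono all)
    also have "\<dots> \<le> (\<Sum>p\<in>{..<n} \<times> {..<n}. K' * g p)"
      using sub K'0 g by (intro sum_mono2) (auto simp: less_imp_le)
    also have "\<dots> = K' * ((\<Sum>i<n. x ^ i) * (\<Sum>i<n. x ^ i))"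
    proof -
      have "(\<Sum>p\<in>{..<n} \<times> {..<n}. g p) = (\<Sum>i<n. \<Sum>j<n. x ^ i * x ^ j)"
        by (subst sum.cartesian_product) (simp add: g_def case_prod_beta)
      also have "\<dots> = (\<Sum>i<n. x ^ i) * (\<Sum>i<n. x ^ i)" by (rule sum_product[symmetric])
      finally show ?thesis by (simp only: sum_distrib_left[symmetric])
    qed
    also have "\<dots> \<le> K' * ((1 / (1 - x)) * (1 / (1 - x)))"
      using K'0 geo x by (intro mult_left_mono mult_mono) (auto intro: sum_nonneg)
    finally show "(\<Sum>p\<in>F. mode_weight a b k \<eta> p) \<le> K' * ((1 / (1 - x)) * (1 / (1 - x)))" .
  qed
qed

lemma summable_mode_weight:
  assumes "0 < a" "0 < b" "0 < k" "0 < \<eta>" and t: "inj t"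
  shows "summable (\<lambda>j. mode_weight a b k \<eta> (t j))"
proof -
  obtain S where S: "\<And>F. finite F \<Longrightarrow> (\<Sum>p\<in>F. mode_weight a b k \<eta> p) \<le> S"
    by (rule mode_weight_sum_bounded[OF assms(1-4)]) blast
  show ?thesis
  proof (rule summableI_nonneg_bounded)
    show "0 \<le> mode_weight a b k \<eta> (t j)" for j by (rule mode_weight_nonneg)
    show "(\<Sum>j<n. mode_weight a b k \<eta> (t j)) \<le> S" for n
      using S[of "t ` {..<n}"] t by (simp add: sum.reindex inj_on_subset[OF t])
  qed
qed

text \<open>The Green function is a sum of dyads. The \<open>in\<close> factors belong to the upper
  point: standing waves satisfying the boundary condition at x_3 = 0, with the coefficients c_m and
  d_n included. The \<open>out\<close> factors belong to the lower point: outgoing modes.\<close>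

definition TE_in :: "real \<Rightarrow> real \<Rightarrow> real \<Rightarrow> (nat \<Rightarrow> nat \<times> nat) \<Rightarrow> nat \<Rightarrow> real^3 \<Rightarrow> complex^3" where
  "TE_in a b k te m y = c_coeff a b k te m *s (M_mode a b k te m y - M_mode a b k te m (reflect y))"

definition TE_out :: "real \<Rightarrow> real \<Rightarrow> real \<Rightarrow> (nat \<Rightarrow> nat \<times> nat) \<Rightarrow> nat \<Rightarrow> real^3 \<Rightarrow> complex^3" where
  "TE_out a b k te m x = M_mode a b k te m (reflect x)"

definition TM_in :: "real \<Rightarrow> real \<Rightarrow> real \<Rightarrow> (nat \<Rightarrow> nat \<times> nat) \<Rightarrow> nat \<Rightarrow> real^3 \<Rightarrow> complex^3" where
  "TM_in a b k tm n y = d_coeff a b k tm n *s ((P_mode a b k tm n y - P_mode a b k tm n (reflect y))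
     + (Q_mode a b k tm n y + Q_mode a b k tm n (reflect y)))"

definition TM_out :: "real \<Rightarrow> real \<Rightarrow> real \<Rightarrow> (nat \<Rightarrow> nat \<times> nat) \<Rightarrow> nat \<Rightarrow> real^3 \<Rightarrow> complex^3" where
  "TM_out a b k tm n x = P_mode a b k tm n (reflect x) - Q_mode a b k tm n (reflect x)"

lemma sep_profile_add: "sep (trig_profile i p q (\<lambda>t. f t + z * g t)) x
    = sep (trig_profile i p q f) x + z * sep (trig_profile i p q g) x"
  by (simp add: sep_3 trig_profile_simps(1) trig_profile_def three_distinct algebra_simps)

lemma TE_in_nth: "TE_in a b k te m y $ i = c_coeff a b k te m * (TE_coeff a b (te m) i
    * sep (profile_at a b i (te m) (\<lambda>t. exp (\<i> * h_const a b k te m * of_real t) + (-1) * exp (- \<i> * h_const a b k te m * of_real t))) y)"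
  unfolding TE_in_def vector_smult_component vector_minus_component M_mode_nth(1)[of a b k te m y] M_mode_nth(2)
  by (simp only: sep_profile_add) (simp add: right_diff_distrib)

lemma TM_in_nth: "TM_in a b k tm n y $ i = d_coeff a b k tm n * (TM_coeff a b k (g_const a b k tm n) (tm n) i
    * sep (profile_at a b i (tm n) (\<lambda>t. exp (\<i> * g_const a b k tm n * of_real t) + (if i = 3 then 1 else -1) * exp (- \<i> * g_const a b k tm n * of_real t))) y)"
proof -
  have e: "(P_mode a b k tm n y - P_mode a b k tm n (reflect y)) + (Q_mode a b k tm n y + Q_mode a b k tm n (reflect y))
      = (P_mode a b k tm n y + Q_mode a b k tm n y) - (P_mode a b k tm n (reflect y) - Q_mode a b k tm n (reflect y))"
    by simp
  show ?thesis
    unfolding TM_in_def e vector_smult_component vector_minus_component[of "P_mode a b k tm n y + Q_mode a b k tm n y"] PQ_mode_nth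
    by (simp only: sep_profile_add) (cases "i = 3"; simp add: right_diff_distrib distrib_left)
qed

lemma norm_vec3_le:
  fixes v :: "complex^3"
  assumes "\<And>i. norm (v $ i) \<le> C"
  shows "norm v \<le> 3 * C"
proof -
  have "norm v \<le> (\<Sum>i\<in>UNIV. norm (v $ i))" unfolding norm_vec_def by (rule L2_set_le_sum) simp
  also have "\<dots> \<le> (\<Sum>i\<in>(UNIV::3 set). C)" by (intro sum_mono assms)
  finally show ?thesis by simp
qed

lemma norm_profile_le: "norm (sep (trig_profile i p q f) x) \<le> norm (f (x $ 3))"
proof -
  have "norm (trig_profile i p q f 1 (x $ 1)) \<le> 1" "norm (trig_profile i p q f 2 (x $ 2)) \<le> 1"
    by (simp_all add: trig_profile_def three_distinct)
  then have "norm (trig_profile i p q f 1 (x $ 1)) * norm (trig_profile i p q f 2 (x $ 2)) \<le> 1 * 1"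
    by (intro mult_mono) auto
  then have "(norm (trig_profile i p q f 1 (x $ 1)) * norm (trig_profile i p q f 2 (x $ 2))) * norm (f (x $ 3)) \<le> 1 * norm (f (x $ 3))"
    by (intro mult_right_mono) auto
  then show ?thesis by (simp add: sep_3 norm_mult trig_profile_simps(1))
qed

lemma norm_exp_axial: "norm (exp (\<i> * \<kappa> * of_real t)) = exp (- Im \<kappa> * t)" "norm (exp (- \<i> * \<kappa> * of_real t)) = exp (Im \<kappa> * t)"
  by (simp_all add: norm_exp_eq_Re)

lemma norm_standing_wave:
  assumes "0 \<le> Im \<kappa>" "t \<le> 0" "norm s = 1"
  shows "norm (exp (\<i> * \<kappa> * of_real t) + s * exp (- \<i> * \<kappa> * of_real t)) \<le> 2 * exp (- Im \<kappa> * t)"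
proof -
  have "norm (exp (\<i> * \<kappa> * of_real t) + s * exp (- \<i> * \<kappa> * of_real t)) \<le> exp (- Im \<kappa> * t) + exp (Im \<kappa> * t)"
    by (rule norm_triangle_le) (simp only: norm_mult norm_exp_axial assms(3) mult_1_left order_refl)
  also have "Im \<kappa> * t \<le> 0" using assms by (simp add: mult_nonneg_nonpos)
  then have "exp (Im \<kappa> * t) \<le> exp (- Im \<kappa> * t)" by (simp only: exp_le_cancel_iff)
  finally show ?thesis by simp
qed

text \<open>The sequences \<open>\<alpha>\<close> and \<open>\<beta>\<close> grow and decay exponentially; only their product is summable.\<close>

definition decaying_pair :: "real \<Rightarrow> real \<Rightarrow> (nat \<Rightarrow> real^3 \<Rightarrow> complex^3) \<Rightarrow> (nat \<Rightarrow> real^3 \<Rightarrow> complex^3) \<Rightarrow>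
    (nat \<Rightarrow> real) \<Rightarrow> (nat \<Rightarrow> real) \<Rightarrow> bool" where
  "decaying_pair \<rho> \<sigma> \<psi> \<phi> \<alpha> \<beta> \<longleftrightarrow>
     (\<forall>j. continuous_on UNIV (\<psi> j) \<and> continuous_on UNIV (\<phi> j) \<and> 0 \<le> \<alpha> j \<and> 0 \<le> \<beta> j) \<and>
     (\<forall>j y. \<rho> \<le> y $ 3 \<longrightarrow> y $ 3 \<le> 0 \<longrightarrow> norm (\<psi> j y) \<le> \<alpha> j) \<and>
     (\<forall>j x. x $ 3 \<le> \<sigma> \<longrightarrow> norm (\<phi> j x) \<le> \<beta> j) \<and>
     summable (\<lambda>j. \<alpha> j * \<beta> j)"

text \<open>Only the pair (0, 0) has eigenvalue 0, and the enumeration is monotone. Hence the TE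
  series, which starts at 1, never divides by a vanishing eigenvalue.\<close>

lemma te_zero:
  assumes ab: "0 < a" "0 < b" and enum: "mode_enumeration a b te tm"
  shows "te m = (0, 0) \<longleftrightarrow> m = 0"
proof -
  obtain m0 where m0: "te m0 = (0, 0)" using enum unfolding mode_enumeration_def bij_def by (metis surj_def)
  have "lam a b te 0 \<le> lam a b te m0" using enum unfolding mode_enumeration_def mono_def by simp
  then have l: "eigen_rt a b (te 0) \<le> 0" by (simp add: lam_def m0 eigen_rt_def[of a b "(0,0)"])
  have z: "n = 0" if "real n * pi / d \<le> 0" "0 < d" for n d
    using that pi_gt_zero by (auto simp: divide_le_0_iff mult_le_0_iff)
  have "te 0 = (0, 0)"
    using z[OF order_trans[OF eigen_rt_lower(1)[OF ab] l] ab(1)] z[OF order_trans[OF eigen_rt_lower(2)[OF ab] l] ab(2)]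
    by (simp add: prod_eq_iff)
  moreover have "inj te" using enum unfolding mode_enumeration_def bij_def by blast
  ultimately show ?thesis unfolding inj_def by metis
qed

lemma eigen_rt_pos: "0 < a \<Longrightarrow> 0 < b \<Longrightarrow> p \<noteq> (0, 0) \<Longrightarrow> 0 < eigen_rt a b p"
proof -
  assume ab: "0 < a" "0 < b" and p: "p \<noteq> (0, 0)"
  then have "0 < real (fst p) * pi / a \<or> 0 < real (snd p) * pi / b" by (cases p) auto
  then show ?thesis using eigen_rt_lower(1,2)[OF ab, of p] by linarith
qed

text \<open>Between \<rho> and 0 the standing wave is at most 2 exp (- \<rho> Im \<kappa>), and
  below \<sigma> the outgoing wave is at most exp (\<sigma> Im \<kappa>). Their product is the decay
  factor of \<open>mode_weight\<close> at distance \<rho> - \<sigma>.\<close>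

lemma decaying_TE:
  assumes ab: "0 < a" "0 < b" and k: "0 < k" and enum: "mode_enumeration a b te tm"
    and nonres: "\<And>m. k\<^sup>2 \<noteq> (lam a b te m)\<^sup>2" and \<rho>: "\<sigma> < \<rho>"
  obtains \<alpha> \<beta> where "decaying_pair \<rho> \<sigma> (\<lambda>j. TE_in a b k te (Suc j)) (\<lambda>j. TE_out a b k te (Suc j)) \<alpha> \<beta>"
proof -
  \<comment> \<open>A bound of the normalising constants, from \<open>cos_norm_lower\<close>: the
    squared norms are at least a b / 4.\<close>
  define C0 where "C0 = 2 / sqrt (a * b)"
  have C0: "C0 > 0" using ab by (simp add: C0_def)
  let ?L = "\<lambda>j. eigen_rt a b (te (Suc j))" and ?\<kappa> = "\<lambda>j. axial_const a b k (te (Suc j))"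
  have L: "?L j > 0" for j
    using te_zero[OF ab enum, of "Suc j"] eigen_rt_pos[OF ab] by simp
  have \<kappa>: "?\<kappa> j \<noteq> 0" for j
    using axial_const_nonzero[of k a b "te (Suc j)"] nonres[of "Suc j"] by (simp add: lam_def)
  have inj: "inj (\<lambda>j. te (Suc j))" using enum unfolding mode_enumeration_def bij_def inj_def by auto
  \<comment> \<open>The factor 3 passes from components to the vector. The fraction is the modulus
    of c_m, the rest bounds the coefficient of the mode and the standing wave.\<close>
  define \<alpha> where "\<alpha> j = 3 * (1 / (2 * norm (?\<kappa> j) * (?L j)\<^sup>2) * (C0 * ?L j * (2 * exp (- Im (?\<kappa> j) * \<rho>))))" for j
  define \<beta> where "\<beta> j = 3 * (C0 * ?L j * exp (Im (?\<kappa> j) * \<sigma>))" for j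
  have TEc: "norm (TE_coeff a b (te (Suc j)) i) \<le> C0 * ?L j" for j i
  proof -
    let ?N = "cos_norm a b (te (Suc j))"
    have N: "?N > 0" by (rule cos_norm_lower(2)[OF ab])
    have "sqrt (a * b / 4) \<le> ?N" using cos_norm_lower(1)[OF ab] N by (intro real_le_lsqrt) auto
    then have "sqrt (a * b) / 2 \<le> ?N" by (simp add: real_sqrt_divide)
    then have "1 / ?N \<le> 1 / (sqrt (a * b) / 2)" using ab N by (intro divide_left_mono) auto
    then have N1: "1 / ?N \<le> C0" by (simp add: C0_def)
    have "s / ?N \<le> C0 * ?L j" if "0 \<le> s" "s \<le> ?L j" for s
    proof -
      have "(1 / ?N) * s \<le> C0 * ?L j" using that N1 C0 by (intro mult_mono) auto
      then show ?thesis by simp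
    qed
    from this[OF _ eigen_rt_lower(1)[OF ab]] this[OF _ eigen_rt_lower(2)[OF ab]] show ?thesis
      using N C0 L[of j] ab unfolding TE_coeff_def by (simp add: norm_divide norm_mult abs_mult abs_divide)
  qed
  have "decaying_pair \<rho> \<sigma> (\<lambda>j. TE_in a b k te (Suc j)) (\<lambda>j. TE_out a b k te (Suc j)) \<alpha> \<beta>"
    unfolding decaying_pair_def
  proof (intro conjI allI impI)
    fix j
    show "continuous_on UNIV (TE_in a b k te (Suc j))"
      by (rule continuous_on_vec_components, simp only: TE_in_nth)
         (intro continuous_on_mult_left continuous_on_profile continuous_intros)
    show "continuous_on UNIV (TE_out a b k te (Suc j))"
      unfolding TE_out_def by (rule continuous_on_modes(2))
    show "0 \<le> \<alpha> j" "0 \<le> \<beta> j" using C0 L[of j] by (simp_all add: \<alpha>_def \<beta>_def)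
    show "norm (TE_out a b k te (Suc j) x) \<le> \<beta> j" if "x $ 3 \<le> \<sigma>" for x
      unfolding \<beta>_def
    proof (rule norm_vec3_le)
      fix i
      have "norm (sep (profile_at a b i (te (Suc j)) (\<lambda>t. exp (- \<i> * ?\<kappa> j * of_real t))) x) \<le> exp (Im (?\<kappa> j) * x $ 3)"
        using norm_profile_le[of i _ _ "\<lambda>t. exp (- \<i> * ?\<kappa> j * of_real t)" x] unfolding norm_exp_axial .
      also have "\<dots> \<le> exp (Im (?\<kappa> j) * \<sigma>)" using that axial_const_Im_nonneg by (simp add: mult_left_mono)
      finally show "norm (TE_out a b k te (Suc j) x $ i) \<le> C0 * ?L j * exp (Im (?\<kappa> j) * \<sigma>)"
        unfolding TE_out_def M_mode_nth(2) norm_mult axial_const_eqs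
        using TEc C0 L[of j] by (intro mult_mono) auto
    qed
    show "norm (TE_in a b k te (Suc j) y) \<le> \<alpha> j" if "\<rho> \<le> y $ 3" "y $ 3 \<le> 0" for y
      unfolding \<alpha>_def
    proof (rule norm_vec3_le)
      fix i
      have "norm (sep (profile_at a b i (te (Suc j)) (\<lambda>t. exp (\<i> * ?\<kappa> j * of_real t) + (-1) * exp (- \<i> * ?\<kappa> j * of_real t))) y)
          \<le> 2 * exp (- Im (?\<kappa> j) * y $ 3)"
        by (rule order_trans[OF norm_profile_le], rule norm_standing_wave[OF axial_const_Im_nonneg that(2)]) simp
      also have "\<dots> \<le> 2 * exp (- Im (?\<kappa> j) * \<rho>)" using that axial_const_Im_nonneg by (simp add: mult_left_mono)
      finally have 1: "norm (TE_coeff a b (te (Suc j)) i) * norm (sep (profile_at a b i (te (Suc j)) (\<lambda>t. exp (\<i> * ?\<kappa> j * of_real t) + (-1) * exp (- \<i> * ?\<kappa> j * of_real t))) y)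
          \<le> C0 * ?L j * (2 * exp (- Im (?\<kappa> j) * \<rho>))"
        using TEc C0 L[of j] by (intro mult_mono) auto
      have "norm (c_coeff a b k te (Suc j)) = 1 / (2 * norm (?\<kappa> j) * (?L j)\<^sup>2)"
        by (simp add: c_coeff_def norm_divide norm_mult norm_power axial_const_eqs lam_def)
      then show "norm (TE_in a b k te (Suc j) y $ i) \<le> 1 / (2 * norm (?\<kappa> j) * (?L j)\<^sup>2) * (C0 * ?L j * (2 * exp (- Im (?\<kappa> j) * \<rho>)))"
        unfolding TE_in_nth norm_mult axial_const_eqs by (simp only:) (rule mult_left_mono[OF 1], simp)
    qed
    show "summable (\<lambda>j. \<alpha> j * \<beta> j)"
    proof (rule summable_comparison_test'[where N = 0])
      show "summable (\<lambda>j. 9 * C0\<^sup>2 * mode_weight a b k (\<rho> - \<sigma>) (te (Suc j)))"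
        using summable_mode_weight[OF ab k _ inj, of "\<rho> - \<sigma>"] \<rho> by (intro summable_mult) simp
      fix j
      have "\<alpha> j * \<beta> j = 9 * C0\<^sup>2 * (1 / norm (?\<kappa> j) * exp (- (\<rho> - \<sigma>) * Im (?\<kappa> j)))"
      proof -
        have "exp (- (\<rho> - \<sigma>) * Im (?\<kappa> j)) = exp (- Im (?\<kappa> j) * \<rho>) * exp (Im (?\<kappa> j) * \<sigma>)"
          by (simp add: exp_add[symmetric] algebra_simps)
        then show ?thesis
          using L[of j] \<kappa>[of j] unfolding \<alpha>_def \<beta>_def by (simp add: field_simps power2_eq_square)
      qed
      also have "\<dots> \<le> 9 * C0\<^sup>2 * mode_weight a b k (\<rho> - \<sigma>) (te (Suc j))"
        unfolding mode_weight_def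
        using C0 L[of j] by (intro mult_left_mono mult_right_mono divide_right_mono one_le_power) auto
      finally show "norm (\<alpha> j * \<beta> j) \<le> 9 * C0\<^sup>2 * mode_weight a b k (\<rho> - \<sigma>) (te (Suc j))"
        using C0 L[of j] by (simp add: \<alpha>_def \<beta>_def)
    qed
  qed
  then show thesis by (rule that)
qed

lemma decaying_TM:
  assumes ab: "0 < a" "0 < b" and k: "0 < k" and enum: "mode_enumeration a b te tm"
    and nonres: "\<And>n. n \<ge> 1 \<Longrightarrow> k\<^sup>2 \<noteq> (mu a b tm n)\<^sup>2" and \<rho>: "\<sigma> < \<rho>"
  obtains \<alpha> \<beta> where "decaying_pair \<rho> \<sigma> (\<lambda>j. TM_in a b k tm (Suc j)) (\<lambda>j. TM_out a b k tm (Suc j)) \<alpha> \<beta>"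
proof -
  define C0 where "C0 = 2 / sqrt (a * b)"
  have C0: "C0 > 0" using ab by (simp add: C0_def)
  let ?L = "\<lambda>j. eigen_rt a b (tm (Suc j))" and ?\<kappa> = "\<lambda>j. axial_const a b k (tm (Suc j))"
  have pos: "fst (tm (Suc j)) \<noteq> 0" "snd (tm (Suc j)) \<noteq> 0" for j
  proof -
    have "tm (Suc j) \<in> {1..} \<times> {1..}" using enum unfolding mode_enumeration_def bij_betw_def by auto
    then show "fst (tm (Suc j)) \<noteq> 0" "snd (tm (Suc j)) \<noteq> 0" by auto
  qed
  have L: "?L j > 0" for j
    by (rule eigen_rt_pos[OF ab]) (use pos(1)[of j] in auto)
  have \<kappa>: "?\<kappa> j \<noteq> 0" for j
    using axial_const_nonzero[of k a b "tm (Suc j)"] nonres[of "Suc j"] by (simp add: mu_def)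
  have inj: "inj (\<lambda>j. tm (Suc j))" using enum unfolding mode_enumeration_def bij_betw_def inj_on_def by auto
  define D where "D j = C0 / k * ((norm (?\<kappa> j) + ?L j) * ?L j)" for j
  have D: "0 < D j" for j using C0 k L[of j] by (simp add: D_def add_nonneg_pos)
  define \<alpha> where "\<alpha> j = 3 * (1 / (2 * norm (?\<kappa> j) * (?L j)\<^sup>2) * (D j * (2 * exp (- Im (?\<kappa> j) * \<rho>))))" for j
  define \<beta> where "\<beta> j = 3 * (D j * exp (Im (?\<kappa> j) * \<sigma>))" for j
  have TMc: "norm (TM_coeff a b k (?\<kappa> j) (tm (Suc j)) i) \<le> D j" for j i
  proof -
    let ?N = "sin_norm a b (tm (Suc j))"
    have N: "?N > 0" by (rule cos_norm_lower(4)[OF ab pos])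
    have "?N = sqrt (a * b / 4)"
      using cos_norm_lower(3)[OF ab pos] N by (metis less_imp_le real_sqrt_unique)
    then have "?N = sqrt (a * b) / 2" by (simp add: real_sqrt_divide)
    then have N1: "1 / ?N = C0" by (simp only: C0_def) simp
    have b1: "norm (?\<kappa> j) * (s / (k * ?N)) \<le> D j" if "0 \<le> s" "s \<le> ?L j" for s
    proof -
      have "norm (?\<kappa> j) * (s / (k * ?N)) = C0 / k * (norm (?\<kappa> j) * s)"
        unfolding N1[symmetric] by simp
      also have "\<dots> \<le> D j"
        unfolding D_def using that C0 k L[of j] by (intro mult_left_mono mult_mono) auto
      finally show ?thesis .
    qed
    have b3: "(?L j)\<^sup>2 / (k * ?N) \<le> D j"
    proof -
      have "(?L j)\<^sup>2 / (k * ?N) = C0 / k * (?L j * ?L j)"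
        unfolding N1[symmetric] by (simp add: power2_eq_square)
      also have "\<dots> \<le> D j"
        unfolding D_def using C0 k L[of j] by (intro mult_left_mono mult_right_mono) auto
      finally show ?thesis .
    qed
    have n: "norm (\<i> * ?\<kappa> j * of_real (s / (k * ?N))) = norm (?\<kappa> j) * (s / (k * ?N))" if "0 \<le> s" for s
      using that k N by (simp add: norm_mult norm_divide)
    have n3: "norm (complex_of_real ((?L j)\<^sup>2 / (k * ?N))) = (?L j)\<^sup>2 / (k * ?N)"
      using k N by (simp add: norm_divide norm_mult norm_power)
    have s: "0 \<le> real (fst (tm (Suc j))) * pi / a" "0 \<le> real (snd (tm (Suc j))) * pi / b" using ab by simp_all
    show ?thesis
      using b1[OF s(1) eigen_rt_lower(1)[OF ab]] b1[OF s(2) eigen_rt_lower(2)[OF ab]] b3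
      unfolding TM_coeff_def by (simp only: n[OF s(1)] n[OF s(2)] n3 split: if_split) simp
  qed
  have "decaying_pair \<rho> \<sigma> (\<lambda>j. TM_in a b k tm (Suc j)) (\<lambda>j. TM_out a b k tm (Suc j)) \<alpha> \<beta>"
    unfolding decaying_pair_def
  proof (intro conjI allI impI)
    fix j
    show "continuous_on UNIV (TM_in a b k tm (Suc j))"
      by (rule continuous_on_vec_components, simp only: TM_in_nth)
         (intro continuous_on_mult_left continuous_on_profile continuous_intros)
    show "continuous_on UNIV (TM_out a b k tm (Suc j))"
      unfolding TM_out_def by (rule continuous_on_modes(4))
    show "0 \<le> \<alpha> j" "0 \<le> \<beta> j" using D[of j] by (simp_all add: \<alpha>_def \<beta>_def)
    show "norm (TM_out a b k tm (Suc j) x) \<le> \<beta> j" if "x $ 3 \<le> \<sigma>" for x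
      unfolding \<beta>_def
    proof (rule norm_vec3_le)
      fix i
      have "norm (sep (profile_at a b i (tm (Suc j)) (\<lambda>t. exp (- \<i> * ?\<kappa> j * of_real t))) x) \<le> exp (Im (?\<kappa> j) * x $ 3)"
        using norm_profile_le[of i _ _ "\<lambda>t. exp (- \<i> * ?\<kappa> j * of_real t)" x] unfolding norm_exp_axial .
      also have "\<dots> \<le> exp (Im (?\<kappa> j) * \<sigma>)" using that axial_const_Im_nonneg by (simp add: mult_left_mono)
      finally have "norm (TM_coeff a b k (?\<kappa> j) (tm (Suc j)) i) * norm (sep (profile_at a b i (tm (Suc j)) (\<lambda>t. exp (- \<i> * ?\<kappa> j * of_real t))) x)
          \<le> D j * exp (Im (?\<kappa> j) * \<sigma>)"
        using TMc D[of j] by (intro mult_mono) auto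
      then show "norm (TM_out a b k tm (Suc j) x $ i) \<le> D j * exp (Im (?\<kappa> j) * \<sigma>)"
        unfolding TM_out_def PQ_mode_nth(2) norm_mult axial_const_eqs by (cases "i = 3") simp_all
    qed
    show "norm (TM_in a b k tm (Suc j) y) \<le> \<alpha> j" if "\<rho> \<le> y $ 3" "y $ 3 \<le> 0" for y
      unfolding \<alpha>_def
    proof (rule norm_vec3_le)
      fix i :: 3
      let ?s = "if i = 3 then 1 else (-1 :: complex)"
      have "norm (sep (profile_at a b i (tm (Suc j)) (\<lambda>t. exp (\<i> * ?\<kappa> j * of_real t) + ?s * exp (- \<i> * ?\<kappa> j * of_real t))) y)
          \<le> 2 * exp (- Im (?\<kappa> j) * y $ 3)"
        by (rule order_trans[OF norm_profile_le], rule norm_standing_wave[OF axial_const_Im_nonneg that(2)]) simp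
      also have "\<dots> \<le> 2 * exp (- Im (?\<kappa> j) * \<rho>)" using that axial_const_Im_nonneg by (simp add: mult_left_mono)
      finally have 1: "norm (TM_coeff a b k (?\<kappa> j) (tm (Suc j)) i) * norm (sep (profile_at a b i (tm (Suc j)) (\<lambda>t. exp (\<i> * ?\<kappa> j * of_real t) + ?s * exp (- \<i> * ?\<kappa> j * of_real t))) y)
          \<le> D j * (2 * exp (- Im (?\<kappa> j) * \<rho>))"
        using TMc D[of j] by (intro mult_mono) auto
      have "norm (d_coeff a b k tm (Suc j)) = 1 / (2 * norm (?\<kappa> j) * (?L j)\<^sup>2)"
        by (simp add: d_coeff_def norm_divide norm_mult norm_power axial_const_eqs mu_def)
      then show "norm (TM_in a b k tm (Suc j) y $ i) \<le> 1 / (2 * norm (?\<kappa> j) * (?L j)\<^sup>2) * (D j * (2 * exp (- Im (?\<kappa> j) * \<rho>)))"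
        unfolding TM_in_nth norm_mult axial_const_eqs by (simp only:) (rule mult_left_mono[OF 1], simp)
    qed
    show "summable (\<lambda>j. \<alpha> j * \<beta> j)"
    proof (rule summable_comparison_test'[where N = 0])
      show "summable (\<lambda>j. 9 * (C0 / k)\<^sup>2 * mode_weight a b k (\<rho> - \<sigma>) (tm (Suc j)))"
        using summable_mode_weight[OF ab k _ inj, of "\<rho> - \<sigma>"] \<rho> by (intro summable_mult) simp
      fix j
      have "\<alpha> j * \<beta> j = 9 * (C0 / k)\<^sup>2 * ((norm (?\<kappa> j) + ?L j)\<^sup>2 / norm (?\<kappa> j) * exp (- (\<rho> - \<sigma>) * Im (?\<kappa> j)))"
      proof -
        have e: "exp (- (\<rho> - \<sigma>) * Im (?\<kappa> j)) = exp (- Im (?\<kappa> j) * \<rho>) * exp (Im (?\<kappa> j) * \<sigma>)"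
          by (simp add: exp_add[symmetric] algebra_simps)
        have al: "3 * (1 / (2 * n * L\<^sup>2) * (C * ((n + L) * L) * (2 * e1))) * (3 * (C * ((n + L) * L) * e2))
            = 9 * C\<^sup>2 * ((n + L)\<^sup>2 / n * (e1 * e2))" if "L \<noteq> 0" "n \<noteq> 0" for n L C e1 e2 :: real
          using that by (simp add: divide_simps power2_eq_square)
        show ?thesis
          unfolding \<alpha>_def \<beta>_def D_def e by (rule al) (use L[of j] \<kappa>[of j] in auto)
      qed
      also have "\<dots> \<le> 9 * (C0 / k)\<^sup>2 * mode_weight a b k (\<rho> - \<sigma>) (tm (Suc j))"
        unfolding mode_weight_def
        using C0 L[of j] by (intro mult_left_mono mult_right_mono divide_right_mono power_mono) auto
      finally show "norm (\<alpha> j * \<beta> j) \<le> 9 * (C0 / k)\<^sup>2 * mode_weight a b k (\<rho> - \<sigma>) (tm (Suc j))"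
        using D[of j] by (simp add: \<alpha>_def \<beta>_def)
    qed
  qed
  then show thesis by (rule that)
qed

section \<open>Test fields, kernels given by decaying series, point values\<close>

lemma norm_vsmult: "norm (c *s v) = norm c * norm v" for v :: "complex^3"
  by (simp add: norm_vec_def L2_set_def norm_mult power_mult_distrib real_sqrt_mult flip: sum_distrib_left)

lemma norm_cdot_le: "norm (cdot u v) \<le> 3 * (norm u * norm v)"
proof -
  have "norm (cdot u v) \<le> (\<Sum>i\<in>UNIV. norm (u $ i * v $ i))" unfolding cdot_def by (rule norm_sum)
  also have "\<dots> \<le> (\<Sum>i\<in>(UNIV :: 3 set). norm u * norm v)"
    unfolding norm_mult by (intro sum_mono mult_mono Finite_Cartesian_Product.norm_nth_le) auto
  finally show ?thesis by simp
qed

lemma cdot_simps: "cdot (u + u') v = cdot u v + cdot u' v" "cdot u (v + v') = cdot u v + cdot u v'"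
    "cdot (c *s u) v = c * cdot u v" "cdot u (c *s v) = c * cdot u v" "cdot u v = cdot v u"
  by (simp_all add: cdot_def sum.distrib sum_distrib_left distrib_left distrib_right mult_ac)

lemma borel_measurable_vec3I:
  fixes f :: "'a \<Rightarrow> complex^3"
  assumes "\<And>i. (\<lambda>x. f x $ i) \<in> borel_measurable M"
  shows "f \<in> borel_measurable M"
proof (rule borel_measurable_euclidean_space[THEN iffD2], intro ballI)
  fix b :: "complex^3" assume "b \<in> Basis"
  then obtain i c where b: "b = axis i c" by (auto simp: Basis_vec_def)
  have "f x \<bullet> b = f x $ i \<bullet> c" for x by (simp add: b inner_axis)
  then show "(\<lambda>x. f x \<bullet> b) \<in> borel_measurable M" using assms[of i] by simp
qed

lemma borel_measurable_vsmult:
  fixes f :: "'a \<Rightarrow> complex^3"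
  assumes "m \<in> borel_measurable M" "f \<in> borel_measurable M"
  shows "(\<lambda>x. m x *s f x) \<in> borel_measurable M"
  by (rule borel_measurable_vec3I) (simp, intro borel_measurable_times assms borel_measurable_vec_nth)

lemma borel_measurable_cdot:
  "f \<in> borel_measurable M \<Longrightarrow> g \<in> borel_measurable M \<Longrightarrow> (\<lambda>x. cdot (f x) (g x)) \<in> borel_measurable M"
  unfolding cdot_def by (intro borel_measurable_sum borel_measurable_times borel_measurable_vec_nth)

lemma L2_subset:
  assumes "f \<in> L2 S" "T \<subseteq> S" "T \<in> sets lebesgue" "S \<in> sets lebesgue"
  shows "f \<in> L2 T"
proof -
  have 1: "f \<in> borel_measurable (lebesgue_on T)"
    by (rule measurable_restrict_mono[OF L2_measurable[OF assms(1)] assms(2)])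
  have "integrable lebesgue (\<lambda>x. indicator S x *\<^sub>R (norm (f x))\<^sup>2)"
    using L2_integrable[OF assms(1)] assms(4) by (simp add: integrable_restrict_space)
  from integrable_mult_indicator[OF assms(3) this]
  have "integrable lebesgue (\<lambda>x. indicator T x *\<^sub>R (indicator S x *\<^sub>R (norm (f x))\<^sup>2))" .
  moreover have "(\<lambda>x. indicator T x *\<^sub>R (indicator S x *\<^sub>R (norm (f x))\<^sup>2)) = (\<lambda>x. indicator T x *\<^sub>R (norm (f x))\<^sup>2)"
    by (rule ext) (use assms(2) in \<open>auto simp: indicator_def\<close>)
  ultimately show ?thesis
    using 1 assms(3) by (simp add: L2_def integrable_restrict_space)
qed

lemma L2_mult_AE_bounded:
  fixes f :: "'a::euclidean_space \<Rightarrow> complex^3"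
  assumes f: "f \<in> L2 S" and m: "m \<in> borel_measurable (lebesgue_on S)" "AE x in lebesgue_on S. norm (m x) \<le> C"
  shows "(\<lambda>x. m x *s f x) \<in> L2 S"
    and "L2norm S (\<lambda>x. m x *s f x) \<le> C * L2norm S f \<or> C < 0"
proof -
  have ms: "(\<lambda>x. m x *s f x) \<in> borel_measurable (lebesgue_on S)"
    by (rule borel_measurable_vsmult[OF m(1) L2_measurable[OF f]])
  have bd: "AE x in lebesgue_on S. (norm (m x *s f x))\<^sup>2 \<le> C\<^sup>2 * (norm (f x))\<^sup>2"
    using m(2)
  proof eventually_elim
    case (elim x)
    then have "norm (m x) * norm (f x) \<le> C * norm (f x)" by (intro mult_right_mono) auto
    then have "(norm (m x *s f x))\<^sup>2 \<le> (C * norm (f x))\<^sup>2" unfolding norm_vsmult by (intro power_mono) auto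
    then show ?case by (simp add: power_mult_distrib)
  qed
  have i2: "integrable (lebesgue_on S) (\<lambda>x. C\<^sup>2 * (norm (f x))\<^sup>2)" using L2_integrable[OF f] by simp
  have i1: "integrable (lebesgue_on S) (\<lambda>x. (norm (m x *s f x))\<^sup>2)"
  proof (rule Bochner_Integration.integrable_bound[OF i2])
    show "(\<lambda>x. (norm (m x *s f x))\<^sup>2) \<in> borel_measurable (lebesgue_on S)"
      using ms by measurable
    show "AE x in lebesgue_on S. norm ((norm (m x *s f x))\<^sup>2) \<le> norm (C\<^sup>2 * (norm (f x))\<^sup>2)"
      using bd by eventually_elim simp
  qed
  show "(\<lambda>x. m x *s f x) \<in> L2 S" using ms i1 by (simp add: L2_def)
  have "(LINT x|lebesgue_on S. (norm (m x *s f x))\<^sup>2) \<le> (LINT x|lebesgue_on S. C\<^sup>2 * (norm (f x))\<^sup>2)"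
    by (rule integral_mono_AE[OF i1 i2 bd])
  then have "L2norm S (\<lambda>x. m x *s f x) \<le> sqrt (C\<^sup>2 * (LINT x|lebesgue_on S. (norm (f x))\<^sup>2))"
    unfolding L2norm_def by (intro real_sqrt_le_mono) simp
  then show "L2norm S (\<lambda>x. m x *s f x) \<le> C * L2norm S f \<or> C < 0"
    by (auto simp: real_sqrt_mult L2norm_def)
qed

lemma partial_component:
  fixes f :: "real^3 \<Rightarrow> complex^3"
  assumes "f differentiable at x"
  shows "partial j (\<lambda>z. f z $ i) x = partial j f x $ i"
proof -
  have d: "((\<lambda>t. x + t *\<^sub>R axis j 1) has_derivative (\<lambda>t. t *\<^sub>R axis j 1)) (at (0::real))"
    by (auto intro!: derivative_eq_intros)
  obtain f' where f': "(f has_derivative f') (at (x + 0 *\<^sub>R axis j 1))"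
    using assms unfolding differentiable_def by auto
  have "(\<lambda>t. f (x + t *\<^sub>R axis j 1)) differentiable at 0"
    using diff_chain_at[OF d f'] unfolding differentiable_def o_def by blast
  then have v: "((\<lambda>t. f (x + t *\<^sub>R axis j 1)) has_vector_derivative partial j f x) (at 0)"
    unfolding partial_def by (simp add: vector_derivative_works[symmetric])
  have "((\<lambda>t. f (x + t *\<^sub>R axis j 1) $ i) has_vector_derivative partial j f x $ i) (at 0)"
    by (rule bounded_linear.has_vector_derivative[OF bounded_linear_vec_nth v])
  then show ?thesis unfolding partial_def[of j "\<lambda>z. f z $ i"] by (rule vector_derivative_at)
qed

lemma test_field_props:
  assumes "\<phi> \<in> test_fields S"
  obtains K where "compact K" "K \<subseteq> S" "continuous_on UNIV \<phi>" "continuous_on UNIV (curl \<phi>)"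
    "\<And>x. x \<notin> K \<Longrightarrow> \<phi> x = 0" "\<And>x. x \<notin> K \<Longrightarrow> curl \<phi> x = 0"
proof -
  define K where "K = closure {x. \<phi> x \<noteq> 0}"
  have K: "compact K" "K \<subseteq> S" and sm: "foldr partial is \<phi> differentiable_on UNIV" for "is"
    using assms unfolding test_fields_def smooth_def K_def by auto
  have d0: "\<phi> differentiable at x" for x
    using sm[of "[]"] by (simp add: differentiable_on_def)
  have d1: "continuous_on UNIV (partial j \<phi>)" for j
    using sm[of "[j]"] by (simp add: differentiable_imp_continuous_on)
  have c0: "continuous_on UNIV \<phi>" using sm[of "[]"] by (simp add: differentiable_imp_continuous_on)
  have curl: "curl \<phi> x = vector [partial 2 \<phi> x $ 3 - partial 3 \<phi> x $ 2, partial 3 \<phi> x $ 1 - partial 1 \<phi> x $ 3,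
      partial 1 \<phi> x $ 2 - partial 2 \<phi> x $ 1]" for x
    unfolding curl_def partial_component[OF d0] ..
  have "continuous_on UNIV (\<lambda>x. curl \<phi> x $ i)" for i
    using exhaust_3[of i]
    by (elim disjE; hypsubst; simp add: curl; intro continuous_on_diff continuous_on_component d1)
  then have c1: "continuous_on UNIV (curl \<phi>)" by (rule continuous_on_vec_components)
  have z0: "\<phi> x = 0" if "x \<notin> K" for x
    using that closure_subset[of "{x. \<phi> x \<noteq> 0}"] by (auto simp: K_def)
  have pz: "partial j \<phi> x = 0" if "x \<notin> K" for x j
  proof -
    have o: "open ((\<lambda>t::real. x + t *\<^sub>R axis j 1) -` (- K))"
      by (intro continuous_open_vimage continuous_intros) (use K(1) in \<open>auto simp: compact_imp_closed\<close>)
    have "((\<lambda>t::real. 0::complex^3) has_vector_derivative 0) (at 0)" by simp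
    then have "((\<lambda>t. \<phi> (x + t *\<^sub>R axis j 1)) has_vector_derivative 0) (at 0)"
      by (rule has_vector_derivative_transform_within_open[OF _ o]) (use that z0 in auto)
    then show ?thesis unfolding partial_def by (rule vector_derivative_at)
  qed
  have "curl \<phi> x = 0" if "x \<notin> K" for x
    using pz[OF that] by (simp add: curl vec_eq_iff forall_3)
  then show thesis using that[OF K c0 c1 z0] by blast
qed

lemma integrable_cdot_waveguide:
  fixes v G :: "real^3 \<Rightarrow> complex^3"
  assumes v: "\<And>R. R < 0 \<Longrightarrow> v \<in> L2 (section_between a b R 0)"
    and G: "continuous_on UNIV G" "compact K" "\<And>x. x \<notin> K \<Longrightarrow> G x = 0"
  shows "integrable (lebesgue_on (waveguide a b)) (\<lambda>x. cdot (v x) (G x))"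
proof -
  obtain C where C: "\<And>x. x \<in> K \<Longrightarrow> norm x \<le> C"
    using compact_imp_bounded[OF G(2)] unfolding bounded_iff by blast
  \<comment> \<open>K lies in a ball of radius C, hence above this height, so the infinite guide may
    be truncated there.\<close>
  define R where "R = - \<bar>C\<bar> - 1"
  have R: "R < 0" by (simp add: R_def)
  have "bounded (G ` K)" by (intro compact_imp_bounded compact_continuous_image continuous_on_subset[OF G(1)] G(2)) auto
  then obtain B where B: "\<And>x. x \<in> K \<Longrightarrow> norm (G x) \<le> B" unfolding bounded_iff by blast
  have B': "norm (G x $ i) \<le> \<bar>B\<bar>" for x i
  proof (cases "x \<in> K")
    case True
    then show ?thesis using B[of x] Finite_Cartesian_Product.norm_nth_le[of "G x" i] by linarith
  next
    case False
    then show ?thesis by (simp add: G(3))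
  qed
  have "integrable (lebesgue_on (section_between a b R 0)) (\<lambda>x. v x $ i * G x $ i)" for i
    by (rule L2_integrable_mult[OF v[OF R] lmeasurable_section_between _ B'])
       (intro continuous_measurable_lebesgue_on continuous_on_component G)
  then have "integrable (lebesgue_on (section_between a b R 0)) (\<lambda>x. cdot (v x) (G x))"
    unfolding cdot_def by (intro Bochner_Integration.integrable_sum)
  moreover have "cdot (v x) (G x) = 0" if x: "x \<in> waveguide a b - section_between a b R 0" for x
  proof -
    have "x $ 3 \<le> R" using x by (auto simp: waveguide_eq section_between_eq)
    then have "C < norm x" using component_le_norm_cart[of x 3] by (simp add: R_def)
    then have "x \<notin> K" using C[of x] by auto
    then show ?thesis by (simp add: G(3) cdot_def)
  qed
  ultimately show ?thesis
    by (subst integral_lebesgue_on_subset(2)) (auto simp: section_subset_waveguide)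
qed

section \<open>Kernels given by series of dyads\<close>

lemma norm_outer_le: "norm (outer u v) \<le> 9 * (norm u * norm v)"
proof -
  have "norm (outer u v) \<le> (\<Sum>i\<in>UNIV. norm (outer u v $ i))" unfolding norm_vec_def[of "outer u v"] by (rule L2_set_le_sum) simp
  also have "\<dots> \<le> (\<Sum>i\<in>(UNIV :: 3 set). 3 * (norm u * norm v))"
  proof (rule sum_mono)
    fix i
    show "norm (outer u v $ i) \<le> 3 * (norm u * norm v)"
      by (rule norm_vec3_le) (simp add: outer_def norm_mult mult_mono Finite_Cartesian_Product.norm_nth_le)
  qed
  finally show ?thesis by simp
qed

lemma bounded_linear_matrix_apply:
  "bounded_linear (\<lambda>A. A *v v)" "bounded_linear (\<lambda>A. transpose A *v v)" for v :: "complex^3"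
  by (rule linear_conv_bounded_linear[THEN iffD1],
      simp add: linear_iff vec_eq_iff matrix_vector_mult_def transpose_def algebra_simps sum.distrib scaleR_sum_right)+

lemma outer_apply: "outer u w *v v = cdot w v *s u" "transpose (outer u w) *v v = cdot u v *s w"
  by (simp_all add: vec_eq_iff matrix_vector_mult_def outer_def transpose_def cdot_def sum_distrib_left sum_distrib_right mult_ac)

context
  fixes \<rho> \<sigma> \<psi> \<phi> \<alpha> \<beta>
  assumes dp: "decaying_pair \<rho> \<sigma> \<psi> \<phi> \<alpha> \<beta>"
begin

lemma decaying_pairD:
  "continuous_on UNIV (\<psi> j)" "continuous_on UNIV (\<phi> j)" "0 \<le> \<alpha> j" "0 \<le> \<beta> j"
  "\<rho> \<le> y $ 3 \<Longrightarrow> y $ 3 \<le> 0 \<Longrightarrow> norm (\<psi> j y) \<le> \<alpha> j"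
  "x $ 3 \<le> \<sigma> \<Longrightarrow> norm (\<phi> j x) \<le> \<beta> j"
  "summable (\<lambda>j. \<alpha> j * \<beta> j)"
  using dp unfolding decaying_pair_def by auto

lemma kernel_summable:
  assumes "\<rho> \<le> y $ 3" "y $ 3 \<le> 0" "x $ 3 \<le> \<sigma>"
  shows "summable (\<lambda>j. outer (\<psi> j y) (\<phi> j x))"
proof (rule summable_comparison_test')
  show "summable (\<lambda>j. 9 * (\<alpha> j * \<beta> j))" by (intro summable_mult decaying_pairD)
  fix j
  have "norm (outer (\<psi> j y) (\<phi> j x)) \<le> 9 * (norm (\<psi> j y) * norm (\<phi> j x))" by (rule norm_outer_le)
  also have "\<dots> \<le> 9 * (\<alpha> j * \<beta> j)"
    using decaying_pairD assms by (intro mult_left_mono mult_mono) auto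
  finally show "norm (outer (\<psi> j y) (\<phi> j x)) \<le> 9 * (\<alpha> j * \<beta> j)" .
qed

lemma kernel_apply:
  assumes "\<rho> \<le> y $ 3" "y $ 3 \<le> 0" "x $ 3 \<le> \<sigma>"
  shows "transpose (\<Sum>j. outer (\<psi> j y) (\<phi> j x)) *v v = (\<Sum>j. cdot (\<psi> j y) v *s \<phi> j x)"
    and "(\<Sum>j. outer (\<psi> j y) (\<phi> j x)) *v v = (\<Sum>j. cdot (\<phi> j x) v *s \<psi> j y)"
    and "summable (\<lambda>j. cdot (\<psi> j y) v *s \<phi> j x)"
    and "summable (\<lambda>j. cdot (\<phi> j x) v *s \<psi> j y)"
  using bounded_linear.suminf[OF bounded_linear_matrix_apply(2) kernel_summable[OF assms], of v]
    bounded_linear.suminf[OF bounded_linear_matrix_apply(1) kernel_summable[OF assms], of v]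
    bounded_linear.summable[OF bounded_linear_matrix_apply(2) kernel_summable[OF assms], of v]
    bounded_linear.summable[OF bounded_linear_matrix_apply(1) kernel_summable[OF assms], of v]
  by (simp_all only: outer_apply)

end

text \<open>Only one factor of each term depends on the integration variable; the vectors v enter
  through the bounds \<beta> alone. The lemma therefore serves twice: for the integral over D, and
  with exchanged roles for the integral over the measurement surface.\<close>

lemma integral_cdot_series:
  fixes \<psi> :: "nat \<Rightarrow> 'a \<Rightarrow> complex^3" and f :: "'a \<Rightarrow> complex^3" and v :: "nat \<Rightarrow> complex^3"
  assumes f: "integrable M f" and m: "\<And>j. \<psi> j \<in> borel_measurable M"
    and \<alpha>: "\<And>j x. x \<in> space M \<Longrightarrow> norm (\<psi> j x) \<le> \<alpha> j" and \<beta>: "\<And>j. norm (v j) \<le> \<beta> j"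
    and s: "summable (\<lambda>j. \<alpha> j * \<beta> j)" and nn: "\<And>j. 0 \<le> \<alpha> j"
  shows "(LINT x|M. (\<Sum>j. cdot (\<psi> j x) (f x) *s v j)) = (\<Sum>j. (LINT x|M. cdot (\<psi> j x) (f x)) *s v j)"
    and "integrable M (\<lambda>x. (\<Sum>j. cdot (\<psi> j x) (f x) *s v j))"
    and "summable (\<lambda>j. (LINT x|M. cdot (\<psi> j x) (f x)) *s v j)"
    and "norm (LINT x|M. cdot (\<psi> j x) (f x)) \<le> 3 * \<alpha> j * (LINT x|M. norm (f x))"
    and "integrable M (\<lambda>x. cdot (\<psi> j x) (f x))"
proof -
  have nf: "integrable M (\<lambda>x. norm (f x))" using f by simp
  have \<beta>0: "0 \<le> \<beta> j" for j using order_trans[OF norm_ge_zero \<beta>[of j]] .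
  have bd: "norm (cdot (\<psi> j x) (f x)) \<le> 3 * \<alpha> j * norm (f x)" if "x \<in> space M" for j x
  proof -
    have "norm (cdot (\<psi> j x) (f x)) \<le> 3 * (norm (\<psi> j x) * norm (f x))" by (rule norm_cdot_le)
    also have "\<dots> \<le> 3 * (\<alpha> j * norm (f x))"
      using \<alpha>[OF that] by (intro mult_left_mono mult_right_mono) auto
    finally show ?thesis by simp
  qed
  have ic: "integrable M (\<lambda>x. cdot (\<psi> j x) (f x))" for j
  proof (rule Bochner_Integration.integrable_bound)
    show "integrable M (\<lambda>x. 3 * \<alpha> j * norm (f x))" using nf by simp
    show "(\<lambda>x. cdot (\<psi> j x) (f x)) \<in> borel_measurable M"
      by (rule borel_measurable_cdot[OF m borel_measurable_integrable[OF f]])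
    show "AE x in M. norm (cdot (\<psi> j x) (f x)) \<le> norm (3 * \<alpha> j * norm (f x))"
      using bd nn[of j] by (intro AE_I2) simp
  qed
  then show "integrable M (\<lambda>x. cdot (\<psi> j x) (f x))" .
  have ib: "norm (LINT x|M. cdot (\<psi> j x) (f x)) \<le> 3 * \<alpha> j * (LINT x|M. norm (f x))" for j
  proof -
    have "norm (LINT x|M. cdot (\<psi> j x) (f x)) \<le> (LINT x|M. norm (cdot (\<psi> j x) (f x)))" by (rule integral_norm_bound)
    also have "\<dots> \<le> (LINT x|M. 3 * \<alpha> j * norm (f x))"
      using nf bd by (intro integral_mono integrable_norm ic) auto
    finally show ?thesis by simp
  qed
  then show "norm (LINT x|M. cdot (\<psi> j x) (f x)) \<le> 3 * \<alpha> j * (LINT x|M. norm (f x))" .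
  have bl: "bounded_linear (\<lambda>c. c *s v j)" for j by (rule bounded_linear_vector_smult)
  have iv: "integrable M (\<lambda>x. cdot (\<psi> j x) (f x) *s v j)" for j
    by (rule integrable_bounded_linear[OF bl ic])
  have lv: "(LINT x|M. cdot (\<psi> j x) (f x) *s v j) = (LINT x|M. cdot (\<psi> j x) (f x)) *s v j" for j
    by (rule integral_bounded_linear[OF bl ic])
  have nv: "norm (cdot (\<psi> j x) (f x) *s v j) \<le> 3 * norm (f x) * (\<alpha> j * \<beta> j)" if "x \<in> space M" for j x
  proof -
    have "norm (cdot (\<psi> j x) (f x) *s v j) \<le> (3 * \<alpha> j * norm (f x)) * \<beta> j"
      unfolding norm_vsmult using bd[OF that] \<beta> nn[of j] by (intro mult_mono) auto
    then show ?thesis by (simp add: mult_ac)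
  qed
  have sAE: "AE x in M. summable (\<lambda>j. norm (cdot (\<psi> j x) (f x) *s v j))"
  proof (rule AE_I2)
    fix x assume x: "x \<in> space M"
    show "summable (\<lambda>j. norm (cdot (\<psi> j x) (f x) *s v j))"
      by (rule summable_comparison_test'[OF summable_mult[OF s, of "3 * norm (f x)"]]) (use nv[OF x] in simp)
  qed
  have sI: "summable (\<lambda>j. LINT x|M. norm (cdot (\<psi> j x) (f x) *s v j))"
  proof (rule summable_comparison_test'[OF summable_mult[OF s, of "3 * (LINT x|M. norm (f x))"]])
    fix j
    have "(LINT x|M. norm (cdot (\<psi> j x) (f x) *s v j)) \<le> (LINT x|M. (3 * (\<alpha> j * \<beta> j)) * norm (f x))"
      using nv nf by (intro integral_mono integrable_norm iv) (auto simp: mult_ac)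
    also have "\<dots> = 3 * (LINT x|M. norm (f x)) * (\<alpha> j * \<beta> j)" by simp
    finally show "norm (LINT x|M. norm (cdot (\<psi> j x) (f x) *s v j)) \<le> 3 * (LINT x|M. norm (f x)) * (\<alpha> j * \<beta> j)"
      by (simp add: Bochner_Integration.integral_nonneg)
  qed
  show "(LINT x|M. (\<Sum>j. cdot (\<psi> j x) (f x) *s v j)) = (\<Sum>j. (LINT x|M. cdot (\<psi> j x) (f x)) *s v j)"
    unfolding lv[symmetric] by (rule integral_suminf[OF iv sAE sI])
  show "integrable M (\<lambda>x. (\<Sum>j. cdot (\<psi> j x) (f x) *s v j))"
    by (rule integrable_suminf[OF iv sAE sI])
  show "summable (\<lambda>j. (LINT x|M. cdot (\<psi> j x) (f x)) *s v j)"
  proof (rule summable_comparison_test'[OF summable_mult[OF s, of "3 * (LINT x|M. norm (f x))"]])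
    fix j
    have "norm ((LINT x|M. cdot (\<psi> j x) (f x)) *s v j) \<le> (3 * \<alpha> j * (LINT x|M. norm (f x))) * \<beta> j"
      unfolding norm_vsmult using ib \<beta> nn[of j]
      by (intro mult_mono) (auto simp: Bochner_Integration.integral_nonneg)
    then show "norm ((LINT x|M. cdot (\<psi> j x) (f x)) *s v j) \<le> 3 * (LINT x|M. norm (f x)) * (\<alpha> j * \<beta> j)"
      by (simp add: mult_ac)
  qed
qed

section \<open>Point values of fields known almost everywhere, and the boundary of the
  scatterer\<close>

lemma AE_eq_continuous_imp_eq:
  fixes f g :: "real^3 \<Rightarrow> complex^3"
  assumes "open U" "x \<in> U" "continuous_on U f" "continuous_on U g" "AE z in lebesgue_on U. f z = g z"
  shows "f x = g x"
proof (rule ccontr)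
  assume ne: "f x \<noteq> g x"
  define O' where "O' = {z \<in> U. f z - g z \<noteq> 0}"
  have "O' = U \<inter> (\<lambda>z. f z - g z) -` (- {0})" by (auto simp: O'_def)
  moreover have "open \<dots>"
    by (rule continuous_open_preimage[OF continuous_on_diff[OF assms(3,4)] assms(1)]) auto
  ultimately have o: "open O'" by simp
  have "AE z in lebesgue. z \<notin> O'"
    using assms(1,5) by (simp add: AE_restrict_space_iff O'_def)
  then have "O' \<in> null_sets lebesgue" using o by (subst AE_iff_null_sets) auto
  then have "negligible O'" by (simp add: negligible_iff_null_sets)
  then have "O' = {}" using o open_not_negligible by blast
  then show False using ne assms(2) by (auto simp: O'_def)
qed

lemma point_value_eq:
  assumes "open U" "x \<in> U" "continuous_on U f" "AE z in lebesgue_on U. f z = w z"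
  shows "point_value w x = f x"
  unfolding point_value_def
proof (rule the_equality)
  show "\<exists>U f'. open U \<and> x \<in> U \<and> continuous_on U f' \<and> (AE z in lebesgue_on U. f' z = w z) \<and> f' x = f x"
    using assms by blast
  fix v assume "\<exists>U f'. open U \<and> x \<in> U \<and> continuous_on U f' \<and> (AE z in lebesgue_on U. f' z = w z) \<and> f' x = v"
  then obtain U' f' where *: "open U'" "x \<in> U'" "continuous_on U' f'" "AE z in lebesgue_on U'. f' z = w z" "f' x = v"
    by blast
  have "AE z in lebesgue. z \<in> U \<longrightarrow> f z = w z" "AE z in lebesgue. z \<in> U' \<longrightarrow> f' z = w z"
    using assms(1,4) *(1,4) by (simp_all add: AE_restrict_space_iff)
  then have "AE z in lebesgue. z \<in> U \<inter> U' \<longrightarrow> f' z = f z" by eventually_elim auto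
  then have "AE z in lebesgue_on (U \<inter> U'). f' z = f z"
    using assms(1) *(1) by (simp add: AE_restrict_space_iff open_Int)
  then have "f' x = f x"
    by (intro AE_eq_continuous_imp_eq[of "U \<inter> U'"])
       (use assms * in \<open>auto intro: continuous_on_subset\<close>)
  then show "v = f x" using *(5) by simp
qed

text \<open>The permittivity is known to be 1 only off the closure of D, while the source is an
  integral over D, so the frontier has to be a null set. Locally it lies in the graph of a Lipschitz
  function, which is the Lipschitz image of a plane.\<close>

lemma negligible_frontier_lipschitz:
  assumes "lipschitz_domain D"
  shows "negligible (frontier D)"
proof -
  have loc: "\<exists>U. open U \<and> p \<in> U \<and> negligible (frontier D \<inter> U)" if p: "p \<in> frontier D" for p
  proof -
    have "\<exists>U (A :: real^3 \<Rightarrow> real^3) (\<phi> :: real^2 \<Rightarrow> real) L.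
        open U \<and> p \<in> U \<and> orthogonal_transformation A \<and> L-lipschitz_on UNIV \<phi> \<and>
        D \<inter> U = {x \<in> U. A x $ 3 < \<phi> (vector [A x $ 1, A x $ 2])}"
      using assms p unfolding lipschitz_domain_def by blast
    then obtain U A \<phi> L where U: "open U" "p \<in> U" and A: "orthogonal_transformation (A :: real^3 \<Rightarrow> real^3)"
      and \<phi>: "L-lipschitz_on UNIV (\<phi> :: real^2 \<Rightarrow> real)"
      and D: "D \<inter> U = {x \<in> U. A x $ 3 < \<phi> (vector [A x $ 1, A x $ 2])}" by blast
    \<comment> \<open>Where G < 0 a point is in the open set D, and where G > 0 it has a
      neighbourhood disjoint from D. A frontier point therefore has G = 0.\<close>
    define G where "G x = A x $ 3 - \<phi> (vector [A x $ 1, A x $ 2])" for x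
    have linA: "linear A" using A by (simp add: orthogonal_transformation_def)
    have cA: "continuous_on UNIV A" by (rule linear_continuous_on) (simp add: linA linear_conv_bounded_linear[symmetric])
    have cv: "continuous_on UNIV (\<lambda>x. vector [A x $ 1, A x $ 2] :: real^2)"
    proof -
      have "(\<lambda>x. vector [A x $ 1, A x $ 2] :: real^2) = (\<lambda>x. \<chi> i. if i = 1 then A x $ 1 else A x $ 2)"
        by (auto simp: fun_eq_iff vec_eq_iff forall_2)
      moreover have "continuous_on UNIV (\<lambda>x. (\<chi> i. if i = 1 then A x $ 1 else A x $ 2) :: real^2)"
      proof (rule continuous_on_vec_lambda)
        show "continuous_on UNIV (\<lambda>x. if i = 1 then A x $ 1 else A x $ 2)" for i :: 2
          by (cases "i = 1") (simp_all add: continuous_on_component cA)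
      qed
      ultimately show ?thesis by (rule ssubst[where P = "continuous_on UNIV"])
    qed
    have cG: "continuous_on UNIV G"
      unfolding G_def
      by (intro continuous_on_diff continuous_on_component cA continuous_on_compose2[OF lipschitz_on_continuous_on[OF \<phi>] cv]) auto
    have sub: "frontier D \<inter> U \<subseteq> {x. G x = 0}"
    proof safe
      fix x assume x: "x \<in> frontier D" "x \<in> U"
      have "G x \<noteq> 0 \<Longrightarrow> False"
      proof -
        assume "G x \<noteq> 0"
        then consider "G x < 0" | "G x > 0" by linarith
        then show False
        proof cases
          case 1
          then have "x \<in> D" using x(2) D by (auto simp: G_def)
          moreover have "open D" using assms by (simp add: lipschitz_domain_def)
          ultimately show False using x(1) by (simp add: frontier_def interior_open)
        next
          case 2
          have "open (U \<inter> G -` {0<..})"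
            by (intro continuous_open_preimage U(1) continuous_on_subset[OF cG]) auto
          moreover have "x \<in> U \<inter> G -` {0<..}" using x(2) 2 by simp
          moreover have "(U \<inter> G -` {0<..}) \<inter> D = {}"
          proof (intro equals0I)
            fix z assume z: "z \<in> (U \<inter> G -` {0<..}) \<inter> D"
            then have "z \<in> {x \<in> U. A x $ 3 < \<phi> (vector [A x $ 1, A x $ 2])}" unfolding D[symmetric] by blast
            then show False using z by (simp add: G_def)
          qed
          moreover have "x \<in> closure D" using x(1) by (simp add: frontier_def)
          ultimately show False by (meson closure_iff_nhds_not_empty subset_refl disjoint_iff Int_commute)
        qed
      qed
      then show "G x = 0" by blast
    qed
    \<comment> \<open>Lifts a point to the graph and undoes the rigid motion. Only the first two
      coordinates of y matter, so the plane y_3 = 0 is already mapped onto the whole graph.\<close>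
    define H where "H y = inv A (vector [y $ 1, y $ 2, \<phi> (vector [y $ 1, y $ 2])])" for y :: "real^3"
    have bij: "bij A" using A by (rule orthogonal_transformation_bij)
    have img: "{x. G x = 0} \<subseteq> H ` {y. y $ 3 = 0}"
    proof
      fix x assume "x \<in> {x. G x = 0}"
      then have e: "A x $ 3 = \<phi> (vector [A x $ 1, A x $ 2])" by (simp add: G_def)
      have "vector [A x $ 1, A x $ 2, \<phi> (vector [A x $ 1, A x $ 2])] = A x"
        using e by (simp add: vec_eq_iff forall_3)
      then have "H (vector [A x $ 1, A x $ 2, 0]) = x"
        using bij by (simp add: H_def bij_is_inj)
      then show "x \<in> H ` {y. y $ 3 = 0}" by (intro image_eqI[of _ _ "vector [A x $ 1, A x $ 2, 0]"]) auto
    qed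
    have Hlip: "norm (H y - H x) \<le> (3 + \<bar>L\<bar> * 2) * norm (y - x)" for x y
    proof -
      let ?d = "vector [y $ 1, y $ 2, \<phi> (vector [y $ 1, y $ 2])] - vector [x $ 1, x $ 2, \<phi> (vector [x $ 1, x $ 2])] :: real^3"
      have AH: "A (H y) = vector [y $ 1, y $ 2, \<phi> (vector [y $ 1, y $ 2])]" for y
        unfolding H_def by (rule surj_f_inv_f[OF bij_is_surj[OF bij]])
      have "norm (H y - H x) = norm (A (H y - H x))" by (simp only: orthogonal_transformation_norm[OF A])
      then have "norm (H y - H x) = norm ?d" by (simp only: linear_diff[OF linA] AH)
      also have "\<dots> \<le> (\<Sum>i\<in>UNIV. \<bar>?d $ i\<bar>)" by (rule norm_le_l1_cart)
      also have "\<dots> = \<bar>y $ 1 - x $ 1\<bar> + \<bar>y $ 2 - x $ 2\<bar> + \<bar>\<phi> (vector [y $ 1, y $ 2]) - \<phi> (vector [x $ 1, x $ 2])\<bar>"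
        by (simp add: sum_3)
      finally have "norm (H y - H x) \<le> \<bar>y $ 1 - x $ 1\<bar> + \<bar>y $ 2 - x $ 2\<bar>
          + \<bar>\<phi> (vector [y $ 1, y $ 2]) - \<phi> (vector [x $ 1, x $ 2])\<bar>" .
      moreover have "\<bar>\<phi> (vector [y $ 1, y $ 2]) - \<phi> (vector [x $ 1, x $ 2])\<bar> \<le> \<bar>L\<bar> * (2 * norm (y - x))"
      proof -
        have "\<bar>\<phi> (vector [y $ 1, y $ 2]) - \<phi> (vector [x $ 1, x $ 2])\<bar> \<le> L * dist (vector [y $ 1, y $ 2] :: real^2) (vector [x $ 1, x $ 2])"
          using lipschitz_onD[OF \<phi>] by (simp add: dist_real_def)
        also have "\<dots> \<le> \<bar>L\<bar> * (2 * norm (y - x))"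
        proof (intro mult_mono)
          have "dist (vector [y $ 1, y $ 2] :: real^2) (vector [x $ 1, x $ 2]) \<le> (\<Sum>i\<in>UNIV. \<bar>(vector [y $ 1, y $ 2] - vector [x $ 1, x $ 2] :: real^2) $ i\<bar>)"
            unfolding dist_norm by (rule norm_le_l1_cart)
          also have "\<dots> = \<bar>(y - x) $ 1\<bar> + \<bar>(y - x) $ 2\<bar>" by (simp add: sum_2)
          also have "\<dots> \<le> 2 * norm (y - x)"
            using component_le_norm_cart[of "y - x" 1] component_le_norm_cart[of "y - x" 2] by linarith
          finally show "dist (vector [y $ 1, y $ 2] :: real^2) (vector [x $ 1, x $ 2]) \<le> 2 * norm (y - x)" .
        qed auto
        finally show ?thesis .
      qed
      moreover have "\<bar>y $ 1 - x $ 1\<bar> \<le> norm (y - x)" using component_le_norm_cart[of "y - x" 1] by simp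
      moreover have "\<bar>y $ 2 - x $ 2\<bar> \<le> norm (y - x)" using component_le_norm_cart[of "y - x" 2] by simp
      moreover have "(3 + \<bar>L\<bar> * 2) * norm (y - x) = 3 * norm (y - x) + \<bar>L\<bar> * (2 * norm (y - x))"
        by (simp add: algebra_simps)
      ultimately show ?thesis using norm_ge_zero[of "y - x"] by linarith
    qed
    have "negligible {y :: real^3. y $ 3 = 0}"
      by (rule negligible_standard_hyperplane_cart)
    then have "negligible (H ` {y. y $ 3 = 0})"
    proof (rule negligible_locally_Lipschitz_image[OF order_refl])
      fix x :: "real^3"
      show "\<exists>T B. open T \<and> x \<in> T \<and> (\<forall>y\<in>{y. y $ 3 = 0} \<inter> T. norm (H y - H x) \<le> B * norm (y - x))"
        using Hlip by (intro exI[of _ UNIV] exI[of _ "3 + \<bar>L\<bar> * 2"]) simp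
    qed
    then show ?thesis
      using U negligible_subset[OF _ subset_trans[OF sub img]] by blast
  qed
  show ?thesis
  proof (subst locally_negligible_alt, intro ballI)
    fix p assume p: "p \<in> frontier D"
    then obtain U where "open U" "p \<in> U" "negligible (frontier D \<inter> U)" using loc by blast
    then show "\<exists>U. openin (top_of_set (frontier D)) U \<and> p \<in> U \<and> negligible U"
      using p by (intro exI[of _ "frontier D \<inter> U"]) (simp add: openin_open_Int)
  qed
qed

section \<open>Representation of the scattered field below the scatterer\<close>

lemma AE_lebesgue_on: "S \<in> sets lebesgue \<Longrightarrow> (AE x in lebesgue_on S. P x) \<longleftrightarrow> (AE x in lebesgue. x \<in> S \<longrightarrow> P x)"
  by (simp add: AE_restrict_space_iff)

text \<open>Brings the potential, a uniform limit of modal sums, under the hypotheses of a radiating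
  field, so that its amplitudes are read off by the same lemmas as those of the scattered
  field.\<close>

lemma L2_uniform_limit:
  fixes V :: "real^3 \<Rightarrow> complex^3"
  assumes u: "uniform_limit (section_between a b R' R) VN V sequentially"
    and c: "\<And>N. continuous_on UNIV (VN N)"
  shows "continuous_on (section_between a b R' R) V" "V \<in> L2 (section_between a b R' R)"
    "(\<lambda>N. L2norm (section_between a b R' R) (\<lambda>x. V x - VN N x)) \<longlonglongrightarrow> 0"
proof -
  let ?S = "section_between a b R' R"
  show V: "continuous_on ?S V"
    by (rule uniform_limit_theorem[OF always_eventually u]) (intro allI continuous_on_subset[OF c] subset_UNIV, simp)
  have vm: "V \<in> borel_measurable (lebesgue_on ?S)"
    by (rule continuous_imp_measurable_on_sets_lebesgue[OF V sets_section_between])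
  have dm: "(\<lambda>x. V x - VN N x) \<in> borel_measurable (lebesgue_on ?S)" for N
    using vm continuous_measurable_lebesgue_on[OF c] by (intro borel_measurable_diff)
  have close: "\<exists>N0. \<forall>N\<ge>N0. \<forall>x\<in>?S. norm (V x - VN N x) \<le> e" if "e > 0" for e
    using u that unfolding uniform_limit_iff eventually_sequentially dist_norm
    by (metis less_imp_le norm_minus_commute)
  obtain N1 where N1: "\<forall>x\<in>?S. norm (V x - VN N1 x) \<le> 1" using close[of 1] by auto
  have "(\<lambda>x. V x - VN N1 x) \<in> L2 ?S"
    by (rule L2_bounded[OF dm lmeasurable_section_between]) (use N1 in blast)
  from L2_add[OF this L2_continuous_section[OF c[of N1]]] show VL2: "V \<in> L2 ?S" by simp
  let ?v = "measure lebesgue ?S"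
  have bound: "L2norm ?S (\<lambda>x. V x - VN N x) \<le> e * sqrt ?v" if e: "0 < e" and le: "\<forall>x\<in>?S. norm (V x - VN N x) \<le> e" for e N
  proof -
    have i: "integrable (lebesgue_on ?S) (\<lambda>x. (norm (V x - VN N x))\<^sup>2)"
      by (rule L2_integrable[OF L2_diff[OF VL2 L2_continuous_section[OF c]]])
    have "(LINT x|lebesgue_on ?S. (norm (V x - VN N x))\<^sup>2) \<le> (LINT x|lebesgue_on ?S. e\<^sup>2)"
      by (rule integral_mono[OF i integrable_const_lebesgue_on[OF lmeasurable_section_between]])
         (use le in \<open>auto intro!: power_mono\<close>)
    also have "\<dots> = e\<^sup>2 * ?v" by (simp add: measure_restrict_space)
    finally have "L2norm ?S (\<lambda>x. V x - VN N x) \<le> sqrt (e\<^sup>2 * ?v)" unfolding L2norm_def by (rule real_sqrt_le_mono)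
    then show ?thesis using e by (simp add: real_sqrt_mult)
  qed
  show "(\<lambda>N. L2norm ?S (\<lambda>x. V x - VN N x)) \<longlonglongrightarrow> 0"
  proof (rule LIMSEQ_I)
    fix d :: real assume d: "0 < d"
    define e where "e = d / (2 * (sqrt ?v + 1))"
    have e: "e > 0" using d by (simp add: e_def add_nonneg_pos)
    obtain N0 where N0: "\<forall>N\<ge>N0. \<forall>x\<in>?S. norm (V x - VN N x) \<le> e" using close[OF e] by blast
    have "norm (L2norm ?S (\<lambda>x. V x - VN N x) - 0) < d" if "N \<ge> N0" for N
    proof -
      have "L2norm ?S (\<lambda>x. V x - VN N x) \<le> e * sqrt ?v" using bound[OF e] N0 that by blast
      also have "\<dots> < e * (2 * (sqrt ?v + 1))"
      proof -
        have "s < 2 * (s + 1)" if "0 \<le> s" for s :: real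
          using that by (simp add: algebra_simps add_strict_increasing2)
        from this[of "sqrt ?v"] have "sqrt ?v < 2 * (sqrt ?v + 1)" by simp
        then show ?thesis using e by (intro mult_strict_left_mono)
      qed
      also have "\<dots> = d"
      proof -
        have "2 * (sqrt ?v + 1) \<noteq> 0" by (simp add: add_nonneg_eq_0_iff)
        then show ?thesis by (simp add: e_def)
      qed
      finally have "L2norm ?S (\<lambda>x. V x - VN N x) < d" .
      moreover have "0 \<le> L2norm ?S (\<lambda>x. V x - VN N x)" unfolding L2norm_def by (simp add: Bochner_Integration.integral_nonneg)
      ultimately show ?thesis by simp
    qed
    then show "\<exists>N0. \<forall>N\<ge>N0. norm (L2norm ?S (\<lambda>x. V x - VN N x) - 0) < d" by blast
  qed
qed

lemma linear_system_unique:
  fixes P Q m1 m2 n1 n2 :: complex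
  assumes "- Q * m1 + P * m2 = - Q * n1 + P * n2" "P * m1 + Q * m2 = P * n1 + Q * n2" "P\<^sup>2 + Q\<^sup>2 \<noteq> 0"
  shows "m1 = n1" "m2 = n2"
proof -
  have "(P\<^sup>2 + Q\<^sup>2) * m1 = P * (P * m1 + Q * m2) - Q * (- Q * m1 + P * m2)"
    "(P\<^sup>2 + Q\<^sup>2) * m2 = Q * (P * m1 + Q * m2) + P * (- Q * m1 + P * m2)"
    by (simp_all add: algebra_simps power2_eq_square)
  moreover have "(P\<^sup>2 + Q\<^sup>2) * n1 = P * (P * n1 + Q * n2) - Q * (- Q * n1 + P * n2)"
    "(P\<^sup>2 + Q\<^sup>2) * n2 = Q * (P * n1 + Q * n2) + P * (- Q * n1 + P * n2)"
    by (simp_all add: algebra_simps power2_eq_square)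
  ultimately have "(P\<^sup>2 + Q\<^sup>2) * m1 = (P\<^sup>2 + Q\<^sup>2) * n1" "(P\<^sup>2 + Q\<^sup>2) * m2 = (P\<^sup>2 + Q\<^sup>2) * n2"
    unfolding assms(1,2) by simp_all
  then show "m1 = n1" "m2 = n2" using assms(3) by simp_all
qed

text \<open>Two heights are fixed between the surface and D. The source lies above \<rho>, fields
  are represented by modes below \<sigma>, and the gap between the two is the distance that yields
  exponential decay. The surface is strictly below \<sigma>, so it has a neighbourhood where the
  representation holds.\<close>

locale waveguide_scattering =
  fixes a b k r \<rho> \<sigma> :: real and te tm :: "nat \<Rightarrow> nat \<times> nat" and D :: "(real^3) set" and eps :: "real^3 \<Rightarrow> complex"
  assumes ab: "0 < a" "0 < b" and k: "0 < k" and enum: "mode_enumeration a b te tm"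
    and te_nonres: "\<And>m. k\<^sup>2 \<noteq> (lam a b te m)\<^sup>2"
    and tm_nonres: "\<And>n. n \<ge> 1 \<Longrightarrow> k\<^sup>2 \<noteq> (mu a b tm n)\<^sup>2"
    and adm: "admissible_scatterer a b D r"
    and perm: "permittivity a b D eps"
    and wp: "well_posed a b k te tm D eps"
    and levels: "r < \<sigma>" "\<sigma> < \<rho>" "\<rho> < 0" "\<And>x. x \<in> D \<Longrightarrow> \<rho> < x $ 3"
begin

abbreviation W where "W \<equiv> waveguide a b"
abbreviation sec where "sec \<equiv> section_between a b"
abbreviation scat where "scat \<equiv> scattered_field a b k te tm D eps"
abbreviation T where "T \<equiv> T_op a b k te tm D eps"
abbreviation ssol where "ssol \<equiv> solves_scattering a b k te tm D eps"

definition contrast :: "real^3 \<Rightarrow> complex" where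
  "contrast x = of_real (k\<^sup>2) * (eps x - 1)"

lemma T_eq: "T wi x = contrast x *s (wi x + scat wi x)"
  by (simp add: T_op_def contrast_def)

lemma D_props: "open D" "D \<in> sets lebesgue" "D \<subseteq> sec r 0" "D \<subseteq> W" "D \<in> lmeasurable" "r < 0"
proof -
  have *: "open D" "bounded D" "D \<subseteq> sec r 0" "r < 0"
    using adm unfolding admissible_scatterer_def lipschitz_domain_def by auto
  then show "open D" "D \<subseteq> sec r 0" "r < 0" by auto
  show s: "D \<in> sets lebesgue" using *(1) by (simp add: borel_open sets_completionI_sets)
  show "D \<subseteq> W" using *(3) section_subset_waveguide[of 0 a b r] by auto
  show "D \<in> lmeasurable" by (rule bounded_set_imp_lmeasurable[OF *(2) s])
qed

lemma eps_outside: "AE x in lebesgue. x \<in> W \<longrightarrow> x \<notin> D \<longrightarrow> eps x = 1"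
proof -
  have c: "W - closure D \<in> sets lebesgue" by (intro sets.Diff sets_waveguide) (simp add: borel_closed sets_completionI_sets)
  have "AE x in lebesgue_on (W - closure D). eps x = 1" using perm unfolding permittivity_def by blast
  then have 1: "AE x in lebesgue. x \<in> W - closure D \<longrightarrow> eps x = 1" unfolding AE_lebesgue_on[OF c] .
  have "negligible (frontier D)"
    using adm unfolding admissible_scatterer_def by (intro negligible_frontier_lipschitz) auto
  then have "AE x in lebesgue. x \<notin> frontier D" by (simp add: negligible_iff_null_sets AE_not_in)
  with 1 show ?thesis
  proof eventually_elim
    case (elim x)
    then show ?case using D_props(1) by (auto simp: frontier_def interior_open)
  qed
qed

lemma contrast_measurable: "S \<subseteq> W \<Longrightarrow> contrast \<in> borel_measurable (lebesgue_on S)"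
proof -
  assume S: "S \<subseteq> W"
  have "eps \<in> borel_measurable (lebesgue_on W)" using perm unfolding permittivity_def by blast
  then have "eps \<in> borel_measurable (lebesgue_on S)" by (rule measurable_restrict_mono[OF _ S])
  then show ?thesis unfolding contrast_def by measurable
qed

lemma contrast_bounded:
  obtains C where "0 \<le> C" "\<And>S. S \<subseteq> W \<Longrightarrow> S \<in> sets lebesgue \<Longrightarrow> AE x in lebesgue_on S. norm (contrast x) \<le> C"
proof -
  obtain C where "AE x in lebesgue_on W. norm (eps x) \<le> C" using perm unfolding permittivity_def by blast
  then have C: "AE x in lebesgue. x \<in> W \<longrightarrow> norm (eps x) \<le> C" unfolding AE_lebesgue_on[OF sets_waveguide] .
  show thesis
  proof (rule that[of "k\<^sup>2 * (\<bar>C\<bar> + 1)"])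
    fix S assume S: "S \<subseteq> W" "S \<in> sets lebesgue"
    show "AE x in lebesgue_on S. norm (contrast x) \<le> k\<^sup>2 * (\<bar>C\<bar> + 1)"
      unfolding AE_lebesgue_on[OF S(2)] using C
    proof eventually_elim
      case (elim x)
      show ?case
      proof
        assume "x \<in> S"
        then have "norm (eps x) \<le> \<bar>C\<bar>" using elim S(1) by auto
        then have "norm (eps x - 1) \<le> \<bar>C\<bar> + 1" using norm_triangle_ineq4[of "eps x" 1] by simp
        then show "norm (contrast x) \<le> k\<^sup>2 * (\<bar>C\<bar> + 1)"
          unfolding contrast_def norm_mult by (simp add: norm_power mult_left_mono)
      qed
    qed
  qed simp
qed

lemma contrast_L2:
  fixes f :: "real^3 \<Rightarrow> complex^3"
  assumes "f \<in> L2 S" "S \<subseteq> W" "S \<in> sets lebesgue"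
  shows "(\<lambda>x. contrast x *s f x) \<in> L2 S"
proof -
  obtain C where "AE x in lebesgue_on S. norm (contrast x) \<le> C"
    using contrast_bounded assms(2,3) by metis
  then show ?thesis by (rule L2_mult_AE_bounded(1)[OF assms(1) contrast_measurable[OF assms(2)]])
qed

lemma scat_solves: "wi \<in> L2 D \<Longrightarrow> \<exists>c. ssol wi (scat wi) c"
proof -
  assume "wi \<in> L2 D"
  then have "\<exists>w. \<exists>c. ssol wi w c" using wp unfolding well_posed_def by blast
  then show ?thesis unfolding scattered_field_def by (rule someI_ex)
qed

lemma ssol_L2: "ssol wi w c \<Longrightarrow> R < 0 \<Longrightarrow> w \<in> L2 (sec R 0)" "ssol wi w c \<Longrightarrow> R < 0 \<Longrightarrow> c \<in> L2 (sec R 0)"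
  unfolding solves_scattering_def by blast+

lemma ssol_L2_D: "ssol wi w c \<Longrightarrow> w \<in> L2 D"
  by (rule L2_subset[OF ssol_L2(1) D_props(3,2) sets_section_between]) (use D_props(6) in auto)

lemma T_L2: "wi \<in> L2 D \<Longrightarrow> T wi \<in> L2 D"
proof -
  assume wi: "wi \<in> L2 D"
  obtain c where "ssol wi (scat wi) c" using scat_solves[OF wi] by blast
  from L2_add[OF wi ssol_L2_D[OF this]] have "(\<lambda>x. contrast x *s (wi x + scat wi x)) \<in> L2 D"
    by (rule contrast_L2[OF _ D_props(4,2)])
  then show ?thesis unfolding T_eq[abs_def] .
qed

definition src :: "(real^3 \<Rightarrow> complex^3) \<Rightarrow> real^3 \<Rightarrow> complex^3" where
  "src wi x = indicator D x *\<^sub>R T wi x"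

lemma src_L2: "wi \<in> L2 D \<Longrightarrow> S \<in> sets lebesgue \<Longrightarrow> src wi \<in> L2 S"
proof -
  assume wi: "wi \<in> L2 D" and S: "S \<in> sets lebesgue"
  have "src wi \<in> borel_measurable lebesgue"
    using L2_measurable[OF T_L2[OF wi]] D_props(2)
    by (simp add: borel_measurable_restrict_space_iff src_def[abs_def])
  moreover have "integrable lebesgue (\<lambda>x. (norm (src wi x))\<^sup>2)"
  proof -
    have "(\<lambda>x. (norm (src wi x))\<^sup>2) = (\<lambda>x. indicator D x *\<^sub>R (norm (T wi x))\<^sup>2)"
      by (rule ext) (auto simp: src_def indicator_def)
    then show ?thesis
      using L2_integrable[OF T_L2[OF wi]] D_props(2) by (simp add: integrable_restrict_space)
  qed
  ultimately have "src wi \<in> L2 UNIV" by (simp add: L2_def lebesgue_on_UNIV_eq)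
  from L2_subset[OF this _ S] show ?thesis by simp
qed

lemma src_integral:
  fixes h :: "complex^3 \<Rightarrow> real^3 \<Rightarrow> complex"
  assumes "\<And>x. h 0 x = 0"
  shows "(LINT x|lebesgue_on W. h (src wi x) x) = (LINT x|lebesgue_on D. h (T wi x) x)"
proof -
  have "(LINT x|lebesgue_on W. h (src wi x) x) = (LINT x|lebesgue_on D. h (src wi x) x)"
    by (rule integral_lebesgue_on_subset(1)[OF D_props(4,2) sets_waveguide]) (simp add: src_def assms)
  also have "\<dots> = (LINT x|lebesgue_on D. h (T wi x) x)"
    by (rule Bochner_Integration.integral_cong) (auto simp: src_def)
  finally show ?thesis .
qed

lemma ssol_weak_maxwell:
  assumes wi: "wi \<in> L2 D" and sol: "ssol wi (scat wi) c"
  shows "weak_maxwell a b k \<rho> (scat wi) c (src wi)"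
proof
  let ?w = "scat wi"
  show "0 < a" "0 < b" "0 < k" "\<rho> < 0" by (rule ab k levels)+
  show w: "?w \<in> L2 (sec R 0)" and cc: "c \<in> L2 (sec R 0)" if "R < 0" for R
    using ssol_L2[OF sol that] .
  show "src wi \<in> L2 (sec R 0)" for R by (rule src_L2[OF wi sets_section_between])
  show "zero_tangential_trace W ?w c" using sol unfolding solves_scattering_def by blast
  show "src wi x = 0" if "x $ 3 \<le> \<rho>" for x
    using levels(4)[of x] that by (auto simp: src_def indicator_def)
  fix \<phi> assume \<phi>: "\<phi> \<in> test_fields W"
  obtain K where K: "compact K" "continuous_on UNIV \<phi>" "continuous_on UNIV (curl \<phi>)"
    "\<And>x. x \<notin> K \<Longrightarrow> \<phi> x = 0" "\<And>x. x \<notin> K \<Longrightarrow> curl \<phi> x = 0"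
    by (rule test_field_props[OF \<phi>]) blast
  define u where "u x = contrast x *s ?w x" for x
  have uL2: "u \<in> L2 (sec R 0)" if "R < 0" for R
    unfolding u_def by (rule contrast_L2[OF w[OF that] section_subset_waveguide sets_section_between]) simp
  have i1: "integrable (lebesgue_on W) (\<lambda>x. cdot (c x) (curl \<phi> x))"
    by (rule integrable_cdot_waveguide[OF cc K(3,1,5)])
  have i2: "integrable (lebesgue_on W) (\<lambda>x. cdot (?w x) (\<phi> x))"
    by (rule integrable_cdot_waveguide[OF w K(2,1,4)])
  have i3: "integrable (lebesgue_on W) (\<lambda>x. cdot (u x) (\<phi> x))"
    by (rule integrable_cdot_waveguide[OF uL2 K(2,1,4)])
  have "bounded (\<phi> ` K)" by (intro compact_imp_bounded compact_continuous_image continuous_on_subset[OF K(2)] K(1)) auto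
  then obtain B where B: "\<And>x. x \<in> K \<Longrightarrow> norm (\<phi> x) \<le> B" unfolding bounded_iff by blast
  have B': "norm (\<phi> x $ i) \<le> \<bar>B\<bar>" for x i
    using B[of x] Finite_Cartesian_Product.norm_nth_le[of "\<phi> x" i] K(4)[of x] by (cases "x \<in> K") auto
  have iD: "integrable (lebesgue_on D) (\<lambda>x. cdot (v x) (\<phi> x))" if "v \<in> L2 D" for v
    unfolding cdot_def
    by (intro Bochner_Integration.integrable_sum L2_integrable_mult[OF that D_props(5) _ B']
        continuous_measurable_lebesgue_on continuous_on_component K)
  have mwi: "(\<lambda>x. contrast x *s wi x) \<in> L2 D" by (rule contrast_L2[OF wi D_props(4,2)])
  have mw: "u \<in> L2 D" unfolding u_def by (rule contrast_L2[OF ssol_L2_D[OF sol] D_props(4,2)])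
  have eq: "(LINT x|lebesgue_on W. cdot (c x) (curl \<phi> x) - of_real (k\<^sup>2) * eps x * cdot (?w x) (\<phi> x))
        = (LINT x|lebesgue_on D. of_real (k\<^sup>2) * (eps x - 1) * cdot (wi x) (\<phi> x))"
    using sol \<phi> unfolding solves_scattering_def by blast
  have e1: "cdot (c x) (curl \<phi> x) - of_real (k\<^sup>2) * eps x * cdot (?w x) (\<phi> x)
      = (cdot (c x) (curl \<phi> x) - of_real (k\<^sup>2) * cdot (?w x) (\<phi> x)) - cdot (u x) (\<phi> x)" for x
    unfolding u_def cdot_simps(3) contrast_def by (simp add: algebra_simps)
  have e2: "of_real (k\<^sup>2) * (eps x - 1) * cdot (wi x) (\<phi> x) = cdot (contrast x *s wi x) (\<phi> x)" for x
    unfolding cdot_simps(3) contrast_def by simp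
  have A: "(LINT x|lebesgue_on W. cdot (c x) (curl \<phi> x) - of_real (k\<^sup>2) * cdot (?w x) (\<phi> x))
      = (LINT x|lebesgue_on D. cdot (contrast x *s wi x) (\<phi> x)) + (LINT x|lebesgue_on W. cdot (u x) (\<phi> x))"
  proof -
    have "integrable (lebesgue_on W) (\<lambda>x. cdot (c x) (curl \<phi> x) - of_real (k\<^sup>2) * cdot (?w x) (\<phi> x))"
      using i1 i2 by (intro Bochner_Integration.integrable_diff integrable_mult_right)
    from Bochner_Integration.integral_diff[OF this i3] eq[unfolded e1 e2]
    have "(LINT x|lebesgue_on W. cdot (c x) (curl \<phi> x) - of_real (k\<^sup>2) * cdot (?w x) (\<phi> x))
        - (LINT x|lebesgue_on W. cdot (u x) (\<phi> x)) = (LINT x|lebesgue_on D. cdot (contrast x *s wi x) (\<phi> x))"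
      by (simp only:)
    then show ?thesis by (simp only: diff_eq_eq)
  qed
  \<comment> \<open>Outside D the contrast vanishes almost everywhere, the frontier being a null
    set.\<close>
  have U: "(LINT x|lebesgue_on W. cdot (u x) (\<phi> x)) = (LINT x|lebesgue_on D. cdot (u x) (\<phi> x))"
  proof -
    have "(LINT x|lebesgue_on W. cdot (u x) (\<phi> x)) = (LINT x|lebesgue_on W. indicator D x *\<^sub>R cdot (u x) (\<phi> x))"
    proof (rule integral_cong_AE)
      show "(\<lambda>x. cdot (u x) (\<phi> x)) \<in> borel_measurable (lebesgue_on W)" using i3 by simp
      then show "(\<lambda>x. indicator D x *\<^sub>R cdot (u x) (\<phi> x)) \<in> borel_measurable (lebesgue_on W)"
      proof (intro borel_measurable_scaleR borel_measurable_indicator)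
        show "D \<in> sets (lebesgue_on W)"
          using D_props(2,4) by (simp add: sets_restrict_space_iff)
      qed
      show "AE x in lebesgue_on W. cdot (u x) (\<phi> x) = indicator D x *\<^sub>R cdot (u x) (\<phi> x)"
        unfolding AE_lebesgue_on[OF sets_waveguide] using eps_outside
      proof eventually_elim
        case (elim x)
        then show ?case by (cases "x \<in> D") (auto simp: u_def contrast_def cdot_def)
      qed
    qed
    also have "\<dots> = (LINT x|lebesgue_on D. indicator D x *\<^sub>R cdot (u x) (\<phi> x))"
      by (rule integral_lebesgue_on_subset(1)[OF D_props(4,2) sets_waveguide]) simp
    also have "\<dots> = (LINT x|lebesgue_on D. cdot (u x) (\<phi> x))"
      by (rule Bochner_Integration.integral_cong) auto
    finally show ?thesis .
  qed
  have S: "(LINT x|lebesgue_on W. cdot (src wi x) (\<phi> x)) = (LINT x|lebesgue_on D. cdot (T wi x) (\<phi> x))"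
    by (rule src_integral[of "\<lambda>v x. cdot v (\<phi> x)"]) (simp add: cdot_def)
  have "(LINT x|lebesgue_on D. cdot (T wi x) (\<phi> x))
      = (LINT x|lebesgue_on D. cdot (contrast x *s wi x) (\<phi> x) + cdot (u x) (\<phi> x))"
    unfolding T_eq u_def cdot_simps(1,3) by (simp add: algebra_simps)
  also have "\<dots> = (LINT x|lebesgue_on D. cdot (contrast x *s wi x) (\<phi> x)) + (LINT x|lebesgue_on D. cdot (u x) (\<phi> x))"
    by (rule Bochner_Integration.integral_add[OF iD[OF mwi] iD[OF mw]])
  finally show "(LINT x|lebesgue_on W. cdot (c x) (curl \<phi> x) - of_real (k\<^sup>2) * cdot (?w x) (\<phi> x))
      = (LINT x|lebesgue_on W. cdot (src wi x) (\<phi> x))"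
    unfolding A U S by simp
qed

abbreviation TEi where "TEi j \<equiv> TE_in a b k te (Suc j)"
abbreviation TEo where "TEo j \<equiv> TE_out a b k te (Suc j)"
abbreviation TMi where "TMi j \<equiv> TM_in a b k tm (Suc j)"
abbreviation TMo where "TMo j \<equiv> TM_out a b k tm (Suc j)"

text \<open>The amplitude of the outgoing mode m below D, as predicted by the Green function: the
  moment of the source against the standing-wave factor of its term.\<close>

definition te_amp :: "(real^3 \<Rightarrow> complex^3) \<Rightarrow> nat \<Rightarrow> complex" where
  "te_amp wi m = (LINT y|lebesgue_on D. cdot (TE_in a b k te m y) (T wi y))"

definition tm_amp :: "(real^3 \<Rightarrow> complex^3) \<Rightarrow> nat \<Rightarrow> complex" where
  "tm_amp wi n = (LINT y|lebesgue_on D. cdot (TM_in a b k tm n y) (T wi y))"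

text \<open>The volume potential of the source, written with integral and series already exchanged.
  \<open>potential_green\<close> identifies it with the integral of the Green function over
  D.\<close>

definition potential :: "(real^3 \<Rightarrow> complex^3) \<Rightarrow> real^3 \<Rightarrow> complex^3" where
  "potential wi x = (\<Sum>j. te_amp wi (Suc j) *s TEo j x) + (\<Sum>j. tm_amp wi (Suc j) *s TMo j x)"

lemma src_pairing:
  assumes wi: "wi \<in> L2 D" and v: "\<And>y i. v y $ i = z * (co i * sep (profile_at a b i p (f i)) y)"
    and f: "\<And>i. smooth1 (f i)"
  shows "(LINT y|lebesgue_on D. cdot (v y) (T wi y))
    = z * (\<Sum>i\<in>UNIV. co i * mode_int a b (real (fst p) * pi / a) (real (snd p) * pi / b) (src wi) i (f i))"
proof -
  have i: "integrable (lebesgue_on W) (\<lambda>x. src wi x $ i * sep (profile_at a b i p (f i)) x)" for i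
  proof -
    have "integrable (lebesgue_on (sec \<rho> 0)) (\<lambda>x. src wi x $ i * sep (profile_at a b i p (f i)) x)"
      by (rule integrable_sep_section[OF src_L2[OF wi sets_section_between]]) (rule smooth1_trig_profile[OF f])
    moreover have "src wi x = 0" if "x \<in> W - sec \<rho> 0" for x
      using that levels(4)[of x] by (auto simp: waveguide_eq section_between_eq src_def indicator_def)
    ultimately show ?thesis
      by (subst integral_lebesgue_on_subset(2)[of "sec \<rho> 0"]) (auto simp: section_subset_waveguide)
  qed
  have "(LINT y|lebesgue_on D. cdot (v y) (T wi y)) = (LINT y|lebesgue_on W. cdot (v y) (src wi y))"
    by (rule src_integral[of "\<lambda>u y. cdot (v y) u", symmetric]) (simp add: cdot_def)
  also have "\<dots> = (LINT y|lebesgue_on W. (\<Sum>i\<in>UNIV. z * (co i * (src wi y $ i * sep (profile_at a b i p (f i)) y))))"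
    unfolding cdot_def v by (simp add: mult_ac)
  also have "\<dots> = (\<Sum>i\<in>UNIV. z * (co i * (LINT y|lebesgue_on W. src wi y $ i * sep (profile_at a b i p (f i)) y)))"
    using i by simp
  finally show ?thesis unfolding mode_int_def wint_def by (simp add: sum_distrib_left)
qed

end

section \<open>Amplitudes of the scattered field and equality with the potential\<close>

context waveguide_scattering
begin

lemma T_integrable: "wi \<in> L2 D \<Longrightarrow> integrable (lebesgue_on D) (T wi)"
  using integrable_norm_iff[OF L2_measurable[OF T_L2]] L2_integrable_norm[OF T_L2 D_props(5)] by blast

lemma D_height: "x \<in> D \<Longrightarrow> \<rho> \<le> x $ 3" "x \<in> D \<Longrightarrow> x $ 3 \<le> 0"
  using levels(4)[of x] D_props(4) by (auto simp: waveguide_eq)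

lemma source_series:
  assumes dp: "decaying_pair \<rho> \<sigma> \<psi> \<phi> \<alpha> \<beta>" and wi: "wi \<in> L2 D"
  shows "uniform_limit {x. x $ 3 \<le> \<sigma>} (\<lambda>N x. \<Sum>j<N. (LINT y|lebesgue_on D. cdot (\<psi> j y) (T wi y)) *s \<phi> j x)
      (\<lambda>x. \<Sum>j. (LINT y|lebesgue_on D. cdot (\<psi> j y) (T wi y)) *s \<phi> j x) sequentially"
    and "x $ 3 \<le> \<sigma> \<Longrightarrow> (LINT y|lebesgue_on D. (\<Sum>j. cdot (\<psi> j y) (T wi y) *s \<phi> j x))
      = (\<Sum>j. (LINT y|lebesgue_on D. cdot (\<psi> j y) (T wi y)) *s \<phi> j x)"
    and "x $ 3 \<le> \<sigma> \<Longrightarrow> integrable (lebesgue_on D) (\<lambda>y. (\<Sum>j. cdot (\<psi> j y) (T wi y) *s \<phi> j x))"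
    and "norm (LINT y|lebesgue_on D. cdot (\<psi> j y) (T wi y)) \<le> 3 * \<alpha> j * (LINT y|lebesgue_on D. norm (T wi y))"
    and "integrable (lebesgue_on D) (\<lambda>y. cdot (\<psi> j y) (T wi y))"
proof -
  note d = decaying_pairD[OF dp]
  have m: "\<psi> j \<in> borel_measurable (lebesgue_on D)" for j by (rule continuous_measurable_lebesgue_on[OF d(1)])
  have \<alpha>: "norm (\<psi> j y) \<le> \<alpha> j" if "y \<in> space (lebesgue_on D)" for j y
    using that by (intro d(5) D_height) auto
  note ser = integral_cdot_series[OF T_integrable[OF wi] m \<alpha>]
  \<comment> \<open>This and the next conclusion involve neither v nor \<beta>, so both are set to
    0. The bounds \<alpha> alone need not be summable.\<close>
  show b: "norm (LINT y|lebesgue_on D. cdot (\<psi> j y) (T wi y)) \<le> 3 * \<alpha> j * (LINT y|lebesgue_on D. norm (T wi y))" for j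
    by (rule ser(4)[where v = "\<lambda>_. 0" and \<beta> = "\<lambda>_. 0"]) (use d(3) in auto)
  show "integrable (lebesgue_on D) (\<lambda>y. cdot (\<psi> j y) (T wi y))"
    by (rule ser(5)[where v = "\<lambda>_. 0" and \<beta> = "\<lambda>_. 0"]) (use d(3) in auto)
  show "(LINT y|lebesgue_on D. (\<Sum>j. cdot (\<psi> j y) (T wi y) *s \<phi> j x))
      = (\<Sum>j. (LINT y|lebesgue_on D. cdot (\<psi> j y) (T wi y)) *s \<phi> j x)" if "x $ 3 \<le> \<sigma>"
    by (rule ser(1)[where \<beta> = \<beta>]) (use d(3,6,7) that in auto)
  show "integrable (lebesgue_on D) (\<lambda>y. (\<Sum>j. cdot (\<psi> j y) (T wi y) *s \<phi> j x))" if "x $ 3 \<le> \<sigma>"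
    by (rule ser(2)[where \<beta> = \<beta>]) (use d(3,6,7) that in auto)
  let ?t = "LINT y|lebesgue_on D. norm (T wi y)"
  show "uniform_limit {x. x $ 3 \<le> \<sigma>} (\<lambda>N x. \<Sum>j<N. (LINT y|lebesgue_on D. cdot (\<psi> j y) (T wi y)) *s \<phi> j x)
      (\<lambda>x. \<Sum>j. (LINT y|lebesgue_on D. cdot (\<psi> j y) (T wi y)) *s \<phi> j x) sequentially"
  proof (rule Weierstrass_m_test)
    show "summable (\<lambda>j. 3 * ?t * (\<alpha> j * \<beta> j))" by (intro summable_mult d(7))
    fix j and x :: "real^3" assume "x \<in> {x. x $ 3 \<le> \<sigma>}"
    then have "norm (LINT y|lebesgue_on D. cdot (\<psi> j y) (T wi y)) * norm (\<phi> j x) \<le> (3 * \<alpha> j * ?t) * \<beta> j"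
      using b d(3)[of j] d(6)[of x j] by (intro mult_mono) (auto simp: Bochner_Integration.integral_nonneg)
    then show "norm ((LINT y|lebesgue_on D. cdot (\<psi> j y) (T wi y)) *s \<phi> j x) \<le> 3 * ?t * (\<alpha> j * \<beta> j)"
      unfolding norm_vsmult by (simp add: mult_ac)
  qed
qed

lemma potential_uniform:
  assumes wi: "wi \<in> L2 D"
  shows "uniform_limit {x. x $ 3 \<le> \<sigma>} (modal_sum a b k te tm (te_amp wi) (tm_amp wi)) (potential wi) sequentially"
proof -
  obtain \<alpha> \<beta> where E: "decaying_pair \<rho> \<sigma> (\<lambda>j. TEi j) (\<lambda>j. TEo j) \<alpha> \<beta>"
    by (rule decaying_TE[OF ab k enum te_nonres levels(2)]) blast
  obtain \<alpha>' \<beta>' where M: "decaying_pair \<rho> \<sigma> (\<lambda>j. TMi j) (\<lambda>j. TMo j) \<alpha>' \<beta>'"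
    by (rule decaying_TM[OF ab k enum tm_nonres levels(2)]) blast+
  have "modal_sum a b k te tm (te_amp wi) (tm_amp wi) N x
      = (\<Sum>j<N. te_amp wi (Suc j) *s TEo j x) + (\<Sum>j<N. tm_amp wi (Suc j) *s TMo j x)" for N x
    unfolding modal_sum_def TE_out_def TM_out_def by (simp add: sum.atLeast1_atMost_eq)
  then have "modal_sum a b k te tm (te_amp wi) (tm_amp wi)
      = (\<lambda>N x. (\<Sum>j<N. te_amp wi (Suc j) *s TEo j x) + (\<Sum>j<N. tm_amp wi (Suc j) *s TMo j x))"
    by (simp add: fun_eq_iff)
  then show ?thesis
    unfolding potential_def[abs_def] te_amp_def tm_amp_def
    by (simp only:) (rule uniform_limit_add[OF source_series(1)[OF E wi] source_series(1)[OF M wi]])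
qed

lemma sin_mode_ends: "sin (real n * pi / a * a) = 0" "sin (real n * pi / b * b) = 0"
  using ab by simp_all

lemma radiating:
  assumes "ssol wi (scat wi) c"
  obtains R A B where "R < 0" "\<And>R'. R' < R \<Longrightarrow> scat wi \<in> L2 (sec R' R)"
    "\<And>R'. R' < R \<Longrightarrow> (\<lambda>N. L2norm (sec R' R) (\<lambda>x. scat wi x - modal_sum a b k te tm A B N x)) \<longlonglongrightarrow> 0"
proof -
  have "outgoing_radiating a b k te tm (scat wi)" using assms unfolding solves_scattering_def by blast
  then show thesis unfolding outgoing_radiating_def modal_sum_def[symmetric] using that by blast
qed

text \<open>The radiation condition provides some amplitude \<open>A j\<close>, for profiles
  supported far below only. \<open>TE_moment\<close> replaces it by a source moment and extends the
  formula to all profiles supported below \<rho>, in particular to those near the surface.\<close>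

lemma TE_scat:
  assumes wi: "wi \<in> L2 D" and sol: "ssol wi (scat wi) c" and j: "j \<ge> 1"
    and f: "smooth1 f" "\<And>t. t \<notin> {l..u} \<Longrightarrow> f t = 0" "l \<le> u" "u \<le> \<rho>"
  defines "P \<equiv> real (fst (te j)) * pi / a" and "Q \<equiv> real (snd (te j)) * pi / b"
  shows "- of_real Q * mode_int a b P Q (scat wi) 1 f + of_real P * mode_int a b P Q (scat wi) 2 f
    = te_amp wi j * exp_moment (h_const a b k te j) f * of_real ((lam a b te j)\<^sup>2 * cos_norm a b (te j))"
proof -
  interpret Wm: weak_maxwell a b k \<rho> "scat wi" c "src wi" by (rule ssol_weak_maxwell[OF wi sol])
  obtain R A B where R: "R < 0" "\<And>R'. R' < R \<Longrightarrow> scat wi \<in> L2 (sec R' R)"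
    "\<And>R'. R' < R \<Longrightarrow> (\<lambda>N. L2norm (sec R' R) (\<lambda>x. scat wi x - modal_sum a b k te tm A B N x)) \<longlonglongrightarrow> 0"
    by (rule radiating[OF sol]) blast
  have pq: "sin (P * a) = 0" "sin (Q * b) = 0" unfolding P_def Q_def by (rule sin_mode_ends)+
  let ?h = "h_const a b k te j" and ?N = "cos_norm a b (te j)" and ?lm = "lam a b te j"
  let ?K = "complex_of_real (?lm\<^sup>2 * ?N)"
  have l2: "?lm\<^sup>2 = P\<^sup>2 + Q\<^sup>2" unfolding lam_def eigen_rt_sq P_def Q_def ..
  have h0: "?h \<noteq> 0" unfolding axial_const_eqs using axial_const_nonzero te_nonres[of j] by (simp add: lam_def)
  have hsq: "?h\<^sup>2 = of_real (k\<^sup>2 - (P\<^sup>2 + Q\<^sup>2))"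
    unfolding axial_const_eqs axial_const_sq l2[symmetric] lam_def ..
  have te: "Wm.TE P Q v \<zeta> = - of_real Q * mode_int a b P Q v 1 \<zeta> + of_real P * mode_int a b P Q v 2 \<zeta>" for v \<zeta>
    by (simp add: Wm.TE_def[OF pq])
  have rad: "Wm.TE P Q (scat wi) \<zeta> = (A j * ?K) * exp_moment ?h \<zeta>"
    if \<zeta>: "smooth1 \<zeta>" "l' \<le> u'" "u' < R" "\<And>t. t \<notin> {l'..u'} \<Longrightarrow> \<zeta> t = 0" for \<zeta> l' u'
  proof -
    have R': "l' - 1 < R" "l' - 1 < l'" using \<zeta>(2,3) by auto
    have "- of_real Q * mode_int a b P Q (scat wi) 1 \<zeta> + of_real P * mode_int a b P Q (scat wi) 2 \<zeta>
        = A j * exp_moment ?h \<zeta> * ?K"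
      unfolding P_def Q_def
      by (rule modal_TE[OF ab k enum less_imp_le[OF R(1)] R(2)[OF R'(1)] R(3)[OF R'(1)] \<zeta>(1) \<zeta>(4) R'(2) \<zeta>(3) j])
    then show ?thesis unfolding te by (simp add: mult_ac)
  qed
  let ?e = "\<lambda>t. exp (\<i> * ?h * complex_of_real t) - exp (- \<i> * ?h * complex_of_real t)"
  have mom: "Wm.TE P Q (scat wi) f = \<i> / (2 * ?h) * Wm.TE P Q (src wi) ?e * exp_moment ?h f"
    by (rule Wm.TE_moment[OF pq h0 hsq rad f])
  have N0: "?N > 0" by (rule cos_norm_lower(2)[OF ab])
  have lm0: "?lm \<noteq> 0"
    using te_zero[OF ab enum, of j] eigen_rt_pos[OF ab, of "te j"] j by (simp add: lam_def)
  have es: "smooth1 (\<lambda>t. exp (\<i> * ?h * of_real t) + (-1) * exp (- \<i> * ?h * of_real t))"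
    by (intro smooth1_add smooth1_mult smooth1_const smooth1_exp)
  have ee: "(\<lambda>t. exp (\<i> * ?h * of_real t) + (-1) * exp (- \<i> * ?h * of_real t)) = ?e" by simp
  have "te_amp wi j = c_coeff a b k te j * (\<Sum>i\<in>UNIV. TE_coeff a b (te j) i * mode_int a b P Q (src wi) i
      (\<lambda>t. exp (\<i> * ?h * of_real t) + (-1) * exp (- \<i> * ?h * of_real t)))"
    unfolding te_amp_def P_def Q_def by (rule src_pairing[OF wi TE_in_nth es])
  also have "\<dots> = c_coeff a b k te j * (Wm.TE P Q (src wi) ?e / of_real ?N)"
    unfolding ee te by (simp add: sum_3 TE_coeff_def three_distinct P_def Q_def add_divide_distrib diff_divide_distrib)
  finally have amp: "te_amp wi j = c_coeff a b k te j * (Wm.TE P Q (src wi) ?e / of_real ?N)" .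
  have "te_amp wi j * ?K = \<i> / (2 * ?h) * Wm.TE P Q (src wi) ?e"
    unfolding amp c_coeff_def using N0 lm0 h0 by (simp add: field_simps)
  then show ?thesis using mom unfolding te by (simp add: mult_ac)
qed

text \<open>The axial component determines the amplitude; it enters P - Q with a minus sign, which
  is matched by the minus sign in d_n. The transversal formula then follows from the second part of
  \<open>TM_moment\<close>.\<close>

lemma TM_scat:
  assumes wi: "wi \<in> L2 D" and sol: "ssol wi (scat wi) c" and j: "j \<ge> 1"
    and f: "smooth1 f" "\<And>t. t \<notin> {l..u} \<Longrightarrow> f t = 0" "l \<le> u" "u \<le> \<rho>"
  defines "P \<equiv> real (fst (tm j)) * pi / a" and "Q \<equiv> real (snd (tm j)) * pi / b"
    and "K \<equiv> complex_of_real ((mu a b tm j)\<^sup>2 * sin_norm a b (tm j) / k)"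
  shows "of_real P * mode_int a b P Q (scat wi) 1 f + of_real Q * mode_int a b P Q (scat wi) 2 f
    = tm_amp wi j * exp_moment (g_const a b k tm j) f * (\<i> * g_const a b k tm j * K)"
    and "mode_int a b P Q (scat wi) 3 f = - tm_amp wi j * exp_moment (g_const a b k tm j) f * K"
proof -
  interpret Wm: weak_maxwell a b k \<rho> "scat wi" c "src wi" by (rule ssol_weak_maxwell[OF wi sol])
  obtain R A B where R: "R < 0" "\<And>R'. R' < R \<Longrightarrow> scat wi \<in> L2 (sec R' R)"
    "\<And>R'. R' < R \<Longrightarrow> (\<lambda>N. L2norm (sec R' R) (\<lambda>x. scat wi x - modal_sum a b k te tm A B N x)) \<longlonglongrightarrow> 0"
    by (rule radiating[OF sol]) blast
  have pq: "sin (P * a) = 0" "sin (Q * b) = 0" unfolding P_def Q_def by (rule sin_mode_ends)+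
  let ?g = "g_const a b k tm j" and ?N = "sin_norm a b (tm j)" and ?\<mu> = "mu a b tm j"
  have m2: "?\<mu>\<^sup>2 = P\<^sup>2 + Q\<^sup>2" unfolding mu_def eigen_rt_sq P_def Q_def ..
  have g0: "?g \<noteq> 0" unfolding axial_const_eqs using axial_const_nonzero tm_nonres[OF j] by (simp add: mu_def)
  have gsq: "?g\<^sup>2 = of_real (k\<^sup>2 - (P\<^sup>2 + Q\<^sup>2))"
    unfolding axial_const_eqs axial_const_sq m2[symmetric] mu_def ..
  have tmd: "Wm.TM P Q v \<zeta> = of_real P * mode_int a b P Q v 1 \<zeta> + of_real Q * mode_int a b P Q v 2 \<zeta>" for v \<zeta>
    by (simp add: Wm.TM_def[OF pq])
  have rad: "mode_int a b P Q (scat wi) 3 \<zeta> = (- B j * K) * exp_moment ?g \<zeta>"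
    if \<zeta>: "smooth1 \<zeta>" "l' \<le> u'" "u' < R" "\<And>t. t \<notin> {l'..u'} \<Longrightarrow> \<zeta> t = 0" for \<zeta> l' u'
  proof -
    have R': "l' - 1 < R" "l' - 1 < l'" using \<zeta>(2,3) by auto
    have "mode_int a b P Q (scat wi) 3 \<zeta> = - B j * exp_moment ?g \<zeta> * K"
      unfolding P_def Q_def K_def
      by (rule modal_TM(2)[OF ab k enum less_imp_le[OF R(1)] R(2)[OF R'(1)] R(3)[OF R'(1)] \<zeta>(1) \<zeta>(4) R'(2) \<zeta>(3) j])
    then show ?thesis by (simp add: mult_ac)
  qed
  let ?S = "Wm.TM_source P Q ?g"
  have mom3: "mode_int a b P Q (scat wi) 3 f = \<i> / (2 * ?g) * ?S * exp_moment ?g f"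
    by (rule Wm.TM_moment(1)[OF pq g0 gsq rad f])
  have momT: "Wm.TM P Q (scat wi) f = 1 / 2 * ?S * exp_moment ?g f"
    by (rule Wm.TM_moment(2)[OF pq g0 gsq rad f])
  have pos: "fst (tm j) \<noteq> 0" "snd (tm j) \<noteq> 0"
  proof -
    have "tm j \<in> {1..} \<times> {1..}" using enum j unfolding mode_enumeration_def bij_betw_def by auto
    then show "fst (tm j) \<noteq> 0" "snd (tm j) \<noteq> 0" by auto
  qed
  have N0: "?N > 0" by (rule cos_norm_lower(4)[OF ab pos])
  have \<mu>0: "?\<mu> \<noteq> 0"
    using eigen_rt_pos[OF ab, of "tm j"] pos by (cases "tm j") (auto simp: mu_def)
  let ?f = "\<lambda>(i::3) t. exp (\<i> * ?g * complex_of_real t) + (if i = 3 then 1 else -1) * exp (- \<i> * ?g * complex_of_real t)"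
  let ?em = "\<lambda>t. exp (\<i> * ?g * complex_of_real t) - exp (- \<i> * ?g * complex_of_real t)"
  let ?ep = "\<lambda>t. exp (\<i> * ?g * complex_of_real t) + exp (- \<i> * ?g * complex_of_real t)"
  have es: "smooth1 (?f i)" for i
    by (intro smooth1_add smooth1_mult smooth1_const smooth1_exp)
  have fe: "?f 1 = ?em" "?f 2 = ?em" "?f 3 = ?ep" by (simp_all add: three_distinct)
  have "tm_amp wi j = d_coeff a b k tm j * (\<Sum>i\<in>UNIV. TM_coeff a b k ?g (tm j) i * mode_int a b P Q (src wi) i (?f i))"
    unfolding tm_amp_def P_def Q_def by (rule src_pairing[OF wi TM_in_nth es])
  also have "(\<Sum>i\<in>UNIV. TM_coeff a b k ?g (tm j) i * mode_int a b P Q (src wi) i (?f i))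
      = TM_coeff a b k ?g (tm j) 1 * mode_int a b P Q (src wi) 1 ?em + TM_coeff a b k ?g (tm j) 2 * mode_int a b P Q (src wi) 2 ?em
        + TM_coeff a b k ?g (tm j) 3 * mode_int a b P Q (src wi) 3 ?ep"
    unfolding sum_3 fe ..
  also have "\<dots> = of_real k * ?S / of_real ?N"
  proof -
    have c: "TM_coeff a b k ?g (tm j) 1 = \<i> * ?g * of_real P / (of_real k * of_real ?N)"
      "TM_coeff a b k ?g (tm j) 2 = \<i> * ?g * of_real Q / (of_real k * of_real ?N)"
      "TM_coeff a b k ?g (tm j) 3 = of_real (P\<^sup>2 + Q\<^sup>2) / (of_real k * of_real ?N)"
      unfolding TM_coeff_def m2[unfolded mu_def] by (simp_all add: three_distinct P_def Q_def)
    have S: "?S = (\<i> * ?g * (of_real P * mode_int a b P Q (src wi) 1 ?em + of_real Q * mode_int a b P Q (src wi) 2 ?em)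
        + of_real (P\<^sup>2 + Q\<^sup>2) * mode_int a b P Q (src wi) 3 ?ep) / of_real (k\<^sup>2)"
      unfolding Wm.TM_source_def[OF pq] tmd ..
    have "of_real k \<noteq> (0::complex)" using k by simp
    then show ?thesis
      unfolding c S of_real_power using N0 by (simp add: divide_simps power2_eq_square) (simp add: algebra_simps)
  qed
  finally have amp: "tm_amp wi j = d_coeff a b k tm j * (of_real k * ?S / of_real ?N)" .
  have ampK: "tm_amp wi j * K = - \<i> / (2 * ?g) * ?S"
    unfolding amp d_coeff_def K_def using N0 \<mu>0 g0 k by (simp add: field_simps power2_eq_square)
  show "mode_int a b P Q (scat wi) 3 f = - tm_amp wi j * exp_moment ?g f * K"
  proof -
    have "- tm_amp wi j * exp_moment ?g f * K = - (tm_amp wi j * K) * exp_moment ?g f" by simp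
    then show ?thesis unfolding ampK mom3 by simp
  qed
  show "of_real P * mode_int a b P Q (scat wi) 1 f + of_real Q * mode_int a b P Q (scat wi) 2 f
    = tm_amp wi j * exp_moment ?g f * (\<i> * ?g * K)"
  proof -
    have "tm_amp wi j * exp_moment ?g f * (\<i> * ?g * K) = (tm_amp wi j * K) * (\<i> * ?g * exp_moment ?g f)"
      by (simp only: mult_ac)
    also have "\<dots> = 1 / 2 * ?S * exp_moment ?g f" unfolding ampK using g0 by (simp add: mult_ac)
    finally have e: "tm_amp wi j * exp_moment ?g f * (\<i> * ?g * K) = 1 / 2 * ?S * exp_moment ?g f" .
    show ?thesis unfolding e by (rule momT[unfolded tmd])
  qed
qed

lemma mode_int_degenerate:
  "p = 0 \<Longrightarrow> i \<noteq> 1 \<Longrightarrow> mode_int a b (real p * pi / a) q v i f = 0"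
  "q' = 0 \<Longrightarrow> i \<noteq> 2 \<Longrightarrow> mode_int a b p' (real q' * pi / b) v i f = 0"
  unfolding mode_int_def wint_def by (simp_all add: sep_3 trig_profile_def three_distinct)

text \<open>If both indices are nonzero, the TE and TM combinations fix the transversal components.
  If exactly one index is 0, there is no TM mode, but all sine profiles of frequency 0 vanish and
  the TE equation fixes the single component left. For m = n = 0 every pairing is 0.\<close>

lemma mode_int_scat_eq_potential:
  assumes wi: "wi \<in> L2 D" and sol: "ssol wi (scat wi) c"
    and f: "smooth1 f" "\<And>t. t \<notin> {l..u} \<Longrightarrow> f t = 0" "r - 2 < l" "l \<le> u" "u < \<sigma>"
  shows "mode_int a b (real m * pi / a) (real n * pi / b) (scat wi) i f
    = mode_int a b (real m * pi / a) (real n * pi / b) (potential wi) i f"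
proof -
  define P where "P = real m * pi / a"
  define Q where "Q = real n * pi / b"
  let ?V = "potential wi"
  have sub: "sec (r - 2) \<sigma> \<subseteq> {x. x $ 3 \<le> \<sigma>}" by (auto simp: section_between_eq)
  note VL = L2_uniform_limit[OF uniform_limit_on_subset[OF potential_uniform[OF wi] sub] continuous_on_modal_sum]
  have \<sigma>0: "\<sigma> \<le> 0" and u\<rho>: "u \<le> \<rho>" using levels f(5) by auto
  have te: "- of_real Q * mode_int a b P Q (scat wi) 1 f + of_real P * mode_int a b P Q (scat wi) 2 f
      = - of_real Q * mode_int a b P Q ?V 1 f + of_real P * mode_int a b P Q ?V 2 f" if "(m, n) \<noteq> (0, 0)"
  proof -
    obtain j where j: "te j = (m, n)" using enum unfolding mode_enumeration_def bij_def by (metis surj_def)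
    then have j1: "j \<ge> 1" using te_zero[OF ab enum, of j] that by (cases j) auto
    have "- of_real Q * mode_int a b P Q ?V 1 f + of_real P * mode_int a b P Q ?V 2 f
        = te_amp wi j * exp_moment (h_const a b k te j) f * of_real ((lam a b te j)\<^sup>2 * cos_norm a b (te j))"
      using modal_TE[OF ab k enum \<sigma>0 VL(2,3) f(1) _ f(3,5) j1] f(2) unfolding j P_def Q_def by simp
    then show ?thesis
      using TE_scat[OF wi sol j1 f(1) _ f(4) u\<rho>] f(2) unfolding j P_def Q_def by simp
  qed
  have tm: "of_real P * mode_int a b P Q (scat wi) 1 f + of_real Q * mode_int a b P Q (scat wi) 2 f
      = of_real P * mode_int a b P Q ?V 1 f + of_real Q * mode_int a b P Q ?V 2 f"
    "mode_int a b P Q (scat wi) 3 f = mode_int a b P Q ?V 3 f" if mn: "m \<noteq> 0" "n \<noteq> 0"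
  proof -
    have "(m, n) \<in> {1..} \<times> {1..}" using mn by auto
    then obtain j where j: "tm j = (m, n)" "j \<ge> 1"
      using enum unfolding mode_enumeration_def bij_betw_def by (metis atLeast_iff image_iff)
    show "of_real P * mode_int a b P Q (scat wi) 1 f + of_real Q * mode_int a b P Q (scat wi) 2 f
      = of_real P * mode_int a b P Q ?V 1 f + of_real Q * mode_int a b P Q ?V 2 f"
      using modal_TM(1)[OF ab k enum \<sigma>0 VL(2,3) f(1) _ f(3,5) j(2)]
        TM_scat(1)[OF wi sol j(2) f(1) _ f(4) u\<rho>] f(2) unfolding j P_def Q_def by simp
    show "mode_int a b P Q (scat wi) 3 f = mode_int a b P Q ?V 3 f"
      using modal_TM(2)[OF ab k enum \<sigma>0 VL(2,3) f(1) _ f(3,5) j(2)]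
        TM_scat(2)[OF wi sol j(2) f(1) _ f(4) u\<rho>] f(2) unfolding j P_def Q_def by simp
  qed
  have deg: "m = 0 \<Longrightarrow> i \<noteq> 1 \<Longrightarrow> mode_int a b P Q v i f = 0" "n = 0 \<Longrightarrow> i \<noteq> 2 \<Longrightarrow> mode_int a b P Q v i f = 0" for v i
    unfolding P_def Q_def using mode_int_degenerate by blast+
  have P0: "P \<noteq> 0 \<longleftrightarrow> m \<noteq> 0" and Q0: "Q \<noteq> 0 \<longleftrightarrow> n \<noteq> 0" using ab by (simp_all add: P_def Q_def)
  have 12: "mode_int a b P Q (scat wi) 1 f = mode_int a b P Q ?V 1 f \<and> mode_int a b P Q (scat wi) 2 f = mode_int a b P Q ?V 2 f"
  proof (cases "m = 0"; cases "n = 0")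
    assume "m = 0" "n = 0"
    then show ?thesis using deg(1)[of 2] deg(2)[of 1] by (simp add: three_distinct)
  next
    assume mn: "m = 0" "n \<noteq> 0"
    then show ?thesis using te deg(1)[of 2] P0 Q0 by (simp add: three_distinct)
  next
    assume mn: "m \<noteq> 0" "n = 0"
    then show ?thesis using te deg(2)[of 1] P0 Q0 by (simp add: three_distinct)
  next
    assume mn: "m \<noteq> 0" "n \<noteq> 0"
    have "P\<^sup>2 + Q\<^sup>2 \<noteq> 0" using P0 mn(1) by (simp add: sum_power2_eq_zero_iff)
    then have "(complex_of_real P)\<^sup>2 + (complex_of_real Q)\<^sup>2 \<noteq> 0"
      by (metis of_real_add of_real_eq_0_iff of_real_power)
    from linear_system_unique[OF te tm(1)[OF mn] this] mn show ?thesis by simp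
  qed
  have 3: "mode_int a b P Q (scat wi) 3 f = mode_int a b P Q ?V 3 f"
    using tm(2) deg(1)[of 3] deg(2)[of 3] by (cases "m = 0 \<or> n = 0") (auto simp: three_distinct)
  show ?thesis using 12 3 exhaust_3[of i] unfolding P_def[symmetric] Q_def[symmetric] by auto
qed

text \<open>The difference of the two fields is orthogonal to all profiles in a slab around the
  surface, hence zero almost everywhere near it. The potential is continuous there and so provides
  the point value.\<close>

theorem scattered_field_eq_potential:
  assumes wi: "wi \<in> L2 D" and x: "x \<in> surface a b r"
  shows "point_value (scat wi) x = potential wi x"
proof -
  obtain c where sol: "ssol wi (scat wi) c" using scat_solves[OF wi] by blast
  let ?V = "potential wi" and ?S = "sec (r - 2) \<sigma>"
  have sub: "?S \<subseteq> {x. x $ 3 \<le> \<sigma>}" by (auto simp: section_between_eq)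
  note VL = L2_uniform_limit[OF uniform_limit_on_subset[OF potential_uniform[OF wi] sub] continuous_on_modal_sum]
  have \<sigma>0: "\<sigma> \<le> 0" using levels by auto
  have r2: "r - 2 < 0" using D_props(6) by simp
  have wS: "scat wi \<in> L2 ?S"
    by (rule L2_subset[OF ssol_L2(1)[OF sol r2] _ sets_section_between sets_section_between])
       (use \<sigma>0 in \<open>auto simp: section_between_eq\<close>)
  have int: "integrable (lebesgue_on ?S) (\<lambda>x. v x $ i * sep (trig_profile i p q f) x)" if "v \<in> L2 ?S" "smooth1 f" for v :: "real^3 \<Rightarrow> complex^3" and i p q f
    by (rule integrable_sep_section[OF that(1)]) (rule smooth1_trig_profile[OF that(2)])
  have comp: "AE x in lebesgue_on (sec (r - 1) ((r + \<sigma>) / 2)). scat wi x $ i - ?V x $ i = 0" for i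
  \<comment> \<open>Nested slabs around height r: orthogonality is known between r - 2 and \<sigma>,
    and the conclusion is drawn between r - 1 and the midpoint of r and \<sigma>, which still
    surrounds the surface.\<close>
  proof (rule orth_profiles_zero[OF ab, where R' = "r - 2" and R = \<sigma> and i = i])
    have 1: "integrable (lebesgue_on ?S) (\<lambda>x. v x $ i * 1)" if "v \<in> L2 ?S" for v :: "real^3 \<Rightarrow> complex^3"
      by (rule L2_integrable_mult[OF that lmeasurable_section_between, where C = 1]) auto
    show "integrable (lebesgue_on ?S) (\<lambda>x. scat wi x $ i - ?V x $ i)"
      using 1[OF wS] 1[OF VL(2)] by simp
    show "r - 2 < r - 1" "r - 1 \<le> (r + \<sigma>) / 2" "(r + \<sigma>) / 2 < \<sigma>" using levels(1) by auto
    fix m n :: nat and f l u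
    assume f: "smooth1 f" "r - 2 < l" "l \<le> u" "u < \<sigma>" "\<And>t. t \<notin> {l..u} \<Longrightarrow> f t = 0"
    have mi: "mode_int a b (real m * pi / a) (real n * pi / b) v i f
        = (LINT x|lebesgue_on ?S. v x $ i * sep (trig_profile i (real m * pi / a) (real n * pi / b) f) x)" for v
      using mode_int_section[OF ab k enum \<sigma>0 VL(2,3) f(1) _ f(2,4), of "(m, n)" v i] f(5) by simp
    have "(LINT x|lebesgue_on ?S. (scat wi x $ i - ?V x $ i) * sep (trig_profile i (real m * pi / a) (real n * pi / b) f) x)
        = mode_int a b (real m * pi / a) (real n * pi / b) (scat wi) i f - mode_int a b (real m * pi / a) (real n * pi / b) ?V i f"
      unfolding mi left_diff_distrib by (rule Bochner_Integration.integral_diff[OF int[OF wS f(1)] int[OF VL(2) f(1)]])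
    also have "\<dots> = 0"
      using mode_int_scat_eq_potential[OF wi sol f(1) _ f(2,3,4)] f(5) by simp
    finally show "(LINT x|lebesgue_on ?S. (scat wi x $ i - ?V x $ i) * sep (trig_profile i (real m * pi / a) (real n * pi / b) f) x) = 0" .
  qed
  let ?U = "sec (r - 1) ((r + \<sigma>) / 2)"
  have ae: "AE x in lebesgue_on ?U. ?V x = scat wi x"
    using comp[of 1] comp[of 2] comp[of 3] by eventually_elim (simp add: vec_eq_iff forall_3)
  have "continuous_on ?U ?V"
    by (rule continuous_on_subset[OF VL(1)]) (use levels(1) in \<open>auto simp: section_between_eq\<close>)
  moreover have "open ?U" unfolding section_between_eq_box by (rule open_box)
  moreover have "x \<in> ?U"
    using x levels(1) by (auto simp: surface_def section_between_eq at_height_def cross_section_def)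
  ultimately show ?thesis using ae by (intro point_value_eq)
qed

end

section \<open>Linear dependence of the far field on the incident field\<close>

lemma L2norm_mono:
  assumes f: "f \<in> L2 S" and T: "T \<subseteq> S" "T \<in> sets lebesgue" "S \<in> sets lebesgue"
  shows "L2norm T f \<le> L2norm S f"
proof -
  have i: "integrable lebesgue (\<lambda>x. indicator A x *\<^sub>R (norm (f x))\<^sup>2)" if "f \<in> L2 A" "A \<in> sets lebesgue" for A
    using L2_integrable[OF that(1)] that(2) by (simp add: integrable_restrict_space)
  have "(LINT x|lebesgue. indicator T x *\<^sub>R (norm (f x))\<^sup>2) \<le> (LINT x|lebesgue. indicator S x *\<^sub>R (norm (f x))\<^sup>2)"
    by (rule integral_mono[OF i[OF L2_subset[OF f T] T(2)] i[OF f T(3)]])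
       (use T(1) in \<open>auto simp: indicator_def\<close>)
  then show ?thesis
    unfolding L2norm_def using T(2,3) by (simp add: integral_restrict_space)
qed

text \<open>A weak form of Minkowski's inequality; the factor 2 is harmless for limits equal to
  0.\<close>

lemma L2norm_lin_le:
  fixes f g :: "'a::euclidean_space \<Rightarrow> complex^3"
  assumes f: "f \<in> L2 S" and g: "g \<in> L2 S"
  shows "L2norm S (\<lambda>x. z *s f x + g x) \<le> 2 * (norm z * L2norm S f + L2norm S g)"
proof -
  have sq: "(L2norm S h)\<^sup>2 = (LINT x|lebesgue_on S. (norm (h x))\<^sup>2)" for h :: "'a \<Rightarrow> complex^3"
    unfolding L2norm_def by (intro real_sqrt_pow2 Bochner_Integration.integral_nonneg) auto
  have nn: "0 \<le> L2norm S h" for h :: "'a \<Rightarrow> complex^3"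
    unfolding L2norm_def by (simp add: Bochner_Integration.integral_nonneg)
  have "(LINT x|lebesgue_on S. (norm (z *s f x + g x))\<^sup>2)
      \<le> (LINT x|lebesgue_on S. (2 * (norm z)\<^sup>2) * (norm (f x))\<^sup>2 + 2 * (norm (g x))\<^sup>2)"
  proof (rule integral_mono)
    show "integrable (lebesgue_on S) (\<lambda>x. (norm (z *s f x + g x))\<^sup>2)"
      by (rule L2_integrable[OF L2_add[OF L2_const_mult[OF f] g]])
    show "integrable (lebesgue_on S) (\<lambda>x. (2 * (norm z)\<^sup>2) * (norm (f x))\<^sup>2 + 2 * (norm (g x))\<^sup>2)"
      using L2_integrable[OF f] L2_integrable[OF g] by simp
    fix x show "(norm (z *s f x + g x))\<^sup>2 \<le> (2 * (norm z)\<^sup>2) * (norm (f x))\<^sup>2 + 2 * (norm (g x))\<^sup>2"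
      using norm_add_sq_le[of "z *s f x" "g x"] by (simp add: norm_vsmult power_mult_distrib mult_ac)
  qed
  also have "\<dots> = (2 * (norm z)\<^sup>2) * (L2norm S f)\<^sup>2 + 2 * (L2norm S g)\<^sup>2"
    unfolding sq using L2_integrable[OF f] L2_integrable[OF g] by simp
  also have "\<dots> \<le> (2 * (norm z * L2norm S f + L2norm S g))\<^sup>2"
  proof -
    have "2 * X\<^sup>2 + 2 * Y\<^sup>2 \<le> (2 * (X + Y))\<^sup>2" if "0 \<le> X" "0 \<le> Y" for X Y :: real
      using mult_nonneg_nonneg[OF that] zero_le_power2[of X] zero_le_power2[of Y]
      unfolding power2_eq_square by (simp add: algebra_simps)
    from this[of "norm z * L2norm S f" "L2norm S g"] nn show ?thesis
      by (simp add: power_mult_distrib)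
  qed
  finally have le: "(LINT x|lebesgue_on S. (norm (z *s f x + g x))\<^sup>2) \<le> (2 * (norm z * L2norm S f + L2norm S g))\<^sup>2" .
  show ?thesis
    unfolding L2norm_def[of S "\<lambda>x. z *s f x + g x"] by (intro real_le_lsqrt le) (simp_all add: nn)
qed

lemma L2norm_bounded:
  fixes f :: "'a::euclidean_space \<Rightarrow> complex^3"
  assumes f: "f \<in> L2 S" and S: "S \<in> lmeasurable" and M: "\<And>x. x \<in> S \<Longrightarrow> norm (f x) \<le> M" and nn: "0 \<le> M"
  shows "L2norm S f \<le> M * sqrt (measure lebesgue S)"
proof -
  have "(LINT x|lebesgue_on S. (norm (f x))\<^sup>2) \<le> (LINT x|lebesgue_on S. M\<^sup>2)"
    by (rule integral_mono[OF L2_integrable[OF f] integrable_const_lebesgue_on[OF S]])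
       (use M in \<open>auto intro!: power_mono\<close>)
  also have "\<dots> = M\<^sup>2 * measure lebesgue S" using S by (simp add: measure_restrict_space)
  finally have "L2norm S f \<le> sqrt (M\<^sup>2 * measure lebesgue S)" unfolding L2norm_def by (rule real_sqrt_le_mono)
  then show ?thesis using nn by (simp add: real_sqrt_mult)
qed

lemma modal_sum_lin:
  "modal_sum a b k te tm (\<lambda>m. z * A m + A' m) (\<lambda>n. z * B n + B' n) N x
    = z *s modal_sum a b k te tm A B N x + modal_sum a b k te tm A' B' N x"
  unfolding vec_eq_iff modal_sum_def
  by (simp only: vector_add_component vector_minus_component vector_smult_component sum_component
      sum.distrib sum_distrib_left distrib_right distrib_left mult.assoc) (simp add: algebra_simps)

lemma outgoing_radiating_lin:
  assumes w: "outgoing_radiating a b k te tm w" and w': "outgoing_radiating a b k te tm w'"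
  shows "outgoing_radiating a b k te tm (\<lambda>x. z *s w x + w' x)"
proof -
  let ?s = "section_between a b" and ?m = "modal_sum a b k te tm"
  obtain R A B where R: "R < 0" "\<And>R'. R' < R \<Longrightarrow> w \<in> L2 (?s R' R)"
    "\<And>R'. R' < R \<Longrightarrow> (\<lambda>N. L2norm (?s R' R) (\<lambda>x. w x - ?m A B N x)) \<longlonglongrightarrow> 0"
    using w unfolding outgoing_radiating_def modal_sum_def[symmetric] by blast
  obtain Q A' B' where Q: "Q < 0" "\<And>R'. R' < Q \<Longrightarrow> w' \<in> L2 (?s R' Q)"
    "\<And>R'. R' < Q \<Longrightarrow> (\<lambda>N. L2norm (?s R' Q) (\<lambda>x. w' x - ?m A' B' N x)) \<longlonglongrightarrow> 0"
    using w' unfolding outgoing_radiating_def modal_sum_def[symmetric] by blast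
  define X where "X = min R Q"
  have "(\<lambda>x. z *s w x + w' x) \<in> L2 (?s R' X) \<and>
     (\<lambda>N. L2norm (?s R' X) (\<lambda>x. (z *s w x + w' x) - ?m (\<lambda>m. z * A m + A' m) (\<lambda>n. z * B n + B' n) N x)) \<longlonglongrightarrow> 0"
    if "R' < X" for R'
  proof
    have sub: "?s R' X \<subseteq> ?s R' R" "?s R' X \<subseteq> ?s R' Q" and lt: "R' < R" "R' < Q"
      using that by (auto simp: X_def section_between_eq)
    have d: "(\<lambda>x. w x - ?m A B N x) \<in> L2 (?s R' R)" "(\<lambda>x. w' x - ?m A' B' N x) \<in> L2 (?s R' Q)" for N
      by (intro L2_diff R(2) Q(2) lt L2_continuous_section continuous_on_modal_sum)+
    note s = sets_section_between[of a b]
    show "(\<lambda>x. z *s w x + w' x) \<in> L2 (?s R' X)"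
      by (intro L2_add L2_const_mult L2_subset[OF R(2)[OF lt(1)] sub(1) s s] L2_subset[OF Q(2)[OF lt(2)] sub(2) s s])
    show "(\<lambda>N. L2norm (?s R' X) (\<lambda>x. (z *s w x + w' x) - ?m (\<lambda>m. z * A m + A' m) (\<lambda>n. z * B n + B' n) N x)) \<longlonglongrightarrow> 0"
    proof (rule Lim_null_comparison)
      let ?g = "\<lambda>N. 2 * (norm z * L2norm (?s R' R) (\<lambda>x. w x - ?m A B N x) + L2norm (?s R' Q) (\<lambda>x. w' x - ?m A' B' N x))"
      have "?g \<longlonglongrightarrow> 2 * (norm z * 0 + 0)"
        by (intro tendsto_intros R(3) Q(3) lt)
      then show "?g \<longlonglongrightarrow> 0" by simp
      have "norm (L2norm (?s R' X) (\<lambda>x. (z *s w x + w' x) - ?m (\<lambda>m. z * A m + A' m) (\<lambda>n. z * B n + B' n) N x)) \<le> ?g N" for N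
      proof -
        have e: "(z *s w x + w' x) - ?m (\<lambda>m. z * A m + A' m) (\<lambda>n. z * B n + B' n) N x
            = z *s (w x - ?m A B N x) + (w' x - ?m A' B' N x)" for x
          unfolding modal_sum_lin by (simp add: vec_eq_iff algebra_simps)
        have "L2norm (?s R' X) (\<lambda>x. z *s (w x - ?m A B N x) + (w' x - ?m A' B' N x))
            \<le> 2 * (norm z * L2norm (?s R' X) (\<lambda>x. w x - ?m A B N x) + L2norm (?s R' X) (\<lambda>x. w' x - ?m A' B' N x))"
          by (intro L2norm_lin_le L2_subset[OF d(1) sub(1) s s] L2_subset[OF d(2) sub(2) s s])
        also have "\<dots> \<le> ?g N"
          by (intro mult_left_mono add_mono L2norm_mono[OF d(1) sub(1) s s] L2norm_mono[OF d(2) sub(2) s s]) auto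
        finally show ?thesis
          unfolding e by (simp add: L2norm_def Bochner_Integration.integral_nonneg)
      qed
      then show "\<forall>\<^sub>F N in sequentially. norm (L2norm (?s R' X) (\<lambda>x. (z *s w x + w' x)
          - ?m (\<lambda>m. z * A m + A' m) (\<lambda>n. z * B n + B' n) N x)) \<le> ?g N"
        by (intro always_eventually allI)
    qed
  qed
  moreover have "X < 0" using R(1) Q(1) by (simp add: X_def)
  ultimately show ?thesis unfolding outgoing_radiating_def modal_sum_def[symmetric] by blast
qed

lemma integral_cdot_lin:
  assumes "integrable M (\<lambda>x. cdot (u x) (G x))" "integrable M (\<lambda>x. cdot (u' x) (G x))"
  shows "(LINT x|M. cdot (z *s u x + u' x) (G x)) = z * (LINT x|M. cdot (u x) (G x)) + (LINT x|M. cdot (u' x) (G x))"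
  using assms by (simp add: cdot_simps(1,3))

section \<open>Linearity of the solution map and of the potential\<close>

context waveguide_scattering
begin

lemma test_integrable:
  assumes s: "ssol wi w c" and \<phi>: "\<phi> \<in> test_fields S"
  shows "integrable (lebesgue_on W) (\<lambda>x. cdot (w x) (\<phi> x))" "integrable (lebesgue_on W) (\<lambda>x. cdot (w x) (curl \<phi> x))"
    "integrable (lebesgue_on W) (\<lambda>x. cdot (c x) (\<phi> x))" "integrable (lebesgue_on W) (\<lambda>x. cdot (c x) (curl \<phi> x))"
    "integrable (lebesgue_on W) (\<lambda>x. cdot (eps x *s w x) (\<phi> x))"
    "v \<in> L2 D \<Longrightarrow> integrable (lebesgue_on D) (\<lambda>x. cdot (v x) (\<phi> x))"
proof -
  obtain K where K: "compact K" "continuous_on UNIV \<phi>" "continuous_on UNIV (curl \<phi>)"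
    "\<And>x. x \<notin> K \<Longrightarrow> \<phi> x = 0" "\<And>x. x \<notin> K \<Longrightarrow> curl \<phi> x = 0"
    by (rule test_field_props[OF \<phi>]) blast
  show "integrable (lebesgue_on W) (\<lambda>x. cdot (w x) (\<phi> x))" "integrable (lebesgue_on W) (\<lambda>x. cdot (w x) (curl \<phi> x))"
    "integrable (lebesgue_on W) (\<lambda>x. cdot (c x) (\<phi> x))" "integrable (lebesgue_on W) (\<lambda>x. cdot (c x) (curl \<phi> x))"
    by (rule integrable_cdot_waveguide[OF ssol_L2(1)[OF s] K(2,1,4)] integrable_cdot_waveguide[OF ssol_L2(1)[OF s] K(3,1,5)]
        integrable_cdot_waveguide[OF ssol_L2(2)[OF s] K(2,1,4)] integrable_cdot_waveguide[OF ssol_L2(2)[OF s] K(3,1,5)]; assumption)+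
  \<comment> \<open>Written through the contrast, so that its essential bound and its measurability
    carry over to the permittivity.\<close>
  have "eps x *s w x = (1 / of_real (k\<^sup>2)) *s (contrast x *s w x) + w x" for x
    using k by (simp add: contrast_def vec_eq_iff field_simps)
  then have e: "(\<lambda>x. eps x *s w x) = (\<lambda>x. (1 / of_real (k\<^sup>2)) *s (contrast x *s w x) + w x)" by (rule ext)
  have "(\<lambda>x. eps x *s w x) \<in> L2 (sec R 0)" if "R < 0" for R
    unfolding e using ssol_L2(1)[OF s that]
    by (intro L2_add L2_const_mult contrast_L2 section_subset_waveguide sets_section_between) simp_all
  from integrable_cdot_waveguide[OF this K(2,1,4)]
  show "integrable (lebesgue_on W) (\<lambda>x. cdot (eps x *s w x) (\<phi> x))" .
  have "bounded (\<phi> ` K)" by (intro compact_imp_bounded compact_continuous_image continuous_on_subset[OF K(2)] K(1)) auto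
  then obtain B where B: "\<And>x. x \<in> K \<Longrightarrow> norm (\<phi> x) \<le> B" unfolding bounded_iff by blast
  have B': "norm (\<phi> x $ i) \<le> \<bar>B\<bar>" for x i
    using B[of x] Finite_Cartesian_Product.norm_nth_le[of "\<phi> x" i] K(4)[of x] by (cases "x \<in> K") auto
  show "integrable (lebesgue_on D) (\<lambda>x. cdot (v x) (\<phi> x))" if "v \<in> L2 D"
    unfolding cdot_def
    by (intro Bochner_Integration.integrable_sum L2_integrable_mult[OF that D_props(5) _ B']
        continuous_measurable_lebesgue_on continuous_on_component K)
qed

lemma ssol_lin:
  assumes wi: "wi \<in> L2 D" "wi' \<in> L2 D" and s: "ssol wi w c" and s': "ssol wi' w' c'"
  shows "ssol (\<lambda>x. z *s wi x + wi' x) (\<lambda>x. z *s w x + w' x) (\<lambda>x. z *s c x + c' x)"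
proof -
  note i = test_integrable[OF s] and i' = test_integrable[OF s']
  have "has_weak_curl W w c" "has_weak_curl W w' c'" using s s' unfolding solves_scattering_def by blast+
  then have wc: "has_weak_curl W (\<lambda>x. z *s w x + w' x) (\<lambda>x. z *s c x + c' x)"
    unfolding has_weak_curl_def
    by (auto simp: integral_cdot_lin[OF i(2) i'(2)] integral_cdot_lin[OF i(3) i'(3)])
  have "zero_tangential_trace W w c" "zero_tangential_trace W w' c'" using s s' unfolding solves_scattering_def by blast+
  then have t: "zero_tangential_trace W (\<lambda>x. z *s w x + w' x) (\<lambda>x. z *s c x + c' x)"
    unfolding zero_tangential_trace_def
  proof (intro ballI)
    fix \<phi> assume \<phi>: "\<phi> \<in> test_fields (UNIV :: (real^3) set)"
      and z: "\<forall>\<phi>\<in>test_fields UNIV. (LINT x|lebesgue_on W. cdot (c x) (\<phi> x) - cdot (w x) (curl \<phi> x)) = 0"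
        "\<forall>\<phi>\<in>test_fields UNIV. (LINT x|lebesgue_on W. cdot (c' x) (\<phi> x) - cdot (w' x) (curl \<phi> x)) = 0"
    have e: "cdot (z *s c x + c' x) (\<phi> x) - cdot (z *s w x + w' x) (curl \<phi> x)
        = z * (cdot (c x) (\<phi> x) - cdot (w x) (curl \<phi> x)) + (cdot (c' x) (\<phi> x) - cdot (w' x) (curl \<phi> x))" for x
      by (simp add: cdot_simps(1,3) algebra_simps)
    have "(LINT x|lebesgue_on W. z * (cdot (c x) (\<phi> x) - cdot (w x) (curl \<phi> x)) + (cdot (c' x) (\<phi> x) - cdot (w' x) (curl \<phi> x)))
        = z * (LINT x|lebesgue_on W. cdot (c x) (\<phi> x) - cdot (w x) (curl \<phi> x)) + (LINT x|lebesgue_on W. cdot (c' x) (\<phi> x) - cdot (w' x) (curl \<phi> x))"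
      using Bochner_Integration.integral_add[OF integrable_mult_right[of z, OF Bochner_Integration.integrable_diff[OF i(3,2)[OF \<phi>]]]
          Bochner_Integration.integrable_diff[OF i'(3,2)[OF \<phi>]]] by simp
    then show "(LINT x|lebesgue_on W. cdot (z *s c x + c' x) (\<phi> x) - cdot (z *s w x + w' x) (curl \<phi> x)) = 0"
      unfolding e using z \<phi> by simp
  qed
  have eq: "(LINT x|lebesgue_on W. cdot (z *s c x + c' x) (curl \<phi> x) - of_real (k\<^sup>2) * eps x * cdot (z *s w x + w' x) (\<phi> x))
      = (LINT x|lebesgue_on D. of_real (k\<^sup>2) * (eps x - 1) * cdot (z *s wi x + wi' x) (\<phi> x))"
    if \<phi>: "\<phi> \<in> test_fields W" for \<phi>
  proof -
    define F where "F x = cdot (c x) (curl \<phi> x) - of_real (k\<^sup>2) * eps x * cdot (w x) (\<phi> x)" for x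
    define F' where "F' x = cdot (c' x) (curl \<phi> x) - of_real (k\<^sup>2) * eps x * cdot (w' x) (\<phi> x)" for x
    have F: "integrable (lebesgue_on W) F"
      using Bochner_Integration.integrable_diff[OF i(4)[OF \<phi>] integrable_mult_right[OF i(5)[OF \<phi>], of "of_real (k\<^sup>2)"]]
      unfolding F_def cdot_simps(3) by (simp only: mult.assoc)
    have F': "integrable (lebesgue_on W) F'"
      using Bochner_Integration.integrable_diff[OF i'(4)[OF \<phi>] integrable_mult_right[OF i'(5)[OF \<phi>], of "of_real (k\<^sup>2)"]]
      unfolding F'_def cdot_simps(3) by (simp only: mult.assoc)
    have L: "cdot (z *s c x + c' x) (curl \<phi> x) - of_real (k\<^sup>2) * eps x * cdot (z *s w x + w' x) (\<phi> x) = z * F x + F' x" for x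
      unfolding F_def F'_def cdot_simps(1,3) by (simp add: algebra_simps)
    have m: "(\<lambda>x. contrast x *s wi x) \<in> L2 D" "(\<lambda>x. contrast x *s wi' x) \<in> L2 D"
      by (intro contrast_L2 wi D_props(4,2))+
    have G: "of_real (k\<^sup>2) * (eps x - 1) * cdot (v x) (\<phi> x) = cdot (contrast x *s v x) (\<phi> x)" for v :: "real^3 \<Rightarrow> complex^3" and x
      unfolding cdot_simps(3) contrast_def ..
    have H: "contrast x *s (z *s wi x + wi' x) = z *s (contrast x *s wi x) + contrast x *s wi' x" for x
      by (simp add: vec_eq_iff algebra_simps)
    have "(LINT x|lebesgue_on W. F x) = (LINT x|lebesgue_on D. cdot (contrast x *s wi x) (\<phi> x))"
      "(LINT x|lebesgue_on W. F' x) = (LINT x|lebesgue_on D. cdot (contrast x *s wi' x) (\<phi> x))"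
      using s s' \<phi> unfolding solves_scattering_def F_def F'_def G[symmetric] by blast+
    then have "(LINT x|lebesgue_on W. z * F x + F' x)
        = z * (LINT x|lebesgue_on D. cdot (contrast x *s wi x) (\<phi> x)) + (LINT x|lebesgue_on D. cdot (contrast x *s wi' x) (\<phi> x))"
      using F F' by simp
    then show ?thesis
      unfolding L G[where v = "\<lambda>x. z *s wi x + wi' x"] H integral_cdot_lin[OF i(6)[OF \<phi> m(1)] i(6)[OF \<phi> m(2)]] .
  qed
  have "outgoing_radiating a b k te tm (\<lambda>x. z *s w x + w' x)"
    by (rule outgoing_radiating_lin) (use s s' in \<open>auto simp: solves_scattering_def\<close>)
  then show ?thesis
    unfolding solves_scattering_def
    using wc t eq ssol_L2[OF s] ssol_L2[OF s'] by (intro conjI allI impI ballI L2_add L2_const_mult) auto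
qed

text \<open>\<open>scattered_field\<close> chooses a solution separately for each incident field, so
  linearity cannot be pointwise. A combination of solutions solves the combined problem, and
  uniqueness identifies the two almost everywhere.\<close>

lemma T_lin:
  assumes wi: "wi \<in> L2 D" "wi' \<in> L2 D"
  shows "AE y in lebesgue_on D. T (\<lambda>x. z *s wi x + wi' x) y = z *s T wi y + T wi' y"
proof -
  let ?v = "\<lambda>x. z *s wi x + wi' x"
  have v: "?v \<in> L2 D" by (intro L2_add L2_const_mult wi)
  obtain c0 where c0: "ssol ?v (scat ?v) c0" using scat_solves[OF v] by blast
  obtain c where c: "ssol wi (scat wi) c" using scat_solves[OF wi(1)] by blast
  obtain c' where c': "ssol wi' (scat wi') c'" using scat_solves[OF wi(2)] by blast
  have "AE x in lebesgue_on W. scat ?v x = z *s scat wi x + scat wi' x"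
    using wp v c0 ssol_lin[OF wi c c', of z] unfolding well_posed_def by blast
  then have "AE x in lebesgue. x \<in> W \<longrightarrow> scat ?v x = z *s scat wi x + scat wi' x"
    unfolding AE_lebesgue_on[OF sets_waveguide] .
  then show ?thesis
    unfolding AE_lebesgue_on[OF D_props(2)]
  proof eventually_elim
    case (elim x)
    then show ?case using D_props(4) by (auto simp: T_eq vec_eq_iff algebra_simps)
  qed
qed

text \<open>The set of solutions depends on the incident field through its values in D only, and so
  does the choice made from it. The equality is therefore exact, and the values of the Green
  function outside D are irrelevant.\<close>

lemma scat_cong: "(\<And>x. x \<in> D \<Longrightarrow> wi x = wi' x) \<Longrightarrow> scat wi = scat wi'"
proof -
  assume "\<And>x. x \<in> D \<Longrightarrow> wi x = wi' x"
  then have "(LINT x|lebesgue_on D. of_real (k\<^sup>2) * (eps x - 1) * cdot (wi x) (\<phi> x))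
      = (LINT x|lebesgue_on D. of_real (k\<^sup>2) * (eps x - 1) * cdot (wi' x) (\<phi> x))" for \<phi>
    by (intro Bochner_Integration.integral_cong) auto
  then show ?thesis unfolding scattered_field_def solves_scattering_def by simp
qed

lemma green_above_eq:
  "green_above a b k te tm y x = (\<Sum>j. outer (TEi j y) (TEo j x)) + (\<Sum>j. outer (TMi j y) (TMo j x))"
  unfolding green_above_def TE_in_def TE_out_def TM_in_def TM_out_def ..

lemma decay:
  obtains \<alpha> \<beta> \<alpha>' \<beta>' where "decaying_pair \<rho> \<sigma> (\<lambda>j. TEi j) (\<lambda>j. TEo j) \<alpha> \<beta>"
    "decaying_pair \<rho> \<sigma> (\<lambda>j. TMi j) (\<lambda>j. TMo j) \<alpha>' \<beta>'"
proof -
  obtain \<alpha> \<beta> where E: "decaying_pair \<rho> \<sigma> (\<lambda>j. TEi j) (\<lambda>j. TEo j) \<alpha> \<beta>"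
    by (rule decaying_TE[OF ab k enum te_nonres levels(2)]) blast
  obtain \<alpha>' \<beta>' where M: "decaying_pair \<rho> \<sigma> (\<lambda>j. TMi j) (\<lambda>j. TMo j) \<alpha>' \<beta>'"
    by (rule decaying_TM[OF ab k enum tm_nonres levels(2)]) blast+
  show thesis by (rule that[OF E M])
qed

text \<open>For x below D the definition takes the transposed series in the first case and the
  series itself in the second. In both, the outgoing factor stands at x and the standing wave at
  y.\<close>

lemma green_apply:
  assumes y: "y \<in> D" and x: "x $ 3 \<le> \<sigma>"
  shows "green a b k te tm x y *v v = (\<Sum>j. cdot (TEi j y) v *s TEo j x) + (\<Sum>j. cdot (TMi j y) v *s TMo j x)"
    and "green a b k te tm y x *v v = (\<Sum>j. cdot (TEo j x) v *s TEi j y) + (\<Sum>j. cdot (TMo j x) v *s TMi j y)"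
proof -
  obtain \<alpha> \<beta> \<alpha>' \<beta>' where E: "decaying_pair \<rho> \<sigma> (\<lambda>j. TEi j) (\<lambda>j. TEo j) \<alpha> \<beta>"
    and M: "decaying_pair \<rho> \<sigma> (\<lambda>j. TMi j) (\<lambda>j. TMo j) \<alpha>' \<beta>'" by (rule decay)
  note h = D_height[OF y]
  have lt: "x $ 3 < y $ 3" using x h levels by simp
  have tr: "transpose (A + B) *v v = transpose A *v v + transpose B *v v" for A B :: "complex^3^3"
    by (simp del: transpose_matrix_vector add: vec_eq_iff matrix_vector_mult_def transpose_def algebra_simps sum.distrib)
  have "green a b k te tm x y = transpose ((\<Sum>j. outer (TEi j y) (TEo j x)) + (\<Sum>j. outer (TMi j y) (TMo j x)))"
    using lt unfolding green_def green_above_eq by simp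
  then show "green a b k te tm x y *v v = (\<Sum>j. cdot (TEi j y) v *s TEo j x) + (\<Sum>j. cdot (TMi j y) v *s TMo j x)"
    by (simp only: tr kernel_apply(1)[OF E h x] kernel_apply(1)[OF M h x])
  show "green a b k te tm y x *v v = (\<Sum>j. cdot (TEo j x) v *s TEi j y) + (\<Sum>j. cdot (TMo j x) v *s TMi j y)"
    using lt unfolding green_def green_above_eq
    by (simp add: matrix_vector_mult_add_rdistrib kernel_apply(2)[OF E h x] kernel_apply(2)[OF M h x])
qed

text \<open>Undoes the exchange of integral and series built into \<open>potential\<close>; from
  here on the potential inherits linearity from \<open>T\<close>.\<close>

lemma potential_green:
  assumes wi: "wi \<in> L2 D" and x: "x $ 3 \<le> \<sigma>"
  shows "integrable (lebesgue_on D) (\<lambda>y. green a b k te tm x y *v T wi y)"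
    and "(LINT y|lebesgue_on D. green a b k te tm x y *v T wi y) = potential wi x"
proof -
  obtain \<alpha> \<beta> \<alpha>' \<beta>' where E: "decaying_pair \<rho> \<sigma> (\<lambda>j. TEi j) (\<lambda>j. TEo j) \<alpha> \<beta>"
    and M: "decaying_pair \<rho> \<sigma> (\<lambda>j. TMi j) (\<lambda>j. TMo j) \<alpha>' \<beta>'" by (rule decay)
  let ?h = "\<lambda>y. (\<Sum>j. cdot (TEi j y) (T wi y) *s TEo j x) + (\<Sum>j. cdot (TMi j y) (T wi y) *s TMo j x)"
  have e: "green a b k te tm x y *v T wi y = ?h y" if "y \<in> space (lebesgue_on D)" for y
    using green_apply(1)[OF _ x] that by simp
  note i = source_series(3)[OF E wi x] source_series(3)[OF M wi x]
  show "integrable (lebesgue_on D) (\<lambda>y. green a b k te tm x y *v T wi y)"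
  proof -
    have "integrable (lebesgue_on D) (\<lambda>y. green a b k te tm x y *v T wi y) \<longleftrightarrow> integrable (lebesgue_on D) ?h"
      by (rule Bochner_Integration.integrable_cong[OF refl]) (rule e)
    with Bochner_Integration.integrable_add[OF i] show ?thesis by simp
  qed
  have "(LINT y|lebesgue_on D. green a b k te tm x y *v T wi y) = (LINT y|lebesgue_on D. ?h y)"
    by (rule Bochner_Integration.integral_cong) (use e in auto)
  also have "\<dots> = potential wi x"
    unfolding Bochner_Integration.integral_add[OF i] source_series(2)[OF E wi x] source_series(2)[OF M wi x]
      potential_def te_amp_def tm_amp_def ..
  finally show "(LINT y|lebesgue_on D. green a b k te tm x y *v T wi y) = potential wi x" .
qed

lemma bounded_linear_vsmult: "bounded_linear ((*s) z :: complex^3 \<Rightarrow> _)"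
  by (rule linear_conv_bounded_linear[THEN iffD1]) (simp add: linear_iff vec_eq_iff algebra_simps)

lemma potential_lin:
  assumes wi: "wi \<in> L2 D" "wi' \<in> L2 D" and x: "x $ 3 \<le> \<sigma>"
  shows "potential (\<lambda>y. z *s wi y + wi' y) x = z *s potential wi x + potential wi' x"
proof -
  let ?v = "\<lambda>y. z *s wi y + wi' y" and ?G = "green a b k te tm x"
  have v: "?v \<in> L2 D" by (intro L2_add L2_const_mult wi)
  note g = potential_green[OF wi(1) x] and g' = potential_green[OF wi(2) x] and gv = potential_green[OF v x]
  have i: "integrable (lebesgue_on D) (\<lambda>y. z *s (?G y *v T wi y))"
    by (rule integrable_bounded_linear[OF bounded_linear_vsmult g(1)])
  have "(LINT y|lebesgue_on D. ?G y *v T ?v y) = (LINT y|lebesgue_on D. z *s (?G y *v T wi y) + ?G y *v T wi' y)"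
  proof (rule integral_cong_AE)
    show "AE y in lebesgue_on D. ?G y *v T ?v y = z *s (?G y *v T wi y) + ?G y *v T wi' y"
      using T_lin[OF wi, of z]
    proof eventually_elim
      case (elim y)
      show ?case unfolding elim
        by (simp add: vec_eq_iff matrix_vector_mult_def sum_distrib_left sum.distrib algebra_simps)
    qed
    show "(\<lambda>y. ?G y *v T ?v y) \<in> borel_measurable (lebesgue_on D)"
      by (rule borel_measurable_integrable[OF gv(1)])
    show "(\<lambda>y. z *s (?G y *v T wi y) + ?G y *v T wi' y) \<in> borel_measurable (lebesgue_on D)"
      by (rule borel_measurable_integrable[OF Bochner_Integration.integrable_add[OF i g'(1)]])
  qed
  also have "\<dots> = z *s (LINT y|lebesgue_on D. ?G y *v T wi y) + (LINT y|lebesgue_on D. ?G y *v T wi' y)"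
    unfolding Bochner_Integration.integral_add[OF i g'(1)] integral_bounded_linear[OF bounded_linear_vsmult g(1)] ..
  finally show ?thesis unfolding g(2) g'(2) gv(2) .
qed

end

section \<open>Superposition over the measurement surface\<close>

lemma lmeasurable_cross_section: "cross_section a b \<in> lmeasurable"
proof -
  have "cross_section a b = box (vector [0, 0]) (vector [a, b])"
    by (auto simp: cross_section_def mem_box_cart forall_2)
  then show ?thesis by simp
qed

lemma continuous_on_at_height: "continuous_on UNIV (at_height r)"
proof -
  have "at_height r = (\<lambda>s. \<chi> i. if i = 1 then s $ 1 else if i = 2 then s $ 2 else r)"
    by (auto simp: fun_eq_iff at_height_def vec_eq_iff forall_3)
  moreover have "continuous_on UNIV (\<lambda>s::real^2. (\<chi> i::3. if i = 1 then s $ 1 else if i = 2 then s $ 2 else r))"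
  proof (rule continuous_on_vec_lambda)
    fix i :: 3
    show "continuous_on UNIV (\<lambda>s::real^2. if i = 1 then s $ 1 else if i = 2 then s $ 2 else r)"
      by (cases "i = 1"; cases "i = 2") (auto intro!: continuous_intros)
  qed
  ultimately show ?thesis by simp
qed

lemma at_height_3: "at_height r s $ 3 = r"
  by (simp add: at_height_def)

section \<open>Continuity of the potential and its action on modal series\<close>

context waveguide_scattering
begin

lemma scat_D_bound:
  obtains C where "0 \<le> C" "\<And>wi. wi \<in> L2 D \<Longrightarrow> L2norm D (scat wi) \<le> C * L2norm D wi"
proof -
  obtain C where C: "\<forall>wi \<in> L2 D. \<forall>w c. ssol wi w c \<longrightarrow> L2norm (sec r 0) w + L2norm (sec r 0) c \<le> C * L2norm D wi"
    using wp D_props(6) unfolding well_posed_def by meson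
  have nn: "0 \<le> L2norm S h" for S and h :: "real^3 \<Rightarrow> complex^3"
    unfolding L2norm_def by (simp add: Bochner_Integration.integral_nonneg)
  show thesis
  proof (rule that[of "\<bar>C\<bar>"])
    fix wi :: "real^3 \<Rightarrow> complex^3" assume wi: "wi \<in> L2 D"
    obtain c where c: "ssol wi (scat wi) c" using scat_solves[OF wi] by blast
    have "L2norm D (scat wi) \<le> L2norm (sec r 0) (scat wi)"
      by (rule L2norm_mono[OF ssol_L2(1)[OF c D_props(6)] D_props(3,2) sets_section_between])
    also have "\<dots> \<le> C * L2norm D wi" using C wi c nn[of "sec r 0" c] by fastforce
    also have "\<dots> \<le> \<bar>C\<bar> * L2norm D wi" by (intro mult_right_mono nn) simp
    finally show "L2norm D (scat wi) \<le> \<bar>C\<bar> * L2norm D wi" .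
  qed simp
qed

text \<open>The incident field is measured in the supremum norm because tails of modal series are
  small uniformly on D. The source is measured in L1 because it is paired with bounded standing
  waves.\<close>

lemma T_L1_bound:
  obtains C where "0 \<le> C"
    "\<And>wi M. wi \<in> L2 D \<Longrightarrow> 0 < M \<Longrightarrow> (\<And>x. x \<in> D \<Longrightarrow> norm (wi x) \<le> M) \<Longrightarrow> (LINT y|lebesgue_on D. norm (T wi y)) \<le> C * M"
proof -
  obtain Cc where Cc: "0 \<le> Cc" "\<And>S. S \<subseteq> W \<Longrightarrow> S \<in> sets lebesgue \<Longrightarrow> AE x in lebesgue_on S. norm (contrast x) \<le> Cc"
    by (rule contrast_bounded) blast
  obtain Cs where Cs: "0 \<le> Cs" "\<And>wi. wi \<in> L2 D \<Longrightarrow> L2norm D (scat wi) \<le> Cs * L2norm D wi"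
    by (rule scat_D_bound) blast
  define V where "V = measure lebesgue D"
  have V: "0 \<le> V" by (simp add: V_def)
  \<comment> \<open>V comes from the incident field, the second summand from \<open>L1_le_L2\<close>
    for the scattered field. The 1 added to Cs * sqrt V keeps the L2 bound positive, as that lemma
    requires.\<close>
  define C where "C = Cc * (V + (Cs * sqrt V + 1) * (V + 1))"
  show thesis
  proof (rule that[of C])
    show "0 \<le> C" unfolding C_def using Cc(1) Cs(1) V by (intro mult_nonneg_nonneg add_nonneg_nonneg) auto
    fix wi :: "real^3 \<Rightarrow> complex^3" and M :: real
    assume wi: "wi \<in> L2 D" and M: "0 < M" and le: "\<And>x. x \<in> D \<Longrightarrow> norm (wi x) \<le> M"
    obtain c where "ssol wi (scat wi) c" using scat_solves[OF wi] by blast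
    note sD = ssol_L2_D[OF this]
    have "L2norm D (scat wi) \<le> Cs * (M * sqrt V)"
      using order_trans[OF Cs(2)[OF wi] mult_left_mono[OF L2norm_bounded[OF wi D_props(5) le less_imp_le[OF M]] Cs(1)]]
      by (simp add: V_def)
    also have "\<dots> \<le> (Cs * sqrt V + 1) * M" using M by (simp add: algebra_simps)
    finally have "L2norm D (scat wi) \<le> (Cs * sqrt V + 1) * M" .
    moreover have "0 < (Cs * sqrt V + 1) * M" using M Cs(1) V by (intro mult_pos_pos add_nonneg_pos) auto
    ultimately have s: "(LINT x|lebesgue_on D. norm (scat wi x)) \<le> (Cs * sqrt V + 1) * M * (V + 1)"
      unfolding V_def by (rule L1_le_L2[OF sD D_props(5)])
    note isc = L2_integrable_norm[OF sD D_props(5)] and iw = integrable_const_lebesgue_on[OF D_props(5), of M]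
    have "(LINT y|lebesgue_on D. norm (T wi y)) \<le> (LINT y|lebesgue_on D. Cc * (M + norm (scat wi y)))"
    proof (rule integral_mono_AE)
      show "integrable (lebesgue_on D) (\<lambda>y. norm (T wi y))" by (rule L2_integrable_norm[OF T_L2[OF wi] D_props(5)])
      show "integrable (lebesgue_on D) (\<lambda>y. Cc * (M + norm (scat wi y)))"
        by (intro integrable_mult_right Bochner_Integration.integrable_add iw isc)
      show "AE y in lebesgue_on D. norm (T wi y) \<le> Cc * (M + norm (scat wi y))"
        using Cc(2)[OF D_props(4,2)] AE_space
      proof eventually_elim
        case (elim y)
        then have "norm (wi y + scat wi y) \<le> M + norm (scat wi y)"
          using le[of y] norm_triangle_ineq[of "wi y" "scat wi y"] by simp
        then show ?case unfolding T_eq norm_vsmult using elim(1) Cc(1) by (intro mult_mono) auto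
      qed
    qed
    also have "\<dots> = Cc * (M * V + (LINT y|lebesgue_on D. norm (scat wi y)))"
      using Bochner_Integration.integral_add[OF iw isc] D_props(5) by (simp add: measure_restrict_space V_def mult.commute)
    also have "\<dots> \<le> Cc * (M * V + (Cs * sqrt V + 1) * M * (V + 1))"
      by (intro mult_left_mono add_left_mono s Cc(1))
    also have "\<dots> = C * M" by (simp add: C_def algebra_simps)
    finally show "(LINT y|lebesgue_on D. norm (T wi y)) \<le> C * M" .
  qed
qed

lemma series_bound:
  assumes dp: "decaying_pair \<rho> \<sigma> \<psi> \<phi> \<alpha> \<beta>" and wi: "wi \<in> L2 D" and x: "x $ 3 \<le> \<sigma>"
  shows "norm (\<Sum>j. (LINT y|lebesgue_on D. cdot (\<psi> j y) (T wi y)) *s \<phi> j x)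
    \<le> 3 * (\<Sum>j. \<alpha> j * \<beta> j) * (LINT y|lebesgue_on D. norm (T wi y))"
proof -
  note d = decaying_pairD[OF dp]
  let ?t = "LINT y|lebesgue_on D. norm (T wi y)"
  have b: "norm ((LINT y|lebesgue_on D. cdot (\<psi> j y) (T wi y)) *s \<phi> j x) \<le> 3 * ?t * (\<alpha> j * \<beta> j)" for j
  proof -
    have "norm (LINT y|lebesgue_on D. cdot (\<psi> j y) (T wi y)) * norm (\<phi> j x) \<le> (3 * \<alpha> j * ?t) * \<beta> j"
      using source_series(4)[OF dp wi] d(3)[of j] d(6)[OF x, of j]
      by (intro mult_mono) (auto simp: Bochner_Integration.integral_nonneg)
    then show ?thesis unfolding norm_vsmult by (simp add: mult_ac)
  qed
  have s: "summable (\<lambda>j. 3 * ?t * (\<alpha> j * \<beta> j))" by (intro summable_mult d(7))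
  have "norm (\<Sum>j. (LINT y|lebesgue_on D. cdot (\<psi> j y) (T wi y)) *s \<phi> j x) \<le> (\<Sum>j. 3 * ?t * (\<alpha> j * \<beta> j))"
    using b by (intro norm_suminf_le[OF _ s]) auto
  also have "\<dots> = 3 * ?t * (\<Sum>j. \<alpha> j * \<beta> j)" by (rule suminf_mult[OF d(7)])
  finally show ?thesis by (simp add: mult_ac)
qed

lemma potential_bound:
  obtains C where "0 \<le> C" "\<And>wi M x. wi \<in> L2 D \<Longrightarrow> 0 \<le> M \<Longrightarrow> (\<And>y. y \<in> D \<Longrightarrow> norm (wi y) \<le> M) \<Longrightarrow> x $ 3 \<le> \<sigma>
    \<Longrightarrow> norm (potential wi x) \<le> C * M"
proof -
  obtain \<alpha> \<beta> \<alpha>' \<beta>' where E: "decaying_pair \<rho> \<sigma> (\<lambda>j. TEi j) (\<lambda>j. TEo j) \<alpha> \<beta>"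
    and Mm: "decaying_pair \<rho> \<sigma> (\<lambda>j. TMi j) (\<lambda>j. TMo j) \<alpha>' \<beta>'" by (rule decay)
  obtain Ct where Ct: "0 \<le> Ct" "\<And>wi M. wi \<in> L2 D \<Longrightarrow> 0 < M \<Longrightarrow> (\<And>x. x \<in> D \<Longrightarrow> norm (wi x) \<le> M)
      \<Longrightarrow> (LINT y|lebesgue_on D. norm (T wi y)) \<le> Ct * M"
    by (rule T_L1_bound) blast
  define S where "S = 3 * (\<Sum>j. \<alpha> j * \<beta> j) + 3 * (\<Sum>j. \<alpha>' j * \<beta>' j)"
  have S: "0 \<le> S" unfolding S_def
    by (intro add_nonneg_nonneg mult_nonneg_nonneg suminf_nonneg decaying_pairD[OF E] decaying_pairD[OF Mm]) auto
  show thesis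
  proof (rule that[of "S * Ct"])
    show "0 \<le> S * Ct" using S Ct(1) by simp
    fix wi :: "real^3 \<Rightarrow> complex^3" and M :: real and x :: "real^3"
    assume wi: "wi \<in> L2 D" and M: "0 \<le> M" and le: "\<And>y. y \<in> D \<Longrightarrow> norm (wi y) \<le> M" and x: "x $ 3 \<le> \<sigma>"
    have pos: "norm (potential wi x) \<le> S * Ct * M'" if "0 < M'" "M \<le> M'" for M'
    proof -
      have "(LINT y|lebesgue_on D. norm (T wi y)) \<le> Ct * M'"
        by (rule Ct(2)[OF wi that(1)]) (use le that(2) in force)
      then have t: "S * (LINT y|lebesgue_on D. norm (T wi y)) \<le> S * (Ct * M')" by (rule mult_left_mono[OF _ S])
      have "norm (potential wi x) \<le> S * (LINT y|lebesgue_on D. norm (T wi y))"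
        unfolding potential_def te_amp_def tm_amp_def S_def distrib_right
        by (rule norm_triangle_le[OF add_mono[OF series_bound[OF E wi x] series_bound[OF Mm wi x]]])
      with t show ?thesis by simp
    qed
    \<comment> \<open>The estimate so far needs a positive bound; M = 0 is reached by enlarging M by
      an arbitrarily small d.\<close>
    show "norm (potential wi x) \<le> S * Ct * M"
    proof (rule field_le_epsilon)
      fix e :: real assume e: "0 < e"
      define d where "d = e / (S * Ct + 1)"
      have p: "0 < S * Ct + 1" using S Ct(1) by (simp add: add_nonneg_pos)
      have d: "0 < d" using e p by (simp add: d_def)
      have "S * Ct * d \<le> (S * Ct + 1) * d" using d by (intro mult_right_mono) auto
      also have "\<dots> = e" using p by (simp add: d_def)
      finally have "S * Ct * d \<le> e" .
      moreover have "norm (potential wi x) \<le> S * Ct * (M + d)" using d M by (intro pos) auto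
      ultimately show "norm (potential wi x) \<le> S * Ct * M + e" by (simp add: distrib_left)
    qed
  qed
qed

lemma potential_0: "x $ 3 \<le> \<sigma> \<Longrightarrow> potential (\<lambda>y. 0) x = 0"
proof -
  assume x: "x $ 3 \<le> \<sigma>"
  have z: "(\<lambda>y. 0 :: complex^3) \<in> L2 D" by (rule L2_bounded[OF _ D_props(5), where C = 0]) auto
  from potential_lin[OF z z x, of "-1"] show ?thesis by simp
qed

text \<open>The coefficients are bounded by the \<beta>, the standing waves by the \<alpha>, so the
  series converges uniformly on D. The potential is linear and bounded with respect to the supremum
  norm on D, hence it may be applied term by term. This is where the continuity in the
  well-posedness is used.\<close>

lemma modal_series:
  assumes dp: "decaying_pair \<rho> \<sigma> \<psi> \<phi> \<alpha> \<beta>" and t: "\<And>j. norm (t j) \<le> K * \<beta> j"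
  shows "(\<lambda>y. \<Sum>j. t j *s \<psi> j y) \<in> L2 D"
    and "\<psi> j \<in> L2 D"
    and "x $ 3 \<le> \<sigma> \<Longrightarrow> potential (\<lambda>y. \<Sum>j. t j *s \<psi> j y) x = (\<Sum>j. t j *s potential (\<psi> j) x)"
proof -
  note d = decaying_pairD[OF dp]
  let ?M = "\<lambda>j. K * (\<alpha> j * \<beta> j)" and ?V = "\<lambda>y. \<Sum>j. t j *s \<psi> j y" and ?S = "\<lambda>N y. \<Sum>j<N. t j *s \<psi> j y"
  have sM: "summable ?M" by (intro summable_mult d(7))
  have b: "norm (t j *s \<psi> j y) \<le> ?M j" if "y \<in> D" for j y
  proof -
    have "norm (t j) * norm (\<psi> j y) \<le> (K * \<beta> j) * \<alpha> j"
      using t[of j] d(5)[OF D_height[OF that], of j] order_trans[OF norm_ge_zero t[of j]] by (intro mult_mono) auto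
    then show ?thesis unfolding norm_vsmult by (simp add: mult_ac)
  qed
  have m: "\<psi> j \<in> borel_measurable (lebesgue_on D)" for j by (rule continuous_measurable_lebesgue_on[OF d(1)])
  show \<psi>L: "\<psi> j \<in> L2 D" for j
    by (rule L2_bounded[OF m D_props(5)]) (rule d(5)[OF D_height])
  have SL: "?S N \<in> L2 D" for N
  proof (induction N)
    case 0
    show ?case by (rule L2_bounded[OF _ D_props(5), where C = 0]) auto
  next
    case (Suc N)
    from L2_add[OF L2_const_mult[OF \<psi>L[of N], of "t N"] Suc] show ?case by (simp add: add.commute)
  qed
  have sm: "summable (\<lambda>j. t j *s \<psi> j y)" if "y \<in> D" for y
    by (rule summable_comparison_test'[OF sM b[OF that]])
  have Vm: "?V \<in> borel_measurable (lebesgue_on D)"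
  proof (rule borel_measurable_LIMSEQ_metric)
    show "?S N \<in> borel_measurable (lebesgue_on D)" for N by (rule L2_measurable[OF SL])
    show "(\<lambda>N. ?S N y) \<longlonglongrightarrow> ?V y" if "y \<in> space (lebesgue_on D)" for y
      by (rule summable_LIMSEQ[OF sm]) (use that in simp)
  qed
  have tail: "norm (?V y - ?S N y) \<le> (\<Sum>j. ?M (j + N))" if y: "y \<in> D" for N y
  proof -
    have "?V y - ?S N y = (\<Sum>j. t (j + N) *s \<psi> (j + N) y)"
      using suminf_split_initial_segment[OF sm[OF y], of N] by simp
    also have "norm (\<Sum>j. t (j + N) *s \<psi> (j + N) y) \<le> (\<Sum>j. ?M (j + N))"
      by (rule norm_suminf_le[OF b[OF y]]) (rule summable_ignore_initial_segment[OF sM])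
    finally show ?thesis .
  qed
  \<comment> \<open>The tail estimate with N = 0, where the partial sum is empty, bounds the series
    itself.\<close>
  show VL: "?V \<in> L2 D"
    by (rule L2_bounded[OF Vm D_props(5)]) (use tail[of _ 0] in simp)
  show "potential ?V x = (\<Sum>j. t j *s potential (\<psi> j) x)" if x: "x $ 3 \<le> \<sigma>"
  proof -
    obtain C where C: "0 \<le> C" "\<And>wi M x. wi \<in> L2 D \<Longrightarrow> 0 \<le> M \<Longrightarrow> (\<And>y. y \<in> D \<Longrightarrow> norm (wi y) \<le> M) \<Longrightarrow> x $ 3 \<le> \<sigma>
      \<Longrightarrow> norm (potential wi x) \<le> C * M" by (rule potential_bound) blast
    have PS: "potential (?S N) x = (\<Sum>j<N. t j *s potential (\<psi> j) x)" for N
    proof (induction N)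
      case 0
      show ?case using potential_0[OF x] by simp
    next
      case (Suc N)
      have "potential (?S (Suc N)) x = potential (\<lambda>y. t N *s \<psi> N y + ?S N y) x" by (simp add: add.commute)
      also have "\<dots> = t N *s potential (\<psi> N) x + potential (?S N) x" by (rule potential_lin[OF \<psi>L SL x])
      finally show ?case using Suc by (simp add: add.commute)
    qed
    have Mn: "0 \<le> ?M j" for j
      using order_trans[OF norm_ge_zero t[of j]] d(3)[of j] mult_nonneg_nonneg[of "K * \<beta> j" "\<alpha> j"] by (simp add: mult_ac)
    have e: "norm (potential ?V x - (\<Sum>j<N. t j *s potential (\<psi> j) x)) \<le> C * (\<Sum>j. ?M (j + N))" for N
    proof -
      have DL: "(\<lambda>y. (-1) *s ?S N y + ?V y) \<in> L2 D" by (intro L2_add L2_const_mult SL VL)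
      have "norm (potential (\<lambda>y. (-1) *s ?S N y + ?V y) x) \<le> C * (\<Sum>j. ?M (j + N))"
      proof (rule C(2)[OF DL _ _ x])
        show "0 \<le> (\<Sum>j. ?M (j + N))"
          by (rule suminf_nonneg[OF summable_ignore_initial_segment[OF sM] Mn])
        show "norm ((-1) *s ?S N y + ?V y) \<le> (\<Sum>j. ?M (j + N))" if "y \<in> D" for y
          using tail[OF that, of N] by simp
      qed
      then show ?thesis unfolding potential_lin[OF SL VL x] PS by simp
    qed
    have "(\<lambda>N. C * (\<Sum>j. ?M (j + N))) \<longlonglongrightarrow> C * 0"
      by (intro tendsto_mult_left suminf_exist_split2 sM)
    then have "(\<lambda>N. C * (\<Sum>j. ?M (j + N))) \<longlonglongrightarrow> 0" by simp
    from Lim_null_comparison[OF always_eventually[OF allI[OF e]] this]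
    have "(\<lambda>N. potential ?V x - (\<Sum>j<N. t j *s potential (\<psi> j) x)) \<longlonglongrightarrow> 0" .
    then have "(\<lambda>N. potential ?V x - (potential ?V x - (\<Sum>j<N. t j *s potential (\<psi> j) x))) \<longlonglongrightarrow> potential ?V x - 0"
      by (intro tendsto_diff tendsto_const)
    then have "(\<lambda>j. t j *s potential (\<psi> j) x) sums potential ?V x" by (simp add: sums_def)
    then show ?thesis by (simp add: sums_iff)
  qed
qed

text \<open>For each s the field \<open>P s\<close> is a modal series whose coefficients depend on
  s. Applying the potential and integrating over s, or integrating first and then applying it, gives
  the same series of integrated coefficients times the potentials of the standing waves. The field h
  is that integrated series; it is claimed to agree with the surface integral in D only.\<close>

lemma superposition:
  assumes dp: "decaying_pair \<rho> \<sigma> \<psi> \<phi> \<alpha> \<beta>" and f: "integrable (lebesgue_on (cross_section a b)) f" and x: "x $ 3 \<le> \<sigma>"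
  defines "P \<equiv> \<lambda>s y. \<Sum>j. cdot (\<phi> j (at_height r s)) (f s) *s \<psi> j y"
    and "H \<equiv> \<lambda>y. LINT s|lebesgue_on (cross_section a b). (\<Sum>j. cdot (\<phi> j (at_height r s)) (f s) *s \<psi> j y)"
  shows "P s \<in> L2 D"
    and "\<exists>h \<in> L2 D. (\<forall>y\<in>D. h y = H y)
      \<and> (LINT s|lebesgue_on (cross_section a b). potential (P s) x) = potential h x"
    and "integrable (lebesgue_on (cross_section a b)) (\<lambda>s. potential (P s) x)"
    and "y \<in> D \<Longrightarrow> integrable (lebesgue_on (cross_section a b)) (\<lambda>s. P s y)"
proof -
  note d = decaying_pairD[OF dp]
  let ?cs = "lebesgue_on (cross_section a b)"
  let ?t = "\<lambda>j. LINT s|?cs. cdot (\<phi> j (at_height r s)) (f s)"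
  have m: "(\<lambda>s. \<phi> j (at_height r s)) \<in> borel_measurable ?cs" for j
    by (intro continuous_measurable_lebesgue_on continuous_on_compose2[OF d(2) continuous_on_at_height]) auto
  have \<beta>: "norm (\<phi> j (at_height r s)) \<le> \<beta> j" for j s
    using levels(1) by (intro d(6)) (simp add: at_height_3)
  have su: "summable (\<lambda>j. \<beta> j * \<alpha> j)" using d(7) by (simp add: mult.commute)
  have b: "norm (cdot (\<phi> j (at_height r s)) (f s)) \<le> (3 * norm (f s)) * \<beta> j" for j s
    using norm_cdot_le[of "\<phi> j (at_height r s)" "f s"] mult_right_mono[OF \<beta>[of j s], of "norm (f s)"]
    by (simp add: mult_ac)
  note ms = modal_series[OF dp b]
  show "P s \<in> L2 D" unfolding P_def by (rule ms(1))
  have Px: "potential (P s) x = (\<Sum>j. cdot (\<phi> j (at_height r s)) (f s) *s potential (\<psi> j) x)" for s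
    unfolding P_def by (rule ms(3)[OF x])
  obtain C where C: "0 \<le> C" "\<And>wi M x. wi \<in> L2 D \<Longrightarrow> 0 \<le> M \<Longrightarrow> (\<And>y. y \<in> D \<Longrightarrow> norm (wi y) \<le> M) \<Longrightarrow> x $ 3 \<le> \<sigma>
      \<Longrightarrow> norm (potential wi x) \<le> C * M" by (rule potential_bound) blast
  \<comment> \<open>The potential of a standing wave at x is again of order \<alpha>, so the product
    of bounds that was summable for the kernel remains summable.\<close>
  have pb: "norm (potential (\<psi> j) x) \<le> C * \<alpha> j" for j
    by (rule C(2)[OF ms(2) d(3) d(5)[OF D_height] x])
  have su': "summable (\<lambda>j. \<beta> j * (C * \<alpha> j))" using summable_mult[OF su, of C] by (simp add: mult_ac)
  note I = integral_cdot_series[OF f m \<beta> pb su' d(4)]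
  show "integrable ?cs (\<lambda>s. potential (P s) x)" unfolding Px by (rule I(2))
  have tb: "norm (?t j) \<le> (3 * (LINT s|?cs. norm (f s))) * \<beta> j" for j
    using I(4)[of j] by (simp add: mult_ac)
  note mt = modal_series[OF dp tb]
  have yb: "norm (\<psi> j y) \<le> \<alpha> j" if "y \<in> D" for j y by (rule d(5)[OF D_height[OF that]])
  note J = integral_cdot_series[OF f m \<beta> yb su d(4)]
  show "integrable ?cs (\<lambda>s. P s y)" if "y \<in> D" unfolding P_def by (rule J(2)[OF that])
  show "\<exists>h \<in> L2 D. (\<forall>y\<in>D. h y = H y) \<and> (LINT s|?cs. potential (P s) x) = potential h x"
  proof (rule bexI[OF _ mt(1)], intro conjI ballI)
    show "(\<Sum>j. ?t j *s \<psi> j y) = H y" if "y \<in> D" for y unfolding H_def by (rule J(1)[OF that, symmetric])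
    show "(LINT s|?cs. potential (P s) x) = potential (\<lambda>y. \<Sum>j. ?t j *s \<psi> j y) x"
      unfolding Px mt(3)[OF x] by (rule I(1))
  qed
qed

end

section \<open>Exchange of the surface integral with the scattering map\<close>

context waveguide_scattering
begin

text \<open>By linearity the scattered field for the superposed incident field \<open>H_op g\<close>
  is the superposition of the scattered fields. TE and TM parts of the Green function are superposed
  separately, since they decay with different bounds, and are added afterwards.\<close>

lemma far_field_superposition:
  assumes g: "g \<in> L2t a b r" and x: "x \<in> surface a b r"
  shows "surface_integral a b r (\<lambda>y. E_scat a b k te tm D eps x y (g y))
    = (LINT y|lebesgue_on D. green a b k te tm x y *v T (H_op a b k te tm r g) y)"
proof -
  let ?cs = "lebesgue_on (cross_section a b)" and ?G = "green a b k te tm" and ?H = "H_op a b k te tm r g"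
  obtain \<alpha> \<beta> \<alpha>' \<beta>' where E: "decaying_pair \<rho> \<sigma> (\<lambda>j. TEi j) (\<lambda>j. TEo j) \<alpha> \<beta>"
    and M: "decaying_pair \<rho> \<sigma> (\<lambda>j. TMi j) (\<lambda>j. TMo j) \<alpha>' \<beta>'" by (rule decay)
  define f where "f s = g (at_height r s)" for s
  have fL: "f \<in> L2 (cross_section a b)" using g unfolding L2t_def f_def[abs_def] by blast
  have f: "integrable ?cs f"
    using integrable_norm_iff[OF L2_measurable[OF fL]] L2_integrable_norm[OF fL lmeasurable_cross_section] by blast
  have x3: "x $ 3 \<le> \<sigma>" using x levels(1) by (auto simp: surface_def at_height_3)
  define P where "P s y = (\<Sum>j. cdot (TEo j (at_height r s)) (f s) *s TEi j y)" for s y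
  define P' where "P' s y = (\<Sum>j. cdot (TMo j (at_height r s)) (f s) *s TMi j y)" for s y
  note SE = superposition[OF E f x3, folded P_def[abs_def]]
  note SM = superposition[OF M f x3, folded P'_def[abs_def]]
  have green: "?G y (at_height r s) *v f s = P s y + P' s y" if "y \<in> D" for y s
    unfolding P_def P'_def using levels(1) by (intro green_apply(2) that) (simp add: at_height_3)
  obtain h where h: "h \<in> L2 D" "\<forall>y\<in>D. h y = (LINT s|?cs. P s y)" "(LINT s|?cs. potential (P s) x) = potential h x"
    using SE(2) unfolding P_def by blast
  obtain h' where h': "h' \<in> L2 D" "\<forall>y\<in>D. h' y = (LINT s|?cs. P' s y)" "(LINT s|?cs. potential (P' s) x) = potential h' x"
    using SM(2) unfolding P'_def by blast
  \<comment> \<open>The factor 1 gives the sum the form in which \<open>potential_lin\<close> is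
    stated.\<close>
  let ?h = "\<lambda>y. 1 *s h y + h' y"
  have PL: "P s \<in> L2 D" "P' s \<in> L2 D" for s using SE(1)[of s] SM(1)[of s] unfolding P_def[abs_def] P'_def[abs_def] by auto
  have Es: "E_scat a b k te tm D eps x (at_height r s) (g (at_height r s)) = potential (P s) x + potential (P' s) x" for s
  proof -
    have "scat (\<lambda>z. ?G z (at_height r s) *v f s) = scat (\<lambda>z. 1 *s P s z + P' s z)"
      by (rule scat_cong) (simp add: green)
    moreover have "point_value (scat (\<lambda>z. 1 *s P s z + P' s z)) x = potential (\<lambda>z. 1 *s P s z + P' s z) x"
      by (intro scattered_field_eq_potential x L2_add L2_const_mult PL)
    ultimately show ?thesis
      unfolding E_scat_def f_def[symmetric] potential_lin[OF PL x3] by simp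
  qed
  have "surface_integral a b r (\<lambda>y. E_scat a b k te tm D eps x y (g y)) = (LINT s|?cs. potential (P s) x + potential (P' s) x)"
    unfolding surface_integral_def Es ..
  also have "\<dots> = potential h x + potential h' x"
    using Bochner_Integration.integral_add[OF SE(3) SM(3)] h(3) h'(3) unfolding P_def P'_def by simp
  also have "\<dots> = potential ?h x" unfolding potential_lin[OF h(1) h'(1) x3] by simp
  also have "\<dots> = (LINT y|lebesgue_on D. ?G x y *v T ?h y)"
    by (rule potential_green(2)[OF _ x3, symmetric]) (intro L2_add L2_const_mult h(1) h'(1))
  also have "\<dots> = (LINT y|lebesgue_on D. ?G x y *v T ?H y)"
  proof -
    have H: "?h y = ?H y" if y: "y \<in> D" for y
    proof -
      have "?H y = (LINT s|?cs. P s y + P' s y)"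
        unfolding H_op_def surface_integral_def f_def[symmetric] green[OF y] ..
      also have "\<dots> = h y + h' y"
        using Bochner_Integration.integral_add[OF SE(4)[OF y] SM(4)[OF y]] h(2) h'(2) y unfolding P_def P'_def by simp
      finally show ?thesis by simp
    qed
    have sc: "scat ?h = scat ?H" by (rule scat_cong) (rule H)
    have "T ?h y = T ?H y" if "y \<in> D" for y unfolding T_eq sc H[OF that] ..
    then show ?thesis by (intro Bochner_Integration.integral_cong) auto
  qed
  finally show ?thesis .
qed

end

section \<open>Complex conjugation, and the conclusion\<close>

lemma vec_cnj_bounded_linear: "bounded_linear vec_cnj"
  by (rule linear_conv_bounded_linear[THEN iffD1]) (simp add: linear_iff vec_eq_iff vec_cnj_def)

lemma vec_cnj_vec_cnj: "vec_cnj (vec_cnj v) = v"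
  by (simp add: vec_eq_iff vec_cnj_def)

lemma mat_cnj_mult_vec_cnj: "mat_cnj A *v vec_cnj v = vec_cnj (A *v v)"
  by (simp add: vec_eq_iff matrix_vector_mult_def mat_cnj_def vec_cnj_def)

lemma integral_vec_cnj: "(LINT y|M. vec_cnj (f y)) = vec_cnj (LINT y|M. f y)"
  by (rule integral_bounded_linear'[OF vec_cnj_bounded_linear vec_cnj_bounded_linear]) (simp add: vec_cnj_vec_cnj)

text \<open>The normal is real, so conjugation commutes with taking the tangential part.\<close>

lemma vec_cnj_tangential: "vec_cnj (ccross (ccross normal (vec_cnj v)) normal) = ccross (ccross normal v) normal"
  by (simp add: vec_eq_iff forall_3 vec_cnj_def ccross_def normal_def)

text \<open>A point z of D lies vertically above the point of the surface with the same projection,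
  at distance z_3 - r, so the distance assumption is a gap in height. The bound \<delta> \<le> - r
  leaves room for both intermediate heights below 0.\<close>

lemma height_gap:
  assumes "admissible_scatterer a b D r"
  obtains \<delta> where "0 < \<delta>" "\<delta> \<le> - r" "\<And>z. z \<in> D \<Longrightarrow> r + \<delta> \<le> z $ 3"
proof -
  obtain \<delta> where \<delta>: "0 < \<delta>" "\<forall>z\<in>D. \<forall>y\<in>surface a b r. \<delta> \<le> dist z y" and r: "r < 0" and D: "D \<subseteq> section_between a b r 0"
    using assms unfolding admissible_scatterer_def by blast
  show thesis
  proof (rule that[of "min \<delta> (- r)"])
    fix z assume z: "z \<in> D"
    then have z': "proj12 z \<in> cross_section a b" "r < z $ 3" using D unfolding section_between_def by auto
    have "z - at_height r (proj12 z) = axis 3 (z $ 3 - r)"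
      by (simp add: vec_eq_iff forall_3 at_height_def proj12_def axis_def three_distinct)
    then have "dist z (at_height r (proj12 z)) = z $ 3 - r" using z' by (simp add: dist_norm norm_vec_def L2_set_def sum_3 axis_def three_distinct)
    moreover have "\<delta> \<le> dist z (at_height r (proj12 z))" using \<delta>(2) z z' unfolding surface_def by blast
    ultimately show "r + min \<delta> (- r) \<le> z $ 3" by simp
  qed (use \<delta> r in auto)
qed

theorem theorem3p2:
  fixes a b k r :: real
    and te tm :: "nat \<Rightarrow> nat \<times> nat"
    and D :: "(real^3) set"
    and eps :: "real^3 \<Rightarrow> complex"
    and g :: "real^3 \<Rightarrow> complex^3"
  assumes "a > 0" and "b > 0" and "k > 0"
    and "mode_enumeration a b te tm"
    and "\<And>m. k\<^sup>2 \<noteq> (lam a b te m)\<^sup>2"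
    and "\<And>n. n \<ge> 1 \<Longrightarrow> k\<^sup>2 \<noteq> (mu a b tm n)\<^sup>2"
    and "admissible_scatterer a b D r"
    and "permittivity a b D eps"
    and "well_posed a b k te tm D eps"
    and "g \<in> L2t a b r"
  shows "\<forall>x \<in> surface a b r.
    ccross (N_op a b k te tm D eps r g x) normal =
    vec_cnj (H_adj a b k te tm D
      (\<lambda>z. vec_cnj (T_op a b k te tm D eps (H_op a b k te tm r g) z)) x)"
proof
  fix x assume x: "x \<in> surface a b r"
  obtain \<delta> where \<delta>: "0 < \<delta>" "\<delta> \<le> - r" "\<And>z. z \<in> D \<Longrightarrow> r + \<delta> \<le> z $ 3"
    by (rule height_gap[OF assms(7)]) blast
  \<comment> \<open>\<rho> is taken at half and \<sigma> at a quarter of the gap above the surface;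
    both are negative since \<delta> \<le> - r.\<close>
  interpret waveguide_scattering a b k r "r + \<delta> / 2" "r + \<delta> / 4" te tm D eps
  proof
    show "r + \<delta> / 2 < z $ 3" if "z \<in> D" for z using \<delta>(1) \<delta>(3)[OF that] by simp
  qed (use assms \<delta> in auto)
  show "ccross (N_op a b k te tm D eps r g x) normal =
    vec_cnj (H_adj a b k te tm D
      (\<lambda>z. vec_cnj (T_op a b k te tm D eps (H_op a b k te tm r g) z)) x)"
    \<comment> \<open>The conjugations of the kernel, of the density and of the result cancel, so
      the right side is the tangential part of the potential of \<open>T_op\<close> applied to
      \<open>H_op g\<close>. This is the surface integral inside \<open>N_op\<close> by
      \<open>far_field_superposition\<close>.\<close>
    unfolding N_op_def H_adj_def mat_cnj_mult_vec_cnj integral_vec_cnj vec_cnj_tangential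
      far_field_superposition[OF assms(10) x] ..
qed

end
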